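(* For a semantics $\sigma\in\{\mathtt{co},\mathtt{st},\mathtt{pr},\mathtt{sst}\}$, let $\mathsf{CF\text{-}EX}^{\sigma}$ be the following decision problem. Input: an argumentation framework $\Lambda=\langle A,R\rangle$, a goal argument $g\in A$, an integer $k\in\mathbb{N}$, and a $\sigma$-labelling $\mathcal{L}\in\sigma(\Lambda)$. Question: does there exist a labelling $\mathcal{L}'\in\sigma(\Lambda)$ such that $\mathcal{L}(g)\neq\mathcal{L}'(g)$ and $\delta(\mathcal{L},\mathcal{L}')\le k$? Then $\mathsf{CF\text{-}EX}^{\sigma}$ is: (1) $NP$-complete for $\sigma\in\{\mathtt{co},\mathtt{st}\}$; and (2) $\Sigma_2^p$-complete for $\sigma\in\{\mathtt{pr},\mathtt{sst}\}$.
   Context: An argumentation framework (AF) is a pair $\Lambda=\langle A,R\rangle$ with $A$ a (finite) set of arguments and $R\subseteq A\times A$ a set of attacks. For $S\subseteq A$ let $\mathit{Def}(S)=\{a\in A\mid \exists b\in S,\ (b,a)\in R\}$ and $\mathit{Acc}(S)=\{a\in A\mid \forall (b,a)\in R,\ b\in \mathit{Def}(S)\}$. $S$ is conflict-free iff $S\cap \mathit{Def}(S)=\emptyset$, and admissible iff it is conflict-free and $S\subseteq \mathit{Acc}(S)$. A set $S\subseteq A$ is an extension called: complete ($\mathtt{co}$) iff it is admissible and $S=\mathit{Acc}(S)$; preferred ($\mathtt{pr}$) iff it is a $\subseteq$-maximal complete extension; stable ($\mathtt{st}$) iff it is a preferred extension with $S\cup \mathit{Def}(S)=A$; semi-stable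 ($\mathtt{sst}$) iff it is a preferred extension such that $S\cup \mathit{Def}(S)$ is $\subseteq$-maximal (among preferred extensions). A labelling is a total function $\mathcal{L}:A\to\{\mathbf{in},\mathbf{out},\mathbf{und}\}$. The labelling corresponding to an extension $E$ assigns $\mathbf{in}$ to the elements of $E$, $\mathbf{out}$ to the elements of $\mathit{Def}(E)$, and $\mathbf{und}$ to all other arguments. A $\sigma$-labelling of $\Lambda$ is the labelling corresponding to a $\sigma$-extension of $\Lambda$; $\sigma(\Lambda)$ denotes the set of $\sigma$-labellings of $\Lambda$. The distance between labellings is $\delta(\mathcal{L},\mathcal{L}')=|\{a\in A\mid \mathcal{L}(a)\neq\mathcal{L}'(a)\}|$. Complexity: $\Sigma_2^p=NP^{NP}$. *)

theory Defs
  imports Main "HOL-Computational_Algebra.Polynomial"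
begin

section \<open>Argumentation frameworks\<close>

record 'a af =
  args :: "'a set"
  attacks :: "('a \<times> 'a) set"

definition is_af :: "'a af \<Rightarrow> bool" where
  "is_af F \<longleftrightarrow> finite (args F) \<and> attacks F \<subseteq> args F \<times> args F"

definition defeated :: "'a af \<Rightarrow> 'a set \<Rightarrow> 'a set" where
  "defeated F S = {a \<in> args F. \<exists>b\<in>S. (b, a) \<in> attacks F}"

definition acceptable :: "'a af \<Rightarrow> 'a set \<Rightarrow> 'a set" where
  "acceptable F S = {a \<in> args F. \<forall>b. (b, a) \<in> attacks F \<longrightarrow> b \<in> defeated F S}"

definition conflict_free :: "'a af \<Rightarrow> 'a set \<Rightarrow> bool" where
  "conflict_free F S \<longleftrightarrow> S \<inter> defeated F S = {}"

definition admissible :: "'a af \<Rightarrow> 'a set \<Rightarrow> bool" where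
  "admissible F S \<longleftrightarrow> conflict_free F S \<and> S \<subseteq> acceptable F S"

definition complete_exts :: "'a af \<Rightarrow> 'a set set" where
  "complete_exts F = {S. S \<subseteq> args F \<and> admissible F S \<and> S = acceptable F S}"

definition preferred_exts :: "'a af \<Rightarrow> 'a set set" where
  "preferred_exts F =
     {S \<in> complete_exts F. \<forall>T\<in>complete_exts F. S \<subseteq> T \<longrightarrow> T = S}"

definition stable_exts :: "'a af \<Rightarrow> 'a set set" where
  "stable_exts F = {S \<in> preferred_exts F. S \<union> defeated F S = args F}"

definition semi_stable_exts :: "'a af \<Rightarrow> 'a set set" where
  "semi_stable_exts F =
     {S \<in> preferred_exts F. \<forall>T\<in>preferred_exts F.
        S \<union> defeated F S \<subseteq> T \<union> defeated F T \<longrightarrow> T \<union> defeated F T = S \<union> defeated F S}"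

datatype semantics = CO | ST | PR | SST

fun extensions :: "semantics \<Rightarrow> 'a af \<Rightarrow> 'a set set" where
  "extensions CO F = complete_exts F"
| "extensions ST F = stable_exts F"
| "extensions PR F = preferred_exts F"
| "extensions SST F = semi_stable_exts F"

datatype label = In | Out | Und

text \<open>A labelling is a function on \<^term>\<open>args F\<close>; it is represented by the function on the whole
  type that takes the value \<^const>\<open>Und\<close> outside \<^term>\<open>args F\<close>.\<close>

definition labelling_of :: "'a af \<Rightarrow> 'a set \<Rightarrow> 'a \<Rightarrow> label" where
  "labelling_of F E a = (if a \<in> E then In else if a \<in> defeated F E then Out else Und)"

definition labellings :: "semantics \<Rightarrow> 'a af \<Rightarrow> ('a \<Rightarrow> label) set" where
  "labellings \<sigma> F = labelling_of F ` extensions \<sigma> F"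

definition distance :: "'a af \<Rightarrow> ('a \<Rightarrow> label) \<Rightarrow> ('a \<Rightarrow> label) \<Rightarrow> nat" where
  "distance F L L' = card {a \<in> args F. L a \<noteq> L' a}"

definition has_counterfactual ::
  "semantics \<Rightarrow> 'a af \<Rightarrow> 'a \<Rightarrow> nat \<Rightarrow> ('a \<Rightarrow> label) \<Rightarrow> bool" where
  "has_counterfactual \<sigma> F g k L \<longleftrightarrow>
     (\<exists>L'\<in>labellings \<sigma> F. L g \<noteq> L' g \<and> distance F L L' \<le> k)"


section \<open>Nondeterministic multi-tape Turing machines\<close>

datatype symbol = Blank | Bit bool | Aux nat

datatype move = Left | Stay | Right

text \<open>A tape is infinite in both directions and is given by its contents and its head position.\<close>

type_synonym tape = "(int \<Rightarrow> symbol) \<times> int"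

type_synonym config = "nat \<times> tape list"

text \<open>A transition (q, rs, q', as) is enabled in state q if the heads scan the symbols rs; it
  enters state q', and on each tape it writes a symbol and then moves the head as listed in as.
  Since the set of transitions of a machine is finite, so are its sets of states and symbols.\<close>

type_synonym transition = "nat \<times> symbol list \<times> nat \<times> (symbol \<times> move) list"

record ntm =
  num_tapes :: nat
  transitions :: "transition set"
  start_state :: nat
  accept_state :: nat

definition wf_ntm :: "('x) ntm_scheme \<Rightarrow> bool" where
  "wf_ntm M \<longleftrightarrow> num_tapes M > 0 \<and> finite (transitions M) \<and>
     (\<forall>(q, rs, q', as) \<in> transitions M. length rs = num_tapes M \<and> length as = num_tapes M)"

definition deterministic :: "('x) ntm_scheme \<Rightarrow> bool" where
  "deterministic M \<longleftrightarrow>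
     (\<forall>q rs q1 as1 q2 as2.
        (q, rs, q1, as1) \<in> transitions M \<longrightarrow> (q, rs, q2, as2) \<in> transitions M \<longrightarrow>
        q1 = q2 \<and> as1 = as2)"

fun scanned :: "tape \<Rightarrow> symbol" where
  "scanned (t, i) = t i"

fun shift :: "move \<Rightarrow> int" where
  "shift Left = - 1"
| "shift Stay = 0"
| "shift Right = 1"

fun act :: "symbol \<times> move \<Rightarrow> tape \<Rightarrow> tape" where
  "act (s, m) (t, i) = (t(i := s), i + shift m)"

inductive step :: "('x) ntm_scheme \<Rightarrow> config \<Rightarrow> config \<Rightarrow> bool" for M where
  "(q, map scanned ts, q', as) \<in> transitions M \<Longrightarrow> step M (q, ts) (q', map2 act as ts)"

definition input_tape :: "bool list \<Rightarrow> tape" where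
  "input_tape x =
     ((\<lambda>i. if 0 \<le> i \<and> i < int (length x) then Bit (x ! nat i) else Blank), 0)"

definition init_config :: "('x) ntm_scheme \<Rightarrow> bool list \<Rightarrow> config" where
  "init_config M x = (start_state M, input_tape x # replicate (num_tapes M - 1) (input_tape []))"

text \<open>The word on a tape starts at cell 0 and extends up to the first cell that does not hold
  a bit.\<close>

definition tape_word :: "tape \<Rightarrow> bool list \<Rightarrow> bool" where
  "tape_word tp w \<longleftrightarrow>
     (\<forall>i < length w. fst tp (int i) = Bit (w ! i)) \<and> fst tp (int (length w)) \<notin> range Bit"


section \<open>Oracle machines\<close>

text \<open>The last tape is the query tape. In the query state, a single step asks whether the word on
  the query tape belongs to the oracle; it changes the state only.\<close>

record oracle_ntm = ntm +
  query_state :: nat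
  yes_state :: nat
  no_state :: nat

inductive oracle_step :: "bool list set \<Rightarrow> oracle_ntm \<Rightarrow> config \<Rightarrow> config \<Rightarrow> bool" for B M where
  ordinary: "q \<noteq> query_state M \<Longrightarrow> step M (q, ts) c \<Longrightarrow> oracle_step B M (q, ts) c"
| query: "q = query_state M \<Longrightarrow> tape_word (last ts) w \<Longrightarrow>
    oracle_step B M (q, ts) (if w \<in> B then yes_state M else no_state M, ts)"


section \<open>Complexity classes\<close>

definition halts_within :: "(config \<Rightarrow> config \<Rightarrow> bool) \<Rightarrow> config \<Rightarrow> nat \<Rightarrow> bool" where
  "halts_within R c t \<longleftrightarrow> (\<forall>n c'. (R ^^ n) c c' \<longrightarrow> n \<le> t)"

definition poly_time :: "(config \<Rightarrow> config \<Rightarrow> bool) \<Rightarrow> ('x) ntm_scheme \<Rightarrow> bool" where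
  "poly_time R M \<longleftrightarrow>
     (\<exists>p :: nat poly. \<forall>x. halts_within R (init_config M x) (poly p (length x)))"

definition accepts :: "(config \<Rightarrow> config \<Rightarrow> bool) \<Rightarrow> ('x) ntm_scheme \<Rightarrow> bool list \<Rightarrow> bool" where
  "accepts R M x \<longleftrightarrow> (\<exists>ts. R\<^sup>*\<^sup>* (init_config M x) (accept_state M, ts))"

definition NP :: "bool list set set" where
  "NP = {L. \<exists>M :: ntm. wf_ntm M \<and> poly_time (step M) M \<and> L = {x. accepts (step M) M x}}"

definition NP_oracle :: "bool list set \<Rightarrow> bool list set set" where
  "NP_oracle B = {L. \<exists>M :: oracle_ntm. wf_ntm M \<and> poly_time (oracle_step B M) M \<and>
     L = {x. accepts (oracle_step B M) M x}}"

definition Sigma2p :: "bool list set set" where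
  "Sigma2p = (\<Union>B\<in>NP. NP_oracle B)"

text \<open>The output of a deterministic machine is the word on its last tape when it halts.\<close>

definition poly_time_computable :: "(bool list \<Rightarrow> bool list) \<Rightarrow> bool" where
  "poly_time_computable f \<longleftrightarrow>
     (\<exists>M :: ntm. wf_ntm M \<and> deterministic M \<and> poly_time (step M) M \<and>
        (\<forall>x q ts. (step M)\<^sup>*\<^sup>* (init_config M x) (q, ts) \<and> (\<nexists>c. step M (q, ts) c) \<longrightarrow>
           tape_word (last ts) (f x)))"

definition poly_time_reducible :: "bool list set \<Rightarrow> bool list set \<Rightarrow> bool" where
  "poly_time_reducible L L' \<longleftrightarrow> (\<exists>f. poly_time_computable f \<and> (\<forall>x. x \<in> L \<longleftrightarrow> f x \<in> L'))"

definition complete_for :: "bool list set set \<Rightarrow> bool list set \<Rightarrow> bool" where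
  "complete_for C L \<longleftrightarrow> L \<in> C \<and> (\<forall>L'\<in>C. poly_time_reducible L' L)"


section \<open>The decision problem\<close>

text \<open>Least significant bit first, without leading zeros.\<close>

fun binary :: "nat \<Rightarrow> bool list" where
  "binary k = (if k = 0 then [] else odd k # binary (k div 2))"

declare binary.simps [simp del]

fun label_code :: "label \<Rightarrow> bool list" where
  "label_code In = [True, False]"
| "label_code Out = [False, True]"
| "label_code Und = [False, False]"

text \<open>The list xs enumerates the arguments. The code of an instance consists of the number of
  arguments in unary, the adjacency matrix of the attack relation, the characteristic vector of the
  goal, the labelling, and k in binary. It depends only on the isomorphism type of the instance and
  on the order of the enumeration, so it loses no generality that the arguments below are
  natural numbers.\<close>

definition encode :: "'a list \<Rightarrow> 'a af \<Rightarrow> 'a \<Rightarrow> nat \<Rightarrow> ('a \<Rightarrow> label) \<Rightarrow> bool list" where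
  "encode xs F g k L =
     replicate (length xs) True @ [False] @
     concat (map (\<lambda>x. map (\<lambda>y. (x, y) \<in> attacks F) xs) xs) @
     map (\<lambda>x. x = g) xs @
     concat (map (\<lambda>x. label_code (L x)) xs) @
     binary k"

definition CF_EX :: "semantics \<Rightarrow> bool list set" where
  "CF_EX \<sigma> = {encode xs F g k L | (xs :: nat list) F g k L.
     is_af F \<and> distinct xs \<and> set xs = args F \<and> g \<in> args F \<and> L \<in> labellings \<sigma> F \<and>
     has_counterfactual \<sigma> F g k L}"

end

theory Submission imports Defs
begin

text \<open>Membership: a labelling is a certificate whose completeness is a local condition, and the maximality required for the
  preferred and semi-stable semantics adds a single universally quantified labelling. The verifiers are built from number
  functions of polynomial size, which are closed under bounded counting and hence under bounded quantification.

  Hardness: the computations of a nondeterministic machine correspond to the assignments that satisfy a polynomial-time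
  family of clauses. For an oracle machine the positive answers are certified by accepting runs of the oracle's machine;
  the negative ones say that a second family of clauses has no satisfying assignment extending the values already chosen.
  So a language in NP is a question \<open>\<exists>W. \<Phi>\<close> and one in \<open>\<Sigma>\<^sub>2\<close> a question \<open>\<exists>X. \<Phi> \<and> \<not> (\<exists>Y. \<Psi>)\<close> about clause families. Both are
  turned into an argumentation framework with a default labelling, such that the goal changes its label in another
  labelling exactly if the question has a positive answer; k is so large that the distance does not matter.\<close>

section \<open>A structured language for Turing machines\<close>

text \<open>The input contains a correct labelling, so a reduction has to print one without solving
  anything. This is what the switch is for: with the switch in, the labelling is forced and does not
  mention the clauses. For \<open>CO\<close> the labelling that is undecided everywhere takes its
  place. On the membership side the given labelling has to be verified as well, so one universally
  quantified competitor is set against the given and the guessed labelling at the same time. An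
  oracle run may contain many negative answers, and the negation of a conjunction of clauses is not
  again a clause family. Therefore the opponent selects a wrong answer by selector variables and
  presents one accepting run against it, which is a clause family again. A table that satisfies the
  tableau constraints may contain surplus facts. Horn form makes them harmless, except on the query
  word, where they are excluded explicitly.\<close>

datatype com = GoR nat | GoL nat | Put nat bool | Guess nat | Test nat "symbol \<Rightarrow> bool"
  | Seq com com (infixr \<open>;;\<close> 60) | Ite nat "symbol \<Rightarrow> bool" com com
  | Whl nat "symbol \<Rightarrow> bool" com

text \<open>Every tape carries the mark \<^term>\<open>Aux 0\<close> in cell -1. A store holds, for each tape, its
  contents from cell 0 on and its head position, where position 0 is the mark and position
  \<^term>\<open>Suc i\<close> is cell i. So a head position serves as a counter that can be tested for 0.\<close>

type_synonym store = "(nat \<Rightarrow> nat \<Rightarrow> bool option) \<times> (nat \<Rightarrow> nat)"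

fun bit_symbol :: "bool option \<Rightarrow> symbol" where
  "bit_symbol None = Blank"
| "bit_symbol (Some b) = Bit b"

definition scan :: "store \<Rightarrow> nat \<Rightarrow> symbol" where
  "scan s j = (if snd s j = 0 then Aux 0 else bit_symbol (fst s j (snd s j - 1)))"

definition go_right :: "nat \<Rightarrow> store \<Rightarrow> store" where
  "go_right j s = (fst s, (snd s)(j := Suc (snd s j)))"

definition go_left :: "nat \<Rightarrow> store \<Rightarrow> store" where
  "go_left j s = (fst s, (snd s)(j := snd s j - 1))"

definition put :: "nat \<Rightarrow> bool \<Rightarrow> store \<Rightarrow> store" where
  "put j b s = (if snd s j = 0 then s
     else ((fst s)(j := (fst s j)(snd s j - 1 := Some b)), snd s))"

text \<open>\<open>ter c s t X\<close>: every execution of c from s ends within t steps, and X is the set of the stores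
  in which it can end without a failed test.\<close>

inductive ter :: "com \<Rightarrow> store \<Rightarrow> nat \<Rightarrow> store set \<Rightarrow> bool" where
  GoR: "ter (GoR j) s 1 {go_right j s}"
| GoL: "ter (GoL j) s 1 {go_left j s}"
| Put: "ter (Put j b) s 1 {put j b s}"
| Guess: "ter (Guess j) s 1 {put j False s, put j True s}"
| Test: "ter (Test j P) s 1 (if P (scan s j) then {s} else {})"
| Seq: "ter c s t X \<Longrightarrow> (\<And>s'. s' \<in> X \<Longrightarrow> ter d s' u (Y s')) \<Longrightarrow> ter (c ;; d) s (t + u) (\<Union>s'\<in>X. Y s')"
| Ite_True: "P (scan s j) \<Longrightarrow> ter c s t X \<Longrightarrow> ter (Ite j P c d) s (t + 2) X"
| Ite_False: "\<not> P (scan s j) \<Longrightarrow> ter d s t X \<Longrightarrow> ter (Ite j P c d) s (t + 2) X"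
| Whl_False: "\<not> P (scan s j) \<Longrightarrow> ter (Whl j P c) s 1 {s}"
| Whl_True: "P (scan s j) \<Longrightarrow> ter c s t X \<Longrightarrow> (\<And>s'. s' \<in> X \<Longrightarrow> ter (Whl j P c) s' u (Y s')) \<Longrightarrow>
    ter (Whl j P c) s (t + 2 + u) (\<Union>s'\<in>X. Y s')"
| mono: "ter c s t X \<Longrightarrow> t \<le> u \<Longrightarrow> ter c s u X"

section \<open>Compilation of commands to machine code and its correctness\<close>

type_synonym instr = "nat \<times> (symbol \<Rightarrow> (symbol \<times> move \<times> nat) list)"

fun csize :: "com \<Rightarrow> nat" where
  "csize (c ;; d) = csize c + csize d"
| "csize (Ite j P c d) = csize c + csize d + 2"
| "csize (Whl j P c) = csize c + 2"
| "csize _ = 1"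

text \<open>The code of \<open>c\<close> occupies the states from \<open>a\<close> to
  \<open>a + csize c - 1\<close> and leaves at \<open>a + csize c\<close>. On the mark,
  \<open>GoL\<close> stays and \<open>Put\<close> rewrites the mark, so the mark is never lost or
  passed; this is what allows head positions to be natural numbers with truncated subtraction. A
  failed \<open>Test\<close> has no successor and so kills its branch.\<close>

fun compile :: "nat \<Rightarrow> com \<Rightarrow> instr list" where
  "compile a (GoR j) = [(j, \<lambda>s. [(s, Right, a + 1)])]"
| "compile a (GoL j) = [(j, \<lambda>s. [(s, if s = Aux 0 then Stay else Left, a + 1)])]"
| "compile a (Put j b) = [(j, \<lambda>s. [(if s = Aux 0 then s else Bit b, Stay, a + 1)])]"
| "compile a (Guess j) = [(j, \<lambda>s. [(if s = Aux 0 then s else Bit False, Stay, a + 1),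
     (if s = Aux 0 then s else Bit True, Stay, a + 1)])]"
| "compile a (Test j P) = [(j, \<lambda>s. if P s then [(s, Stay, a + 1)] else [])]"
| "compile a (c ;; d) = compile a c @ compile (a + csize c) d"
| "compile a (Ite j P c d) =
     (j, \<lambda>s. [(s, Stay, if P s then a + 1 else a + 2 + csize c)]) # compile (a + 1) c @
     (j, \<lambda>s. [(s, Stay, a + 2 + csize c + csize d)]) # compile (a + 2 + csize c) d"
| "compile a (Whl j P c) =
     (j, \<lambda>s. [(s, Stay, if P s then a + 1 else a + 2 + csize c)]) # compile (a + 1) c @
     [(j, \<lambda>s. [(s, Stay, a)])]"

fun tapes :: "com \<Rightarrow> nat" where
  "tapes (c ;; d) = max (tapes c) (tapes d)"
| "tapes (Ite j P c d) = max (Suc j) (max (tapes c) (tapes d))"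
| "tapes (Whl j P c) = max (Suc j) (tapes c)"
| "tapes (GoR j) = Suc j"
| "tapes (GoL j) = Suc j"
| "tapes (Put j b) = Suc j"
| "tapes (Guess j) = Suc j"
| "tapes (Test j P) = Suc j"

fun guess_free :: "com \<Rightarrow> bool" where
  "guess_free (c ;; d) \<longleftrightarrow> guess_free c \<and> guess_free d"
| "guess_free (Ite j P c d) \<longleftrightarrow> guess_free c \<and> guess_free d"
| "guess_free (Whl j P c) \<longleftrightarrow> guess_free c"
| "guess_free (Guess j) \<longleftrightarrow> False"
| "guess_free _ \<longleftrightarrow> True"

lemma length_compile [simp]: "length (compile a c) = csize c"
  by (induction c arbitrary: a) auto

lemma compile_not_Nil [simp]: "compile a c \<noteq> []"
  by (induction c arbitrary: a) auto

definition cell :: "(nat \<Rightarrow> bool option) \<Rightarrow> int \<Rightarrow> symbol" where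
  "cell c i = (if i < - 1 then Blank else if i = - 1 then Aux 0 else bit_symbol (c (nat i)))"

definition conc :: "nat \<Rightarrow> store \<Rightarrow> tape list" where
  "conc K s = map (\<lambda>j. (cell (fst s j), int (snd s j) - 1)) [0..<K]"

lemma length_conc [simp]: "length (conc K s) = K"
  by (simp add: conc_def)

lemma nth_conc: "j < K \<Longrightarrow> conc K s ! j = (cell (fst s j), int (snd s j) - 1)"
  by (simp add: conc_def)

lemma scanned_conc: "j < K \<Longrightarrow> scanned (conc K s ! j) = scan s j"
  by (auto simp: nth_conc scan_def cell_def nat_diff_distrib)

lemma conc_stay: "j < K \<Longrightarrow> (conc K s)[j := act (scan s j, Stay) (conc K s ! j)] = conc K s"
  using scanned_conc[of j K s] by (auto simp: nth_conc list_update_same_conv fun_eq_iff)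

lemma conc_right:
  "j < K \<Longrightarrow> (conc K s)[j := act (scan s j, Right) (conc K s ! j)] = conc K (go_right j s)"
  using scanned_conc[of j K s]
  by (intro nth_equalityI) (auto simp: nth_conc nth_list_update go_right_def)

lemma conc_left:
  "j < K \<Longrightarrow> (conc K s)[j := act (scan s j, if scan s j = Aux 0 then Stay else Left) (conc K s ! j)]
     = conc K (go_left j s)"
  using scanned_conc[of j K s]
  apply (intro nth_equalityI) 
   apply (auto simp: nth_conc nth_list_update go_left_def)
   apply (auto simp: scan_def cell_def split: if_splits)
  apply (metis bit_symbol.elims symbol.distinct(3) symbol.distinct(5))
  done

lemma conc_put:
  "j < K \<Longrightarrow> (conc K s)[j := act (if scan s j = Aux 0 then scan s j else Bit b, Stay) (conc K s ! j)]
     = conc K (put j b s)"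
  using scanned_conc[of j K s]
  apply (intro nth_equalityI)
   apply (auto simp: nth_conc nth_list_update put_def fun_eq_iff)
   apply (auto simp: scan_def cell_def split: if_splits)
  apply (metis bit_symbol.elims symbol.distinct(3) symbol.distinct(5))
  done

text \<open>The relation \<open>R\<close> is left open so that the same code can be run by
  \<open>step\<close> and by \<open>oracle_step\<close>, which agree on the states of a
  program.\<close>

definition code :: "(config \<Rightarrow> config \<Rightarrow> bool) \<Rightarrow> nat \<Rightarrow> nat \<Rightarrow> instr list \<Rightarrow> bool" where
  "code R K a is \<longleftrightarrow> (\<forall>i<length is. \<forall>s c'. R (a + i, conc K s) c' \<longleftrightarrow>
     (\<exists>(w, m, q') \<in> set (snd (is ! i) (scan s (fst (is ! i)))).
        c' = (q', (conc K s)[fst (is ! i) := act (w, m) (conc K s ! fst (is ! i))])))"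

lemma code_append:
  "code R K a (is @ js) \<longleftrightarrow> code R K a is \<and> code R K (a + length is) js"
proof (intro iffI conjI)
  assume l: "code R K a (is @ js)"
  show "code R K a is"
    unfolding code_def
  proof (intro allI impI)
    fix i s c' assume "i < length is"
    then show "R (a + i, conc K s) c' \<longleftrightarrow> (\<exists>(w, m, q') \<in> set (snd (is ! i) (scan s (fst (is ! i)))).
        c' = (q', (conc K s)[fst (is ! i) := act (w, m) (conc K s ! fst (is ! i))]))"
      using l[unfolded code_def, rule_format, of i s c'] by (simp add: nth_append)
  qed
  show "code R K (a + length is) js"
    unfolding code_def
  proof (intro allI impI)
    fix i s c' assume "i < length js"
    then show "R (a + length is + i, conc K s) c' \<longleftrightarrow>
        (\<exists>(w, m, q') \<in> set (snd (js ! i) (scan s (fst (js ! i)))).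
        c' = (q', (conc K s)[fst (js ! i) := act (w, m) (conc K s ! fst (js ! i))]))"
      using l[unfolded code_def, rule_format, of "length is + i" s c']
      by (simp add: nth_append add.assoc)
  qed
next
  assume r: "code R K a is \<and> code R K (a + length is) js"
  show "code R K a (is @ js)"
    unfolding code_def
  proof (intro allI impI)
    fix i s c' assume i: "i < length (is @ js)"
    show "R (a + i, conc K s) c' \<longleftrightarrow> (\<exists>(w, m, q') \<in> set (snd ((is @ js) ! i) (scan s (fst ((is @ js) ! i)))).
        c' = (q', (conc K s)[fst ((is @ js) ! i) := act (w, m) (conc K s ! fst ((is @ js) ! i))]))"
    proof (cases "i < length is")
      case True
      then show ?thesis
        using r[THEN conjunct1, unfolded code_def, rule_format, of i s c'] by (simp add: nth_append)
    next
      case False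
      then show ?thesis
        using i r[THEN conjunct2, unfolded code_def, rule_format, of "i - length is" s c']
        by (simp add: nth_append)
    qed
  qed
qed

lemma code_single:
  "code R K a [(j, f)] \<Longrightarrow> R (a, conc K s) c' \<longleftrightarrow>
     (\<exists>(w, m, q') \<in> set (f (scan s j)). c' = (q', (conc K s)[j := act (w, m) (conc K s ! j)]))"
  unfolding code_def by (drule spec[of _ 0], drule mp, simp, drule spec[of _ s], drule spec[of _ c'], simp)

lemma code_Cons:
  "is \<noteq> [] \<Longrightarrow> code R K a (x # is) \<longleftrightarrow> code R K a [x] \<and> code R K (a + 1) is"
  using code_append[of R K a "[x]" "is"] by simp

text \<open>The time clause is relative to a bound for what follows, so that bounds add up under
  composition. The last clause says that a run gets to the state \<open>e\<close> only through the
  exit \<open>b\<close>; with \<open>e\<close> the accepting state this excludes acceptance inside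
  the segment.\<close>

definition seg :: "(config \<Rightarrow> config \<Rightarrow> bool) \<Rightarrow> nat \<Rightarrow> nat \<Rightarrow> nat \<Rightarrow> nat \<Rightarrow> store \<Rightarrow> nat \<Rightarrow> store set \<Rightarrow> bool"
  where
  "seg R K e a b s t X \<longleftrightarrow>
     (\<forall>s'\<in>X. R\<^sup>*\<^sup>* (a, conc K s) (b, conc K s')) \<and>
     (\<forall>u. (\<forall>s'\<in>X. halts_within R (b, conc K s') u) \<longrightarrow> halts_within R (a, conc K s) (t + u)) \<and>
     (\<forall>ts. R\<^sup>*\<^sup>* (a, conc K s) (e, ts) \<longrightarrow> (\<exists>s'\<in>X. R\<^sup>*\<^sup>* (b, conc K s') (e, ts)))"

lemma halts_within_mono: "halts_within R c t \<Longrightarrow> t \<le> u \<Longrightarrow> halts_within R c u"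
  by (meson halts_within_def le_trans)

lemma halts_within_step:
  assumes "\<And>c'. R c c' \<Longrightarrow> halts_within R c' u"
  shows "halts_within R c (Suc u)"
  unfolding halts_within_def
proof (intro allI impI)
  fix n c' assume "(R ^^ n) c c'"
  then show "n \<le> Suc u"
    using assms unfolding halts_within_def by (cases n) (blast elim: relpowp_Suc_E2)+
qed

lemma seg_step:
  assumes R: "\<And>c'. R (a, conc K s) c' \<longleftrightarrow> (\<exists>s'\<in>X. c' = (b, conc K s'))" and "a \<noteq> e"
  shows "seg R K e a b s 1 X"
  unfolding seg_def
proof (intro conjI ballI allI impI)
  fix s' assume "s' \<in> X"
  then show "R\<^sup>*\<^sup>* (a, conc K s) (b, conc K s')" using R by blast
next
  fix u assume "\<forall>s'\<in>X. halts_within R (b, conc K s') u"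
  then show "halts_within R (a, conc K s) (1 + u)"
    using halts_within_step[of R "(a, conc K s)" u] R by auto
next
  fix ts assume "R\<^sup>*\<^sup>* (a, conc K s) (e, ts)"
  then show "\<exists>s'\<in>X. R\<^sup>*\<^sup>* (b, conc K s') (e, ts)"
    using R \<open>a \<noteq> e\<close> by (metis converse_rtranclpE prod.inject)
qed

lemma seg_trans:
  assumes 1: "seg R K e a b s t X" and 2: "\<And>s'. s' \<in> X \<Longrightarrow> seg R K e b c s' u (Y s')"
  shows "seg R K e a c s (t + u) (\<Union>s'\<in>X. Y s')"
  unfolding seg_def
proof (intro conjI ballI allI impI)
  fix s' assume "s' \<in> (\<Union>s'\<in>X. Y s')"
  then show "R\<^sup>*\<^sup>* (a, conc K s) (c, conc K s')"
    using 1 2 unfolding seg_def by (metis UN_E rtranclp_trans)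
next
  fix v assume "\<forall>s'\<in>\<Union>s'\<in>X. Y s'. halts_within R (c, conc K s') v"
  then have "\<forall>s'\<in>X. halts_within R (b, conc K s') (u + v)"
    using 2 unfolding seg_def by (metis UN_I)
  then show "halts_within R (a, conc K s) (t + u + v)"
    using 1 unfolding seg_def by (metis add.assoc)
next
  fix ts assume "R\<^sup>*\<^sup>* (a, conc K s) (e, ts)"
  then show "\<exists>s'\<in>\<Union>s'\<in>X. Y s'. R\<^sup>*\<^sup>* (c, conc K s') (e, ts)"
    using 1 2 unfolding seg_def by (metis UN_I)
qed

lemma seg_from: "seg R K e a b s t {s'} \<Longrightarrow> seg R K e b c s' u Y \<Longrightarrow> seg R K e a c s (t + u) Y"
  using seg_trans[of R K e a b s t "{s'}" c u "\<lambda>_. Y"] by simp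

lemma seg_to:
  "seg R K e a b s t X \<Longrightarrow> (\<And>s'. s' \<in> X \<Longrightarrow> seg R K e b c s' u {s'}) \<Longrightarrow> seg R K e a c s (t + u) X"
  using seg_trans[of R K e a b s t X c u "\<lambda>s'. {s'}"] by simp

lemma seg_mono: "seg R K e a b s t X \<Longrightarrow> t \<le> u \<Longrightarrow> seg R K e a b s u X"
  unfolding seg_def by (meson add_le_mono1 halts_within_mono)

lemma seg_goto:
  assumes "code R K a [(j, \<lambda>s. [(s, Stay, f s)])]" "j < K" "a \<noteq> e"
  shows "seg R K e a (f (scan s j)) s 1 {s}"
  using assms conc_stay[OF \<open>j < K\<close>, of s]
  by (intro seg_step) (auto simp: code_single)

text \<open>Induction on the execution. The loop closes because its last instruction jumps back to
  the address \<open>a\<close>, where the induction hypothesis for the remaining rounds applies. The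
  state \<open>e\<close> has to lie outside the code, otherwise a run could reach it before the
  exit.\<close>

theorem ter_seg:
  assumes "ter c s t X" "code R K a (compile a c)" "tapes c \<le> K" "e \<notin> {a..<a + csize c}"
  shows "seg R K e a (a + csize c) s t X"
  using assms
proof (induction arbitrary: a rule: ter.induct)
  case (GoR j s)
  then show ?case
    using conc_right[of j K s] by (intro seg_step) (auto simp: code_single)
next
  case (GoL j s)
  then show ?case
    using conc_left[of j K s] by (intro seg_step) (auto simp: code_single)
next
  case (Put j b s)
  then show ?case
    using conc_put[of j K s b] by (intro seg_step) (auto simp: code_single)
next
  case (Guess j s)
  then show ?case
    using conc_put[of j K s True] conc_put[of j K s False]
    by (intro seg_step) (auto simp: code_single)
next
  case (Test j P s)
  then show ?case
    using conc_stay[of j K s] by (intro seg_step) (auto simp: code_single)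
next
  case (Seq c s t X d u Y)
  have "seg R K e a (a + csize c) s t X"
    using Seq.prems by (intro Seq.IH) (auto simp: code_append)
  moreover have "seg R K e (a + csize c) (a + csize c + csize d) s' u (Y s')" if "s' \<in> X" for s'
    using Seq.prems that by (intro Seq.IH) (auto simp: code_append)
  ultimately show ?case using seg_trans[of R K e a "a + csize c" s t X] by (simp add: add.assoc)
next
  case (Ite_True P s j c t X d)
  have 0: "code R K a [(j, \<lambda>s. [(s, Stay, if P s then a + 1 else a + 2 + csize c)])]"
    and 1: "code R K (a + 1) (compile (a + 1) c)"
    and 2: "code R K (a + 1 + csize c) [(j, \<lambda>s. [(s, Stay, a + 2 + csize c + csize d)])]"
    using Ite_True.prems(1) by (simp_all add: code_Cons code_append)
  have 3: "seg R K e a (a + 1) s 1 {s}"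
    using seg_goto[OF 0, of e s] Ite_True.prems Ite_True.hyps by auto
  have 4: "seg R K e (a + 1) (a + 1 + csize c) s t X"
    using Ite_True.prems 1 by (intro Ite_True.IH) auto
  have "seg R K e (a + 1 + csize c) (a + 2 + csize c + csize d) s' 1 {s'}" for s'
    using Ite_True.prems by (intro seg_goto[OF 2]) auto
  from seg_from[OF 3 seg_to[OF 4 this]] show ?case by (simp add: add_ac)
next
  case (Ite_False P s j d t X c)
  have 0: "code R K a [(j, \<lambda>s. [(s, Stay, if P s then a + 1 else a + 2 + csize c)])]"
    and 1: "code R K (a + 2 + csize c) (compile (a + 2 + csize c) d)"
    using Ite_False.prems(1) by (simp_all add: code_Cons code_append)
  have 3: "seg R K e a (a + 2 + csize c) s 1 {s}"
    using seg_goto[OF 0, of e s] Ite_False.prems Ite_False.hyps by auto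
  have "seg R K e (a + 2 + csize c) (a + 2 + csize c + csize d) s t X"
    using Ite_False.prems 1 by (intro Ite_False.IH) auto
  from seg_mono[OF seg_from[OF 3 this], of "t + 2"] show ?case by (simp add: add_ac)
next
  case (Whl_False P s j c)
  have "code R K a [(j, \<lambda>s. [(s, Stay, if P s then a + 1 else a + 2 + csize c)])]"
    using Whl_False.prems(1) by (simp add: code_Cons)
  from seg_goto[OF this, of e s] have "seg R K e a (a + 2 + csize c) s 1 {s}"
    using Whl_False.prems Whl_False.hyps by auto
  then show ?case by simp
next
  case (Whl_True P s j c t X u Y)
  have 0: "code R K a [(j, \<lambda>s. [(s, Stay, if P s then a + 1 else a + 2 + csize c)])]"
    and 1: "code R K (a + 1) (compile (a + 1) c)"
    and 2: "code R K (a + 1 + csize c) [(j, \<lambda>s. [(s, Stay, a)])]"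
    using Whl_True.prems(1) by (simp_all add: code_Cons code_append)
  have 3: "seg R K e a (a + 1) s 1 {s}"
    using seg_goto[OF 0, of e s] Whl_True.prems Whl_True.hyps by auto
  have 4: "seg R K e (a + 1) (a + 1 + csize c) s t X"
    using Whl_True.prems 1 by (intro Whl_True.IH) auto
  have "seg R K e (a + 1 + csize c) (a + csize (Whl j P c)) s' (1 + u) (Y s')" if "s' \<in> X" for s'
  proof (rule seg_from)
    show "seg R K e (a + 1 + csize c) a s' 1 {s'}"
      using Whl_True.prems by (intro seg_goto[OF 2]) auto
    show "seg R K e a (a + csize (Whl j P c)) s' u (Y s')"
      using that Whl_True.prems by (rule Whl_True.IH)
  qed
  from seg_from[OF 3 seg_trans[OF 4 this]] show ?case by (simp add: add_ac)
next
  case (mono c s t X u)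
  then show ?case using seg_mono by blast
qed

section \<open>Machines built from compiled code\<close>

definition words :: "nat \<Rightarrow> symbol list set" where
  "words K = {rs. set rs \<subseteq> {Blank, Bit False, Bit True, Aux 0} \<and> length rs = K}"

text \<open>Only the four symbols that a store can show are tabulated, which keeps the set of
  transitions finite. All tapes but one are rewritten as they are.\<close>

definition instr_trans :: "nat \<Rightarrow> nat \<Rightarrow> instr list \<Rightarrow> transition set" where
  "instr_trans K a is = (\<Union>i\<in>{..<length is}. \<Union>rs\<in>words K.
     (\<lambda>(w, m, q'). (a + i, rs, q', (map (\<lambda>s. (s, Stay)) rs)[fst (is ! i) := (w, m)])) `
       set (snd (is ! i) (rs ! fst (is ! i))))"

text \<open>States 0 and 1 write the mark into cell -1 of every tape; the code starts in state 2.\<close>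

definition program_trans :: "nat \<Rightarrow> com \<Rightarrow> transition set" where
  "program_trans K c = (\<lambda>rs. (0, rs, 1, map (\<lambda>s. (s, Left)) rs)) ` words K \<union>
     (\<lambda>rs. (1, rs, 2, map (\<lambda>s. (Aux 0, Stay)) rs)) ` words K \<union>
     instr_trans K 2 (compile 2 c)"

definition word_store :: "bool list \<Rightarrow> store" where
  "word_store x = (\<lambda>j i. if j = 0 \<and> i < length x then Some (x ! i) else None, \<lambda>_. 0)"

lemma finite_words: "finite (words K)"
  unfolding words_def by (rule finite_lists_length_eq) simp

lemma finite_program_trans: "finite (program_trans K c)"
  by (simp add: program_trans_def instr_trans_def finite_words)

lemma program_trans_length:
  "(q, rs, q', as) \<in> program_trans K c \<Longrightarrow> length rs = K \<and> length as = K"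
  by (auto simp: program_trans_def instr_trans_def words_def split: prod.splits)

lemma program_trans_state: "(q, rs, q', as) \<in> program_trans K c \<Longrightarrow> q < 2 + csize c"
  by (auto simp: program_trans_def instr_trans_def split: prod.splits)

lemma scanned_words: "map scanned (conc K s) \<in> words K"
proof -
  have "bit_symbol b \<in> {Blank, Bit False, Bit True}" for b
    by (cases b rule: bit_symbol.cases) auto
  then have "scan s j \<in> {Blank, Bit False, Bit True, Aux 0}" for j
    by (auto simp: scan_def)
  moreover have "map scanned (conc K s) = map (scan s) [0..<K]"
    by (rule nth_equalityI) (auto simp: scanned_conc)
  ultimately show ?thesis unfolding words_def by (auto simp del: insert_iff)
qed

lemma compile_tapes: "x \<in> set (compile a c) \<Longrightarrow> fst x < tapes c"
  by (induction c arbitrary: a) force+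

lemma step_iff:
  "step M (q, ts) c' \<longleftrightarrow>
     (\<exists>q' as. c' = (q', map2 act as ts) \<and> (q, map scanned ts, q', as) \<in> transitions M)"
  by (auto simp: step.simps)

lemma map2_act_update:
  assumes "j < length ts"
  shows "map2 act ((map (\<lambda>s. (s, Stay)) (map scanned ts))[j := (w, m)]) ts = ts[j := act (w, m) (ts ! j)]"
proof (rule nth_equalityI)
  fix i assume i: "i < length (map2 act ((map (\<lambda>s. (s, Stay)) (map scanned ts))[j := (w, m)]) ts)"
  then show "map2 act ((map (\<lambda>s. (s, Stay)) (map scanned ts))[j := (w, m)]) ts ! i
      = ts[j := act (w, m) (ts ! j)] ! i"
    by (cases "ts ! i"; cases "i = j") (auto simp: nth_list_update)
qed simp

lemma instr_trans_iff:
  assumes "i < length is" "rs \<in> words K"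
  shows "(a + i, rs, q', as) \<in> instr_trans K a is \<longleftrightarrow>
    (\<exists>(w, m, q'') \<in> set (snd (is ! i) (rs ! fst (is ! i))). q' = q'' \<and>
       as = (map (\<lambda>s. (s, Stay)) rs)[fst (is ! i) := (w, m)])"
  using assms unfolding instr_trans_def by (fastforce split: prod.splits)

lemma program_trans_0: "(0, rs, q', as) \<in> program_trans K c \<longleftrightarrow>
    rs \<in> words K \<and> q' = 1 \<and> as = map (\<lambda>s. (s, Left)) rs"
  by (auto simp: program_trans_def instr_trans_def)

lemma program_trans_1: "(Suc 0, rs, q', as) \<in> program_trans K c \<longleftrightarrow>
    rs \<in> words K \<and> q' = 2 \<and> as = map (\<lambda>s. (Aux 0, Stay)) rs"
  by (auto simp: program_trans_def instr_trans_def)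

lemma program_trans_2: "(2 + i, rs, q', as) \<in> program_trans K c \<longleftrightarrow>
    (2 + i, rs, q', as) \<in> instr_trans K 2 (compile 2 c)"
  by (auto simp: program_trans_def)

lemma code_program:
  assumes "transitions M = program_trans K c" "tapes c \<le> K"
    and R: "\<And>q ts c'. q < 2 + csize c \<Longrightarrow> R (q, ts) c' \<longleftrightarrow> step M (q, ts) c'"
  shows "code R K 2 (compile 2 c)"
  unfolding code_def
proof (intro allI impI)
  fix i s c' assume i: "i < length (compile 2 c)"
  let ?x = "compile 2 c ! i"
  have j: "fst ?x < K" using compile_tapes[OF nth_mem[OF i]] assms(2) by simp
  have tr: "(2 + i, map scanned (conc K s), q', as) \<in> program_trans K c \<longleftrightarrow>
      (\<exists>(w, m, q'') \<in> set (snd ?x (scan s (fst ?x))). q' = q'' \<and>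
         as = (map (\<lambda>s. (s, Stay)) (map scanned (conc K s)))[fst ?x := (w, m)])" for q' as
    unfolding program_trans_2 instr_trans_iff[OF i scanned_words] using j
    by (simp add: scanned_conc)
  have "R (2 + i, conc K s) c' \<longleftrightarrow> (\<exists>q' as. c' = (q', map2 act as (conc K s)) \<and>
      (2 + i, map scanned (conc K s), q', as) \<in> program_trans K c)"
    using R[of "2 + i"] i assms(1) by (simp add: step_iff)
  also have "\<dots> \<longleftrightarrow> (\<exists>q' as. c' = (q', map2 act as (conc K s)) \<and>
      (\<exists>(w, m, q'') \<in> set (snd ?x (scan s (fst ?x))). q' = q'' \<and>
         as = (map (\<lambda>s. (s, Stay)) (map scanned (conc K s)))[fst ?x := (w, m)]))"
    by (simp only: tr)
  also have "\<dots> \<longleftrightarrow> (\<exists>(w, m, q') \<in> set (snd ?x (scan s (fst ?x))).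
      c' = (q', map2 act ((map (\<lambda>s. (s, Stay)) (map scanned (conc K s)))[fst ?x := (w, m)]) (conc K s)))"
    unfolding case_prod_beta by blast
  also have "\<dots> \<longleftrightarrow> (\<exists>(w, m, q') \<in> set (snd ?x (scan s (fst ?x))).
      c' = (q', (conc K s)[fst ?x := act (w, m) (conc K s ! fst ?x)]))"
    using map2_act_update[of "fst ?x" "conc K s"] j by (simp only: length_conc)
  finally show "R (2 + i, conc K s) c' \<longleftrightarrow> (\<exists>(w, m, q') \<in> set (snd ?x (scan s (fst ?x))).
      c' = (q', (conc K s)[fst ?x := act (w, m) (conc K s ! fst ?x)]))" .
qed

lemma program_init:
  assumes M: "transitions M = program_trans K c" "start_state M = 0" "num_tapes M = K" "0 < K"
    and R: "\<And>q ts c'. q < 2 + csize c \<Longrightarrow> R (q, ts) c' \<longleftrightarrow> step M (q, ts) c'"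
  obtains ts where "\<And>c'. R (init_config M x) c' \<longleftrightarrow> c' = (1, ts)"
    "\<And>c'. R (1, ts) c' \<longleftrightarrow> c' = (2, conc K (word_store x))" "fst (init_config M x) = 0"
proof -
  define ts0 where "ts0 = snd (init_config M x)"
  define ts1 where "ts1 = map (\<lambda>(t, i :: int). (t, i - 1)) ts0"
  have ts0: "ts0 = map (\<lambda>j. input_tape (if j = 0 then x else [])) [0..<K]"
    using M by (auto simp: ts0_def init_config_def nth_Cons' intro!: nth_equalityI)
  have 0: "map scanned ts0 \<in> words K" "map scanned ts1 = replicate K Blank"
    by (auto simp: ts0 ts1_def words_def input_tape_def intro!: nth_equalityI)
  have 1: "map2 act (map (\<lambda>s. (s, Left)) (map scanned ts0)) ts0 = ts1"
    by (rule nth_equalityI) (auto simp: ts0 ts1_def input_tape_def)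
  have 2: "map2 act (map (\<lambda>s. (Aux 0, Stay)) (replicate K Blank)) ts1 = conc K (word_store x)"
    by (rule nth_equalityI)
      (auto simp: ts0 ts1_def input_tape_def conc_def word_store_def cell_def fun_eq_iff)
  have e: "init_config M x = (0, ts0)" using M by (simp add: ts0_def init_config_def)
  have K: "replicate K Blank \<in> words K" by (auto simp: words_def)
  show thesis
  proof (rule that[of ts1])
    show "R (init_config M x) c' \<longleftrightarrow> c' = (1, ts1)" for c'
      using R[of 0 ts0 c'] 0 1 e M(1)
      by (simp add: step_iff program_trans_0)
    show "R (1, ts1) c' \<longleftrightarrow> c' = (2, conc K (word_store x))" for c'
      using R[of 1 ts1 c'] 0 2 K e M(1)
      by (simp add: step_iff program_trans_1)
  qed (simp add: e)
qed

text \<open>The summand 2 counts the two steps that write the marks. What happens at the exit state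
  is left open: it can be a halt or the query of an oracle.\<close>

lemma program_seg:
  assumes M: "transitions M = program_trans K c" "start_state M = 0" "num_tapes M = K" "0 < K"
    and R': "\<forall>q ts c'. q < 2 + csize c \<longrightarrow> R (q, ts) c' \<longleftrightarrow> step M (q, ts) c'"
    and t: "ter c (word_store x) t X" "tapes c \<le> K" and e: "2 + csize c \<le> e"
  shows "s \<in> X \<Longrightarrow> R\<^sup>*\<^sup>* (init_config M x) (2 + csize c, conc K s)"
    and "(\<And>s. s \<in> X \<Longrightarrow> halts_within R (2 + csize c, conc K s) u) \<Longrightarrow>
      halts_within R (init_config M x) (t + u + 2)"
    and "R\<^sup>*\<^sup>* (init_config M x) (e, ts) \<Longrightarrow> \<exists>s\<in>X. R\<^sup>*\<^sup>* (2 + csize c, conc K s) (e, ts)"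
proof -
  note R = R'[rule_format]
  have seg: "seg R K e 2 (2 + csize c) (word_store x) t X"
    using code_program[OF M(1) t(2) R] e by (intro ter_seg[OF t(1) _ t(2)]) auto
  obtain ts1 where 1: "\<And>c'. R (init_config M x) c' \<longleftrightarrow> c' = (1, ts1)"
    "\<And>c'. R (1, ts1) c' \<longleftrightarrow> c' = (2, conc K (word_store x))" "fst (init_config M x) = 0"
    using program_init[OF M R] by metis
  show "R\<^sup>*\<^sup>* (init_config M x) (2 + csize c, conc K s)" if "s \<in> X"
    using seg that 1 unfolding seg_def by (metis converse_rtranclp_into_rtranclp)
  show "halts_within R (init_config M x) (t + u + 2)"
    if "\<And>s. s \<in> X \<Longrightarrow> halts_within R (2 + csize c, conc K s) u"
  proof -
    have "halts_within R (2, conc K (word_store x)) (t + u)"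
      using seg that by (simp add: seg_def)
    then have "halts_within R (1, ts1) (Suc (t + u))" using 1 by (rule_tac halts_within_step) auto
    then have "halts_within R (init_config M x) (Suc (Suc (t + u)))"
      using 1 by (rule_tac halts_within_step) auto
    then show ?thesis by simp
  qed
  assume r: "R\<^sup>*\<^sup>* (init_config M x) (e, ts)"
  then have "R\<^sup>*\<^sup>* (1, ts1) (e, ts)"
    using 1 e by (metis converse_rtranclpE fst_conv add_2_eq_Suc less_eq_Suc_le not_less_zero)
  then have "R\<^sup>*\<^sup>* (2, conc K (word_store x)) (e, ts)"
    by (rule converse_rtranclpE) (use 1 e in auto)
  then show "\<exists>s\<in>X. R\<^sup>*\<^sup>* (2 + csize c, conc K s) (e, ts)"
    using seg by (simp add: seg_def)
qed

text \<open>The base \<open>n + 2\<close> is at least 2, so constants, sums and the doubling of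
  \<open>n\<close> are absorbed by a larger exponent.\<close>

definition pbounded :: "(nat \<Rightarrow> nat) \<Rightarrow> bool" where
  "pbounded g \<longleftrightarrow> (\<exists>d. \<forall>n. g n \<le> (n + 2) ^ d)"

lemma pbounded_mono: "pbounded g \<Longrightarrow> (\<And>n. f n \<le> g n) \<Longrightarrow> pbounded f"
  unfolding pbounded_def by (meson le_trans)

lemma pbounded_const: "pbounded (\<lambda>_. k)"
  unfolding pbounded_def
proof (intro exI allI)
  fix n :: nat
  have "k < 2 ^ k" by simp
  also have "\<dots> \<le> (n + 2) ^ k" by (intro power_mono) auto
  finally show "k \<le> (n + 2) ^ k" by simp
qed

lemma pbounded_id: "pbounded (\<lambda>n. n)"
  unfolding pbounded_def by (intro exI[of _ 1]) simp

lemma pbounded_mult: "pbounded f \<Longrightarrow> pbounded g \<Longrightarrow> pbounded (\<lambda>n. f n * g n)"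
  unfolding pbounded_def by (metis mult_le_mono power_add)

lemma pbounded_add:
  assumes "pbounded f" "pbounded g"
  shows "pbounded (\<lambda>n. f n + g n)"
proof (rule pbounded_mono)
  show "pbounded (\<lambda>n. (f n + 1) * (g n + 1))"
  proof (rule pbounded_mult)
    have "pbounded (\<lambda>n. h n + 1)" if "pbounded h" for h
    proof -
      obtain d where d: "\<And>n. h n \<le> (n + 2) ^ d" using \<open>pbounded h\<close> by (auto simp: pbounded_def)
      have "h n + 1 \<le> (n + 2) ^ Suc d" for n
      proof -
        have "1 \<le> (n + 2) ^ d" by simp
        then have "h n + 1 \<le> 2 * (n + 2) ^ d" using d[of n] by linarith
        also have "\<dots> \<le> (n + 2) ^ Suc d" by simp
        finally show ?thesis .
      qed
      then show ?thesis unfolding pbounded_def by blast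
    qed
    with assms show "pbounded (\<lambda>n. f n + 1)" "pbounded (\<lambda>n. g n + 1)" by auto
  qed
qed auto

lemma pbounded_double: "pbounded f \<Longrightarrow> pbounded (\<lambda>n. f (2 * n))"
  unfolding pbounded_def
proof (elim exE, intro exI allI)
  fix d n assume "\<forall>n. f n \<le> (n + 2) ^ d"
  then have "f (2 * n) \<le> (2 * n + 2) ^ d" by simp
  also have "\<dots> \<le> ((n + 2) ^ 2) ^ d" by (intro power_mono) (auto simp: power2_eq_square)
  finally show "f (2 * n) \<le> (n + 2) ^ (2 * d)" by (simp add: power_mult)
qed

section \<open>Programs for NP, Sigma_2 and computable functions\<close>

lemma poly_timeI:
  assumes "pbounded T" "\<And>x. halts_within R (init_config M x) (T (length x))"
  shows "poly_time R M"
proof -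
  obtain d where d: "\<And>n. T n \<le> (n + 2) ^ d" using assms(1) by (auto simp: pbounded_def)
  have "poly ([:2, 1:] ^ d) n = (n + 2) ^ d" for n :: nat by (simp add: add.commute)
  then show ?thesis
    unfolding poly_time_def using assms(2) d by (metis halts_within_mono)
qed

lemma halts_within_stuck: "(\<And>c'. \<not> R c c') \<Longrightarrow> halts_within R c 0"
  unfolding halts_within_def by (metis le0 not0_implies_Suc le_refl relpowp_Suc_E2)

lemma program_stuck:
  assumes "transitions M = program_trans K c" "2 + csize c \<le> q"
  shows "\<not> step M (q, ts) c'"
  unfolding step_iff assms(1) using program_trans_state assms(2) by (metis not_le)

lemma tapes_pos: "tapes c > 0"
  by (induction c) auto

lemma NP_program:
  assumes ter: "\<And>x. ter c (word_store x) (T (length x)) (X x)" and T: "pbounded T"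
  shows "{x. X x \<noteq> {}} \<in> NP"
proof -
  define K where "K = Suc (tapes c)"
  define M :: ntm where "M = \<lparr>num_tapes = K, transitions = program_trans K c, start_state = 0,
    accept_state = 2 + csize c\<rparr>"
  have M: "transitions M = program_trans K c" "start_state M = 0" "num_tapes M = K" "0 < K"
    "tapes c \<le> K"
    by (auto simp: M_def K_def)
  have R: "\<forall>q ts c'. q < 2 + csize c \<longrightarrow> step M (q, ts) c' \<longleftrightarrow> step M (q, ts) c'" by simp
  note seg = program_seg[OF M(1-4) R ter M(5) order.refl]
  have stuck: "\<not> step M (2 + csize c, ts) c'" for ts c'
    by (rule program_stuck[OF M(1)]) simp
  show ?thesis
    unfolding NP_def mem_Collect_eq
  proof (intro exI conjI)
    show "wf_ntm M"
      unfolding wf_ntm_def M(1,3) using M(4) finite_program_trans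
      by (auto dest: program_trans_length)
    have "pbounded (\<lambda>n. T n + 0 + 2)" by (intro pbounded_add T pbounded_const)
    then show "poly_time (step M) M"
      by (rule poly_timeI) (rule seg(2), rule halts_within_stuck, rule stuck)
    have "accept_state M = 2 + csize c" by (simp add: M_def)
    then show "{x. X x \<noteq> {}} = {x. accepts (step M) M x}"
      unfolding accepts_def using seg(1, 3) by fastforce
  qed
qed

lemma tape_word_unique:
  assumes v: "tape_word tp v" and w: "tape_word tp w"
  shows "v = w"
proof -
  have "\<not> length v < length w" if "tape_word tp v" "tape_word tp w" for v w
    using that unfolding tape_word_def by (metis rangeI)
  then have "length v = length w" using v w by (metis linorder_neqE_nat)
  moreover have "Bit (v ! i) = Bit (w ! i)" if "i < length v" for i
    using v w that \<open>length v = length w\<close> unfolding tape_word_def by metis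
  ultimately show ?thesis by (auto intro: nth_equalityI)
qed

lemma oracle_step_iff:
  "oracle_step B M (q, ts) c' \<longleftrightarrow>
     (if q = query_state M
      then \<exists>w. tape_word (last ts) w \<and> c' = (if w \<in> B then yes_state M else no_state M, ts)
      else step M (q, ts) c')"
  by (subst oracle_step.simps) auto

text \<open>The oracle is asked only once, after the program has finished. The accepting state is
  the state for the answer no, which matches the shape of a Sigma_2 statement: something is guessed
  for which no counterexample exists. Taking exactly \<open>tapes c\<close> tapes makes the highest
  tape of the program the query tape.\<close>

lemma Sigma2p_program:
  assumes ter: "\<And>x. ter c (word_store x) (T (length x)) (X x)" and T: "pbounded T"
    and B: "B \<in> NP" and K: "K = tapes c"
    and out: "\<And>x s. s \<in> X x \<Longrightarrow> tape_word (last (conc K s)) (out s)"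
  shows "{x. \<exists>s\<in>X x. out s \<notin> B} \<in> Sigma2p"
proof -
  define b where "b = 2 + csize c"
  define M :: oracle_ntm where "M = \<lparr>num_tapes = K, transitions = program_trans K c,
    start_state = 0, accept_state = b + 2, query_state = b, yes_state = b + 1, no_state = b + 2\<rparr>"
  let ?R = "oracle_step B M"
  have M: "transitions M = program_trans K c" "start_state M = 0" "num_tapes M = K" "0 < K"
    "tapes c \<le> K" "accept_state M = b + 2" "query_state M = b" "yes_state M = b + 1" "no_state M = b + 2"
    by (simp_all add: M_def K tapes_pos)
  have stuck: "\<not> ?R (q, ts) c'" if "b < q" for q ts c'
  proof
    assume "?R (q, ts) c'"
    then have "step M (q, ts) c'" using that M(7) by (simp add: oracle_step_iff)
    then show False using program_stuck[OF M(1)] that by (simp add: b_def)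
  qed
  have query: "?R (b, conc K s) c' \<longleftrightarrow> c' = (if out s \<in> B then b + 1 else b + 2, conc K s)"
    if "s \<in> X x" for s x c'
  proof -
    have "w = out s" if "tape_word (last (conc K s)) w" for w
      using tape_word_unique[OF that out[OF \<open>s \<in> X x\<close>]] .
    then have "(\<exists>w. tape_word (last (conc K s)) w \<and> P w) \<longleftrightarrow> P (out s)" for P
      using out[OF \<open>s \<in> X x\<close>] by blast
    then show ?thesis by (simp only: oracle_step_iff M(7-9) refl if_True)
  qed
  have R: "\<forall>q ts c'. q < 2 + csize c \<longrightarrow> ?R (q, ts) c' \<longleftrightarrow> step M (q, ts) c'"
    by (simp only: oracle_step_iff M(7)) (simp add: b_def)
  have e: "2 + csize c \<le> b + 2" by (simp add: b_def)
  note seg = program_seg[OF M(1-4) R ter M(5) e, folded b_def]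
  have "M = M \<Longrightarrow> {x. \<exists>s\<in>X x. out s \<notin> B} \<in> NP_oracle B"
    unfolding NP_oracle_def mem_Collect_eq
  proof (intro exI conjI)
    show "wf_ntm M"
      unfolding wf_ntm_def M(1,3) using M(4) finite_program_trans
      by (auto dest: program_trans_length)
    have *: "pbounded (\<lambda>n. T n + 1 + 2)" by (intro pbounded_add T pbounded_const)
    have "halts_within ?R (init_config M x) (T (length x) + 1 + 2)" for x
    proof (rule seg(2))
      fix s assume "s \<in> X x"
      have "halts_within ?R (b, conc K s) (Suc 0)"
        by (rule halts_within_step, rule halts_within_stuck)
          (use query[OF \<open>s \<in> X x\<close>] stuck in auto)
      then show "halts_within ?R (b, conc K s) 1" by simp
    qed
    then show "poly_time ?R M" by (rule poly_timeI[OF *])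
    show "{x. \<exists>s\<in>X x. out s \<notin> B} = {x. accepts ?R M x}"
    proof (intro set_eqI iffI)
      fix x assume "x \<in> {x. \<exists>s\<in>X x. out s \<notin> B}"
      then obtain s where s: "s \<in> X x" "out s \<notin> B" by auto
      then have "?R\<^sup>*\<^sup>* (init_config M x) (b + 2, conc K s)"
        using seg(1)[OF s(1)] query[OF s(1)] by (simp add: rtranclp.rtrancl_into_rtrancl)
      then show "x \<in> {x. accepts ?R M x}" using M by (auto simp: accepts_def)
    next
      fix x assume "x \<in> {x. accepts ?R M x}"
      then obtain ts where "?R\<^sup>*\<^sup>* (init_config M x) (b + 2, ts)" using M by (auto simp: accepts_def)
      then obtain s where s: "s \<in> X x" and r: "?R\<^sup>*\<^sup>* (b, conc K s) (b + 2, ts)"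
        using seg(3) by blast
      from r have "\<exists>c'. ?R (b, conc K s) c' \<and> ?R\<^sup>*\<^sup>* c' (b + 2, ts)"
        by (rule converse_rtranclpE) auto
      then have *: "?R\<^sup>*\<^sup>* (if out s \<in> B then b + 1 else b + 2, conc K s) (b + 2, ts)"
        by (simp only: query[OF s] simp_thms)
      have "out s \<notin> B"
      proof
        assume "out s \<in> B"
        with * have "?R\<^sup>*\<^sup>* (b + 1, conc K s) (b + 2, ts)" by simp
        then show False by (rule converse_rtranclpE) (use stuck in auto)
      qed
      then show "x \<in> {x. \<exists>s\<in>X x. out s \<notin> B}" using s by blast
    qed
  qed
  then show ?thesis using B unfolding Sigma2p_def by blast
qed

lemma compile_deterministic: "guess_free c \<Longrightarrow> x \<in> set (compile a c) \<Longrightarrow> length (snd x s) \<le> 1"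
  by (induction c arbitrary: a) (auto simp: numeral_2_eq_2)

text \<open>Computability speaks of all halting configurations that can be reached. The program
  yields one of them, and determinism makes it the only one.\<close>

lemma computable_program:
  assumes ter: "\<And>x. ter c (word_store x) (T (length x)) {F x}" and T: "pbounded T"
    and gf: "guess_free c" and K: "K = tapes c"
    and out: "\<And>x. tape_word (last (conc K (F x))) (f x)"
  shows "poly_time_computable f"
proof -
  define b where "b = 2 + csize c"
  define M :: ntm where "M = \<lparr>num_tapes = K, transitions = program_trans K c, start_state = 0,
    accept_state = b\<rparr>"
  have M: "transitions M = program_trans K c" "start_state M = 0" "num_tapes M = K" "0 < K"
    "tapes c \<le> K"
    by (simp_all add: M_def K tapes_pos)
  have R: "\<forall>q ts c'. q < 2 + csize c \<longrightarrow> step M (q, ts) c' \<longleftrightarrow> step M (q, ts) c'" by simp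
  note seg = program_seg[OF M(1-4) R ter M(5) order.refl, folded b_def]
  have stuck: "\<not> step M (b, ts) c'" for ts c'
    by (rule program_stuck[OF M(1)]) (simp add: b_def)
  have single: "p = r" if "length l \<le> 1" "p \<in> set l" "r \<in> set l" for l and p r :: "symbol \<times> move \<times> nat"
    using that by (cases l) auto
  have det: "deterministic M"
    unfolding deterministic_def M(1)
  proof (intro allI impI)
    fix q rs q1 as1 q2 as2
    assume "(q, rs, q1, as1) \<in> program_trans K c" "(q, rs, q2, as2) \<in> program_trans K c"
    then show "q1 = q2 \<and> as1 = as2"
      unfolding program_trans_def instr_trans_def
      by (auto split: prod.splits dest: single[OF compile_deterministic[OF gf nth_mem], rotated 2])
  qed
  have detR: "c1 = c2" if "step M c0 c1" "step M c0 c2" for c0 c1 c2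
    using that det by (cases c0) (auto simp: step_iff deterministic_def, blast+)
  have final: "c2 = c1" if "(step M)\<^sup>*\<^sup>* c0 c1" "(step M)\<^sup>*\<^sup>* c0 c2" "\<nexists>c. step M c1 c" "\<nexists>c. step M c2 c"
    for c0 c1 c2
    using that
  proof (induction arbitrary: rule: converse_rtranclp_induct)
    case base then show ?case by (auto elim: converse_rtranclpE)
  next
    case (step y z)
    then show ?case by (metis converse_rtranclpE detR)
  qed
  show ?thesis
    unfolding poly_time_computable_def
  proof (intro exI conjI allI impI)
    show "wf_ntm M"
      unfolding wf_ntm_def M(1,3) using M(4) finite_program_trans
      by (auto dest: program_trans_length)
    show "deterministic M" by (rule det)
    have "pbounded (\<lambda>n. T n + 0 + 2)" by (intro pbounded_add T pbounded_const)
    then show "poly_time (step M) M"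
      by (rule poly_timeI) (rule seg(2), rule halts_within_stuck, rule stuck)
    fix x q ts
    assume "(step M)\<^sup>*\<^sup>* (init_config M x) (q, ts) \<and> (\<nexists>c. step M (q, ts) c)"
    then have "(q, ts) = (b, conc K (F x))"
      using seg(1)[of "F x" x] stuck by (intro final[of "init_config M x"]) auto
    then show "tape_word (last ts) (f x)" using out by simp
  qed
qed

section \<open>Deterministic programs on counters\<close>

definition run :: "com \<Rightarrow> store \<Rightarrow> nat \<Rightarrow> store \<Rightarrow> bool" where
  "run c s t s' \<longleftrightarrow> ter c s t {s'}"

lemma run_mono: "run c s t s' \<Longrightarrow> t \<le> u \<Longrightarrow> run c s u s'"
  unfolding run_def by (rule ter.mono)

lemma run_Seq: "run c s t s' \<Longrightarrow> run d s' u s'' \<Longrightarrow> run (c ;; d) s (t + u) s''"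
  unfolding run_def using ter.Seq[of c s t "{s'}" d u "\<lambda>_. {s''}"] by simp

lemma run_GoR: "run (GoR j) (C, p) 1 (C, p(j := Suc (p j)))"
  unfolding run_def using ter.GoR[of j "(C, p)"] by (simp add: go_right_def)

lemma run_GoL: "run (GoL j) (C, p) 1 (C, p(j := p j - 1))"
  unfolding run_def using ter.GoL[of j "(C, p)"] by (simp add: go_left_def)

lemma run_Ite:
  "run (if P (scan s j) then c else d) s t s' \<Longrightarrow> run (Ite j P c d) s (t + 2) s'"
  unfolding run_def using ter.Ite_True ter.Ite_False by (cases "P (scan s j)") auto

text \<open>\<open>S i\<close> is the store before round \<open>i\<close> and plays the role of a
  loop invariant. The summand 2 pays for the test and for the jump back.\<close>

lemma run_for:
  assumes "\<And>i. i < k \<Longrightarrow> P (scan (S i) j)" "\<And>i. i < k \<Longrightarrow> run c (S i) t (S (Suc i))"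
    and "\<not> P (scan (S k) j)"
  shows "run (Whl j P c) (S 0) (k * (t + 2) + 1) (S k)"
proof -
  have "run (Whl j P c) (S i) ((k - i) * (t + 2) + 1) (S k)" if "i \<le> k" for i
    using that
  proof (induction i rule: inc_induct)
    case base
    then show ?case using ter.Whl_False[of P "S k" j c] assms(3) by (simp add: run_def)
  next
    case (step i)
    then have "run (Whl j P c) (S i) (t + 2 + ((k - Suc i) * (t + 2) + 1)) (S k)"
      using ter.Whl_True[of P "S i" j c t "{S (Suc i)}" "(k - Suc i) * (t + 2) + 1" "\<lambda>_. {S k}"]
        assms(1,2)[of i] by (simp add: run_def)
    moreover have "t + 2 + ((k - Suc i) * (t + 2) + 1) = (k - i) * (t + 2) + 1"
      using step.hyps by (metis (no_types, opaque_lifting) Suc_diff_Suc add.assoc mult_Suc)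
    ultimately show ?case by simp
  qed
  from this[of 0] show ?thesis by simp
qed

abbreviation marked :: "symbol \<Rightarrow> bool" where "marked s \<equiv> s \<noteq> Aux 0"

lemma scan_mark: "scan (C, p) j = Aux 0 \<longleftrightarrow> p j = 0"
proof -
  have "bit_symbol b \<noteq> Aux 0" for b by (cases b rule: bit_symbol.cases) auto
  then show ?thesis by (simp add: scan_def)
qed

lemma run_clear:
  assumes "p j \<le> N"
  shows "run (Whl j marked (GoL j)) (C, p) (N * 3 + 1) (C, p(j := 0))"
proof -
  have "run (Whl j marked (GoL j)) (C, p(j := p j - 0)) (p j * (1 + 2) + 1) (C, p(j := p j - p j))"
    by (rule run_for[of "p j" _ "\<lambda>i. (C, p(j := p j - i))"])
      (use run_GoL[of j C "p(j := p j - _)"] in \<open>auto simp: scan_mark\<close>)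
  then show ?thesis using assms by (auto elim!: run_mono)
qed

lemma run_drain:
  assumes "p j \<le> N" "j \<noteq> k"
  shows "run (Whl j marked (GoL j ;; GoR k)) (C, p) (N * 4 + 1) (C, p(j := 0, k := p k + p j))"
proof -
  have "run (GoL j ;; GoR k) (C, p(j := p j - i, k := p k + i)) (1 + 1)
      (C, p(j := p j - Suc i, k := p k + Suc i))" for i
  proof (rule run_Seq)
    show "run (GoL j) (C, p(j := p j - i, k := p k + i)) 1 (C, p(j := p j - Suc i, k := p k + i))"
      using run_GoL[of j C "p(j := p j - i, k := p k + i)"] assms(2) by (simp add: fun_upd_twist)
    show "run (GoR k) (C, p(j := p j - Suc i, k := p k + i)) 1 (C, p(j := p j - Suc i, k := p k + Suc i))"
      using run_GoR[of k C "p(j := p j - Suc i, k := p k + i)"] by simp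
  qed
  then have "run (Whl j marked (GoL j ;; GoR k)) (C, p(j := p j - 0, k := p k + 0)) (p j * (1 + 1 + 2) + 1)
      (C, p(j := p j - p j, k := p k + p j))"
    using assms(2) by (intro run_for[of "p j" _ "\<lambda>i. (C, p(j := p j - i, k := p k + i))"])
      (auto simp: scan_mark)
  then show ?thesis using assms by (auto elim!: run_mono)
qed

text \<open>A counter can only be read by counting it down. So it is drained into two tapes at once
  and then restored from the auxiliary tape \<open>l\<close>.\<close>

lemma run_copy:
  assumes "p j \<le> N" "j \<noteq> k" "j \<noteq> l" "k \<noteq> l" "p k = 0" "p l = 0"
  shows "run (Whl j marked (GoL j ;; GoR k ;; GoR l) ;; Whl l marked (GoL l ;; GoR j)) (C, p)
    (N * 5 + 1 + (N * 4 + 1)) (C, p(k := p j))"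
proof (rule run_Seq)
  have "run (GoL j ;; GoR k ;; GoR l) (C, p(j := p j - i, k := i, l := i)) (1 + (1 + 1))
      (C, p(j := p j - Suc i, k := Suc i, l := Suc i))" for i
  proof (intro run_Seq)
    show "run (GoL j) (C, p(j := p j - i, k := i, l := i)) 1 (C, p(j := p j - Suc i, k := i, l := i))"
      using run_GoL[of j C "p(j := p j - i, k := i, l := i)"] assms by (simp add: fun_upd_twist)
    show "run (GoR k) (C, p(j := p j - Suc i, k := i, l := i)) 1 (C, p(j := p j - Suc i, k := Suc i, l := i))"
      using run_GoR[of k C "p(j := p j - Suc i, k := i, l := i)"] assms by (simp add: fun_upd_twist)
    show "run (GoR l) (C, p(j := p j - Suc i, k := Suc i, l := i)) 1
        (C, p(j := p j - Suc i, k := Suc i, l := Suc i))"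
      using run_GoR[of l C "p(j := p j - Suc i, k := Suc i, l := i)"] by simp
  qed
  then have "run (Whl j marked (GoL j ;; GoR k ;; GoR l)) (C, p(j := p j - 0, k := 0, l := 0))
      (p j * (1 + (1 + 1) + 2) + 1) (C, p(j := p j - p j, k := p j, l := p j))"
    using assms by (intro run_for[of "p j" _ "\<lambda>i. (C, p(j := p j - i, k := i, l := i))"])
      (auto simp: scan_mark)
  moreover have "p(k := 0, l := 0) = p" using assms by auto
  ultimately show "run (Whl j marked (GoL j ;; GoR k ;; GoR l)) (C, p) (N * 5 + 1)
      (C, p(j := 0, k := p j, l := p j))"
    using assms by (auto elim!: run_mono)
  let ?q = "p(j := 0, k := p j, l := p j)"
  have "?q(l := 0, j := ?q j + ?q l) = p(k := p j)" using assms by auto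
  then show "run (Whl l marked (GoL l ;; GoR j)) (C, ?q) (N * 4 + 1) (C, p(k := p j))"
    using run_drain[of ?q l N j C] assms by simp
qed

section \<open>Polynomial-time number functions\<close>

text \<open>The functions take a word and an environment of numbers. For every placement v of the
  environment on tapes below b there is to be a program that leaves the value in the counter b,
  using only tapes from b on that are initially at 0.\<close>

type_synonym 'a wfun = "bool list \<Rightarrow> (nat \<Rightarrow> nat) \<Rightarrow> 'a"

text \<open>The bound is relative to a bound on the whole environment; in this form bounds survive
  composition.\<close>

definition bounded_fun :: "nat wfun \<Rightarrow> bool" where
  "bounded_fun f \<longleftrightarrow> (\<forall>B. pbounded B \<longrightarrow> (\<exists>D. pbounded D \<and>
     (\<forall>z e. (\<forall>i. e i \<le> B (length z)) \<longrightarrow> f z e \<le> D (length z))))"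

text \<open>The final store differs from the initial one only in counter \<open>b\<close>. All
  scratch counters are back at 0 and the input head is back on its mark, so the program can be
  repeated inside a loop.\<close>

definition computes :: "com \<Rightarrow> (nat \<Rightarrow> nat) \<Rightarrow> (nat \<Rightarrow> nat) \<Rightarrow> (nat \<Rightarrow> nat) \<Rightarrow> nat \<Rightarrow> nat wfun \<Rightarrow> bool" where
  "computes c T B v b f \<longleftrightarrow> guess_free c \<and> b < tapes c \<and> (\<forall>z C p.
     C 0 = fst (word_store z) 0 \<longrightarrow> p 0 = 0 \<longrightarrow> (\<forall>i. p (v i) \<le> B (length z)) \<longrightarrow>
     (\<forall>j. b \<le> j \<and> j < tapes c \<longrightarrow> p j = 0) \<longrightarrow>
     run c (C, p) (T (length z)) (C, p(b := f z (\<lambda>i. p (v i)))))"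

definition polyfun :: "nat wfun \<Rightarrow> bool" where
  "polyfun f \<longleftrightarrow> bounded_fun f \<and> (\<forall>B v b. pbounded B \<longrightarrow> (\<forall>i. 0 < v i \<and> v i < b) \<longrightarrow>
     (\<exists>c T. pbounded T \<and> computes c T B v b f))"

lemma computesD:
  "computes c T B v b f \<Longrightarrow> C 0 = fst (word_store z) 0 \<Longrightarrow> p 0 = 0 \<Longrightarrow> (\<And>i. p (v i) \<le> B (length z)) \<Longrightarrow>
     (\<And>j. b \<le> j \<Longrightarrow> j < tapes c \<Longrightarrow> p j = 0) \<Longrightarrow>
     run c (C, p) (T (length z)) (C, p(b := f z (\<lambda>i. p (v i))))"
  unfolding computes_def by blast

lemma polyfunI:
  assumes "bounded_fun f"
    and "\<And>B v b. pbounded B \<Longrightarrow> (\<And>i. 0 < v i) \<Longrightarrow> (\<And>i. v i < b) \<Longrightarrow> \<exists>c T. pbounded T \<and> computes c T B v b f"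
  shows "polyfun f"
  using assms unfolding polyfun_def by blast

lemma polyfunD:
  assumes "polyfun f" "pbounded B" "\<And>i. 0 < v i" "\<And>i. v i < b"
  obtains c T where "pbounded T" "computes c T B v b f"
  using assms unfolding polyfun_def by blast

lemma bounded_funD:
  assumes "bounded_fun f" "pbounded B"
  obtains D where "pbounded D" "\<forall>z e. (\<forall>i. e i \<le> B (length z)) \<longrightarrow> f z e \<le> D (length z)"
  using assms unfolding bounded_fun_def by blast

lemma polyfun_bounded: "polyfun f \<Longrightarrow> bounded_fun f"
  by (simp add: polyfun_def)

lemmas pbounded_intros = pbounded_add pbounded_mult pbounded_const pbounded_id

text \<open>This is the reason for quantifying over all placements \<open>v\<close>: they need not
  be injective, so renaming or identifying variables is a mere change of placement.\<close>

lemma polyfun_rename: "polyfun f \<Longrightarrow> polyfun (\<lambda>z e. f z (\<lambda>i. e (g i)))"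
  unfolding polyfun_def bounded_fun_def computes_def
proof (intro conjI allI impI; elim conjE)
  fix B assume "\<forall>B. pbounded B \<longrightarrow> (\<exists>D. pbounded D \<and> (\<forall>z e. (\<forall>i. e i \<le> B (length z)) \<longrightarrow> f z e \<le> D (length z)))"
    "pbounded B"
  then show "\<exists>D. pbounded D \<and> (\<forall>z e. (\<forall>i. e i \<le> B (length z)) \<longrightarrow> f z (\<lambda>i. e (g i)) \<le> D (length z))"
    by meson
next
  fix B and v :: "nat \<Rightarrow> nat" and b
  assume "pbounded B" "\<forall>i. 0 < v i \<and> v i < b" "\<forall>B v b. pbounded B \<longrightarrow> (\<forall>i. 0 < v i \<and> v i < b) \<longrightarrow>
     (\<exists>c T. pbounded T \<and> guess_free c \<and> b < tapes c \<and> (\<forall>z C p.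
     C 0 = fst (word_store z) 0 \<longrightarrow> p 0 = 0 \<longrightarrow> (\<forall>i. p (v i) \<le> B (length z)) \<longrightarrow>
     (\<forall>j. b \<le> j \<and> j < tapes c \<longrightarrow> p j = 0) \<longrightarrow>
     run c (C, p) (T (length z)) (C, p(b := f z (\<lambda>i. p (v i))))))"
  from this(3)[rule_format, of B "\<lambda>i. v (g i)" b] this(1,2)
  show "\<exists>c T. pbounded T \<and> guess_free c \<and> b < tapes c \<and> (\<forall>z C p.
     C 0 = fst (word_store z) 0 \<longrightarrow> p 0 = 0 \<longrightarrow> (\<forall>i. p (v i) \<le> B (length z)) \<longrightarrow>
     (\<forall>j. b \<le> j \<and> j < tapes c \<longrightarrow> p j = 0) \<longrightarrow>
     run c (C, p) (T (length z)) (C, p(b := f z (\<lambda>i. p (v (g i))))))"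
    by (simp, meson)
qed

lemma polyfun_var: "polyfun (\<lambda>z e. e i)"
proof (rule polyfunI)
  show "bounded_fun (\<lambda>z e. e i)" unfolding bounded_fun_def by blast
  fix B and v :: "nat \<Rightarrow> nat" and b :: nat assume B: "pbounded B" and v: "\<And>i. 0 < v i" "\<And>i. v i < (b::nat)"
  let ?c = "Whl (v i) marked (GoL (v i) ;; GoR b ;; GoR (b + 1)) ;;
    Whl (b + 1) marked (GoL (b + 1) ;; GoR (v i))"
  have "computes ?c (\<lambda>n. B n * 5 + 1 + (B n * 4 + 1)) B v b (\<lambda>z e. e i)"
    unfolding computes_def
  proof (intro conjI allI impI)
    fix z and C :: "nat \<Rightarrow> nat \<Rightarrow> bool option" and p
    assume "\<forall>i. p (v i) \<le> B (length z)" "\<forall>j. b \<le> j \<and> j < tapes ?c \<longrightarrow> p j = 0"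
    then show "run ?c (C, p) (B (length z) * 5 + 1 + (B (length z) * 4 + 1)) (C, p(b := p (v i)))"
      using v(2)[of i] by (intro run_copy) auto
  qed auto
  moreover have "pbounded (\<lambda>n. B n * 5 + 1 + (B n * 4 + 1))" by (intro pbounded_intros B)
  ultimately show "\<exists>c T. pbounded T \<and> computes c T B v b (\<lambda>z e. e i)" by blast
qed

lemma polyfun_0: "polyfun (\<lambda>z e. 0)"
proof (rule polyfunI)
  show "bounded_fun (\<lambda>z e. 0)" unfolding bounded_fun_def using pbounded_const by blast
  fix B and v :: "nat \<Rightarrow> nat" and b :: nat assume "\<And>i. 0 < v i" "\<And>i. v i < (b::nat)"
  have "computes (GoL b) (\<lambda>_. 1) B v b (\<lambda>z e. 0)"
    unfolding computes_def using run_GoL[of b] by auto (metis diff_0_eq_0 lessI order_refl)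
  then show "\<exists>c T. pbounded T \<and> computes c T B v b (\<lambda>z e. 0)" using pbounded_const by blast
qed

lemma polyfun_Suc:
  assumes f: "polyfun f"
  shows "polyfun (\<lambda>z e. Suc (f z e))"
proof (rule polyfunI)
  show "bounded_fun (\<lambda>z e. Suc (f z e))"
    unfolding bounded_fun_def
  proof (intro allI impI)
    fix B assume "pbounded B"
    then obtain D where D: "pbounded D" "\<forall>z e. (\<forall>i. e i \<le> B (length z)) \<longrightarrow> f z e \<le> D (length z)"
      by (rule bounded_funD[OF polyfun_bounded[OF f]])
    have "pbounded (\<lambda>n. D n + 1)" by (intro pbounded_intros D)
    then show "\<exists>D. pbounded D \<and> (\<forall>z e. (\<forall>i. e i \<le> B (length z)) \<longrightarrow> Suc (f z e) \<le> D (length z))"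
      using D(2) by fastforce
  qed
  fix B and v :: "nat \<Rightarrow> nat" and b :: nat assume "pbounded B" and v: "\<And>i. 0 < v i" "\<And>i. v i < (b::nat)"
  then obtain c T where c: "pbounded T" "computes c T B v b f" by (rule polyfunD[OF f])
  have "computes (c ;; GoR b) (\<lambda>n. T n + 1) B v b (\<lambda>z e. Suc (f z e))"
    unfolding computes_def
  proof (intro conjI allI impI)
    fix z and C :: "nat \<Rightarrow> nat \<Rightarrow> bool option" and p :: "nat \<Rightarrow> nat"
    assume p: "C 0 = fst (word_store z) 0" "p 0 = 0" "\<forall>i. p (v i) \<le> B (length z)"
      "\<forall>j. b \<le> j \<and> j < tapes (c ;; GoR b) \<longrightarrow> p j = 0"
    show "run (c ;; GoR b) (C, p) (T (length z) + 1) (C, p(b := Suc (f z (\<lambda>i. p (v i)))))"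
    proof (rule run_Seq)
      show "run c (C, p) (T (length z)) (C, p(b := f z (\<lambda>i. p (v i))))"
        using p by (intro computesD[OF c(2)]) auto
      show "run (GoR b) (C, p(b := f z (\<lambda>i. p (v i)))) 1 (C, p(b := Suc (f z (\<lambda>i. p (v i)))))"
        using run_GoR[of b C "p(b := f z (\<lambda>i. p (v i)))"] by simp
    qed
  qed (use c(2) in \<open>auto simp: computes_def\<close>)
  moreover have "pbounded (\<lambda>n. T n + 1)" by (intro pbounded_intros c)
  ultimately show "\<exists>c T. pbounded T \<and> computes c T B v b (\<lambda>z e. Suc (f z e))" by blast
qed

lemma scan_word:
  assumes "C 0 = fst (word_store z) 0"
  shows "scan (C, p) 0 = (if p 0 = 0 then Aux 0 else if p 0 \<le> length z then Bit (z ! (p 0 - 1)) else Blank)"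
  using assms by (auto simp: scan_def word_store_def)

lemma run_to_end:
  assumes "C 0 = fst (word_store z) 0" "p 0 = 0" "b \<noteq> 0" "p b = 0"
  shows "run (Whl 0 (\<lambda>s. s \<noteq> Blank) (GoR 0 ;; GoR b)) (C, p) ((length z + 1) * 4 + 1)
    (C, p(0 := length z + 1, b := length z + 1))"
proof -
  have "run (GoR 0 ;; GoR b) (C, p(0 := i, b := i)) (1 + 1) (C, p(0 := Suc i, b := Suc i))" for i
  proof (rule run_Seq)
    show "run (GoR 0) (C, p(0 := i, b := i)) 1 (C, p(0 := Suc i, b := i))"
      using run_GoR[of 0 C "p(0 := i, b := i)"] assms(3) by (simp add: fun_upd_twist)
    show "run (GoR b) (C, p(0 := Suc i, b := i)) 1 (C, p(0 := Suc i, b := Suc i))"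
      using run_GoR[of b C "p(0 := Suc i, b := i)"] by simp
  qed
  then have "run (Whl 0 (\<lambda>s. s \<noteq> Blank) (GoR 0 ;; GoR b)) (C, p(0 := 0, b := 0))
      ((length z + 1) * (1 + 1 + 2) + 1) (C, p(0 := length z + 1, b := length z + 1))"
    using assms(3) by (intro run_for[of "length z + 1" _ "\<lambda>i. (C, p(0 := i, b := i))"])
      (auto simp: scan_word[of C z, OF assms(1)])
  moreover have "p(0 := 0, b := 0) = p" using assms by auto
  ultimately show ?thesis by (auto elim!: run_mono)
qed

lemma polyfun_length: "polyfun (\<lambda>z e. length z)"
proof (rule polyfunI)
  show "bounded_fun (\<lambda>z e. length z)" unfolding bounded_fun_def using pbounded_id by blast
  fix B and v :: "nat \<Rightarrow> nat" and b :: nat assume v: "\<And>i. 0 < v i" "\<And>i. v i < (b::nat)"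
  \<comment> \<open>The first blank cell is cell \<open>length z\<close>, that is, position
    \<open>length z + 1\<close>; \<open>GoL b\<close> removes the surplus 1.\<close>
  let ?c = "Whl 0 (\<lambda>s. s \<noteq> Blank) (GoR 0 ;; GoR b) ;; GoL b ;; Whl 0 marked (GoL 0)"
  let ?T = "\<lambda>n. ((n + 1) * 4 + 1) + (1 + ((n + 1) * 3 + 1))"
  have b: "b \<noteq> 0" using v(2)[of 0] by auto
  have "computes ?c ?T B v b (\<lambda>z e. length z)"
    unfolding computes_def
  proof (intro conjI allI impI)
    fix z and C :: "nat \<Rightarrow> nat \<Rightarrow> bool option" and p :: "nat \<Rightarrow> nat"
    assume p: "C 0 = fst (word_store z) 0" "p 0 = 0" "\<forall>j. b \<le> j \<and> j < tapes ?c \<longrightarrow> p j = 0"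
    let ?n = "length z"
    show "run ?c (C, p) (?T ?n) (C, p(b := ?n))"
    proof (intro run_Seq)
      show "run (Whl 0 (\<lambda>s. s \<noteq> Blank) (GoR 0 ;; GoR b)) (C, p) ((?n + 1) * 4 + 1)
          (C, p(0 := ?n + 1, b := ?n + 1))"
        using p b by (intro run_to_end) auto
      show "run (GoL b) (C, p(0 := ?n + 1, b := ?n + 1)) 1 (C, p(0 := ?n + 1, b := ?n))"
        using run_GoL[of b C "p(0 := ?n + 1, b := ?n + 1)"] by simp
      have "p(0 := ?n + 1, b := ?n, 0 := 0) = p(b := ?n)" using p b by auto
      then show "run (Whl 0 marked (GoL 0)) (C, p(0 := ?n + 1, b := ?n)) ((?n + 1) * 3 + 1)
          (C, p(b := ?n))"
        using run_clear[of "p(0 := ?n + 1, b := ?n)" 0 "?n + 1" C] b by simp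
    qed
  qed auto
  moreover have "pbounded ?T" by (intro pbounded_intros)
  ultimately show "\<exists>c T. pbounded T \<and> computes c T B v b (\<lambda>z e. length z)" by blast
qed

lemma polyfun_bit:
  assumes f: "polyfun f"
  shows "polyfun (\<lambda>z e. of_bool (f z e < length z \<and> z ! f z e))"
proof (rule polyfunI)
  show "bounded_fun (\<lambda>z e. of_bool (f z e < length z \<and> z ! f z e))"
    unfolding bounded_fun_def by (metis of_bool_def pbounded_const order_refl zero_le)
  fix B and v :: "nat \<Rightarrow> nat" and b :: nat assume B: "pbounded B" and v: "\<And>i. 0 < v i" "\<And>i. v i < (b::nat)"
  then obtain c T where c: "pbounded T" "computes c T B v b f" by (rule polyfunD[OF f])
  obtain D where D: "pbounded D" "\<forall>z e. (\<forall>i. e i \<le> B (length z)) \<longrightarrow> f z e \<le> D (length z)"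
    by (rule bounded_funD[OF polyfun_bounded[OF f] B])
  \<comment> \<open>Cell \<open>f\<close> is position \<open>f + 1\<close>, hence the extra
    \<open>GoR 0\<close> before the value is moved onto the input head.\<close>
  let ?c = "c ;; GoR 0 ;; Whl b marked (GoL b ;; GoR 0) ;;
    Ite 0 (\<lambda>s. s = Bit True) (GoR b) (GoL b) ;; Whl 0 marked (GoL 0)"
  let ?T = "\<lambda>n. T n + (1 + ((D n * 4 + 1) + ((1 + 2) + ((D n + 1) * 3 + 1))))"
  have b: "b \<noteq> 0" using v(2)[of 0] by auto
  have "computes ?c ?T B v b (\<lambda>z e. of_bool (f z e < length z \<and> z ! f z e))"
    unfolding computes_def
  proof (intro conjI allI impI)
    fix z and C :: "nat \<Rightarrow> nat \<Rightarrow> bool option" and p :: "nat \<Rightarrow> nat"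
    assume p: "C 0 = fst (word_store z) 0" "p 0 = 0" "\<forall>i. p (v i) \<le> B (length z)"
      "\<forall>j. b \<le> j \<and> j < tapes ?c \<longrightarrow> p j = 0"
    let ?f = "f z (\<lambda>i. p (v i))" and ?n = "length z"
    let ?r = "of_bool (?f < length z \<and> z ! ?f) :: nat"
    have fD: "?f \<le> D ?n" using p D by auto
    have "b < tapes c" using c(2) by (simp add: computes_def)
    then have pb: "p b = 0" using p by auto
    show "run ?c (C, p) (?T ?n) (C, p(b := ?r))"
    proof (intro run_Seq)
      show "run c (C, p) (T ?n) (C, p(b := ?f))"
        using p by (intro computesD[OF c(2)]) auto
      show "run (GoR 0) (C, p(b := ?f)) 1 (C, p(0 := 1, b := ?f))"
        using run_GoR[of 0 C "p(b := ?f)"] p b by (simp add: fun_upd_twist)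
      have "p(0 := 1, b := ?f, b := 0, 0 := 1 + ?f) = p(0 := 1 + ?f)" using p b pb by auto
      then show "run (Whl b marked (GoL b ;; GoR 0)) (C, p(0 := 1, b := ?f)) (D ?n * 4 + 1)
          (C, p(0 := 1 + ?f))"
        using run_drain[of "p(0 := 1, b := ?f)" b "D ?n" 0 C] fD b by simp
      have "scan (C, p(0 := 1 + ?f)) 0 = Bit True \<longleftrightarrow> ?f < length z \<and> z ! ?f"
        by (auto simp: scan_word[of C z, OF p(1)])
      then show "run (Ite 0 (\<lambda>s. s = Bit True) (GoR b) (GoL b)) (C, p(0 := 1 + ?f)) (1 + 2)
          (C, p(0 := 1 + ?f, b := ?r))"
        using run_GoR[of b C "p(0 := 1 + ?f)"] run_GoL[of b C "p(0 := 1 + ?f)"] b pb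
        by (intro run_Ite) (cases "?f < length z \<and> z ! ?f"; auto)
      have "p(0 := 1 + ?f, b := ?r, 0 := 0) = p(b := ?r)" using p b by auto
      then show "run (Whl 0 marked (GoL 0)) (C, p(0 := 1 + ?f, b := ?r)) ((D ?n + 1) * 3 + 1)
          (C, p(b := ?r))"
        using run_clear[of "p(0 := 1 + ?f, b := ?r)" 0 "D ?n + 1" C] fD b by simp
    qed
  qed (use c(2) in \<open>auto simp: computes_def\<close>)
  moreover have "pbounded ?T" by (intro pbounded_intros c D)
  ultimately show "\<exists>c T. pbounded T \<and> computes c T B v b (\<lambda>z e. of_bool (f z e < length z \<and> z ! f z e))"
    by blast
qed

text \<open>Primitive recursion becomes a counted loop. Repeated doubling would leave polynomial
  growth, so all intermediate values are required to be bounded. During the loop counter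
  \<open>b\<close> holds the remaining rounds, \<open>b + 1\<close> the accumulator,
  \<open>b + 2\<close> the round number and \<open>b + 3\<close> the new value.\<close>

lemma polyfun_rec:
  assumes k: "polyfun k" and h: "polyfun h"
    and g: "polyfun (\<lambda>z e. g (e 0) (e (Suc 0)) z (\<lambda>i. e (Suc (Suc i))))"
    and bnd: "\<And>B. pbounded B \<Longrightarrow> \<exists>D. pbounded D \<and> (\<forall>z e m. (\<forall>i. e i \<le> B (length z)) \<longrightarrow> m \<le> k z e \<longrightarrow>
      rec_nat (h z e) (\<lambda>i a. g i a z e) m \<le> D (length z))"
  shows "polyfun (\<lambda>z e. rec_nat (h z e) (\<lambda>i a. g i a z e) (k z e))"
proof (rule polyfunI)
  let ?F = "\<lambda>z e. rec_nat (h z e) (\<lambda>i a. g i a z e)"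
  show "bounded_fun (\<lambda>z e. ?F z e (k z e))"
    using bnd unfolding bounded_fun_def by blast
  fix B and v :: "nat \<Rightarrow> nat" and b :: nat assume B: "pbounded B" and v: "\<And>i. 0 < v i" "\<And>i. v i < (b::nat)"
  have v': "v i < b + 1" for i using v(2)[of i] by simp
  obtain ck Tk where ck: "pbounded Tk" "computes ck Tk B v b k" using B v by (rule polyfunD[OF k])
  obtain ch Th where ch: "pbounded Th" "computes ch Th B v (b + 1) h" using B v(1) v' by (rule polyfunD[OF h])
  obtain E where E: "pbounded E" "\<forall>z e. (\<forall>i. e i \<le> B (length z)) \<longrightarrow> k z e \<le> E (length z)"
    by (rule bounded_funD[OF polyfun_bounded[OF k] B])
  obtain D where D: "pbounded D" "\<And>z e m. (\<And>i. e i \<le> B (length z)) \<Longrightarrow> m \<le> k z e \<Longrightarrow> ?F z e m \<le> D (length z)"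
    using bnd[OF B] by blast
  \<comment> \<open>Variable 0 of the body is the round number and variable 1 the accumulator; the
    others are shifted by two.\<close>
  define v2 where "v2 = case_nat (b + 2) (case_nat (b + 1) v)"
  have v2: "0 < v2 i" "v2 i < b + 3" for i
    using v by (auto simp: v2_def split: nat.split intro: trans_less_add1)
  have B2: "pbounded (\<lambda>n. B n + E n + D n)" by (intro pbounded_intros B E D)
  obtain cg Tg where cg: "pbounded Tg" "computes cg Tg (\<lambda>n. B n + E n + D n) v2 (b + 3)
      (\<lambda>z e. g (e 0) (e (Suc 0)) z (\<lambda>i. e (Suc (Suc i))))"
    using B2 v2 by (rule polyfunD[OF g])
  let ?body = "cg ;; Whl (b + 1) marked (GoL (b + 1)) ;; Whl (b + 3) marked (GoL (b + 3) ;; GoR (b + 1)) ;;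
    GoR (b + 2) ;; GoL b"
  let ?c = "ck ;; ch ;; Whl b marked ?body ;; Whl (b + 2) marked (GoL (b + 2)) ;;
    Whl (b + 1) marked (GoL (b + 1) ;; GoR b)"
  let ?Tb = "\<lambda>n. Tg n + ((D n * 3 + 1) + ((D n * 4 + 1) + (1 + 1)))"
  let ?T = "\<lambda>n. Tk n + (Th n + ((E n * (?Tb n + 2) + 1) + ((E n * 3 + 1) + (D n * 4 + 1))))"
  have "computes ?c ?T B v b (\<lambda>z e. ?F z e (k z e))"
    unfolding computes_def
  proof (intro conjI allI impI)
    fix z and C :: "nat \<Rightarrow> nat \<Rightarrow> bool option" and p :: "nat \<Rightarrow> nat"
    assume p: "C 0 = fst (word_store z) 0" "p 0 = 0" "\<forall>i. p (v i) \<le> B (length z)"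
      "\<forall>j. b \<le> j \<and> j < tapes ?c \<longrightarrow> p j = 0"
    let ?e = "\<lambda>i. p (v i)" and ?n = "length z"
    let ?k = "k z ?e"
    have kE: "?k \<le> E ?n" using p E by auto
    have FD: "?F z ?e m \<le> D ?n" if "m \<le> ?k" for m using p D that by auto
    have p0: "p b = 0" "p (b + 1) = 0" "p (b + 2) = 0" "p (b + 3) = 0" using p(4) by auto
    have b0: "b \<noteq> 0" using v(2)[of 0] by auto
    have vb: "v i \<noteq> b" "v i \<noteq> Suc b" "v i \<noteq> Suc (Suc b)" for i using v(2)[of i] by simp_all
    let ?S = "\<lambda>i. (C, p(b := ?k - i, b + 1 := ?F z ?e i, b + 2 := i))"
    show "run ?c (C, p) (?T ?n) (C, p(b := ?F z ?e ?k))"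
    proof (intro run_Seq)
      show "run ck (C, p) (Tk ?n) (C, p(b := ?k))"
        using p by (intro computesD[OF ck(2)]) auto
      have "run ch (C, p(b := ?k)) (Th ?n) (C, (p(b := ?k))(b + 1 := h z (\<lambda>i. (p(b := ?k)) (v i))))"
        using p vb b0 by (intro computesD[OF ch(2)]) auto
      moreover have "(\<lambda>i. (p(b := ?k)) (v i)) = ?e" using vb by simp
      moreover have "(p(b := ?k))(b + 1 := h z ?e) = p(b := ?k - 0, b + 1 := ?F z ?e 0, b + 2 := 0)"
        using p0 by auto
      ultimately show "run ch (C, p(b := ?k)) (Th ?n) (?S 0)" by simp
      have body: "run ?body (?S i) (?Tb ?n) (?S (Suc i))" if i: "i < ?k" for i
      proof (intro run_Seq)
        let ?q = "p(b := ?k - i, b + 1 := ?F z ?e i, b + 2 := i)"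
        have e2: "(\<lambda>j. ?q (v2 j)) = case_nat i (case_nat (?F z ?e i) ?e)"
          using vb by (auto simp: v2_def fun_eq_iff split: nat.split)
        have "?q (v2 j) \<le> B ?n + E ?n + D ?n" for j
        proof -
          have "?F z ?e i \<le> D ?n" using FD[of i] i by simp
          moreover have "?e j \<le> B ?n" for j using p(3) by simp
          ultimately show ?thesis
            using fun_cong[OF e2, of j] i kE by (auto split: nat.splits intro: le_add_same_cancel2 trans_le_add1 trans_le_add2)
        qed
        moreover have "\<forall>j. b + 3 \<le> j \<and> j < tapes cg \<longrightarrow> ?q j = 0" using p(4) by auto
        ultimately have "run cg (C, ?q) (Tg ?n) (C, ?q(b + 3 := g (?q (v2 0)) (?q (v2 (Suc 0))) z
            (\<lambda>j. ?q (v2 (Suc (Suc j))))))"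
          using p(1,2) b0 by (intro computesD[OF cg(2)]) auto
        moreover have "?q (v2 0) = i" "?q (v2 (Suc 0)) = ?F z ?e i" "(\<lambda>j. ?q (v2 (Suc (Suc j)))) = ?e"
          using fun_cong[OF e2, of 0] fun_cong[OF e2, of "Suc 0"] fun_cong[OF e2, of "Suc (Suc _)"] by auto
        ultimately show "run cg (?S i) (Tg ?n) (C, ?q(b + 3 := ?F z ?e (Suc i)))" by simp
        have "?q(b + 3 := ?F z ?e (Suc i), b + 1 := 0) =
            p(b := ?k - i, b + 1 := 0, b + 2 := i, b + 3 := ?F z ?e (Suc i))" by auto
        then show "run (Whl (b + 1) marked (GoL (b + 1))) (C, ?q(b + 3 := ?F z ?e (Suc i))) (D ?n * 3 + 1)
            (C, p(b := ?k - i, b + 1 := 0, b + 2 := i, b + 3 := ?F z ?e (Suc i)))"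
          using run_clear[of "?q(b + 3 := ?F z ?e (Suc i))" "b + 1" "D ?n" C] FD[of i] i by simp
        let ?q2 = "p(b := ?k - i, b + 1 := 0, b + 2 := i, b + 3 := ?F z ?e (Suc i))"
        have "?q2(b + 3 := 0, b + 1 := ?q2 (b + 1) + ?q2 (b + 3)) =
            p(b := ?k - i, b + 1 := ?F z ?e (Suc i), b + 2 := i)" using p0 by auto
        then show "run (Whl (b + 3) marked (GoL (b + 3) ;; GoR (b + 1))) (C, ?q2) (D ?n * 4 + 1)
            (C, p(b := ?k - i, b + 1 := ?F z ?e (Suc i), b + 2 := i))"
          using run_drain[of ?q2 "b + 3" "D ?n" "b + 1" C] FD[of "Suc i"] i by simp
        show "run (GoR (b + 2)) (C, p(b := ?k - i, b + 1 := ?F z ?e (Suc i), b + 2 := i)) 1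
            (C, p(b := ?k - i, b + 1 := ?F z ?e (Suc i), b + 2 := Suc i))"
          using run_GoR[of "b + 2" C "p(b := ?k - i, b + 1 := ?F z ?e (Suc i), b + 2 := i)"] by simp
        have "(p(b := ?k - i, b + 1 := ?F z ?e (Suc i), b + 2 := Suc i))(b := ?k - i - 1) =
          p(b := ?k - Suc i, b + 1 := ?F z ?e (Suc i), b + 2 := Suc i)" by auto
        then show "run (GoL b) (C, p(b := ?k - i, b + 1 := ?F z ?e (Suc i), b + 2 := Suc i)) 1 (?S (Suc i))"
          using run_GoL[of b C "p(b := ?k - i, b + 1 := ?F z ?e (Suc i), b + 2 := Suc i)"] by simp
      qed
      have "run (Whl b marked ?body) (?S 0) (?k * (?Tb ?n + 2) + 1) (?S ?k)"
        by (rule run_for[of ?k _ ?S, OF _ body]) (auto simp: scan_mark)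
      then show "run (Whl b marked ?body) (?S 0) (E ?n * (?Tb ?n + 2) + 1) (?S ?k)"
        by (rule run_mono) (intro add_le_mono1 mult_le_mono1 kE)
      have "p(b := ?k - ?k, b + 1 := ?F z ?e ?k, b + 2 := ?k, b + 2 := 0) = p(b + 1 := ?F z ?e ?k)"
        using p0 by auto
      then show "run (Whl (b + 2) marked (GoL (b + 2))) (?S ?k) (E ?n * 3 + 1) (C, p(b + 1 := ?F z ?e ?k))"
        using run_clear[of "p(b := ?k - ?k, b + 1 := ?F z ?e ?k, b + 2 := ?k)" "b + 2" "E ?n" C] kE by simp
      have "p(b + 1 := ?F z ?e ?k, b + 1 := 0, b := 0 + ?F z ?e ?k) = p(b := ?F z ?e ?k)"
        using p0 by auto
      then show "run (Whl (b + 1) marked (GoL (b + 1) ;; GoR b)) (C, p(b + 1 := ?F z ?e ?k)) (D ?n * 4 + 1)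
          (C, p(b := ?F z ?e ?k))"
        using run_drain[of "p(b + 1 := ?F z ?e ?k)" "b + 1" "D ?n" b C] FD[of ?k] p0 by simp
    qed
  qed (use ck(2) ch(2) cg(2) in \<open>auto simp: computes_def\<close>)
  moreover have "pbounded ?T" by (intro pbounded_intros ck ch cg E D)
  ultimately show "\<exists>c T. pbounded T \<and> computes c T B v b (\<lambda>z e. ?F z e (k z e))" by blast
qed

section \<open>Closure properties of number functions and predicates\<close>

definition polypred :: "bool wfun \<Rightarrow> bool" where
  "polypred P \<longleftrightarrow> polyfun (\<lambda>z e. of_bool (P z e))"

lemma polyfun_rec_le:
  assumes "polyfun k" "polyfun h" "polyfun (\<lambda>z e. g (e 0) (e (Suc 0)) z (\<lambda>i. e (Suc (Suc i))))"
    and D: "bounded_fun D" "\<And>z e m. m \<le> k z e \<Longrightarrow> rec_nat (h z e) (\<lambda>i a. g i a z e) m \<le> D z e"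
  shows "polyfun (\<lambda>z e. rec_nat (h z e) (\<lambda>i a. g i a z e) (k z e))"
proof (rule polyfun_rec[OF assms(1-3)])
  fix B assume "pbounded B"
  then obtain E where "pbounded E" "\<forall>z e. (\<forall>i. e i \<le> B (length z)) \<longrightarrow> D z e \<le> E (length z)"
    by (rule bounded_funD[OF D(1)])
  then show "\<exists>E. pbounded E \<and> (\<forall>z e m. (\<forall>i. e i \<le> B (length z)) \<longrightarrow> m \<le> k z e \<longrightarrow>
      rec_nat (h z e) (\<lambda>i a. g i a z e) m \<le> E (length z))"
    using D(2) by (meson order_trans)
qed

lemma bounded_fun_add:
  assumes "bounded_fun f" "bounded_fun g"
  shows "bounded_fun (\<lambda>z e. f z e + g z e)"
  unfolding bounded_fun_def
proof (intro allI impI)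
  fix B assume B: "pbounded B"
  obtain D where D: "pbounded D" "\<forall>z e. (\<forall>i. e i \<le> B (length z)) \<longrightarrow> f z e \<le> D (length z)"
    by (rule bounded_funD[OF assms(1) B])
  obtain E where E: "pbounded E" "\<forall>z e. (\<forall>i. e i \<le> B (length z)) \<longrightarrow> g z e \<le> E (length z)"
    by (rule bounded_funD[OF assms(2) B])
  show "\<exists>D. pbounded D \<and> (\<forall>z e. (\<forall>i. e i \<le> B (length z)) \<longrightarrow> f z e + g z e \<le> D (length z))"
    using pbounded_add[OF D(1) E(1)] D(2) E(2) by (meson add_le_mono)
qed

lemma bounded_fun_mult:
  assumes "bounded_fun f" "bounded_fun g"
  shows "bounded_fun (\<lambda>z e. f z e * g z e)"
  unfolding bounded_fun_def
proof (intro allI impI)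
  fix B assume B: "pbounded B"
  obtain D where D: "pbounded D" "\<forall>z e. (\<forall>i. e i \<le> B (length z)) \<longrightarrow> f z e \<le> D (length z)"
    by (rule bounded_funD[OF assms(1) B])
  obtain E where E: "pbounded E" "\<forall>z e. (\<forall>i. e i \<le> B (length z)) \<longrightarrow> g z e \<le> E (length z)"
    by (rule bounded_funD[OF assms(2) B])
  show "\<exists>D. pbounded D \<and> (\<forall>z e. (\<forall>i. e i \<le> B (length z)) \<longrightarrow> f z e * g z e \<le> D (length z))"
    using pbounded_mult[OF D(1) E(1)] D(2) E(2) by (meson mult_le_mono)
qed

lemma polyfun_const: "polyfun (\<lambda>z e. k)"
  by (induction k) (auto intro: polyfun_0 polyfun_Suc)

lemma polyfun_add:
  assumes "polyfun f" "polyfun g"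
  shows "polyfun (\<lambda>z e. f z e + g z e)"
proof -
  have *: "rec_nat a (\<lambda>i. Suc) m = a + m" for a m by (induction m) auto
  have "polyfun (\<lambda>z e. rec_nat (f z e) (\<lambda>i a. (\<lambda>i a z e. Suc a) i a z e) (g z e))"
    by (rule polyfun_rec_le[OF assms(2,1) _ bounded_fun_add[OF assms[THEN polyfun_bounded]]])
      (auto simp: * intro: polyfun_Suc polyfun_var)
  then show ?thesis by (simp add: *)
qed

lemma polyfun_mult:
  assumes "polyfun f" "polyfun g"
  shows "polyfun (\<lambda>z e. f z e * g z e)"
proof -
  have *: "rec_nat 0 (\<lambda>i a. a + k) m = k * m" for k m :: nat by (induction m) auto
  have "polyfun (\<lambda>z e. rec_nat 0 (\<lambda>i a. (\<lambda>i a z e. a + f z e) i a z e) (g z e))"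
    by (rule polyfun_rec_le[OF assms(2) polyfun_0 _ bounded_fun_mult[OF assms[THEN polyfun_bounded]]])
      (auto simp: * intro: polyfun_add polyfun_var polyfun_rename[OF assms(1)])
  then show ?thesis by (simp add: *)
qed

lemma polyfun_pred:
  assumes "polyfun f"
  shows "polyfun (\<lambda>z e. f z e - 1)"
proof -
  have *: "rec_nat 0 (\<lambda>i a. i) m = m - 1" for m :: nat by (cases m) auto
  have "polyfun (\<lambda>z e. rec_nat 0 (\<lambda>i a. (\<lambda>i a z e. i) i a z e) (f z e))"
    by (rule polyfun_rec_le[OF assms(1) polyfun_0 _ polyfun_bounded[OF assms]])
      (auto simp: * intro: polyfun_var)
  then show ?thesis by (simp add: *)
qed

lemma polyfun_diff:
  assumes "polyfun f" "polyfun g"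
  shows "polyfun (\<lambda>z e. f z e - g z e)"
proof -
  have *: "rec_nat a (\<lambda>i a. a - Suc 0) m = a - m" for a m by (induction m) auto
  have "polyfun (\<lambda>z e. rec_nat (f z e) (\<lambda>i a. (\<lambda>i a z e. a - 1) i a z e) (g z e))"
    by (rule polyfun_rec_le[OF assms(2,1) _ polyfun_bounded[OF assms(1)]])
      (auto simp: * intro: polyfun_pred[simplified] polyfun_var)
  then show ?thesis by (simp add: *)
qed

lemma polyfun_if:
  assumes "polypred P" "polyfun f" "polyfun g"
  shows "polyfun (\<lambda>z e. if P z e then f z e else g z e)"
proof -
  have *: "rec_nat a (\<lambda>i a. k) m = (if m = 0 then a else k)" for a k m :: nat by (cases m) auto
  have "polyfun (\<lambda>z e. rec_nat (g z e) (\<lambda>i a. (\<lambda>i a z e. f z e) i a z e) (of_bool (P z e)))"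
    by (rule polyfun_rec_le[OF assms(1)[unfolded polypred_def] assms(3) _
          bounded_fun_add[OF assms(2,3)[THEN polyfun_bounded]]])
      (auto simp: * intro: polyfun_rename[OF assms(2)])
  then show ?thesis by (rule back_subst[of polyfun]) (auto simp: * fun_eq_iff)
qed

lemma polypred_const: "polypred (\<lambda>z e. b)"
  unfolding polypred_def by (rule polyfun_const)

lemma polypred_if:
  "polypred P \<Longrightarrow> polypred Q \<Longrightarrow> polypred R \<Longrightarrow> polypred (\<lambda>z e. if P z e then Q z e else R z e)"
  using polyfun_if[of P "\<lambda>z e. of_bool (Q z e)" "\<lambda>z e. of_bool (R z e)"]
  by (simp add: polypred_def if_distrib)

lemma polypred_cong: "polypred Q \<Longrightarrow> (\<And>z e. Q z e = P z e) \<Longrightarrow> polypred P"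
  by (subgoal_tac "Q = P") (auto simp: fun_eq_iff)

lemma polypred_not: "polypred P \<Longrightarrow> polypred (\<lambda>z e. \<not> P z e)"
  by (rule polypred_cong, rule polypred_if[of P "\<lambda>z e. False" "\<lambda>z e. True"])
    (auto intro: polypred_const)

lemma polypred_conj: "polypred P \<Longrightarrow> polypred Q \<Longrightarrow> polypred (\<lambda>z e. P z e \<and> Q z e)"
  by (rule polypred_cong, rule polypred_if[of P Q "\<lambda>z e. False"]) (auto intro: polypred_const)

lemma polypred_disj: "polypred P \<Longrightarrow> polypred Q \<Longrightarrow> polypred (\<lambda>z e. P z e \<or> Q z e)"
  by (rule polypred_cong, rule polypred_if[of P "\<lambda>z e. True" Q]) (auto intro: polypred_const)

lemma polypred_imp: "polypred P \<Longrightarrow> polypred Q \<Longrightarrow> polypred (\<lambda>z e. P z e \<longrightarrow> Q z e)"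
  by (rule polypred_cong, rule polypred_if[of P Q "\<lambda>z e. True"]) (auto intro: polypred_const)

lemma polypred_iff: "polypred P \<Longrightarrow> polypred Q \<Longrightarrow> polypred (\<lambda>z e. P z e \<longleftrightarrow> Q z e)"
  by (rule polypred_cong, rule polypred_if[of P Q "\<lambda>z e. \<not> Q z e"]) (auto intro: polypred_not)

lemma polypred_less:
  assumes "polyfun f" "polyfun g"
  shows "polypred (\<lambda>z e. f z e < g z e)"
proof -
  have *: "rec_nat 0 (\<lambda>i a. Suc 0) m = (if m = 0 then 0 else 1)" for m by (cases m) auto
  have "polyfun (\<lambda>z e. rec_nat 0 (\<lambda>i a. (\<lambda>i a z e. Suc 0) i a z e) (g z e - f z e))"
    by (rule polyfun_rec_le[OF polyfun_diff[OF assms(2,1)] polyfun_0 _ polyfun_bounded[OF polyfun_const[of 1]]])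
      (auto simp: * intro: polyfun_const)
  then show ?thesis
    unfolding polypred_def by (rule back_subst[of polyfun]) (auto simp: * fun_eq_iff)
qed

lemma polypred_le: "polyfun f \<Longrightarrow> polyfun g \<Longrightarrow> polypred (\<lambda>z e. f z e \<le> g z e)"
  using polypred_not[OF polypred_less[of g f]] by (simp add: not_less)

lemma polypred_eq: "polyfun f \<Longrightarrow> polyfun g \<Longrightarrow> polypred (\<lambda>z e. f z e = (g z e :: nat))"
  using polypred_conj[OF polypred_le[of f g] polypred_le[of g f]] by (simp add: eq_iff)

lemma polyfun_of_bool: "polypred P \<Longrightarrow> polyfun (\<lambda>z e. of_bool (P z e))"
  by (simp add: polypred_def)

text \<open>Counting is the source of the bounded quantifiers, of division and of the distance
  between labellings. The recursion is admissible because a count cannot exceed the number of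
  rounds.\<close>

lemma polyfun_count:
  assumes k: "polyfun k" and P: "polypred (\<lambda>z e. P (e 0) z (\<lambda>i. e (Suc i)))"
  shows "polyfun (\<lambda>z e. card {u. u < k z e \<and> P u z e})"
proof -
  have *: "rec_nat 0 (\<lambda>u a. if Q u then Suc a else a) m = card {u. u < m \<and> Q u}" for Q m
  proof (induction m)
    case (Suc m)
    have "{u. u < Suc m \<and> Q u} = (if Q m then insert m else id) {u. u < m \<and> Q u}"
      by (auto simp: less_Suc_eq)
    then show ?case using Suc by simp
  qed auto
  have le: "card {u. u < m \<and> Q u} \<le> m" for m Q
    using card_mono[of "{..<m}" "{u. u < m \<and> Q u}"] by auto
  have "polypred (\<lambda>z e. P (e 0) z (\<lambda>i. e (Suc (Suc i))))"
    using polyfun_rename[OF P[unfolded polypred_def], of "case_nat 0 (\<lambda>i. Suc (Suc i))"]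
    by (simp add: polypred_def)
  then have "polyfun (\<lambda>z e. if P (e 0) z (\<lambda>i. e (Suc (Suc i))) then Suc (e (Suc 0)) else e (Suc 0))"
    by (intro polyfun_if polyfun_Suc polyfun_var)
  then have "polyfun (\<lambda>z e. rec_nat 0 (\<lambda>u a. (\<lambda>u a z e. if P u z e then Suc a else a) u a z e) (k z e))"
  proof (rule polyfun_rec_le[OF k polyfun_0 _ polyfun_bounded[OF k]])
    fix z e m assume "m \<le> k z e"
    then show "rec_nat 0 (\<lambda>u a. if P u z e then Suc a else a) m \<le> k z e"
      using le[of m "\<lambda>u. P u z e"] by (simp add: *)
  qed
  then show ?thesis by (simp add: *)
qed

lemma polypred_Bex:
  assumes "polyfun k" "polypred (\<lambda>z e. P (e 0) z (\<lambda>i. e (Suc i)))"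
  shows "polypred (\<lambda>z e. \<exists>u<k z e. P u z e)"
proof (rule back_subst[of polypred])
  show "polypred (\<lambda>z e. 0 < card {u. u < k z e \<and> P u z e})"
    by (intro polypred_less polyfun_0 polyfun_count assms)
  show "(\<lambda>z e. 0 < card {u. u < k z e \<and> P u z e}) = (\<lambda>z e. \<exists>u<k z e. P u z e)"
    by (auto simp: fun_eq_iff card_gt_0_iff)
qed

lemma polypred_Ball:
  assumes "polyfun k" "polypred (\<lambda>z e. P (e 0) z (\<lambda>i. e (Suc i)))"
  shows "polypred (\<lambda>z e. \<forall>u<k z e. P u z e)"
  using polypred_not[OF polypred_Bex[of k "\<lambda>u z e. \<not> P u z e"]] assms by (simp add: polypred_not)

lemma polyfun_div:
  assumes "polyfun f" "polyfun g"
  shows "polyfun (\<lambda>z e. f z e div g z e)"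
proof (rule back_subst[of polyfun])
  \<comment> \<open>For a positive divisor the quotient is the number of \<open>u\<close> such that
    \<open>Suc u\<close> times the divisor does not exceed the dividend. For the divisor 0 this
    would count every \<open>u\<close>, hence the separate case.\<close>
  show "polyfun (\<lambda>z e. if g z e = 0 then 0 else card {u. u < f z e \<and> Suc u * g z e \<le> f z e})"
    by (intro polyfun_if polyfun_0 polypred_eq polyfun_count polypred_le polyfun_mult
        polyfun_Suc polyfun_var polyfun_rename[OF assms(1)] polyfun_rename[OF assms(2)] assms)
  have "{u. u < a \<and> Suc u * b \<le> a} = {..<a div b}" if "b \<noteq> 0" for a b :: nat
  proof (intro set_eqI iffI)
    fix u assume "u \<in> {u. u < a \<and> Suc u * b \<le> a}"
    then have "Suc u \<le> a div b" using that by (simp add: less_eq_div_iff_mult_less_eq)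
    then show "u \<in> {..<a div b}" by simp
  next
    fix u assume u: "u \<in> {..<a div b}"
    then have "Suc u \<le> a div b" by simp
    then have *: "Suc u * b \<le> a" using that by (simp add: less_eq_div_iff_mult_less_eq)
    moreover have "u < a" using u div_le_dividend[of a b] by (meson lessThan_iff less_le_trans)
    ultimately show "u \<in> {u. u < a \<and> Suc u * b \<le> a}" by simp
  qed
  then show "(\<lambda>z e. if g z e = 0 then 0 else card {u. u < f z e \<and> Suc u * g z e \<le> f z e}) =
      (\<lambda>z e. f z e div g z e)"
    by (auto simp: fun_eq_iff)
qed

lemma polyfun_mod: "polyfun f \<Longrightarrow> polyfun g \<Longrightarrow> polyfun (\<lambda>z e. f z e mod g z e)"
  using polyfun_diff[OF _ polyfun_mult[OF _ polyfun_div[of f g]], of f g]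
  by (simp add: minus_mult_div_eq_mod)

lemma polyfun_poly: "polyfun f \<Longrightarrow> polyfun (\<lambda>z e. poly p (f z e))"
  by (induction p) (auto intro: polyfun_add polyfun_mult polyfun_const)

definition bit_at :: "bool list \<Rightarrow> nat \<Rightarrow> bool" where
  "bit_at z i \<longleftrightarrow> i < length z \<and> z ! i"

lemma polypred_bit_at: "polyfun f \<Longrightarrow> polypred (\<lambda>z e. bit_at z (f z e))"
  unfolding polypred_def bit_at_def by (rule polyfun_bit)

lemmas polyfun_intros = polyfun_var polyfun_const polyfun_Suc polyfun_length polyfun_add polyfun_mult
  polyfun_diff polyfun_if polyfun_of_bool polyfun_count polyfun_div polyfun_mod polyfun_poly
  polypred_const polypred_if polypred_not polypred_conj polypred_disj polypred_imp polypred_iff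
  polypred_less polypred_le polypred_eq polypred_Bex polypred_Ball polypred_bit_at

section \<open>Guessing certificates and writing outputs\<close>

lemma ter_Seq_image:
  assumes "ter c s t (S ` I)" "inj_on S I" "\<And>i. i \<in> I \<Longrightarrow> ter d (S i) u (Y i)"
  shows "ter (c ;; d) s (t + u) (\<Union>i\<in>I. Y i)"
proof -
  have "ter (c ;; d) s (t + u) (\<Union>s'\<in>S ` I. Y (inv_into I S s'))"
    by (rule ter.Seq[OF assms(1)]) (use assms(2,3) in auto)
  then show ?thesis using assms(2) by simp
qed

lemma ter_run_Seq: "run c s t s' \<Longrightarrow> ter d s' u X \<Longrightarrow> ter (c ;; d) s (t + u) X"
  unfolding run_def using ter.Seq[of c s t "{s'}" d u "\<lambda>_. X"] by simp

lemma ter_Whl_image: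
  assumes "P (scan s j)" "ter c s t (S ` I)" "inj_on S I" "\<And>i. i \<in> I \<Longrightarrow> ter (Whl j P c) (S i) u (Y i)"
  shows "ter (Whl j P c) s (t + 2 + u) (\<Union>i\<in>I. Y i)"
proof -
  have "ter (Whl j P c) s (t + 2 + u) (\<Union>s'\<in>S ` I. Y (inv_into I S s'))"
    by (rule ter.Whl_True[of P s j, OF assms(1,2)]) (use assms(3,4) in auto)
  then show ?thesis using assms(3) by simp
qed

lemma word_store_inj: "fst (word_store x) = fst (word_store y) \<Longrightarrow> x = y"
proof -
  assume e: "fst (word_store x) = fst (word_store y)"
  have *: "(if i < length x then Some (x ! i) else None) = (if i < length y then Some (y ! i) else None)" for i
    using fun_cong[OF fun_cong[OF e, of 0], of i] by (simp add: word_store_def)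
  have "\<not> length x < length y" "\<not> length y < length x"
    using *[of "length x"] *[of "length y"] by auto
  then have "length x = length y" by simp
  moreover have "x ! i = y ! i" if "i < length x" for i
    using *[of i] that \<open>length x = length y\<close> by simp
  ultimately show "x = y" by (auto intro: nth_equalityI)
qed

text \<open>Tape 1 counts the length of the input, so the certificate gets the same length; it is
  written right behind the input.\<close>

definition guess_word :: com where
  "guess_word = Whl 0 (\<lambda>s. s \<noteq> Blank) (GoR 0 ;; GoR 1) ;; GoL 1 ;;
     Whl 1 marked (Guess 0 ;; GoR 0 ;; GoL 1) ;; Whl 0 marked (GoL 0)"

definition guess_state :: "bool list \<Rightarrow> nat \<Rightarrow> store" where
  "guess_state w k = (fst (word_store w), (\<lambda>_. 0)(0 := length w + 1, 1 := k))"

lemma ter_guess_bit: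
  "ter (Guess 0 ;; GoR 0 ;; GoL 1) (guess_state w (Suc k)) (1 + (1 + 1))
     ((\<lambda>b. guess_state (w @ [b]) k) ` UNIV)"
proof -
  define S where "S b = (fst (word_store (w @ [b])), (\<lambda>_ :: nat. 0 :: nat)(0 := length w + 1, 1 := Suc k))" for b
  have S: "put 0 b (guess_state w (Suc k)) = S b" for b
    by (auto simp: put_def word_store_def fun_eq_iff nth_append less_Suc_eq guess_state_def S_def)
  have inj: "inj S" by (rule injI) (auto simp: S_def dest: word_store_inj)
  have "ter (Guess 0) (guess_state w (Suc k)) 1 (range S)"
    using ter.Guess[of 0 "guess_state w (Suc k)"] by (simp add: S UNIV_bool insert_commute)
  moreover have "run (GoR 0 ;; GoL 1) (S b) (1 + 1) (guess_state (w @ [b]) k)" for b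
  proof (rule run_Seq)
    show "run (GoR 0) (S b) 1 (fst (word_store (w @ [b])), (\<lambda>_. 0)(0 := length w + 2, 1 := Suc k))"
      using run_GoR[of 0 "fst (word_store (w @ [b]))" "(\<lambda>_. 0)(0 := length w + 1, 1 := Suc k)"]
      by (simp add: S_def fun_upd_twist)
    show "run (GoL 1) (fst (word_store (w @ [b])), (\<lambda>_. 0)(0 := length w + 2, 1 := Suc k)) 1
        (guess_state (w @ [b]) k)"
      using run_GoL[of 1 "fst (word_store (w @ [b]))" "(\<lambda>_. 0)(0 := length w + 2, 1 := Suc k)"]
      by (simp add: guess_state_def)
  qed
  ultimately have "ter (Guess 0 ;; GoR 0 ;; GoL 1) (guess_state w (Suc k)) (1 + (1 + 1))
      (\<Union>b. {guess_state (w @ [b]) k})"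
    by (intro ter_Seq_image[of _ _ _ S UNIV, OF _ inj]) (auto simp: run_def)
  then show ?thesis by (simp add: UNION_singleton_eq_range)
qed

lemma ter_guess_bits:
  "ter (Whl 1 marked (Guess 0 ;; GoR 0 ;; GoL 1)) (guess_state w k)
     (k * 5 + 1) ((\<lambda>y. guess_state (w @ y) 0) ` {y. length y = k})"
proof (induction k arbitrary: w)
  case 0
  then show ?case
    using ter.Whl_False[of marked "guess_state w 0" 1] by (simp add: scan_mark guess_state_def)
next
  case (Suc k)
  have inj: "inj (\<lambda>b. guess_state (w @ [b]) k)"
    by (rule injI) (auto simp: guess_state_def dest: word_store_inj)
  have "ter (Whl 1 marked (Guess 0 ;; GoR 0 ;; GoL 1)) (guess_state w (Suc k))
      (1 + (1 + 1) + 2 + (k * 5 + 1)) (\<Union>b. (\<lambda>y. guess_state ((w @ [b]) @ y) 0) ` {y. length y = k})"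
    by (rule ter_Whl_image[OF _ ter_guess_bit inj Suc.IH]) (simp add: scan_mark guess_state_def)
  moreover have "(\<Union>b. (\<lambda>y. guess_state ((w @ [b]) @ y) 0) ` {y. length y = k}) =
      (\<lambda>y. guess_state (w @ y) 0) ` {y. length y = Suc k}"
    by (auto simp: length_Suc_conv image_iff)
  ultimately show ?case by (auto elim!: ter.mono)
qed

lemma ter_guess_word:
  "ter guess_word (word_store x)
     (((length x + 1) * 4 + 1) + (1 + ((length x * 5 + 1) + ((length x * 2 + 1) * 3 + 1))))
     (word_store ` {z. \<exists>y. length y = length x \<and> z = x @ y})"
proof -
  let ?n = "length x"
  have 1: "run (Whl 0 (\<lambda>s. s \<noteq> Blank) (GoR 0 ;; GoR 1)) (word_store x) ((?n + 1) * 4 + 1)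
      (fst (word_store x), (\<lambda>_. 0)(0 := ?n + 1, 1 := ?n + 1))"
    using run_to_end[of "fst (word_store x)" x "\<lambda>_. 0" 1] by (simp add: word_store_def)
  have 2: "run (GoL 1) (fst (word_store x), (\<lambda>_. 0)(0 := ?n + 1, 1 := ?n + 1)) 1 (guess_state x ?n)"
    using run_GoL[of 1 "fst (word_store x)" "(\<lambda>_. 0)(0 := ?n + 1, 1 := ?n + 1)"]
    by (simp add: guess_state_def)
  have inj: "inj_on (\<lambda>y. guess_state (x @ y) 0) {y. length y = ?n}"
    by (rule inj_onI) (auto simp: guess_state_def dest: word_store_inj)
  have "run (Whl 0 marked (GoL 0)) (guess_state (x @ y) 0) ((?n * 2 + 1) * 3 + 1) (word_store (x @ y))"
    if "length y = ?n" for y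
  proof -
    have *: "(\<lambda>_. 0 :: nat)(0 := length (x @ y) + 1, 1 := 0, 0 := 0) = (\<lambda>_. 0)" by auto
    show ?thesis
      using run_clear[of "(\<lambda>_. 0)(0 := length (x @ y) + 1, 1 := 0)" 0 "?n * 2 + 1" "fst (word_store (x @ y))"]
        that unfolding * guess_state_def by (simp add: word_store_def)
  qed
  then have 3: "ter (Whl 1 marked (Guess 0 ;; GoR 0 ;; GoL 1) ;; Whl 0 marked (GoL 0)) (guess_state x ?n)
      ((?n * 5 + 1) + ((?n * 2 + 1) * 3 + 1)) (\<Union>y\<in>{y. length y = ?n}. {word_store (x @ y)})"
    by (intro ter_Seq_image[OF ter_guess_bits inj]) (auto simp: run_def)
  have 4: "(\<Union>y\<in>{y. length y = ?n}. {word_store (x @ y)}) =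
      word_store ` {z. \<exists>y. length y = length x \<and> z = x @ y}" by auto
  show ?thesis
    unfolding guess_word_def using ter_run_Seq[OF 1 ter_run_Seq[OF 2 3[unfolded 4]]] .
qed

definition eval_state :: "bool list \<Rightarrow> nat \<Rightarrow> store" where
  "eval_state z k = (fst (word_store z), (\<lambda>_. 0)(2 := k))"

lemma run_eval:
  assumes "polyfun (\<lambda>z e. f z)"
  obtains c T where "pbounded T" "guess_free c" "2 < tapes c"
    "\<forall>z. run c (word_store z) (T (length z)) (eval_state z (f z))"
proof -
  obtain c T where c: "pbounded T" "computes c T (\<lambda>_. 0) (\<lambda>_. 1) 2 (\<lambda>z e. f z)"
    by (rule polyfunD[OF assms, of "\<lambda>_. 0" "\<lambda>_. 1" 2]) (auto intro: pbounded_const)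
  have "run c (word_store z) (T (length z)) (eval_state z (f z))" for z
    using computesD[OF c(2), of "fst (word_store z)" z "\<lambda>_. 0"]
    by (simp add: eval_state_def word_store_def)
  then show thesis using that c unfolding computes_def by blast
qed

lemma eval_state_inj: "eval_state z k = eval_state y k' \<Longrightarrow> z = y"
  unfolding eval_state_def by (auto dest: word_store_inj)

lemma ter_guess_test:
  assumes "polypred (\<lambda>z e. P z)"
  obtains c T where "pbounded T" "2 < tapes c"
    "\<forall>x. ter c (word_store x) (T (length x))
       ((\<lambda>z. eval_state z 1) ` {z. (\<exists>y. length y = length x \<and> z = x @ y) \<and> P z})"
proof -
  obtain c T where c: "pbounded T" "2 < tapes c"
    "\<forall>z. run c (word_store z) (T (length z)) (eval_state z (of_bool (P z)))"
    by (rule run_eval[OF assms[unfolded polypred_def]])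
  let ?T = "\<lambda>n. (((n + 1) * 4 + 1) + (1 + ((n * 5 + 1) + ((n * 2 + 1) * 3 + 1)))) + (T (2 * n) + 1)"
  have "ter (guess_word ;; c ;; Test 2 marked) (word_store x) (?T (length x))
      ((\<lambda>z. eval_state z 1) ` {z. (\<exists>y. length y = length x \<and> z = x @ y) \<and> P z})" (is "ter ?c _ _ ?X") for x
  proof -
    have "ter ?c (word_store x) (?T (length x))
      (\<Union>z\<in>{z. \<exists>y. length y = length x \<and> z = x @ y}. if P z then {eval_state z 1} else {})"
    proof (rule ter_Seq_image[OF ter_guess_word])
      show "inj_on word_store {z. \<exists>y. length y = length x \<and> z = x @ y}"
        by (rule inj_onI) (simp add: word_store_inj)
      fix z assume "z \<in> {z. \<exists>y. length y = length x \<and> z = x @ y}"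
      then have l: "length z = 2 * length x" by auto
      have "scan (eval_state z (of_bool (P z))) 2 \<noteq> Aux 0 \<longleftrightarrow> P z"
        by (simp add: eval_state_def scan_mark)
      then show "ter (c ;; Test 2 marked) (word_store z) (T (2 * length x) + 1)
          (if P z then {eval_state z 1} else {})"
        using ter_run_Seq[OF c(3)[rule_format, of z] ter.Test[of 2 marked "eval_state z (of_bool (P z))"]] l
        by (cases "P z") simp_all
    qed
    moreover have "(\<Union>z\<in>{z. \<exists>y. length y = length x \<and> z = x @ y}. if P z then {eval_state z 1} else {}) = ?X"
      by auto
    ultimately show ?thesis by simp
  qed
  moreover have "pbounded ?T" by (intro pbounded_intros c pbounded_double)
  moreover have "2 < tapes (guess_word ;; c ;; Test 2 marked)" using c(2) by simp
  ultimately show thesis using that by blast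
qed

text \<open>Fixing the length of the certificate costs nothing here: the code of an instance
  contains a labelling and is therefore long enough for another one.\<close>

theorem NP_I:
  assumes "polypred (\<lambda>z e. P z)"
  shows "{x. \<exists>y. length y = length x \<and> P (x @ y)} \<in> NP"
proof -
  obtain c T where c: "pbounded T"
    "\<forall>x. ter c (word_store x) (T (length x))
       ((\<lambda>z. eval_state z 1) ` {z. (\<exists>y. length y = length x \<and> z = x @ y) \<and> P z})"
    by (rule ter_guess_test[OF assms])
  have "{x. (\<lambda>z. eval_state z 1) ` {z. (\<exists>y. length y = length x \<and> z = x @ y) \<and> P z} \<noteq> {}} =
      {x. \<exists>y. length y = length x \<and> P (x @ y)}" by auto
  with NP_program[OF c(2)[rule_format] c(1)] show ?thesis by (simp only:)
qed

definition write_bit :: "nat \<Rightarrow> nat \<Rightarrow> (symbol \<Rightarrow> bool) \<Rightarrow> com" where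
  "write_bit out j Q = GoR out ;; Ite j Q (Put out True) (Put out False)"

definition out_state :: "(nat \<Rightarrow> nat \<Rightarrow> bool option) \<Rightarrow> (nat \<Rightarrow> nat) \<Rightarrow> nat \<Rightarrow> bool list \<Rightarrow> store" where
  "out_state C p out w = (C(out := fst (word_store w) 0), p(out := length w))"

lemma run_write_bit:
  assumes "j \<noteq> out"
  shows "run (write_bit out j Q) (out_state C p out w) (1 + (1 + 2))
    (out_state C p out (w @ [Q (scan (C, p) j)]))"
proof -
  let ?b = "Q (scan (C, p) j)"
  let ?s = "(C(out := fst (word_store w) 0), p(out := Suc (length w)))"
  have "scan ?s j = scan (C, p) j" using assms by (simp add: scan_def)
  moreover have "put out b ?s = out_state C p out (w @ [b])" for b
    by (auto simp: put_def out_state_def word_store_def fun_eq_iff nth_append less_Suc_eq)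
  ultimately have "run (Ite j Q (Put out True) (Put out False)) ?s (1 + 2) (out_state C p out (w @ [?b]))"
    using ter.Put[of out ?b ?s] by (intro run_Ite) (auto simp: run_def)
  moreover have "run (GoR out) (out_state C p out w) 1 ?s"
    using run_GoR[of out "C(out := fst (word_store w) 0)" "p(out := length w)"] by (simp add: out_state_def)
  ultimately show ?thesis unfolding write_bit_def by (rule run_Seq[rotated])
qed

lemma tape_word_out_state:
  assumes "out < K"
  shows "tape_word (conc K (out_state C p out w) ! out) w"
  using assms by (auto simp: tape_word_def nth_conc out_state_def cell_def word_store_def)

lemma last_conc: "0 < K \<Longrightarrow> last (conc K s) = conc K s ! (K - 1)"
  by (subst last_conv_nth) (auto simp: conc_def)

lemma out_state_Nil: "p out = 0 \<Longrightarrow> C out = (\<lambda>_. None) \<Longrightarrow> out_state C p out [] = (C, p)"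
  by (auto simp: out_state_def word_store_def fun_eq_iff)

definition copy_word :: "nat \<Rightarrow> com" where
  "copy_word out = GoR 0 ;; Whl 0 (\<lambda>s. s \<noteq> Blank) (write_bit out 0 (\<lambda>s. s = Bit True) ;; GoR 0)"

lemma run_copy_word:
  assumes "C 0 = fst (word_store z) 0" "p 0 = 0" "out \<noteq> 0" "p out = 0" "C out = (\<lambda>_. None)"
  shows "run (copy_word out) (C, p) (1 + (length z * (1 + (1 + 2) + 1 + 2) + 1))
    (out_state C (p(0 := length z + 1)) out z)"
  unfolding copy_word_def
proof (rule run_Seq)
  let ?S = "\<lambda>i. out_state C (p(0 := Suc i)) out (take i z)"
  have "run (GoR 0) (C, p) 1 (C, p(0 := 1))" using run_GoR[of 0 C p] assms by simp
  then show "run (GoR 0) (C, p) 1 (?S 0)"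
    using assms by (simp add: out_state_Nil)
  have sc: "scan (?S i) 0 = (if i < length z then Bit (z ! i) else Blank)" if "i \<le> length z" for i
    using assms that by (auto simp: scan_def out_state_def word_store_def)
  have "run (Whl 0 (\<lambda>s. s \<noteq> Blank) (write_bit out 0 (\<lambda>s. s = Bit True) ;; GoR 0)) (?S 0)
      (length z * (1 + (1 + 2) + 1 + 2) + 1) (?S (length z))"
  proof (rule run_for)
    fix i assume i: "i < length z"
    then show "scan (?S i) 0 \<noteq> Blank" using sc by simp
    show "run (write_bit out 0 (\<lambda>s. s = Bit True) ;; GoR 0) (?S i) (1 + (1 + 2) + 1) (?S (Suc i))"
    proof (rule run_Seq)
      have "(scan (C, p(0 := Suc i)) 0 = Bit True) = z ! i"
        using i assms by (simp add: scan_def word_store_def)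
      then show "run (write_bit out 0 (\<lambda>s. s = Bit True)) (?S i) (1 + (1 + 2))
          (out_state C (p(0 := Suc i)) out (take (Suc i) z))"
        using run_write_bit[of 0 out "\<lambda>s. s = Bit True" C "p(0 := Suc i)" "take i z"] assms(3) i
        by (simp add: take_Suc_conv_app_nth)
      show "run (GoR 0) (out_state C (p(0 := Suc i)) out (take (Suc i) z)) 1 (?S (Suc i))"
        using run_GoR[of 0 "C(out := fst (word_store (take (Suc i) z)) 0)"
            "(p(0 := Suc i))(out := length (take (Suc i) z))"] assms(3)
        by (simp add: out_state_def fun_upd_twist)
    qed
  qed (subst sc, auto)
  then show "run (Whl 0 (\<lambda>s. s \<noteq> Blank) (write_bit out 0 (\<lambda>s. s = Bit True) ;; GoR 0)) (?S 0)
      (length z * (1 + (1 + 2) + 1 + 2) + 1) (out_state C (p(0 := length z + 1)) out z)"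
    by simp
qed

theorem Sigma2p_I:
  assumes "polypred (\<lambda>z e. P z)" "B \<in> NP"
  shows "{x. \<exists>y. length y = length x \<and> P (x @ y) \<and> x @ y \<notin> B} \<in> Sigma2p"
proof -
  obtain c T where c: "pbounded T" "2 < tapes c"
    "\<forall>x. ter c (word_store x) (T (length x))
       ((\<lambda>z. eval_state z 1) ` {z. (\<exists>y. length y = length x \<and> z = x @ y) \<and> P z})"
    by (rule ter_guess_test[OF assms(1)])
  \<comment> \<open>The first tape that \<open>c\<close> does not use: it is still empty, and it
    becomes the last tape of the whole program, as the query tape has to be.\<close>
  define out where "out = tapes c"
  define F where "F z = out_state (fst (word_store z)) ((\<lambda>_. 0)(2 := 1, 0 := length z + 1)) out z" for z
  define X where "X x = F ` {z. (\<exists>y. length y = length x \<and> z = x @ y) \<and> P z}" for x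
  let ?T = "\<lambda>n. T n + (1 + (2 * n * (1 + (1 + 2) + 1 + 2) + 1))"
  have inj: "inj_on (\<lambda>z. eval_state z 1) A" for A by (rule inj_onI) (rule eval_state_inj)
  have out: "out \<noteq> 0" "out \<noteq> 2" using c(2) by (auto simp: out_def)
  have "ter (c ;; copy_word out) (word_store x) (?T (length x)) (X x)" for x
  proof -
    have "ter (c ;; copy_word out) (word_store x) (?T (length x))
        (\<Union>z\<in>{z. (\<exists>y. length y = length x \<and> z = x @ y) \<and> P z}. {F z})"
    proof (rule ter_Seq_image[OF c(3)[rule_format] inj])
      fix z assume "z \<in> {z. (\<exists>y. length y = length x \<and> z = x @ y) \<and> P z}"
      then have "length z = 2 * length x" by auto
      then show "ter (copy_word out) (eval_state z 1) (1 + (2 * length x * (1 + (1 + 2) + 1 + 2) + 1)) {F z}"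
        using run_copy_word[of "fst (word_store z)" z "(\<lambda>_. 0)(2 := 1)" out] out
        by (simp add: F_def eval_state_def run_def word_store_def)
    qed
    then show ?thesis by (simp add: X_def UNION_singleton_eq_range)
  qed
  moreover have "pbounded ?T" by (intro pbounded_intros c)
  moreover have K: "tapes (c ;; copy_word out) = Suc out"
    by (simp add: copy_word_def write_bit_def out_def)
  define word where "word s = (THE w. tape_word (last (conc (Suc out) s)) w)" for s
  have F: "tape_word (last (conc (Suc out) (F z))) z" for z
    unfolding F_def using tape_word_out_state[of out "Suc out"] by (simp add: last_conc)
  then have word: "word (F z) = z" for z
    unfolding word_def by (auto intro: tape_word_unique)
  ultimately have "{x. \<exists>s\<in>X x. word s \<notin> B} \<in> Sigma2p"
    by (intro Sigma2p_program[OF _ _ assms(2) K[symmetric]]) (auto simp: X_def word F)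
  then show ?thesis by (rule back_subst) (auto simp: X_def word)
qed

text \<open>The output is produced bit by bit from its length and from the value of the bit at a
  given position. Counter 2 holds the number of bits still to be written, 3 the position and 4 the
  bit.\<close>

theorem computable_I:
  assumes "polyfun (\<lambda>z e. l z)" "polypred (\<lambda>z e. Q z (e 0))"
  shows "poly_time_computable (\<lambda>x. map (Q x) [0..<l x])"
proof -
  obtain c1 T1 where c1: "pbounded T1" "guess_free c1" "2 < tapes c1"
    "\<forall>z. run c1 (word_store z) (T1 (length z)) (eval_state z (l z))"
    by (rule run_eval[OF assms(1)])
  obtain D where D: "pbounded D" "\<forall>z e. (\<forall>i :: nat. e i \<le> (0 :: nat)) \<longrightarrow> l z \<le> D (length z)"
    by (rule bounded_funD[OF polyfun_bounded[OF assms(1)] pbounded_const[of 0]])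
  have lD: "l z \<le> D (length z)" for z using D(2) by (auto dest!: spec[of _ z] spec[of _ "\<lambda>_. 0"])
  \<comment> \<open>Variable 0 is the position on tape 3; all others are placed on tape 1, which
    stays at 0.\<close>
  define v :: "nat \<Rightarrow> nat" where "v = case_nat 3 (\<lambda>_. 1)"
  have v: "0 < v i" "v i < 4" for i by (auto simp: v_def split: nat.split)
  obtain c2 T2 where c2: "pbounded T2" "computes c2 T2 D v 4 (\<lambda>z e. of_bool (Q z (e 0)))"
    using D(1) v by (rule polyfunD[OF assms(2)[unfolded polypred_def]])
  define out where "out = max (tapes c1) (tapes c2)"
  have out: "out > 4" using c2(2) by (auto simp: out_def computes_def)
  let ?body = "c2 ;; write_bit out 4 marked ;; GoL 4 ;; GoR 3 ;; GoL 2"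
  let ?c = "c1 ;; Whl 2 marked ?body"
  let ?p = "\<lambda>z i. (\<lambda>_. 0 :: nat)(2 := l z - i, 3 := i)"
  let ?S = "\<lambda>z i. out_state (fst (word_store z)) (?p z i) out (map (Q z) [0..<i])"
  let ?Tb = "\<lambda>n. T2 n + ((1 + (1 + 2)) + (1 + (1 + 1)))"
  let ?T = "\<lambda>n. T1 n + (D n * (?Tb n + 2) + 1)"
  have body: "run ?body (?S z i) (?Tb (length z)) (?S z (Suc i))" if i: "i < l z" for z i
  proof (intro run_Seq)
    let ?w = "map (Q z) [0..<i]" and ?C = "fst (word_store z)"
    have 1: "run c2 (?S z i) (T2 (length z)) (fst (?S z i), (snd (?S z i))(4 := of_bool (Q z (snd (?S z i) (v 0)))))"
    proof -
      have "snd (?S z i) (v j) \<le> D (length z)" for j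
        using out i lD[of z] by (auto simp: v_def out_state_def split: nat.split)
      moreover have "fst (?S z i) 0 = fst (word_store z) 0" "snd (?S z i) 0 = 0"
        using out by (simp_all add: out_state_def)
      moreover have "snd (?S z i) j = 0" if "4 \<le> j" "j < tapes c2" for j
        using out that by (auto simp: out_state_def out_def)
      ultimately show ?thesis
        using computesD[OF c2(2), of "fst (?S z i)" z "snd (?S z i)"] by (simp del: fun_upd_apply)
    qed
    then show "run c2 (?S z i) (T2 (length z)) (out_state ?C ((?p z i)(4 := of_bool (Q z i))) out ?w)"
      using out by (simp add: out_state_def v_def fun_upd_twist)
    show "run (write_bit out 4 marked) (out_state ?C ((?p z i)(4 := of_bool (Q z i))) out ?w) (1 + (1 + 2))
        (out_state ?C ((?p z i)(4 := of_bool (Q z i))) out (map (Q z) [0..<Suc i]))"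
      using run_write_bit[of 4 out marked ?C "(?p z i)(4 := of_bool (Q z i))" ?w] out
      by (simp add: scan_mark)
    let ?w' = "map (Q z) [0..<Suc i]"
    show "run (GoL 4) (out_state ?C ((?p z i)(4 := of_bool (Q z i))) out ?w') 1 (out_state ?C (?p z i) out ?w')"
    proof -
      have "((?p z i)(4 := of_bool (Q z i), out := length ?w'))(4 := 0) = (?p z i)(out := length ?w')"
        using out by auto
      then show ?thesis
        using run_GoL[of 4 "?C(out := fst (word_store ?w') 0)" "(?p z i)(4 := of_bool (Q z i), out := length ?w')"] out
        unfolding out_state_def by (simp del: map_append upt_Suc)
    qed
    show "run (GoR 3) (out_state ?C (?p z i) out ?w') 1 (out_state ?C ((?p z i)(3 := Suc i)) out ?w')"
      using run_GoR[of 3 "?C(out := fst (word_store ?w') 0)" "(?p z i)(out := length ?w')"] out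
      by (simp add: out_state_def fun_upd_twist)
    have "((?p z i)(3 := Suc i, out := length ?w'))(2 := l z - Suc i) = (?p z (Suc i))(out := length ?w')"
      using out by auto
    then show "run (GoL 2) (out_state ?C ((?p z i)(3 := Suc i)) out ?w') 1 (?S z (Suc i))"
      using run_GoL[of 2 "?C(out := fst (word_store ?w') 0)" "(?p z i)(3 := Suc i, out := length ?w')"] out
      unfolding out_state_def by (simp del: map_append upt_Suc)
  qed
  have "ter ?c (word_store z) (?T (length z)) {?S z (l z)}" for z
  proof -
    have "run (Whl 2 marked ?body) (?S z 0) (l z * (?Tb (length z) + 2) + 1) (?S z (l z))"
      by (rule run_for[of "l z" marked "?S z" 2, OF _ body]) (use out in \<open>auto simp: scan_mark out_state_def\<close>)
    then have *: "run (Whl 2 marked ?body) (?S z 0) (D (length z) * (?Tb (length z) + 2) + 1) (?S z (l z))"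
      by (rule run_mono) (intro add_le_mono1 mult_le_mono1 lD)
    have "?S z 0 = eval_state z (l z)"
    proof -
      have "(\<lambda>_ :: nat. 0 :: nat)(2 := l z, 3 := 0) = (\<lambda>_. 0)(2 := l z)" by auto
      then show ?thesis
        using out by (simp add: eval_state_def out_state_Nil word_store_def)
    qed
    from run_Seq[OF c1(4)[rule_format, of z] *[unfolded this]] show ?thesis by (simp only: run_def)
  qed
  moreover have "pbounded ?T" by (intro pbounded_intros c1 c2 D)
  moreover have "guess_free ?c" using c1(2) c2(2) by (simp add: computes_def write_bit_def)
  moreover have K: "tapes ?c = Suc out"
    using out by (auto simp: write_bit_def out_def)
  moreover have "tape_word (last (conc (Suc out) (?S x (l x)))) (map (Q x) [0..<l x])" for x
    using tape_word_out_state[of out "Suc out"] by (simp add: last_conc)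
  ultimately show ?thesis by (intro computable_program[OF _ _ _ K[symmetric]])
qed

section \<open>Labellings\<close>

text \<open>Caminada's form of completeness. It is local: quantifiers over arguments suffice to
  check it.\<close>

definition complete_lab :: "'a set \<Rightarrow> ('a \<Rightarrow> 'a \<Rightarrow> bool) \<Rightarrow> ('a \<Rightarrow> label) \<Rightarrow> bool" where
  "complete_lab A R l \<longleftrightarrow> (\<forall>a\<in>A. (l a = In \<longleftrightarrow> (\<forall>b\<in>A. R b a \<longrightarrow> l b = Out)) \<and>
     (l a = Out \<longleftrightarrow> (\<exists>b\<in>A. R b a \<and> l b = In)))"

text \<open>\<open>l'\<close> refutes \<open>l\<close> by enlarging the set of arguments labelled in
  or, for \<open>SST\<close>, the set of decided arguments. Both kinds of refutation are put into
  one predicate, so that a single universally quantified labelling serves \<open>PR\<close> and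
  \<open>SST\<close>. For \<open>CO\<close> and \<open>ST\<close> nothing is ever better.\<close>

definition better :: "semantics \<Rightarrow> 'a set \<Rightarrow> ('a \<Rightarrow> label) \<Rightarrow> ('a \<Rightarrow> label) \<Rightarrow> bool" where
  "better \<sigma> A l l' \<longleftrightarrow>
     (\<sigma> = PR \<or> \<sigma> = SST) \<and> (\<forall>a\<in>A. l a = In \<longrightarrow> l' a = In) \<and> (\<exists>a\<in>A. l' a = In \<and> l a \<noteq> In) \<or>
     \<sigma> = SST \<and> (\<forall>a\<in>A. l a \<noteq> Und \<longrightarrow> l' a \<noteq> Und) \<and> (\<exists>a\<in>A. l' a \<noteq> Und \<and> l a = Und)"

definition sem_lab :: "semantics \<Rightarrow> 'a set \<Rightarrow> ('a \<Rightarrow> 'a \<Rightarrow> bool) \<Rightarrow> ('a \<Rightarrow> label) \<Rightarrow> bool" where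
  "sem_lab \<sigma> A R l \<longleftrightarrow> complete_lab A R l \<and> (\<sigma> = ST \<longrightarrow> (\<forall>a\<in>A. l a \<noteq> Und)) \<and>
     (\<forall>l'. complete_lab A R l' \<longrightarrow> \<not> better \<sigma> A l l')"

definition rel :: "'a af \<Rightarrow> 'a \<Rightarrow> 'a \<Rightarrow> bool" where
  "rel F a b \<longleftrightarrow> (a, b) \<in> attacks F"

lemma complete_lab_cong:
  assumes "\<And>a. a \<in> A \<Longrightarrow> l a = l' a" "\<And>a b. a \<in> A \<Longrightarrow> b \<in> A \<Longrightarrow> R a b = R' a b"
  shows "complete_lab A R l \<longleftrightarrow> complete_lab A R' l'"
  using assms unfolding complete_lab_def by (auto 0 3)

lemma better_cong:
  assumes "\<And>a. a \<in> A \<Longrightarrow> l a = l' a" "\<And>a. a \<in> A \<Longrightarrow> m a = m' a"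
  shows "better \<sigma> A l m \<longleftrightarrow> better \<sigma> A l' m'"
  using assms unfolding better_def by auto

lemma sem_lab_cong:
  assumes "\<And>a. a \<in> A \<Longrightarrow> l a = l' a" "\<And>a b. a \<in> A \<Longrightarrow> b \<in> A \<Longrightarrow> R a b = R' a b"
  shows "sem_lab \<sigma> A R l \<longleftrightarrow> sem_lab \<sigma> A R' l'"
proof -
  have "complete_lab A R m \<longleftrightarrow> complete_lab A R' m" for m
    using assms(2) by (intro complete_lab_cong) auto
  moreover have "complete_lab A R' l \<longleftrightarrow> complete_lab A R' l'"
    using assms(1) by (intro complete_lab_cong) auto
  moreover have "better \<sigma> A l m \<longleftrightarrow> better \<sigma> A l' m" for m
    using assms(1) by (intro better_cong) auto
  ultimately show ?thesis using assms(1) unfolding sem_lab_def by simp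
qed

lemma bij_betw_transfer:
  assumes f: "bij_betw f N A"
  shows "complete_lab N (\<lambda>i j. R (f i) (f j)) (\<lambda>i. l (f i)) \<longleftrightarrow> complete_lab A R l"
    and "better \<sigma> N (\<lambda>i. l (f i)) (\<lambda>i. m (f i)) \<longleftrightarrow> better \<sigma> A l m"
proof -
  have A: "A = f ` N" using f by (simp add: bij_betw_def)
  show "complete_lab N (\<lambda>i j. R (f i) (f j)) (\<lambda>i. l (f i)) \<longleftrightarrow> complete_lab A R l"
    "better \<sigma> N (\<lambda>i. l (f i)) (\<lambda>i. m (f i)) \<longleftrightarrow> better \<sigma> A l m"
    unfolding complete_lab_def better_def A by auto
qed

lemma sem_lab_transfer:
  assumes f: "bij_betw f N A"
  shows "sem_lab \<sigma> N (\<lambda>i j. R (f i) (f j)) (\<lambda>i. l (f i)) \<longleftrightarrow> sem_lab \<sigma> A R l"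
proof -
  have "(\<forall>l'. complete_lab N (\<lambda>i j. R (f i) (f j)) l' \<longrightarrow> \<not> better \<sigma> N (\<lambda>i. l (f i)) l') \<longleftrightarrow>
      (\<forall>l'. complete_lab A R l' \<longrightarrow> \<not> better \<sigma> A l l')" (is "?L \<longleftrightarrow> ?R")
  proof
    assume ?L
    then show ?R using bij_betw_transfer[OF f] by metis
  next
    assume r: ?R
    show ?L
    proof (intro allI impI)
      fix l' assume l': "complete_lab N (\<lambda>i j. R (f i) (f j)) l'"
      let ?m = "\<lambda>a. l' (inv_into N f a)"
      have m: "?m (f i) = l' i" if "i \<in> N" for i
        using f that by (simp add: bij_betw_def)
      have "complete_lab N (\<lambda>i j. R (f i) (f j)) (\<lambda>i. ?m (f i))"
        using l' m complete_lab_cong[of N l' "\<lambda>i. ?m (f i)"] by metis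
      then have "\<not> better \<sigma> A l ?m" using r bij_betw_transfer(1)[OF f] by blast
      then have "\<not> better \<sigma> N (\<lambda>i. l (f i)) (\<lambda>i. ?m (f i))" using bij_betw_transfer(2)[OF f] by blast
      then show "\<not> better \<sigma> N (\<lambda>i. l (f i)) l'" using m better_cong[of N _ _ l' "\<lambda>i. ?m (f i)"] by metis
    qed
  qed
  moreover have "(\<forall>a\<in>N. l (f a) \<noteq> Und) \<longleftrightarrow> (\<forall>a\<in>A. l a \<noteq> Und)"
    using f by (auto simp: bij_betw_def)
  ultimately show ?thesis
    unfolding sem_lab_def using bij_betw_transfer(1)[OF f, of R l] by simp
qed

lemma complete_ext_lab:
  assumes F: "is_af F" and E: "E \<in> complete_exts F"
  shows "complete_lab (args F) (rel F) (labelling_of F E)"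
    and "labelling_of F E a = In \<longleftrightarrow> a \<in> E" and "labelling_of F E a = Out \<longleftrightarrow> a \<in> defeated F E"
    and "E \<subseteq> args F" and "defeated F E \<subseteq> args F"
proof -
  have 1: "E \<inter> defeated F E = {}" "E = acceptable F E"
    using E by (auto simp: complete_exts_def admissible_def conflict_free_def)
  show 2: "labelling_of F E a = In \<longleftrightarrow> a \<in> E" "labelling_of F E a = Out \<longleftrightarrow> a \<in> defeated F E" for a
    using 1(1) by (auto simp: labelling_of_def)
  show 3: "E \<subseteq> args F" "defeated F E \<subseteq> args F"
    using E by (auto simp: complete_exts_def defeated_def)
  have "attacks F \<subseteq> args F \<times> args F" using F by (simp add: is_af_def)
  then have "a \<in> acceptable F E \<longleftrightarrow> a \<in> args F \<and> (\<forall>b\<in>args F. (b, a) \<in> attacks F \<longrightarrow> b \<in> defeated F E)" for a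
    by (auto simp: acceptable_def)
  moreover have "a \<in> defeated F E \<longleftrightarrow> a \<in> args F \<and> (\<exists>b\<in>args F. (b, a) \<in> attacks F \<and> b \<in> E)" for a
    using 3(1) by (auto simp: defeated_def)
  ultimately show "complete_lab (args F) (rel F) (labelling_of F E)"
    using 1(2) unfolding complete_lab_def 2 rel_def by blast
qed

lemma lab_complete_ext:
  assumes F: "is_af F" and l: "complete_lab (args F) (rel F) l"
  defines "E \<equiv> {a \<in> args F. l a = In}"
  shows "E \<in> complete_exts F" and "a \<in> args F \<Longrightarrow> labelling_of F E a = l a"
proof -
  have sub: "attacks F \<subseteq> args F \<times> args F" using F by (simp add: is_af_def)
  have li: "l a = In \<longleftrightarrow> (\<forall>b\<in>args F. (b, a) \<in> attacks F \<longrightarrow> l b = Out)"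
    and lo: "l a = Out \<longleftrightarrow> (\<exists>b\<in>args F. (b, a) \<in> attacks F \<and> l b = In)" if "a \<in> args F" for a
    using l that unfolding complete_lab_def rel_def by blast+
  have d: "a \<in> defeated F E \<longleftrightarrow> a \<in> args F \<and> l a = Out" for a
    using lo[of a] by (auto simp: defeated_def E_def)
  have "a \<in> acceptable F E \<longleftrightarrow> a \<in> args F \<and> (\<forall>b\<in>args F. (b, a) \<in> attacks F \<longrightarrow> l b = Out)" for a
    unfolding acceptable_def mem_Collect_eq d using subsetD[OF sub, of "(_, a)"] by blast
  then have "a \<in> acceptable F E \<longleftrightarrow> a \<in> E" for a
    using li[of a] by (auto simp: E_def)
  then have "acceptable F E = E" by blast
  moreover have "E \<inter> defeated F E = {}" using d by (auto simp: E_def)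
  ultimately show "E \<in> complete_exts F"
    by (auto simp: complete_exts_def admissible_def conflict_free_def E_def)
  show "labelling_of F E a = l a" if "a \<in> args F"
    using that d by (cases "l a") (auto simp: labelling_of_def E_def)
qed

lemma preferred_above:
  assumes F: "is_af F" and T: "T \<in> complete_exts F"
  shows "\<exists>T'\<in>preferred_exts F. T \<subseteq> T'"
proof -
  have "finite (Pow (args F))" using F by (simp add: is_af_def)
  then have "finite (complete_exts F)"
    by (rule rev_finite_subset) (auto simp: complete_exts_def)
  then obtain m where "m \<in> complete_exts F" "T \<subseteq> m" "\<forall>b\<in>complete_exts F. m \<subseteq> b \<longrightarrow> m = b"
    using finite_has_maximal2 T by metis
  then show ?thesis unfolding preferred_exts_def by auto
qed

lemma defeated_mono: "S \<subseteq> T \<Longrightarrow> defeated F S \<subseteq> defeated F T"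
  by (auto simp: defeated_def)

text \<open>Maximality is tested against complete instead of preferred extensions. For
  \<open>SST\<close> this is the same because every complete extension lies below a preferred one,
  whose range is at least as large. For \<open>ST\<close> it is automatic: no conflict-free set
  properly contains a set that decides every argument.\<close>

lemma extensions_iff:
  assumes F: "is_af F"
  shows "E \<in> extensions \<sigma> F \<longleftrightarrow> E \<in> complete_exts F \<and> (\<sigma> = ST \<longrightarrow> E \<union> defeated F E = args F) \<and>
    (\<forall>T\<in>complete_exts F. \<not> ((\<sigma> = PR \<or> \<sigma> = SST) \<and> E \<subset> T \<or>
       \<sigma> = SST \<and> E \<union> defeated F E \<subset> T \<union> defeated F T))"
proof (cases \<sigma>)
  case CO
  then show ?thesis by simp
next
  case PR
  then show ?thesis by (auto simp: preferred_exts_def)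
next
  case ST
  have "E = T" if "E \<in> complete_exts F" "E \<union> defeated F E = args F" "T \<in> complete_exts F" "E \<subseteq> T" for T
  proof -
    have "T \<inter> defeated F T = {}" "T \<subseteq> args F"
      using that(3) by (auto simp: complete_exts_def admissible_def conflict_free_def)
    then show ?thesis using that(2,4) defeated_mono[OF that(4), of F] by blast
  qed
  with ST show ?thesis by (auto simp: stable_exts_def preferred_exts_def)
next
  case SST
  show ?thesis
  proof
    assume "E \<in> extensions \<sigma> F"
    then have E: "E \<in> preferred_exts F" "\<forall>T\<in>preferred_exts F. E \<union> defeated F E \<subseteq> T \<union> defeated F T \<longrightarrow>
        T \<union> defeated F T = E \<union> defeated F E"
      using SST by (auto simp: semi_stable_exts_def)
    have "\<not> E \<union> defeated F E \<subset> T \<union> defeated F T" if T: "T \<in> complete_exts F" for T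
    proof
      assume *: "E \<union> defeated F E \<subset> T \<union> defeated F T"
      obtain T' where T': "T' \<in> preferred_exts F" "T \<subseteq> T'" using preferred_above[OF F T] by blast
      then have "T \<union> defeated F T \<subseteq> T' \<union> defeated F T'" using defeated_mono[OF T'(2), of F] by blast
      with * E(2) T'(1) show False by blast
    qed
    with E(1) show "E \<in> complete_exts F \<and> (\<sigma> = ST \<longrightarrow> E \<union> defeated F E = args F) \<and>
      (\<forall>T\<in>complete_exts F. \<not> ((\<sigma> = PR \<or> \<sigma> = SST) \<and> E \<subset> T \<or>
       \<sigma> = SST \<and> E \<union> defeated F E \<subset> T \<union> defeated F T))"
      using SST by (auto simp: preferred_exts_def)
  next
    assume h: "E \<in> complete_exts F \<and> (\<sigma> = ST \<longrightarrow> E \<union> defeated F E = args F) \<and>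
      (\<forall>T\<in>complete_exts F. \<not> ((\<sigma> = PR \<or> \<sigma> = SST) \<and> E \<subset> T \<or>
       \<sigma> = SST \<and> E \<union> defeated F E \<subset> T \<union> defeated F T))"
    have 1: "\<not> E \<subset> T" "\<not> E \<union> defeated F E \<subset> T \<union> defeated F T" if "T \<in> complete_exts F" for T
      using h SST that by auto
    have "T = E" if "T \<in> complete_exts F" "E \<subseteq> T" for T
      using 1(1)[OF that(1)] that(2) by (metis psubsetI)
    then have "E \<in> preferred_exts F" unfolding preferred_exts_def using h by simp
    moreover have "T \<union> defeated F T = E \<union> defeated F E"
      if "T \<in> preferred_exts F" "E \<union> defeated F E \<subseteq> T \<union> defeated F T" for T
      using 1(2)[of T] that by (metis (no_types, lifting) preferred_exts_def mem_Collect_eq psubsetI)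
    ultimately show "E \<in> extensions \<sigma> F" using SST by (simp add: semi_stable_exts_def)
  qed
qed

lemma better_sets:
  assumes "E \<subseteq> A" "D \<subseteq> A" "T \<subseteq> A" "G \<subseteq> A"
    and l: "\<And>a. a \<in> A \<Longrightarrow> l a = In \<longleftrightarrow> a \<in> E" "\<And>a. a \<in> A \<Longrightarrow> l a = Out \<longleftrightarrow> a \<in> D"
    and l': "\<And>a. a \<in> A \<Longrightarrow> l' a = In \<longleftrightarrow> a \<in> T" "\<And>a. a \<in> A \<Longrightarrow> l' a = Out \<longleftrightarrow> a \<in> G"
  shows "better \<sigma> A l l' \<longleftrightarrow> (\<sigma> = PR \<or> \<sigma> = SST) \<and> E \<subset> T \<or> \<sigma> = SST \<and> E \<union> D \<subset> T \<union> G"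
proof -
  have n: "x = Und \<longleftrightarrow> \<not> (x = In \<or> x = Out)" for x by (cases x) auto
  have "(\<forall>a\<in>A. l a = In \<longrightarrow> l' a = In) \<and> (\<exists>a\<in>A. l' a = In \<and> l a \<noteq> In) \<longleftrightarrow> E \<subset> T"
    using assms(1,3) l(1) l'(1) by blast
  moreover have "(\<forall>a\<in>A. l a \<noteq> Und \<longrightarrow> l' a \<noteq> Und) \<longleftrightarrow> E \<union> D \<subseteq> T \<union> G"
    unfolding n using assms(1-4) l l' by blast
  moreover have "(\<exists>a\<in>A. l' a \<noteq> Und \<and> l a = Und) \<longleftrightarrow> \<not> T \<union> G \<subseteq> E \<union> D"
    unfolding n using assms(1-4) l l' by blast
  ultimately show ?thesis unfolding better_def by blast
qed

lemma labellings_iff: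
  assumes F: "is_af F"
  shows "l \<in> labellings \<sigma> F \<longleftrightarrow> (\<forall>a. a \<notin> args F \<longrightarrow> l a = Und) \<and> sem_lab \<sigma> (args F) (rel F) l"
proof
  assume "l \<in> labellings \<sigma> F"
  then obtain E where E: "E \<in> extensions \<sigma> F" and l: "l = labelling_of F E"
    by (auto simp: labellings_def)
  note E' = E[unfolded extensions_iff[OF F]]
  note c = complete_ext_lab[OF F conjunct1[OF E']]
  have "\<not> better \<sigma> (args F) l l'" if l': "complete_lab (args F) (rel F) l'" for l'
  proof -
    define T where "T = {a \<in> args F. l' a = In}"
    note t = lab_complete_ext[OF F l', folded T_def]
    note t' = complete_ext_lab(2-5)[OF F t(1)]
    have "l' a = In \<longleftrightarrow> a \<in> T" "l' a = Out \<longleftrightarrow> a \<in> defeated F T" if "a \<in> args F" for a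
      using t(2)[OF that] t'(1,2)[of a] by auto
    then have "better \<sigma> (args F) l l' \<longleftrightarrow> (\<sigma> = PR \<or> \<sigma> = SST) \<and> E \<subset> T \<or>
       \<sigma> = SST \<and> E \<union> defeated F E \<subset> T \<union> defeated F T"
      unfolding l using c(2-5) t'(3,4) by (intro better_sets) auto
    then show ?thesis using E' t(1) by blast
  qed
  moreover have "l a \<noteq> Und" if "\<sigma> = ST" "a \<in> args F" for a
    using that E' c(2,3)[of a] l by auto
  moreover have "l a = Und" if "a \<notin> args F" for a
    using that c(2)[of a] c(3)[of a] c(4,5) unfolding l by (cases "labelling_of F E a") auto
  ultimately show "(\<forall>a. a \<notin> args F \<longrightarrow> l a = Und) \<and> sem_lab \<sigma> (args F) (rel F) l"
    using c(1) unfolding sem_lab_def l by blast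
next
  assume r: "(\<forall>a. a \<notin> args F \<longrightarrow> l a = Und) \<and> sem_lab \<sigma> (args F) (rel F) l"
  then have s: "complete_lab (args F) (rel F) l" "\<sigma> = ST \<longrightarrow> (\<forall>a\<in>args F. l a \<noteq> Und)"
    "\<And>l'. complete_lab (args F) (rel F) l' \<Longrightarrow> \<not> better \<sigma> (args F) l l'" by (auto simp: sem_lab_def)
  define E where "E = {a \<in> args F. l a = In}"
  note e = lab_complete_ext[OF F s(1), folded E_def]
  note c = complete_ext_lab(2-5)[OF F e(1)]
  have l: "labelling_of F E = l"
  proof
    fix a show "labelling_of F E a = l a"
    proof (cases "a \<in> args F")
      case False
      then show ?thesis using r c(1)[of a] c(2)[of a] c(3,4) by (cases "labelling_of F E a") auto
    qed (rule e(2))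
  qed
  note c = c[unfolded l]
  have n: "x \<noteq> Und \<longleftrightarrow> x = In \<or> x = Out" for x by (cases x) auto
  have "E \<in> extensions \<sigma> F"
    unfolding extensions_iff[OF F]
  proof (intro conjI impI ballI)
    show "E \<in> complete_exts F" by (rule e)
    show "E \<union> defeated F E = args F" if "\<sigma> = ST"
      using that s(2) c n by blast
    fix T assume T: "T \<in> complete_exts F"
    note t = complete_ext_lab[OF F T]
    show "\<not> ((\<sigma> = PR \<or> \<sigma> = SST) \<and> E \<subset> T \<or> \<sigma> = SST \<and> E \<union> defeated F E \<subset> T \<union> defeated F T)"
      using s(3)[OF t(1)] better_sets[OF c(3,4) t(4,5), of l "labelling_of F T" \<sigma>] c(1,2) t(2,3)
      by blast
  qed
  then show "l \<in> labellings \<sigma> F" unfolding labellings_def using l by blast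
qed

section \<open>Instances over initial segments of the naturals\<close>

definition cf_index :: "semantics \<Rightarrow> nat \<Rightarrow> (nat \<Rightarrow> nat \<Rightarrow> bool) \<Rightarrow> nat \<Rightarrow> nat \<Rightarrow> (nat \<Rightarrow> label) \<Rightarrow> bool" where
  "cf_index \<sigma> N R g k l \<longleftrightarrow> g < N \<and> sem_lab \<sigma> {..<N} R l \<and>
     (\<exists>l'. sem_lab \<sigma> {..<N} R l' \<and> l g \<noteq> l' g \<and> card {i. i < N \<and> l i \<noteq> l' i} \<le> k)"

definition lab_start :: "nat \<Rightarrow> nat" where
  "lab_start N = N + 1 + N * N + N"

text \<open>The encoding as a function of the position. In this form it is arithmetic and can be
  printed by \<open>computable_I\<close>. Of the two bits of a label the first says in and the
  second says out.\<close>

definition code_bit :: "nat \<Rightarrow> (nat \<Rightarrow> nat \<Rightarrow> bool) \<Rightarrow> nat \<Rightarrow> (nat \<Rightarrow> label) \<Rightarrow> nat \<Rightarrow> bool" where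
  "code_bit N R g l i \<longleftrightarrow>
     (if i < N then True else if i < N + 1 then False
      else if i < N + 1 + N * N then R ((i - (N + 1)) div N) ((i - (N + 1)) mod N)
      else if i < lab_start N then i - (N + 1 + N * N) = g
      else l ((i - lab_start N) div 2) = (if even (i - lab_start N) then In else Out))"

definition instance_code :: "nat \<Rightarrow> (nat \<Rightarrow> nat \<Rightarrow> bool) \<Rightarrow> nat \<Rightarrow> nat \<Rightarrow> (nat \<Rightarrow> label) \<Rightarrow> bool list" where
  "instance_code N R g k l = map (code_bit N R g l) [0..<lab_start N + 2 * N] @ binary k"

lemma append_map_upt:
  "map f [0..<a] @ map g [0..<b] = map (\<lambda>i. if i < a then f i else g (i - a)) [0..<a + b]"
  by (rule nth_equalityI) (auto simp: nth_append)

lemma concat_map_upt: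
  "concat (map (\<lambda>a. map (f a) [0..<n]) [0..<m]) = map (\<lambda>i. f (i div n) (i mod n)) [0..<m * n]"
proof (induction m)
  case (Suc m)
  have "concat (map (\<lambda>a. map (f a) [0..<n]) [0..<Suc m]) =
      map (\<lambda>i. f (i div n) (i mod n)) [0..<m * n] @ map (f m) [0..<n]"
    by (simp add: Suc)
  also have "\<dots> = map (\<lambda>i. f (i div n) (i mod n)) [0..<m * n + n]"
    unfolding append_map_upt
  proof (rule map_cong)
    fix i assume "i \<in> set [0..<m * n + n]"
    then have "i < m * n + n" by simp
    moreover have "i div n = m \<and> i mod n = i - m * n" if "\<not> i < m * n"
    proof -
      define r where "r = i - m * n"
      have "i = m * n + r" "r < n" using that \<open>i < m * n + n\<close> by (auto simp: r_def)
      then show ?thesis by simp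
    qed
    ultimately show "(if i < m * n then f (i div n) (i mod n) else f m (i - m * n)) = f (i div n) (i mod n)"
      by simp
  qed simp
  finally show ?case by (simp add: add.commute)
qed simp

lemma encode_eq:
  assumes "g = xs ! gi" "gi < length xs" "distinct xs"
  shows "encode xs F g k L =
    instance_code (length xs) (\<lambda>i j. rel F (xs ! i) (xs ! j)) gi k (\<lambda>i. L (xs ! i))"
proof -
  let ?N = "length xs"
  let ?l = "\<lambda>i. L (xs ! i)"
  have "label_code x = map (\<lambda>j. x = (if even j then In else Out)) [0..<2]" for x
    by (cases x) (auto simp: numeral_2_eq_2)
  then have "concat (map (\<lambda>x. label_code (L x)) xs) =
      concat (map (\<lambda>i. map (\<lambda>j. ?l i = (if even j then In else Out)) [0..<2]) [0..<?N])"
    by (subst (1) map_nth[of xs, symmetric]) (simp only: map_map o_def)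
  also have "\<dots> = map (\<lambda>i. ?l (i div 2) = (if even i then In else Out)) [0..<?N * 2]"
    unfolding concat_map_upt by simp
  finally have 4: "concat (map (\<lambda>x. label_code (L x)) xs) =
      map (\<lambda>i. ?l (i div 2) = (if even i then In else Out)) [0..<?N * 2]" .
  have "concat (map (\<lambda>x. map (\<lambda>y. (x, y) \<in> attacks F) xs) xs) =
      concat (map (\<lambda>i. map (\<lambda>j. rel F (xs ! i) (xs ! j)) [0..<?N]) [0..<?N])"
    by (subst (1 2) map_nth[of xs, symmetric]) (simp only: map_map o_def rel_def)
  then have 2: "concat (map (\<lambda>x. map (\<lambda>y. (x, y) \<in> attacks F) xs) xs) =
      map (\<lambda>i. rel F (xs ! (i div ?N)) (xs ! (i mod ?N))) [0..<?N * ?N]"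
    unfolding concat_map_upt .
  have 3: "map (\<lambda>x. x = g) xs = map (\<lambda>i. i = gi) [0..<?N]"
    using assms by (auto intro!: nth_equalityI simp: nth_eq_iff_index_eq)
  have 1: "replicate ?N True @ [False] = map (\<lambda>i. i < ?N) [0..<?N + 1]"
    by (rule nth_equalityI) (auto simp: nth_append less_Suc_eq)
  have "encode xs F g k L = (((replicate ?N True @ [False]) @
      concat (map (\<lambda>x. map (\<lambda>y. (x, y) \<in> attacks F) xs) xs)) @ map (\<lambda>x. x = g) xs) @
      concat (map (\<lambda>x. label_code (L x)) xs) @ binary k"
    by (simp add: encode_def)
  also have "\<dots> = (((map (\<lambda>i. i < ?N) [0..<?N + 1]) @
      map (\<lambda>i. rel F (xs ! (i div ?N)) (xs ! (i mod ?N))) [0..<?N * ?N]) @ map (\<lambda>i. i = gi) [0..<?N]) @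
      map (\<lambda>i. ?l (i div 2) = (if even i then In else Out)) [0..<?N * 2] @ binary k"
    unfolding 1 2 3 4 ..
  also have "\<dots> = instance_code ?N (\<lambda>i j. rel F (xs ! i) (xs ! j)) gi k ?l"
    unfolding append_map_upt append_assoc[symmetric] instance_code_def append_same_eq
    by (rule map_cong) (auto simp: code_bit_def lab_start_def)
  finally show ?thesis .
qed

lemma cf_index_iff:
  assumes F: "is_af F" and xs: "distinct xs" "set xs = args F" and g: "gi < length xs"
    and L: "\<And>a. a \<notin> args F \<Longrightarrow> L a = Und"
  shows "L \<in> labellings \<sigma> F \<and> has_counterfactual \<sigma> F (xs ! gi) k L \<longleftrightarrow>
    cf_index \<sigma> (length xs) (\<lambda>i j. rel F (xs ! i) (xs ! j)) gi k (\<lambda>i. L (xs ! i))"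
proof -
  let ?N = "length xs"
  have bij: "bij_betw ((!) xs) {..<?N} (args F)"
    using xs by (simp add: bij_betw_nth)
  have sem: "sem_lab \<sigma> {..<?N} (\<lambda>i j. rel F (xs ! i) (xs ! j)) (\<lambda>i. L (xs ! i)) \<longleftrightarrow> L \<in> labellings \<sigma> F"
    if "\<And>a. a \<notin> args F \<Longrightarrow> L a = Und" for L
    using that sem_lab_transfer[OF bij, of \<sigma> "rel F" L] labellings_iff[OF F, of L \<sigma>] by blast
  have dist: "distance F L L' = card {i. i < ?N \<and> L (xs ! i) \<noteq> L' (xs ! i)}" for L'
  proof -
    have "{a \<in> args F. L a \<noteq> L' a} = (!) xs ` {i. i < ?N \<and> L (xs ! i) \<noteq> L' (xs ! i)}"
      using bij by (auto simp: bij_betw_def)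
    moreover have "inj_on ((!) xs) {i. i < ?N \<and> L (xs ! i) \<noteq> L' (xs ! i)}"
      using bij by (auto simp: bij_betw_def inj_on_def)
    ultimately show ?thesis by (simp add: distance_def card_image)
  qed
  have "(\<exists>L'\<in>labellings \<sigma> F. L (xs ! gi) \<noteq> L' (xs ! gi) \<and> distance F L L' \<le> k) \<longleftrightarrow>
    (\<exists>l'. sem_lab \<sigma> {..<?N} (\<lambda>i j. rel F (xs ! i) (xs ! j)) l' \<and> L (xs ! gi) \<noteq> l' gi \<and>
       card {i. i < ?N \<and> L (xs ! i) \<noteq> l' i} \<le> k)" (is "?A \<longleftrightarrow> ?B")
  proof
    assume ?A
    then obtain L' where L': "L' \<in> labellings \<sigma> F" "L (xs ! gi) \<noteq> L' (xs ! gi)" "distance F L L' \<le> k" by blast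
    then have "\<And>a. a \<notin> args F \<Longrightarrow> L' a = Und" using labellings_iff[OF F] by blast
    then have "sem_lab \<sigma> {..<?N} (\<lambda>i j. rel F (xs ! i) (xs ! j)) (\<lambda>i. L' (xs ! i))"
      using sem L'(1) by blast
    then show ?B using L'(2,3) dist[of L'] by auto
  next
    assume ?B
    then obtain l' where l': "sem_lab \<sigma> {..<?N} (\<lambda>i j. rel F (xs ! i) (xs ! j)) l'" "L (xs ! gi) \<noteq> l' gi"
      "card {i. i < ?N \<and> L (xs ! i) \<noteq> l' i} \<le> k" by blast
    define L' where "L' a = (if a \<in> args F then l' (inv_into {..<?N} ((!) xs) a) else Und)" for a
    have L'i: "L' (xs ! i) = l' i" if "i < ?N" for i
      using that bij xs by (auto simp: L'_def bij_betw_def inv_into_f_f)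
    have "sem_lab \<sigma> {..<?N} (\<lambda>i j. rel F (xs ! i) (xs ! j)) (\<lambda>i. L' (xs ! i))"
      using l'(1) L'i sem_lab_cong[of "{..<?N}" "\<lambda>i. L' (xs ! i)" l'] by auto
    then have "L' \<in> labellings \<sigma> F" using sem[of L'] by (simp add: L'_def)
    moreover have "{i. i < ?N \<and> L (xs ! i) \<noteq> L' (xs ! i)} = {i. i < ?N \<and> L (xs ! i) \<noteq> l' i}"
      using L'i by auto
    then have "distance F L L' \<le> k" using dist[of L'] l'(3) by simp
    ultimately show ?A using l'(2) L'i[OF g] by (intro bexI[of _ L']) simp_all
  qed
  then show ?thesis
    unfolding cf_index_def has_counterfactual_def using sem[of L, OF L] g by simp
qed

lemma instance_code_cong:
  assumes "\<And>a b. a < N \<Longrightarrow> b < N \<Longrightarrow> R a b = R' a b" "\<And>a. a < N \<Longrightarrow> l a = l' a"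
  shows "instance_code N R g k l = instance_code N R' g k l'"
proof -
  have "code_bit N R g l i = code_bit N R' g l' i" if "i < lab_start N + 2 * N" for i
  proof -
    consider "i < N + 1" | "\<not> i < N + 1" "i < N + 1 + N * N" | "N + 1 + N * N \<le> i" by linarith
    then show ?thesis
    proof cases
      case 2
      then have "i - (N + 1) < N * N" by linarith
      moreover from this have "0 < N" by (cases N) auto
      ultimately have "(i - (N + 1)) div N < N" "(i - (N + 1)) mod N < N"
        by (auto simp: less_mult_imp_div_less)
      with 2 show ?thesis by (simp add: code_bit_def assms(1))
    next
      case 3
      then have "(i - lab_start N) div 2 < N" if "lab_start N \<le> i"
        using that \<open>i < lab_start N + 2 * N\<close> by linarith
      with 3 show ?thesis by (auto simp: code_bit_def assms(2))
    qed (simp add: code_bit_def)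
  qed
  then show ?thesis by (simp add: instance_code_def)
qed

lemma cf_index_cong:
  assumes "\<And>a b. a < N \<Longrightarrow> b < N \<Longrightarrow> R a b = R' a b" "\<And>a. a < N \<Longrightarrow> l a = l' a"
  shows "cf_index \<sigma> N R g k l \<longleftrightarrow> cf_index \<sigma> N R' g k l'"
proof -
  have "sem_lab \<sigma> {..<N} R m \<longleftrightarrow> sem_lab \<sigma> {..<N} R' m" for m
    using assms(1) by (intro sem_lab_cong) auto
  moreover have "sem_lab \<sigma> {..<N} R l \<longleftrightarrow> sem_lab \<sigma> {..<N} R l'"
    using assms(2) by (intro sem_lab_cong) auto
  moreover have "{i. i < N \<and> l i \<noteq> m i} = {i. i < N \<and> l' i \<noteq> m i}" for m
    using assms(2) by auto
  ultimately show ?thesis unfolding cf_index_def by (auto simp: assms(2))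
qed

lemma CF_EX_eq: "CF_EX \<sigma> = {instance_code N R g k l | N R g k l. cf_index \<sigma> N R g k l}"
proof (intro set_eqI iffI)
  fix x assume "x \<in> CF_EX \<sigma>"
  then obtain xs F g k L where x: "x = encode (xs :: nat list) F g k L" "is_af F" "distinct xs" "set xs = args F"
    "g \<in> args F" "L \<in> labellings \<sigma> F" "has_counterfactual \<sigma> F g k L"
    unfolding CF_EX_def by blast
  then obtain gi where g: "gi < length xs" "g = xs ! gi" by (metis in_set_conv_nth)
  have "\<And>a. a \<notin> args F \<Longrightarrow> L a = Und" using x(2,6) labellings_iff by blast
  then have "cf_index \<sigma> (length xs) (\<lambda>i j. rel F (xs ! i) (xs ! j)) gi k (\<lambda>i. L (xs ! i))"
    using cf_index_iff[of F xs gi L \<sigma> k] x g by blast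
  then show "x \<in> {instance_code N R g k l | N R g k l. cf_index \<sigma> N R g k l}"
    unfolding x(1) encode_eq[OF g(2,1) x(3)] by blast
next
  fix x assume "x \<in> {instance_code N R g k l | N R g k l. cf_index \<sigma> N R g k l}"
  then obtain N R g k l where x: "x = instance_code N R g k l" "cf_index \<sigma> N R g k l" by blast
  define F where "F = \<lparr>args = {..<N}, attacks = {(a, b). a < N \<and> b < N \<and> R a b}\<rparr>"
  define L where "L a = (if a < N then l a else Und)" for a
  have g: "g < length [0..<N]" using x(2) by (simp add: cf_index_def)
  have F: "is_af F" by (auto simp: is_af_def F_def)
  have c: "\<And>a b. a < N \<Longrightarrow> b < N \<Longrightarrow> R a b = rel F ([0..<N] ! a) ([0..<N] ! b)"
    "\<And>a. a < N \<Longrightarrow> l a = L ([0..<N] ! a)" by (auto simp: rel_def F_def L_def)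
  have "L \<in> labellings \<sigma> F \<and> has_counterfactual \<sigma> F ([0..<N] ! g) k L"
  proof (subst cf_index_iff[OF F _ _ g])
    show "cf_index \<sigma> (length [0..<N]) (\<lambda>i j. rel F ([0..<N] ! i) ([0..<N] ! j)) g k (\<lambda>i. L ([0..<N] ! i))"
      using x(2) cf_index_cong[of N R "\<lambda>i j. rel F ([0..<N] ! i) ([0..<N] ! j)" l "\<lambda>i. L ([0..<N] ! i)" \<sigma> g k] c
      by simp
  qed (auto simp: F_def L_def)
  moreover have "x = encode [0..<N] F ([0..<N] ! g) k L"
    using encode_eq[OF refl g] x(1) c
      instance_code_cong[of N R "\<lambda>i j. rel F ([0..<N] ! i) ([0..<N] ! j)" l "\<lambda>i. L ([0..<N] ! i)" g k]
    by simp
  moreover have "distinct [0..<N]" "set [0..<N] = args F" "[0..<N] ! g \<in> args F" using g by (auto simp: F_def)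
  ultimately show "x \<in> CF_EX \<sigma>" unfolding CF_EX_def using F by blast
qed

section \<open>Binary numbers and the recognition of well-formed codes\<close>

fun binary_value :: "bool list \<Rightarrow> nat" where
  "binary_value [] = 0"
| "binary_value (b # bs) = of_bool b + 2 * binary_value bs"

lemma binary_value_binary: "binary_value (binary k) = k"
proof (induction k rule: binary.induct)
  case (1 k)
  show ?case
  proof (cases "k = 0")
    case False
    then show ?thesis using 1 by (subst binary.simps) (simp add: mod_2_eq_odd[symmetric])
  qed (simp add: binary.simps)
qed

lemma binary_last: "binary k \<noteq> [] \<Longrightarrow> last (binary k)"
proof (induction k rule: binary.induct)
  case (1 k)
  then have "k \<noteq> 0" by (metis binary.simps)
  with 1 have "binary (k div 2) \<noteq> [] \<longrightarrow> last (binary (k div 2))" by blast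
  moreover have "binary k = odd k # binary (k div 2)" using \<open>k \<noteq> 0\<close> by (subst binary.simps) simp
  moreover have "odd k" if "binary (k div 2) = []"
    using binary_value_binary[of "k div 2"] that \<open>k \<noteq> 0\<close> by (auto simp: odd_iff_mod_2_eq_one)
  ultimately show ?case by auto
qed

lemma binary_binary_value: "bs = [] \<or> last bs \<Longrightarrow> binary (binary_value bs) = bs"
proof (induction bs)
  case (Cons b bs)
  have pos: "binary_value cs \<noteq> 0" if "cs \<noteq> []" "last cs" for cs
    using that by (induction cs) (auto split: if_splits)
  have "binary_value (b # bs) \<noteq> 0" using pos[of "b # bs"] Cons.prems by simp
  then have "binary (binary_value (b # bs)) = odd (binary_value (b # bs)) # binary (binary_value (b # bs) div 2)"
    by (subst binary.simps) (simp del: binary_value.simps)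
  also have "\<dots> = b # binary (binary_value bs)" by auto
  also have "binary (binary_value bs) = bs" using Cons by (auto split: if_splits)
  finally show ?case .
qed (simp add: binary.simps)

definition att_at :: "bool list \<Rightarrow> nat \<Rightarrow> nat \<Rightarrow> nat \<Rightarrow> bool" where
  "att_at z N a b \<longleftrightarrow> bit_at z (N + 1 + a * N + b)"

definition lab_at :: "bool list \<Rightarrow> nat \<Rightarrow> nat \<Rightarrow> label" where
  "lab_at z s a = (if bit_at z (s + 2 * a) then In else if bit_at z (s + 2 * a + 1) then Out else Und)"

text \<open>The length \<open>h\<close> is a separate parameter because the code may be followed by
  certificates. The last condition forbids leading zeros: a nonempty binary part has to end in its
  most significant 1.\<close>

definition wf_code :: "bool list \<Rightarrow> nat \<Rightarrow> nat \<Rightarrow> nat \<Rightarrow> bool" where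
  "wf_code z h N g \<longleftrightarrow> lab_start N + 2 * N \<le> h \<and> (\<forall>i<N. bit_at z i) \<and> \<not> bit_at z N \<and> g < N \<and>
     (\<forall>i<N. bit_at z (N + 1 + N * N + i) \<longleftrightarrow> i = g) \<and>
     (\<forall>a<N. bit_at z (lab_start N + 2 * a) \<longrightarrow> \<not> bit_at z (lab_start N + 2 * a + 1)) \<and>
     (lab_start N + 2 * N < h \<longrightarrow> bit_at z (h - 1))"

lemma square_index: "a < N \<Longrightarrow> b < N \<Longrightarrow> a * N + b < N * (N :: nat)"
proof -
  assume "a < N" "b < N"
  then have "a * N + b < a * N + N" by simp
  also have "\<dots> = Suc a * N" by simp
  also have "\<dots> \<le> N * N" using \<open>a < N\<close> by (intro mult_le_mono1) simp
  finally show ?thesis .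
qed

lemma instance_code_bits:
  fixes R :: "nat \<Rightarrow> nat \<Rightarrow> bool" and l :: "nat \<Rightarrow> label" and N g k :: nat
  defines "z \<equiv> instance_code N R g k l"
  assumes "g < N"
  shows "a < N \<Longrightarrow> b < N \<Longrightarrow> att_at z N a b = R a b" and "a < N \<Longrightarrow> lab_at z (lab_start N) a = l a"
    and "binary_value (drop (lab_start N + 2 * N) z) = k" and "wf_code z (length z) N g"
proof -
  have b: "bit_at z i = code_bit N R g l i" if "i < lab_start N + 2 * N" for i
    using that by (simp add: z_def instance_code_def bit_at_def nth_append)
  have d: "drop (lab_start N + 2 * N) z = binary k" by (simp add: z_def instance_code_def)
  then show "binary_value (drop (lab_start N + 2 * N) z) = k" by (simp add: binary_value_binary)
  show "att_at z N a b = R a b" if "a < N" "b < N"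
    using square_index[OF that] that b[of "N + 1 + a * N + b"]
    by (simp add: att_at_def code_bit_def lab_start_def add.assoc)
  have lb: "bit_at z (lab_start N + i) \<longleftrightarrow> l (i div 2) = (if even i then In else Out)" if "i < 2 * N" for i
    using b[of "lab_start N + i"] that by (simp add: code_bit_def lab_start_def)
  show "lab_at z (lab_start N) a = l a" if "a < N"
    using lb[of "2 * a"] lb[of "2 * a + 1"] that by (cases "l a") (auto simp: lab_at_def add.assoc)
  have len: "length z = lab_start N + 2 * N + length (binary k)" by (simp add: z_def instance_code_def)
  show "wf_code z (length z) N g"
    unfolding wf_code_def
  proof (intro conjI allI impI)
    show "lab_start N + 2 * N \<le> length z" by (simp add: len)
    show "bit_at z i" if "i < N" for i
      using b[of i] that by (simp add: code_bit_def lab_start_def)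
    show "\<not> bit_at z N" using b[of N] assms(2) by (simp add: code_bit_def lab_start_def)
    show "g < N" by fact
    show "bit_at z (N + 1 + N * N + i) = (i = g)" if "i < N" for i
      using b[of "N + 1 + N * N + i"] that by (simp add: code_bit_def lab_start_def)
    show "\<not> bit_at z (lab_start N + 2 * a + 1)" if "a < N" "bit_at z (lab_start N + 2 * a)" for a
      using lb[of "2 * a"] lb[of "2 * a + 1"] that by (simp add: add.assoc)
    assume "lab_start N + 2 * N < length z"
    then have "binary k \<noteq> []" using len by auto
    then have "last z" using binary_last[of k] by (simp add: z_def instance_code_def)
    moreover have "z \<noteq> []" using \<open>lab_start N + 2 * N < length z\<close> by auto
    ultimately show "bit_at z (length z - 1)" by (simp add: bit_at_def last_conv_nth)
  qed
qed

lemma wf_code_eq: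
  assumes "wf_code x (length x) N g"
  shows "x = instance_code N (att_at x N) g (binary_value (drop (lab_start N + 2 * N) x)) (lab_at x (lab_start N))"
proof -
  let ?m = "lab_start N + 2 * N"
  have w1: "?m \<le> length x" and w2: "\<And>i. i < N \<Longrightarrow> bit_at x i" and w3: "\<not> bit_at x N"
    and w4: "\<And>i. i < N \<Longrightarrow> bit_at x (N + 1 + N * N + i) \<longleftrightarrow> i = g"
    and w5: "\<And>a. a < N \<Longrightarrow> bit_at x (lab_start N + 2 * a) \<Longrightarrow> \<not> bit_at x (lab_start N + 2 * a + 1)"
    and w6: "?m < length x \<Longrightarrow> bit_at x (length x - 1)"
    using assms unfolding wf_code_def by blast+
  have "drop ?m x = [] \<or> last (drop ?m x)"
  proof (cases "?m < length x")
    case True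
    then have "x \<noteq> []" by auto
    with True show ?thesis using w6 by (simp add: bit_at_def last_conv_nth)
  qed simp
  then have "binary (binary_value (drop ?m x)) = drop ?m x" by (rule binary_binary_value)
  moreover have "take ?m x = map (code_bit N (att_at x N) g (lab_at x (lab_start N))) [0..<?m]"
  proof (rule nth_equalityI)
    show "length (take ?m x) = length (map (code_bit N (att_at x N) g (lab_at x (lab_start N))) [0..<?m])"
      using w1 by simp
    fix i assume "i < length (take ?m x)"
    then have i: "i < ?m" "i < length x" using w1 by auto
    have "code_bit N (att_at x N) g (lab_at x (lab_start N)) i = bit_at x i"
    proof -
      consider "i < N" | "i = N" | "N + 1 \<le> i" "i < N + 1 + N * N" | "N + 1 + N * N \<le> i" "i < lab_start N"
        | "lab_start N \<le> i" by linarith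
      then show ?thesis
      proof cases
        case 3
        then have "N + 1 + (i - (N + 1)) div N * N + (i - (N + 1)) mod N = i" by simp
        then show ?thesis using 3 by (simp add: code_bit_def att_at_def)
      next
        case 4
        then have "N + 1 + N * N + (i - (N + 1 + N * N)) = i" "i - (N + 1 + N * N) < N"
          by (auto simp: lab_start_def)
        then show ?thesis using 4 w4[of "i - (N + 1 + N * N)"] by (simp add: code_bit_def)
      next
        case 5
        define j where "j = i - lab_start N"
        have j: "i = lab_start N + j" "j div 2 < N" using 5 i by (auto simp: j_def)
        have "\<not> i < N" "\<not> i < N + 1" "\<not> i < N + 1 + N * N" using 5 by (auto simp: lab_start_def)
        then have "code_bit N (att_at x N) g (lab_at x (lab_start N)) i \<longleftrightarrow>
            lab_at x (lab_start N) (j div 2) = (if even j then In else Out)"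
          using 5 by (simp add: code_bit_def j_def)
        also have "\<dots> \<longleftrightarrow> bit_at x i"
        proof (cases "even j")
          case True
          then show ?thesis using j by (simp add: lab_at_def)
        next
          case False
          then have "2 * (j div 2) + 1 = j" by simp
          then have e: "lab_start N + 2 * (j div 2) + 1 = i" using j by simp
          have "bit_at x (lab_start N + 2 * (j div 2)) \<longrightarrow> \<not> bit_at x i"
            using w5[OF j(2)] e by simp
          then show ?thesis using False e by (simp add: lab_at_def)
        qed
        finally show ?thesis .
      qed (simp_all add: code_bit_def w2 w3)
    qed
    then show "take ?m x ! i = map (code_bit N (att_at x N) g (lab_at x (lab_start N))) [0..<?m] ! i"
      using i by (simp add: bit_at_def)
  qed
  ultimately show ?thesis unfolding instance_code_def by (metis append_take_drop_id)
qed

text \<open>The code determines the instance on its arguments: \<open>N\<close> is the position of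
  the first 0, and all other components are then read from fixed positions.\<close>

lemma CF_EX_code: "g < N \<Longrightarrow> instance_code N R g k l \<in> CF_EX \<sigma> \<longleftrightarrow> cf_index \<sigma> N R g k l"
proof
  assume g: "g < N" and "instance_code N R g k l \<in> CF_EX \<sigma>"
  then obtain N' R' g' k' l' where e: "instance_code N R g k l = instance_code N' R' g' k' l'"
    and c: "cf_index \<sigma> N' R' g' k' l'" unfolding CF_EX_eq by blast
  then have g': "g' < N'" by (simp add: cf_index_def)
  note b = instance_code_bits[OF g, where R = R and k = k and l = l] and b' = instance_code_bits[OF g', where R = R' and k = k' and l = l', folded e]
  have N: "N' = N" using b(4) b'(4) unfolding wf_code_def by (metis linorder_neqE_nat)
  have "g' = g" using b(4) b'(4) g unfolding wf_code_def N by blast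
  moreover have "R' a c = R a c" if "a < N" "c < N" for a c using b(1) b'(1) that N by metis
  moreover have "l' a = l a" if "a < N" for a using b(2) b'(2) that N by metis
  moreover have "k' = k" using b(3) b'(3) N by metis
  ultimately show "cf_index \<sigma> N R g k l" using c cf_index_cong[of N R' R l' l] N by metis
qed (unfold CF_EX_eq, blast)

lemma CF_EX_wf:
  "x \<in> CF_EX \<sigma> \<longleftrightarrow> (\<exists>N g. wf_code x (length x) N g \<and>
     cf_index \<sigma> N (att_at x N) g (binary_value (drop (lab_start N + 2 * N) x)) (lab_at x (lab_start N)))"
proof
  assume "x \<in> CF_EX \<sigma>"
  then obtain N R g k l where x: "x = instance_code N R g k l" "cf_index \<sigma> N R g k l"
    unfolding CF_EX_eq by blast
  then have g: "g < N" by (simp add: cf_index_def)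
  note b = instance_code_bits[OF g, where R = R and k = k and l = l, folded x(1)]
  have "cf_index \<sigma> N (att_at x N) g (binary_value (drop (lab_start N + 2 * N) x)) (lab_at x (lab_start N))"
    using x(2) b(3) cf_index_cong[of N "att_at x N" R "lab_at x (lab_start N)" l] b(1,2) by metis
  then show "\<exists>N g. wf_code x (length x) N g \<and>
     cf_index \<sigma> N (att_at x N) g (binary_value (drop (lab_start N + 2 * N) x)) (lab_at x (lab_start N))"
    using b(4) by blast
next
  assume "\<exists>N g. wf_code x (length x) N g \<and>
     cf_index \<sigma> N (att_at x N) g (binary_value (drop (lab_start N + 2 * N) x)) (lab_at x (lab_start N))"
  then show "x \<in> CF_EX \<sigma>" using wf_code_eq unfolding CF_EX_eq by blast
qed

section \<open>Membership\<close>

lemma polypred_att_at: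
  "polyfun N \<Longrightarrow> polyfun a \<Longrightarrow> polyfun b \<Longrightarrow> polypred (\<lambda>z e. att_at z (N z e) (a z e) (b z e))"
  unfolding att_at_def by (intro polyfun_intros)

lemma polyfun_lab_start: "polyfun N \<Longrightarrow> polyfun (\<lambda>z e. lab_start (N z e))"
  unfolding lab_start_def by (intro polyfun_intros)

lemma polypred_lab_In: "polyfun s \<Longrightarrow> polyfun a \<Longrightarrow> polypred (\<lambda>z e. lab_at z (s z e) (a z e) = In)"
proof (rule polypred_cong)
  show "bit_at z (s z e + 2 * a z e) = (lab_at z (s z e) (a z e) = In)" for z e
    by (simp add: lab_at_def)
qed (intro polyfun_intros)

lemma polypred_lab_Out: "polyfun s \<Longrightarrow> polyfun a \<Longrightarrow> polypred (\<lambda>z e. lab_at z (s z e) (a z e) = Out)"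
proof (rule polypred_cong)
  show "(\<not> bit_at z (s z e + 2 * a z e) \<and> bit_at z (s z e + 2 * a z e + 1)) = (lab_at z (s z e) (a z e) = Out)"
    for z e by (simp add: lab_at_def)
qed (intro polyfun_intros)

lemma label_eq_iff: "x = y \<longleftrightarrow> (x = In \<longleftrightarrow> y = In) \<and> (x = Out \<longleftrightarrow> y = Out)" for x y :: label
  by (cases x; cases y) auto

lemma polypred_lab_Und: "polyfun s \<Longrightarrow> polyfun a \<Longrightarrow> polypred (\<lambda>z e. lab_at z (s z e) (a z e) = Und)"
  by (subst label_eq_iff) (simp, intro polyfun_intros polypred_lab_In polypred_lab_Out)

lemma polypred_lab_eq:
  "polyfun s \<Longrightarrow> polyfun a \<Longrightarrow> polyfun t \<Longrightarrow> polyfun b \<Longrightarrow>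
   polypred (\<lambda>z e. lab_at z (s z e) (a z e) = lab_at z (t z e) (b z e))"
  by (subst label_eq_iff) (intro polyfun_intros polypred_lab_In polypred_lab_Out)

lemmas lab_intros = polypred_att_at polyfun_lab_start polypred_lab_In polypred_lab_Out polypred_lab_Und
  polypred_lab_eq

definition complete_at :: "bool list \<Rightarrow> nat \<Rightarrow> nat \<Rightarrow> bool" where
  "complete_at z N s \<longleftrightarrow> (\<forall>a<N. (lab_at z s a = In \<longleftrightarrow> (\<forall>b<N. att_at z N b a \<longrightarrow> lab_at z s b = Out)) \<and>
     (lab_at z s a = Out \<longleftrightarrow> (\<exists>b<N. att_at z N b a \<and> lab_at z s b = In)))"

definition better_at :: "semantics \<Rightarrow> bool list \<Rightarrow> nat \<Rightarrow> nat \<Rightarrow> nat \<Rightarrow> bool" where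
  "better_at \<sigma> z N s t \<longleftrightarrow>
     (\<sigma> = PR \<or> \<sigma> = SST) \<and> (\<forall>a<N. lab_at z s a = In \<longrightarrow> lab_at z t a = In) \<and>
       (\<exists>a<N. lab_at z t a = In \<and> lab_at z s a \<noteq> In) \<or>
     \<sigma> = SST \<and> (\<forall>a<N. lab_at z s a \<noteq> Und \<longrightarrow> lab_at z t a \<noteq> Und) \<and>
       (\<exists>a<N. lab_at z t a \<noteq> Und \<and> lab_at z s a = Und)"

lemma complete_at_iff: "complete_at z N s \<longleftrightarrow> complete_lab {..<N} (att_at z N) (lab_at z s)"
  by (simp add: complete_at_def complete_lab_def Ball_def Bex_def)

lemma better_at_iff: "better_at \<sigma> z N s t \<longleftrightarrow> better \<sigma> {..<N} (lab_at z s) (lab_at z t)"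
  by (simp add: better_at_def better_def Ball_def Bex_def)

text \<open>Horner's scheme from the most significant bit on, capped at N so that the values stay small.\<close>

definition capped_value :: "bool list \<Rightarrow> nat \<Rightarrow> nat \<Rightarrow> nat \<Rightarrow> nat" where
  "capped_value z N s m = rec_nat 0 (\<lambda>i a. if N \<le> 2 * a + of_bool (bit_at z (s + m - 1 - i)) then N
     else 2 * a + of_bool (bit_at z (s + m - 1 - i))) m"

text \<open>Capping commutes with Horner's step: once a value has reached \<open>N\<close>, doubling
  keeps it there.\<close>

lemma capped_value_eq:
  assumes "s + m = length x" and z: "\<And>i. i < length x \<Longrightarrow> bit_at z i = bit_at x i"
  shows "capped_value z N s m = min N (binary_value (drop s x))"
proof -
  have ind: "rec_nat 0 (\<lambda>i a. if N \<le> 2 * a + of_bool (bit_at z (s + m - 1 - i)) then N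
      else 2 * a + of_bool (bit_at z (s + m - 1 - i))) i = min N (binary_value (drop (length x - i) x))"
    if "i \<le> m" for i
    using that
  proof (induction i)
    case (Suc i)
    define j where "j = length x - Suc i"
    have j: "j < length x" "length x - i = Suc j" "s + m - 1 - i = j" using Suc.prems assms by (auto simp: j_def)
    have "drop j x = x ! j # drop (Suc j) x" using j by (simp add: Cons_nth_drop_Suc)
    then have *: "binary_value (drop j x) = of_bool (bit_at z j) + 2 * binary_value (drop (Suc j) x)"
      using j z[OF j(1)] by (simp add: bit_at_def)
    show ?case
      using Suc j unfolding j_def[symmetric] * by (simp add: min_def)
  qed simp
  have "length x - m = s" using assms(1) by simp
  with ind[OF order_refl] show ?thesis unfolding capped_value_def by (simp only:)
qed

lemma polyfun_capped_value:
  assumes "polyfun N" "polyfun s" "polyfun m"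
  shows "polyfun (\<lambda>z e. capped_value z (N z e) (s z e) (m z e))"
proof -
  let ?g = "\<lambda>i a z e. if N z e \<le> 2 * a + of_bool (bit_at z (s z e + m z e - 1 - i)) then N z e
     else 2 * a + of_bool (bit_at z (s z e + m z e - 1 - i))"
  have "polyfun (\<lambda>z e. rec_nat 0 (\<lambda>i a. ?g i a z e) (m z e))"
  proof (rule polyfun_rec_le[OF assms(3) polyfun_const _ polyfun_bounded[OF assms(1)]])
    show "polyfun (\<lambda>z e. ?g (e 0) (e (Suc 0)) z (\<lambda>i. e (Suc (Suc i))))"
      by (intro polyfun_intros polyfun_rename[OF assms(1)] polyfun_rename[OF assms(2)]
          polyfun_rename[OF assms(3)])
    show "rec_nat 0 (\<lambda>i a. ?g i a z e) k \<le> N z e" for z e k by (cases k) auto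
  qed
  then show ?thesis unfolding capped_value_def .
qed

text \<open>The word is meant to be \<open>x @ y\<close> with both halves of length
  \<open>h\<close>, so the guessed labelling starts at position \<open>h\<close>. The searches for
  \<open>h\<close>, \<open>N\<close> and \<open>g\<close> are bounded and thus stay within
  \<open>polypred\<close>.\<close>

definition guess_check :: "semantics \<Rightarrow> bool list \<Rightarrow> bool" where
  "guess_check \<sigma> z \<longleftrightarrow> (\<exists>h<Suc (length z). 2 * h = length z \<and> (\<exists>N<h. \<exists>g<N. wf_code z h N g \<and>
     complete_at z N (lab_start N) \<and> complete_at z N h \<and>
     (\<sigma> = ST \<longrightarrow> (\<forall>a<N. lab_at z (lab_start N) a \<noteq> Und \<and> lab_at z h a \<noteq> Und)) \<and>
     lab_at z (lab_start N) g \<noteq> lab_at z h g \<and>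
     card {i. i < N \<and> lab_at z (lab_start N) i \<noteq> lab_at z h i} \<le>
       capped_value z N (lab_start N + 2 * N) (h - (lab_start N + 2 * N))))"

text \<open>Here the word is meant to be \<open>(x @ y) @ u\<close> with \<open>u\<close> as long as
  \<open>x @ y\<close>, so the competitor starts at \<open>2 * h\<close>. It may beat the labelling
  given in \<open>x\<close> or the one guessed in \<open>y\<close>. Only what determines
  \<open>N\<close> is checked about \<open>x\<close>; the rest is the task of
  \<open>guess_check\<close>.\<close>

definition improvable :: "semantics \<Rightarrow> bool list \<Rightarrow> bool" where
  "improvable \<sigma> z \<longleftrightarrow> (\<exists>h<Suc (length z). 4 * h = length z \<and> (\<exists>N<h. lab_start N + 2 * N \<le> h \<and>
     (\<forall>i<N. bit_at z i) \<and> \<not> bit_at z N \<and> complete_at z N (2 * h) \<and>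
     (better_at \<sigma> z N (lab_start N) (2 * h) \<or> better_at \<sigma> z N h (2 * h))))"

lemma polypred_wf_code:
  assumes "polyfun h" "polyfun N" "polyfun g"
  shows "polypred (\<lambda>z e. wf_code z (h z e) (N z e) (g z e))"
  unfolding wf_code_def
  by (intro polyfun_intros lab_intros assms[THEN polyfun_rename])

lemma polypred_complete_at:
  assumes "polyfun N" "polyfun s"
  shows "polypred (\<lambda>z e. complete_at z (N z e) (s z e))"
  unfolding complete_at_def
  by (intro polyfun_intros lab_intros assms[THEN polyfun_rename])

lemma polypred_better_at:
  assumes "polyfun N" "polyfun s" "polyfun t"
  shows "polypred (\<lambda>z e. better_at \<sigma> z (N z e) (s z e) (t z e))"
  unfolding better_at_def
  by (intro polyfun_intros lab_intros assms[THEN polyfun_rename])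

lemma polypred_guess_check: "polypred (\<lambda>z e. guess_check \<sigma> z)"
  unfolding guess_check_def
  by (intro polyfun_intros lab_intros polypred_wf_code polypred_complete_at polyfun_capped_value)

lemma polypred_improvable: "polypred (\<lambda>z e. improvable \<sigma> z)"
  unfolding improvable_def
  by (intro polyfun_intros lab_intros polypred_complete_at polypred_better_at)

lemma bit_at_append [simp]:
  "i < length x \<Longrightarrow> bit_at (x @ y) i = bit_at x i" "bit_at (x @ y) (length x + i) = bit_at y i"
  by (auto simp: bit_at_def nth_append)

lemma lab_start_bound: "lab_start N + 2 * N \<le> h \<Longrightarrow> N < h"
  by (simp add: lab_start_def)

lemma att_at_append:
  assumes "lab_start N + 2 * N \<le> length x" "a < N" "b < N"
  shows "att_at (x @ y) N a b = att_at x N a b"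
  unfolding att_at_def using square_index[OF assms(2,3)] assms(1)
  by (intro bit_at_append) (simp add: lab_start_def)

lemma lab_at_append1: "s + 2 * a + 1 < length x \<Longrightarrow> lab_at (x @ y) s a = lab_at x s a"
  by (simp add: lab_at_def)

lemma lab_at_append2: "lab_at (x @ y) (length x) a = lab_at y 0 a"
  using bit_at_append(2)[of x y "2 * a"] bit_at_append(2)[of x y "2 * a + 1"]
  by (simp add: lab_at_def add.assoc)

lemma wf_code_append: "wf_code (x @ y) (length x) N g \<longleftrightarrow> wf_code x (length x) N g"
proof (cases "lab_start N + 2 * N \<le> length x")
  case True
  then have b: "bit_at (x @ y) i = bit_at x i" if "i < lab_start N + 2 * N" for i
    using that by simp
  have "bit_at (x @ y) i = bit_at x i" "bit_at (x @ y) N = bit_at x N"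
    "bit_at (x @ y) (N + 1 + N * N + i) = bit_at x (N + 1 + N * N + i)"
    "bit_at (x @ y) (lab_start N + 2 * i) = bit_at x (lab_start N + 2 * i)"
    "bit_at (x @ y) (lab_start N + 2 * i + 1) = bit_at x (lab_start N + 2 * i + 1)" if "i < N" for i
    using that by (intro b; simp add: lab_start_def)+
  moreover have "bit_at (x @ y) N = bit_at x N" by (rule b) (simp add: lab_start_def)
  moreover have "bit_at (x @ y) (length x - 1) = bit_at x (length x - 1)"
    using True by (intro bit_at_append) (simp add: lab_start_def)
  ultimately show ?thesis unfolding wf_code_def by (simp del: bit_at_append cong: imp_cong)
next
  case False
  then show ?thesis by (simp add: wf_code_def)
qed

lemma complete_at_append:
  assumes "lab_start N + 2 * N \<le> length x" "\<And>a. a < N \<Longrightarrow> lab_at (x @ y) s a = l a"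
  shows "complete_at (x @ y) N s \<longleftrightarrow> complete_lab {..<N} (att_at x N) l"
  unfolding complete_at_iff using att_at_append[OF assms(1)] assms(2)
  by (intro complete_lab_cong) auto

lemma better_at_eq:
  assumes "\<And>a. a < N \<Longrightarrow> lab_at z s a = l a" "\<And>a. a < N \<Longrightarrow> lab_at z t a = m a"
  shows "better_at \<sigma> z N s t \<longleftrightarrow> better \<sigma> {..<N} l m"
  unfolding better_at_iff using assms by (intro better_cong) auto

lemma wf_codeD: "wf_code x h N g \<Longrightarrow> lab_start N + 2 * N \<le> h" "wf_code x h N g \<Longrightarrow> g < N"
  by (auto simp: wf_code_def)

lemma ex_quotient: "0 < k \<Longrightarrow> m = k * n \<Longrightarrow> (\<exists>h<Suc m. k * h = m \<and> P h) \<longleftrightarrow> P (n :: nat)"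
  by (auto simp: less_Suc_eq_le)

lemma guess_check_iff:
  assumes "length y = length x"
  shows "guess_check \<sigma> (x @ y) \<longleftrightarrow> (\<exists>N g. wf_code x (length x) N g \<and>
    complete_lab {..<N} (att_at x N) (lab_at x (lab_start N)) \<and>
    complete_lab {..<N} (att_at x N) (lab_at y 0) \<and>
    (\<sigma> = ST \<longrightarrow> (\<forall>a<N. lab_at x (lab_start N) a \<noteq> Und \<and> lab_at y 0 a \<noteq> Und)) \<and>
    lab_at x (lab_start N) g \<noteq> lab_at y 0 g \<and>
    card {i. i < N \<and> lab_at x (lab_start N) i \<noteq> lab_at y 0 i} \<le> binary_value (drop (lab_start N + 2 * N) x))"
proof -
  let ?C = "\<lambda>h N g. wf_code (x @ y) h N g \<and>
     complete_at (x @ y) N (lab_start N) \<and> complete_at (x @ y) N h \<and>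
     (\<sigma> = ST \<longrightarrow> (\<forall>a<N. lab_at (x @ y) (lab_start N) a \<noteq> Und \<and> lab_at (x @ y) h a \<noteq> Und)) \<and>
     lab_at (x @ y) (lab_start N) g \<noteq> lab_at (x @ y) h g \<and>
     card {i. i < N \<and> lab_at (x @ y) (lab_start N) i \<noteq> lab_at (x @ y) h i} \<le>
       capped_value (x @ y) N (lab_start N + 2 * N) (h - (lab_start N + 2 * N))"
  have "guess_check \<sigma> (x @ y) \<longleftrightarrow> (\<exists>N<length x. \<exists>g<N. ?C (length x) N g)"
    unfolding guess_check_def by (rule ex_quotient) (simp_all add: assms)
  also have "\<dots> \<longleftrightarrow> (\<exists>N g. ?C (length x) N g)"
    using wf_codeD lab_start_bound by meson
  finally have ex: "guess_check \<sigma> (x @ y) \<longleftrightarrow> (\<exists>N g. ?C (length x) N g)" .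
  have eq: "?C (length x) N g \<longleftrightarrow> wf_code x (length x) N g \<and>
    complete_lab {..<N} (att_at x N) (lab_at x (lab_start N)) \<and>
    complete_lab {..<N} (att_at x N) (lab_at y 0) \<and>
    (\<sigma> = ST \<longrightarrow> (\<forall>a<N. lab_at x (lab_start N) a \<noteq> Und \<and> lab_at y 0 a \<noteq> Und)) \<and>
    lab_at x (lab_start N) g \<noteq> lab_at y 0 g \<and>
    card {i. i < N \<and> lab_at x (lab_start N) i \<noteq> lab_at y 0 i} \<le> binary_value (drop (lab_start N + 2 * N) x)" for N g
  proof (cases "wf_code x (length x) N g")
    case True
    note w = wf_codeD[OF True]
    have l: "lab_at (x @ y) (lab_start N) a = lab_at x (lab_start N) a" if "a < N" for a
      using w(1) that by (intro lab_at_append1) simp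
    have "{i. i < N \<and> lab_at (x @ y) (lab_start N) i \<noteq> lab_at (x @ y) (length x) i} =
        {i. i < N \<and> lab_at x (lab_start N) i \<noteq> lab_at y 0 i}"
      by (auto simp: l lab_at_append2)
    \<comment> \<open>The distance never exceeds \<open>N\<close>, so it may be compared with
      \<open>k\<close> capped at \<open>N\<close> instead of \<open>k\<close>.\<close>
    moreover have "card {i. i < N \<and> lab_at x (lab_start N) i \<noteq> lab_at y 0 i} \<le> N"
      using card_mono[of "{..<N}" "{i. i < N \<and> lab_at x (lab_start N) i \<noteq> lab_at y 0 i}"] by auto
    moreover have "capped_value (x @ y) N (lab_start N + 2 * N) (length x - (lab_start N + 2 * N)) =
        min N (binary_value (drop (lab_start N + 2 * N) x))"
      using w(1) by (intro capped_value_eq) auto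
    ultimately show ?thesis
      using complete_at_append[OF w(1) l] complete_at_append[OF w(1) lab_at_append2] l w(2)
      by (simp add: wf_code_append lab_at_append2)
  qed (simp add: wf_code_append)
  show ?thesis unfolding ex eq ..
qed

lemma improvable_iff:
  assumes "length y = length x" "length u = 2 * length x"
  shows "improvable \<sigma> ((x @ y) @ u) \<longleftrightarrow> (\<exists>N. lab_start N + 2 * N \<le> length x \<and>
    (\<forall>i<N. bit_at x i) \<and> \<not> bit_at x N \<and> complete_lab {..<N} (att_at x N) (lab_at u 0) \<and>
    (better \<sigma> {..<N} (lab_at x (lab_start N)) (lab_at u 0) \<or> better \<sigma> {..<N} (lab_at y 0) (lab_at u 0)))"
proof -
  let ?z = "x @ (y @ u)"
  let ?C = "\<lambda>h N. lab_start N + 2 * N \<le> h \<and>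
     (\<forall>i<N. bit_at ?z i) \<and> \<not> bit_at ?z N \<and> complete_at ?z N (2 * h) \<and>
     (better_at \<sigma> ?z N (lab_start N) (2 * h) \<or> better_at \<sigma> ?z N h (2 * h))"
  have "improvable \<sigma> ((x @ y) @ u) \<longleftrightarrow> (\<exists>N<length x. ?C (length x) N)"
    unfolding improvable_def append_assoc by (rule ex_quotient) (simp_all add: assms)
  also have "\<dots> \<longleftrightarrow> (\<exists>N. ?C (length x) N)"
    using lab_start_bound by meson
  finally have ex: "improvable \<sigma> ((x @ y) @ u) \<longleftrightarrow> (\<exists>N. ?C (length x) N)" .
  have eq: "?C (length x) N \<longleftrightarrow> lab_start N + 2 * N \<le> length x \<and>
    (\<forall>i<N. bit_at x i) \<and> \<not> bit_at x N \<and> complete_lab {..<N} (att_at x N) (lab_at u 0) \<and>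
    (better \<sigma> {..<N} (lab_at x (lab_start N)) (lab_at u 0) \<or> better \<sigma> {..<N} (lab_at y 0) (lab_at u 0))" for N
  proof (cases "lab_start N + 2 * N \<le> length x")
    case True
    have 1: "lab_at ?z (lab_start N) a = lab_at x (lab_start N) a" if "a < N" for a
      using True that by (intro lab_at_append1) simp
    have 2: "lab_at ?z (length x) a = lab_at y 0 a" if "a < N" for a
      using True that assms(1) lab_at_append1[of 0 a y u] by (simp add: lab_at_append2)
    have 3: "lab_at ?z (2 * length x) a = lab_at u 0 a" for a
      using lab_at_append2[of "x @ y" u a] assms(1) by (simp add: mult_2)
    have "N < length x" using True by (rule lab_start_bound)
    then show ?thesis
      using complete_at_append[OF True 3] better_at_eq[OF 1 3, of N \<sigma>] better_at_eq[OF 2 3, of N \<sigma>] True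
      by auto
  qed simp
  show ?thesis unfolding ex eq ..
qed

lemma encode_lab:
  assumes "2 * N \<le> h"
  obtains y where "length y = h" "\<And>a. a < N \<Longrightarrow> lab_at y 0 a = l a"
proof
  let ?y = "map (\<lambda>i. l (i div 2) = (if even i then In else Out)) [0..<h]"
  show "length ?y = h" by simp
  show "lab_at ?y 0 a = l a" if "a < N" for a
    using that assms by (cases "l a") (auto simp: lab_at_def bit_at_def)
qed

text \<open>Membership in the language includes that the label block of \<open>x\<close> is itself a
  labelling of the given semantics. So \<open>u\<close> ranges over the competitors of both
  labellings, and one oracle question is enough.\<close>

lemma CF_EX_guess:
  "x \<in> CF_EX \<sigma> \<longleftrightarrow> (\<exists>y. length y = length x \<and> guess_check \<sigma> (x @ y) \<and>
     \<not> (\<exists>u. length u = length (x @ y) \<and> improvable \<sigma> ((x @ y) @ u)))"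
proof
  assume "x \<in> CF_EX \<sigma>"
  then obtain N g where w: "wf_code x (length x) N g"
    and c: "cf_index \<sigma> N (att_at x N) g (binary_value (drop (lab_start N + 2 * N) x)) (lab_at x (lab_start N))"
    unfolding CF_EX_wf by blast
  then obtain l where l: "sem_lab \<sigma> {..<N} (att_at x N) l" "lab_at x (lab_start N) g \<noteq> l g"
    "card {i. i < N \<and> lab_at x (lab_start N) i \<noteq> l i} \<le> binary_value (drop (lab_start N + 2 * N) x)"
    and g: "g < N" and s: "sem_lab \<sigma> {..<N} (att_at x N) (lab_at x (lab_start N))"
    unfolding cf_index_def by blast
  have "2 * N \<le> length x" using wf_codeD(1)[OF w] by simp
  then obtain y where y: "length y = length x" "\<And>a. a < N \<Longrightarrow> lab_at y 0 a = l a"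
    by (rule encode_lab[where l = l]) blast
  have sy: "sem_lab \<sigma> {..<N} (att_at x N) (lab_at y 0)"
    using l(1) y(2) sem_lab_cong[of "{..<N}" "lab_at y 0" l] by auto
  have "{i. i < N \<and> lab_at x (lab_start N) i \<noteq> lab_at y 0 i} = {i. i < N \<and> lab_at x (lab_start N) i \<noteq> l i}"
    using y(2) by auto
  then have "guess_check \<sigma> (x @ y)"
    unfolding guess_check_iff[OF y(1)] using w s sy l y(2) g
    by (intro exI[of _ N] exI[of _ g]) (auto simp: sem_lab_def)
  moreover have "\<not> improvable \<sigma> ((x @ y) @ u)" if "length u = length (x @ y)" for u
  proof
    assume "improvable \<sigma> ((x @ y) @ u)"
    moreover have "length u = 2 * length x" using that y(1) by simp
    ultimately obtain N' where N': "\<forall>i<N'. bit_at x i" "\<not> bit_at x N'"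
      "complete_lab {..<N'} (att_at x N') (lab_at u 0)"
      "better \<sigma> {..<N'} (lab_at x (lab_start N')) (lab_at u 0) \<or> better \<sigma> {..<N'} (lab_at y 0) (lab_at u 0)"
      using improvable_iff[OF y(1), of u \<sigma>] by blast
    \<comment> \<open>Both are the position of the first 0 in \<open>x\<close>.\<close>
    have "N' = N" using N'(1,2) w unfolding wf_code_def by (metis linorder_neqE_nat)
    with N' s sy show False unfolding sem_lab_def by blast
  qed
  ultimately show "\<exists>y. length y = length x \<and> guess_check \<sigma> (x @ y) \<and>
     \<not> (\<exists>u. length u = length (x @ y) \<and> improvable \<sigma> ((x @ y) @ u))" using y(1) by blast
next
  assume "\<exists>y. length y = length x \<and> guess_check \<sigma> (x @ y) \<and>
     \<not> (\<exists>u. length u = length (x @ y) \<and> improvable \<sigma> ((x @ y) @ u))"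
  then obtain y where y: "length y = length x" "guess_check \<sigma> (x @ y)"
    and imp: "\<And>u. length u = length (x @ y) \<Longrightarrow> \<not> improvable \<sigma> ((x @ y) @ u)" by blast
  obtain N g where w: "wf_code x (length x) N g"
    and l: "complete_lab {..<N} (att_at x N) (lab_at x (lab_start N))"
      "complete_lab {..<N} (att_at x N) (lab_at y 0)"
      "\<sigma> = ST \<longrightarrow> (\<forall>a<N. lab_at x (lab_start N) a \<noteq> Und \<and> lab_at y 0 a \<noteq> Und)"
    and d: "lab_at x (lab_start N) g \<noteq> lab_at y 0 g"
      "card {i. i < N \<and> lab_at x (lab_start N) i \<noteq> lab_at y 0 i} \<le> binary_value (drop (lab_start N + 2 * N) x)"
    using y(2) unfolding guess_check_iff[OF y(1)] by blast
  note w' = w[unfolded wf_code_def]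
  have nb: "\<not> better \<sigma> {..<N} (lab_at x (lab_start N)) m \<and> \<not> better \<sigma> {..<N} (lab_at y 0) m"
    if m: "complete_lab {..<N} (att_at x N) m" for m
  proof -
    have "2 * N \<le> 2 * length x" using w' by simp
    then obtain u where u: "length u = 2 * length x" "\<And>a. a < N \<Longrightarrow> lab_at u 0 a = m a"
      by (rule encode_lab[where l = m]) blast
    have "complete_lab {..<N} (att_at x N) (lab_at u 0)"
      using m u(2) complete_lab_cong[of "{..<N}" "lab_at u 0" m] by auto
    moreover have "\<not> improvable \<sigma> ((x @ y) @ u)" using imp u(1) y(1) by simp
    ultimately have "\<not> better \<sigma> {..<N} (lab_at x (lab_start N)) (lab_at u 0)"
      "\<not> better \<sigma> {..<N} (lab_at y 0) (lab_at u 0)"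
      unfolding improvable_iff[OF y(1) u(1)] using w' by blast+
    moreover have "better \<sigma> {..<N} l (lab_at u 0) = better \<sigma> {..<N} l m" for l
      using u(2) by (intro better_cong) auto
    ultimately show ?thesis by blast
  qed
  have "cf_index \<sigma> N (att_at x N) g (binary_value (drop (lab_start N + 2 * N) x)) (lab_at x (lab_start N))"
    unfolding cf_index_def sem_lab_def using l d nb wf_codeD(2)[OF w]
    by (intro conjI exI[of _ "lab_at y 0"]) auto
  with w show "x \<in> CF_EX \<sigma>" unfolding CF_EX_wf by blast
qed

theorem CF_EX_NP: "\<sigma> \<in> {CO, ST} \<Longrightarrow> CF_EX \<sigma> \<in> NP"
proof -
  assume "\<sigma> \<in> {CO, ST}"
  then have "\<not> improvable \<sigma> z" for z by (auto simp: improvable_def better_at_def)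
  then have "CF_EX \<sigma> = {x. \<exists>y. length y = length x \<and> guess_check \<sigma> (x @ y)}"
    using CF_EX_guess by blast
  then show ?thesis using NP_I[OF polypred_guess_check] by simp
qed

theorem CF_EX_Sigma2p: "CF_EX \<sigma> \<in> Sigma2p"
proof -
  define B where "B = {z. \<exists>u. length u = length z \<and> improvable \<sigma> (z @ u)}"
  have "B \<in> NP" unfolding B_def by (rule NP_I[OF polypred_improvable])
  moreover have "CF_EX \<sigma> = {x. \<exists>y. length y = length x \<and> guess_check \<sigma> (x @ y) \<and> x @ y \<notin> B}"
    unfolding B_def using CF_EX_guess by blast
  ultimately show ?thesis using Sigma2p_I[OF polypred_guess_check] by simp
qed

section \<open>The argumentation framework of a pair of clause families\<close>

datatype arg = Lit nat bool | Cmp nat bool | Ca nat | Cb nat | Ph nat | Sf nat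

fun index :: "arg \<Rightarrow> nat" where
  "index (Lit v b) = v" | "index (Cmp v b) = v" | "index (Ca v) = v" | "index (Cb v) = v"
| "index (Ph v) = v" | "index (Sf v) = v"

definition arguments :: "nat \<Rightarrow> arg set" where
  "arguments V = {a. index a < V}"

text \<open>\<^term>\<open>Lit 0 False\<close> is a switch: while it is in, every other literal and every clause argument is out. Otherwise
  the literals describe an assignment. The clause arguments \<^term>\<open>Ca c\<close> and \<^term>\<open>Cb c\<close> of the first and second
  family are out if a literal of the clause is in; \<^term>\<open>Ca c\<close> defeats every \<^term>\<open>Cb c\<close>, so that leaving the first family
  unsatisfied gains nothing, while an undefeated \<^term>\<open>Cb c\<close> attacks itself and makes the arguments \<^term>\<open>Ph v\<close> undecided.
  Then the \<^term>\<open>Sf v\<close> keep the literals outside X undecided, so that only X-variables can be assigned unless the second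
  family becomes satisfied. The flag co makes the labelling with \<^const>\<open>Und\<close> everywhere complete.\<close>

locale gadget =
  fixes co :: bool and X :: "nat \<Rightarrow> bool" and PA PB :: "nat \<Rightarrow> nat \<Rightarrow> bool \<Rightarrow> bool" and V :: nat
  assumes V_pos: "0 < V"
begin

text \<open>For an X-variable a companion attacks itself and is attacked by its own literal: it is
  out if that literal is in and otherwise undecided. The remaining companions are out as soon as one
  of the two literals of variable 0 is in.\<close>

fun atk :: "arg \<Rightarrow> arg \<Rightarrow> bool" where
  "atk (Lit v b) (Lit w c) \<longleftrightarrow> v = w \<and> b \<noteq> c \<or> v = 0 \<and> \<not> b \<and> (w \<noteq> 0 \<or> co \<and> \<not> c)"
| "atk (Lit v b) (Cmp w c) \<longleftrightarrow> (if X w then v = w \<and> b = c else v = 0)"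
| "atk (Lit v b) (Ca w) \<longleftrightarrow> (if v = 0 then \<not> b else PA w v b)"
| "atk (Lit v b) (Cb w) \<longleftrightarrow> (if v = 0 then \<not> b else PB w v b)"
| "atk (Cmp v b) (Cmp w c) \<longleftrightarrow> X w \<and> v = w \<and> b = c"
| "atk (Ca v) (Cb w) \<longleftrightarrow> True"
| "atk (Cb v) (Cb w) \<longleftrightarrow> v = w"
| "atk (Cb v) (Ph w) \<longleftrightarrow> True"
| "atk (Ph v) (Sf w) \<longleftrightarrow> v = w"
| "atk (Sf v) (Sf w) \<longleftrightarrow> v = w"
| "atk (Sf v) (Lit w b) \<longleftrightarrow> v = w \<and> w \<noteq> 0 \<and> \<not> X w"
| "atk _ _ \<longleftrightarrow> False"

abbreviation complete :: "(arg \<Rightarrow> label) \<Rightarrow> bool" where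
  "complete \<equiv> complete_lab (arguments V) atk"

definition sat :: "(nat \<Rightarrow> nat \<Rightarrow> bool \<Rightarrow> bool) \<Rightarrow> nat \<Rightarrow> (nat \<Rightarrow> bool) \<Rightarrow> bool" where
  "sat P c W \<longleftrightarrow> (\<exists>v<V. 0 < v \<and> P c v (W v))"

lemma Ball_arguments: "(\<forall>a\<in>arguments V. P a) \<longleftrightarrow> (\<forall>v<V. (\<forall>b. P (Lit v b)) \<and> (\<forall>b. P (Cmp v b)) \<and>
    P (Ca v) \<and> P (Cb v) \<and> P (Ph v) \<and> P (Sf v))" (is "?L \<longleftrightarrow> ?R")
proof
  show "?L \<Longrightarrow> ?R" by (auto simp: arguments_def)
  assume r: ?R
  show ?L
  proof
    fix a assume "a \<in> arguments V"
    then show "P a" using r by (cases a) (auto simp: arguments_def)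
  qed
qed

text \<open>Both halves of completeness are instances: the label in takes \<open>P\<close> to be
  out, and the label out is the failure for \<open>P\<close> being not in. So the attackers of each
  kind of argument have to be determined only once.\<close>

definition attackers :: "arg \<Rightarrow> (arg \<Rightarrow> bool) \<Rightarrow> bool" where
  "attackers a P \<longleftrightarrow> (\<forall>b\<in>arguments V. atk b a \<longrightarrow> P b)"

lemma attackers_Lit:
  assumes "v < V"
  shows "attackers (Lit v c) P \<longleftrightarrow> P (Lit v (\<not> c)) \<and>
    (if v = 0 then co \<and> \<not> c \<longrightarrow> P (Lit 0 False) else P (Lit 0 False) \<and> (X v \<or> P (Sf v)))"
proof
  assume "attackers (Lit v c) P"
  then have h: "\<And>b. index b < V \<Longrightarrow> atk b (Lit v c) \<Longrightarrow> P b" by (simp add: attackers_def arguments_def)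
  show "P (Lit v (\<not> c)) \<and>
    (if v = 0 then co \<and> \<not> c \<longrightarrow> P (Lit 0 False) else P (Lit 0 False) \<and> (X v \<or> P (Sf v)))"
    using h[of "Lit v (\<not> c)"] h[of "Lit 0 False"] h[of "Sf v"] assms V_pos by auto
next
  assume r: "P (Lit v (\<not> c)) \<and>
    (if v = 0 then co \<and> \<not> c \<longrightarrow> P (Lit 0 False) else P (Lit 0 False) \<and> (X v \<or> P (Sf v)))"
  show "attackers (Lit v c) P"
    unfolding attackers_def
  proof (intro ballI impI)
    fix b assume "atk b (Lit v c)"
    then show "P b" using r by (cases b) (auto split: if_splits)
  qed
qed

lemma attackers_Cmp:
  assumes "v < V"
  shows "attackers (Cmp v c) P \<longleftrightarrow>
    (if X v then P (Lit v c) \<and> P (Cmp v c) else P (Lit 0 True) \<and> P (Lit 0 False))"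
proof
  assume "attackers (Cmp v c) P"
  then have h: "\<And>b. index b < V \<Longrightarrow> atk b (Cmp v c) \<Longrightarrow> P b" by (simp add: attackers_def arguments_def)
  show "if X v then P (Lit v c) \<and> P (Cmp v c) else P (Lit 0 True) \<and> P (Lit 0 False)"
    using h[of "Lit v c"] h[of "Lit 0 False"] h[of "Lit 0 True"] h[of "Cmp v c"] assms V_pos by auto
next
  assume r: "if X v then P (Lit v c) \<and> P (Cmp v c) else P (Lit 0 True) \<and> P (Lit 0 False)"
  show "attackers (Cmp v c) P"
    unfolding attackers_def
  proof (intro ballI impI)
    fix b assume "atk b (Cmp v c)"
    moreover have "P (Lit 0 x)" if "\<not> X v" for x using r that by (cases x) auto
    ultimately show "P b" using r by (cases b) (auto split: if_splits)
  qed
qed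

lemma attackers_Ca:
  "attackers (Ca c) P \<longleftrightarrow> P (Lit 0 False) \<and> (\<forall>v<V. \<forall>b. 0 < v \<and> PA c v b \<longrightarrow> P (Lit v b))"
proof
  assume "attackers (Ca c) P"
  then have h: "\<And>b. index b < V \<Longrightarrow> atk b (Ca c) \<Longrightarrow> P b" by (simp add: attackers_def arguments_def)
  show "P (Lit 0 False) \<and> (\<forall>v<V. \<forall>b. 0 < v \<and> PA c v b \<longrightarrow> P (Lit v b))"
    using h[of "Lit _ _"] V_pos by auto
next
  assume r: "P (Lit 0 False) \<and> (\<forall>v<V. \<forall>b. 0 < v \<and> PA c v b \<longrightarrow> P (Lit v b))"
  show "attackers (Ca c) P"
    unfolding attackers_def arguments_def
  proof (intro ballI impI)
    fix b assume "b \<in> {a. index a < V}" "atk b (Ca c)"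
    then show "P b" using r by (cases b) (auto split: if_splits)
  qed
qed

lemma attackers_Cb:
  assumes "c < V"
  shows "attackers (Cb c) P \<longleftrightarrow> P (Lit 0 False) \<and> (\<forall>v<V. \<forall>b. 0 < v \<and> PB c v b \<longrightarrow> P (Lit v b)) \<and>
    (\<forall>v<V. P (Ca v)) \<and> P (Cb c)"
proof
  assume "attackers (Cb c) P"
  then have h: "\<And>b. index b < V \<Longrightarrow> atk b (Cb c) \<Longrightarrow> P b" by (simp add: attackers_def arguments_def)
  show "P (Lit 0 False) \<and> (\<forall>v<V. \<forall>b. 0 < v \<and> PB c v b \<longrightarrow> P (Lit v b)) \<and> (\<forall>v<V. P (Ca v)) \<and> P (Cb c)"
    using h[of "Lit _ _"] h[of "Ca _"] h[of "Cb _"] V_pos assms by auto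
next
  assume r: "P (Lit 0 False) \<and> (\<forall>v<V. \<forall>b. 0 < v \<and> PB c v b \<longrightarrow> P (Lit v b)) \<and>
    (\<forall>v<V. P (Ca v)) \<and> P (Cb c)"
  show "attackers (Cb c) P"
    unfolding attackers_def arguments_def
  proof (intro ballI impI)
    fix b assume "b \<in> {a. index a < V}" "atk b (Cb c)"
    then show "P b" using r by (cases b) (auto split: if_splits)
  qed
qed

lemma attackers_Ph: "attackers (Ph w) P \<longleftrightarrow> (\<forall>v<V. P (Cb v))"
proof
  assume "attackers (Ph w) P"
  then show "\<forall>v<V. P (Cb v)" by (auto simp: attackers_def arguments_def)
next
  assume r: "\<forall>v<V. P (Cb v)"
  show "attackers (Ph w) P"
    unfolding attackers_def arguments_def
  proof (intro ballI impI)
    fix b assume "b \<in> {a. index a < V}" "atk b (Ph w)"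
    then show "P b" using r by (cases b) auto
  qed
qed

lemma attackers_Sf:
  assumes "w < V"
  shows "attackers (Sf w) P \<longleftrightarrow> P (Ph w) \<and> P (Sf w)"
proof
  assume "attackers (Sf w) P"
  then show "P (Ph w) \<and> P (Sf w)" using assms by (auto simp: attackers_def arguments_def)
next
  assume r: "P (Ph w) \<and> P (Sf w)"
  show "attackers (Sf w) P"
    unfolding attackers_def
  proof (intro ballI impI)
    fix b assume "atk b (Sf w)"
    then show "P b" using r by (cases b) auto
  qed
qed

lemmas attackers_simps = attackers_Lit attackers_Cmp attackers_Ca attackers_Cb attackers_Ph attackers_Sf

lemma complete_iff: "complete l \<longleftrightarrow> (\<forall>a\<in>arguments V. (l a = In \<longleftrightarrow> attackers a (\<lambda>b. l b = Out)) \<and>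
    (l a = Out \<longleftrightarrow> \<not> attackers a (\<lambda>b. l b \<noteq> In)))"
  unfolding complete_lab_def attackers_def by blast

lemma complete_In: "complete l \<Longrightarrow> index a < V \<Longrightarrow> l a = In \<longleftrightarrow> attackers a (\<lambda>b. l b = Out)"
  unfolding complete_iff by (metis arguments_def mem_Collect_eq)

lemma complete_Out: "complete l \<Longrightarrow> index a < V \<Longrightarrow> l a = Out \<longleftrightarrow> \<not> attackers a (\<lambda>b. l b \<noteq> In)"
  unfolding complete_iff by (metis arguments_def mem_Collect_eq)

definition all_und :: "arg \<Rightarrow> label" where
  "all_und a = Und"

text \<open>The labelling that the switch forces. It does not mention the clauses, so a reduction
  can print it.\<close>

fun d_lab :: "arg \<Rightarrow> label" where
  "d_lab (Lit v b) = (if v = 0 \<and> \<not> b then In else Out)"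
| "d_lab (Cmp v b) = (if X v \<and> (v \<noteq> 0 \<or> b) then Und else Out)"
| "d_lab (Ph v) = In"
| "d_lab _ = Out"

fun w_lab :: "(nat \<Rightarrow> bool) \<Rightarrow> arg \<Rightarrow> label" where
  "w_lab W (Lit v b) = (if W v = b then In else Out)"
| "w_lab W (Cmp v b) = (if X v \<and> W v \<noteq> b then Und else Out)"
| "w_lab W (Ca c) = (if sat PA c W then Out else In)"
| "w_lab W (Ph v) = In"
| "w_lab W _ = Out"

text \<open>The labelling that fixes only the X-variables; it is complete when they alone satisfy all
  clauses of the first family but not all of the second one.\<close>

fun x_lab :: "(nat \<Rightarrow> bool) \<Rightarrow> arg \<Rightarrow> label" where
  "x_lab W (Lit v b) = (if X v then if W v = b then In else Out else Und)"
| "x_lab W (Cmp v b) = (if X v \<and> W v \<noteq> b then Und else Out)"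
| "x_lab W (Ca c) = Out"
| "x_lab W (Cb c) = (if \<exists>v<V. 0 < v \<and> X v \<and> PB c v (W v) then Out else Und)"
| "x_lab W _ = Und"

lemma complete_all_und: "complete all_und"
  using V_pos unfolding complete_iff Ball_arguments by (auto simp: attackers_simps all_und_def)

text \<open>With \<open>co\<close> the switch would attack itself and could not be in.\<close>

lemma complete_d_lab:
  assumes "\<not> co"
  shows "complete d_lab"
  using V_pos unfolding complete_iff Ball_arguments
  by (simp add: attackers_simps) (use assms in auto)

text \<open>In both cases every \<open>Cb c\<close> is out: either an unsatisfied \<open>Ca\<close>
  is in and defeats them all, or each is defeated by a true literal. Then \<open>Ph\<close> is in,
  \<open>Sf\<close> is out, and the literals are free to describe \<open>W\<close>.\<close>

lemma complete_w_lab: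
  assumes "W 0" "(\<exists>c<V. \<not> sat PA c W) \<or> (\<forall>c<V. sat PB c W)"
  shows "complete (w_lab W)"
  using V_pos assms unfolding complete_iff Ball_arguments
  by (auto simp: attackers_simps sat_def)

lemma complete_x_lab:
  assumes "W 0" "X 0" "\<And>c v b. PA c v b \<Longrightarrow> X v" "\<And>c. c < V \<Longrightarrow> sat PA c W" "c < V" "\<not> sat PB c W"
  shows "complete (x_lab W)"
  unfolding complete_iff Ball_arguments
proof (intro allI impI conjI)
  have d: "x_lab W (Lit 0 False) = Out" "x_lab W (Lit 0 True) = In" using assms by auto
  have und: "x \<noteq> In \<longleftrightarrow> x = Out \<or> x = Und" for x by (cases x) auto
  fix v assume v: "v < V"
  show "(x_lab W (Lit v b) = In) = attackers (Lit v b) (\<lambda>b. x_lab W b = Out)"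
    "(x_lab W (Lit v b) = Out) = (\<not> attackers (Lit v b) (\<lambda>b. x_lab W b \<noteq> In))" for b
    unfolding attackers_Lit[OF v] d using assms(1,2) by (cases "v = 0"; cases "X v"; auto)+
  show "(x_lab W (Cmp v b) = In) = attackers (Cmp v b) (\<lambda>b. x_lab W b = Out)"
    "(x_lab W (Cmp v b) = Out) = (\<not> attackers (Cmp v b) (\<lambda>b. x_lab W b \<noteq> In))" for b
    unfolding attackers_Cmp[OF v] d by (cases "X v"; auto)+
  obtain u where "u < V" "0 < u" "PA v u (W u)" using assms(4)[OF v] by (auto simp: sat_def)
  moreover from this have "x_lab W (Lit u (W u)) = In" using assms(3) by auto
  ultimately have "\<exists>u<V. \<exists>b. 0 < u \<and> PA v u b \<and> x_lab W (Lit u b) = In" by blast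
  then show "(x_lab W (Ca v) = In) = attackers (Ca v) (\<lambda>b. x_lab W b = Out)"
    "(x_lab W (Ca v) = Out) = (\<not> attackers (Ca v) (\<lambda>b. x_lab W b \<noteq> In))"
    unfolding attackers_Ca d by (simp_all only: x_lab.simps) (metis label.distinct(1))+
  show "(x_lab W (Cb v) = In) = attackers (Cb v) (\<lambda>b. x_lab W b = Out)"
    "(x_lab W (Cb v) = Out) = (\<not> attackers (Cb v) (\<lambda>b. x_lab W b \<noteq> In))"
    unfolding attackers_Cb[OF v] d by auto
  have "x_lab W (Cb c) = Und" using assms(6) by (auto simp: sat_def)
  then show "(x_lab W (Ph v) = In) = attackers (Ph v) (\<lambda>b. x_lab W b = Out)"
    "(x_lab W (Ph v) = Out) = (\<not> attackers (Ph v) (\<lambda>b. x_lab W b \<noteq> In))"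
    unfolding attackers_Ph using assms(5) by (auto split: if_splits)
  show "(x_lab W (Sf v) = In) = attackers (Sf v) (\<lambda>b. x_lab W b = Out)"
    "(x_lab W (Sf v) = Out) = (\<not> attackers (Sf v) (\<lambda>b. x_lab W b \<noteq> In))"
    unfolding attackers_Sf[OF v] by auto
qed

section \<open>What a complete labelling forces\<close>

lemma never_In:
  assumes "complete l" "v < V"
  shows "l (Cb v) \<noteq> In" "l (Sf v) \<noteq> In" "X v \<Longrightarrow> l (Cmp v b) \<noteq> In"
  using complete_In[OF assms(1), of "Cb v"] complete_In[OF assms(1), of "Sf v"]
    complete_In[OF assms(1), of "Cmp v b"] assms(2) by (auto simp: attackers_simps)

lemma Lit_In: "complete l \<Longrightarrow> v < V \<Longrightarrow> l (Lit v b) = In \<Longrightarrow> l (Lit v (\<not> b)) = Out"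
  using complete_In[of l "Lit v b"] by (simp add: attackers_simps)

lemma Ph_eq: "complete l \<Longrightarrow> v < V \<Longrightarrow> l (Ph v) = In \<longleftrightarrow> (\<forall>c<V. l (Cb c) = Out)"
  using complete_In[of l "Ph v"] by (simp add: attackers_simps)

lemma Ph_Out: "complete l \<Longrightarrow> v < V \<Longrightarrow> l (Ph v) \<noteq> Out"
  using complete_Out[of l "Ph v"] never_In[of l] by (auto simp: attackers_simps)

text \<open>When neither the switch nor any \<open>Ca\<close> is in, only a literal can have
  defeated \<open>Cb c\<close>. Reading a variable as true exactly if its positive literal is in is
  right for negative literals too, as complementary literals are never both in.\<close>

lemma sat_of_lab:
  assumes l: "complete l" and d: "l (Lit 0 False) \<noteq> In" and a: "\<And>c. c < V \<Longrightarrow> l (Ca c) \<noteq> In"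
    and c: "c < V" "l (Cb c) = Out"
  shows "sat PB c (\<lambda>v. l (Lit v True) = In)"
proof -
  have "\<not> attackers (Cb c) (\<lambda>b. l b \<noteq> In)" using complete_Out[OF l, of "Cb c"] c by simp
  then obtain v b where vb: "v < V" "0 < v" "PB c v b" "l (Lit v b) = In"
    unfolding attackers_Cb[OF c(1)] using d a never_In(1)[OF l c(1)] by auto
  then have "(l (Lit v True) = In) = b" using Lit_In[OF l vb(1,4)] by (cases b) auto
  then show ?thesis using vb unfolding sat_def by blast
qed

lemma sat_cong: "(\<And>v. 0 < v \<Longrightarrow> W v = W' v) \<Longrightarrow> sat P c W = sat P c W'"
  unfolding sat_def by auto

text \<open>Labels propagate from the switch along the attacks; only self-attacking companions can
  stay undecided.\<close>

lemma d_lab_forced: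
  assumes l: "complete l" and d: "l (Lit 0 False) = In" and a: "a \<in> arguments V"
  shows "l a = d_lab a"
proof -
  have lit: "l (Lit v b) = Out" if "v < V" "v \<noteq> 0 \<or> b" for v b
    using complete_Out[OF l, of "Lit v b"] that d by (auto simp: attackers_simps)
  have cb: "l (Cb c) = Out" "l (Ca c) = Out" if "c < V" for c
    using complete_Out[OF l, of "Cb c"] complete_Out[OF l, of "Ca c"] that d by (auto simp: attackers_simps)
  have ph: "l (Ph w) = In" if "w < V" for w using Ph_eq[OF l that] cb by simp
  have sf: "l (Sf w) = Out" if "w < V" for w
    using complete_Out[OF l, of "Sf w"] that ph by (auto simp: attackers_simps)
  have n: "x = Und" if "x \<noteq> In" "x \<noteq> Out" for x using that by (cases x) auto
  have cmp: "l (Cmp v b) = d_lab (Cmp v b)" if v: "v < V" for v b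
  proof (cases "X v \<and> (v \<noteq> 0 \<or> b)")
    case True
    then have "l (Cmp v b) \<noteq> Out" "l (Cmp v b) \<noteq> In"
      using complete_Out[OF l, of "Cmp v b"] v lit[OF v] never_In(3)[OF l v] by (auto simp: attackers_simps)
    then show ?thesis using n True by simp
  next
    case False
    then show ?thesis
      using complete_Out[OF l, of "Cmp v b"] v d by (auto simp: attackers_simps)
  qed
  show ?thesis using a lit cb ph sf cmp d by (cases a) (auto simp: arguments_def)
qed

text \<open>The NP case reuses the framework with a first family that no assignment can violate:
  every clause holds both literals of variable 1.\<close>

definition trivial :: bool where
  "trivial \<longleftrightarrow> 1 < V \<and> (\<forall>c<V. \<forall>b. PA c 1 b) \<and> (\<forall>v. \<not> X v)"

text \<open>Otherwise both literals of variable 1 would be out although neither the switch nor any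
  \<open>Sf\<close> is in, and then each of them would need the other one in.\<close>

lemma trivial_Ca:
  assumes "trivial" "complete l" "l (Lit 0 False) \<noteq> In" "c < V"
  shows "l (Ca c) \<noteq> In"
proof
  assume "l (Ca c) = In"
  then have o: "l (Lit 1 b) = Out" for b
    using complete_In[OF assms(2), of "Ca c"] assms(1,4) by (auto simp: attackers_simps trivial_def)
  have "1 < V" using assms(1) by (simp add: trivial_def)
  then have "\<not> attackers (Lit 1 True) (\<lambda>b. l b \<noteq> In)"
    using complete_Out[OF assms(2), of "Lit 1 True"] o by simp
  then show False
    using \<open>1 < V\<close> assms(3) o never_In(2)[OF assms(2) \<open>1 < V\<close>] by (simp add: attackers_simps)
qed

text \<open>\<open>Ph 0\<close> is never out, so a label other than undecided means in, and this
  says that all \<open>Cb\<close> are out. Because of \<open>co\<close> the switch cannot be the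
  cause, so the literals are.\<close>

theorem complete_counterfactual:
  assumes "trivial" co
  shows "sem_lab CO (arguments V) atk all_und"
    and "(\<exists>l. sem_lab CO (arguments V) atk l \<and> all_und (Ph 0) \<noteq> l (Ph 0)) \<longleftrightarrow> (\<exists>W. \<forall>c<V. sat PB c W)"
proof -
  have sem: "sem_lab CO (arguments V) atk l \<longleftrightarrow> complete l" for l
    by (simp add: sem_lab_def better_def)
  show "sem_lab CO (arguments V) atk all_und" using sem complete_all_und by blast
  show "(\<exists>l. sem_lab CO (arguments V) atk l \<and> all_und (Ph 0) \<noteq> l (Ph 0)) \<longleftrightarrow> (\<exists>W. \<forall>c<V. sat PB c W)"
  proof
    assume "\<exists>l. sem_lab CO (arguments V) atk l \<and> all_und (Ph 0) \<noteq> l (Ph 0)"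
    then obtain l where l: "complete l" "l (Ph 0) \<noteq> Und" using sem by (auto simp: all_und_def)
    then have "l (Ph 0) = In" using Ph_Out[OF l(1) V_pos] by (cases "l (Ph 0)") auto
    then have "\<forall>c<V. l (Cb c) = Out" using Ph_eq[OF l(1) V_pos] by simp
    moreover have "l (Lit 0 False) \<noteq> In"
      using complete_In[OF l(1), of "Lit 0 False", unfolded attackers_Lit[OF V_pos]] V_pos assms(2) by auto
    ultimately show "\<exists>W. \<forall>c<V. sat PB c W"
      using sat_of_lab[OF l(1)] trivial_Ca[OF assms(1) l(1)] by blast
  next
    assume "\<exists>W. \<forall>c<V. sat PB c W"
    then obtain W where "\<forall>c<V. sat PB c W" by blast
    then have "\<forall>c<V. sat PB c (W(0 := True))" using sat_cong[of W "W(0 := True)"] by simp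
    then have "complete (w_lab (W(0 := True)))" by (intro complete_w_lab) auto
    then show "\<exists>l. sem_lab CO (arguments V) atk l \<and> all_und (Ph 0) \<noteq> l (Ph 0)"
      unfolding sem by (intro exI[of _ "w_lab (W(0 := True))"]) (simp add: all_und_def)
  qed
qed

text \<open>\<open>Ph 0\<close> cannot be the goal here, since the default labelling and the
  labellings of assignments agree on it. A stable labelling that moves \<open>Lit 0 True\<close> has
  given up the switch; the \<open>Cb\<close>, which are never in and must not be undecided, are then
  defeated by literals.\<close>

theorem stable_counterfactual:
  assumes "trivial" "\<not> co"
  shows "sem_lab ST (arguments V) atk d_lab"
    and "(\<exists>l. sem_lab ST (arguments V) atk l \<and> d_lab (Lit 0 True) \<noteq> l (Lit 0 True)) \<longleftrightarrow> (\<exists>W. \<forall>c<V. sat PB c W)"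
proof -
  have sem: "sem_lab ST (arguments V) atk l \<longleftrightarrow> complete l \<and> (\<forall>a\<in>arguments V. l a \<noteq> Und)" for l
    by (simp add: sem_lab_def better_def)
  have X: "\<not> X v" for v using assms(1) by (simp add: trivial_def)
  have "d_lab a \<noteq> Und" for a by (cases a) (auto simp: X)
  then show "sem_lab ST (arguments V) atk d_lab" using sem complete_d_lab[OF assms(2)] by blast
  show "(\<exists>l. sem_lab ST (arguments V) atk l \<and> d_lab (Lit 0 True) \<noteq> l (Lit 0 True)) \<longleftrightarrow> (\<exists>W. \<forall>c<V. sat PB c W)"
  proof
    assume "\<exists>l. sem_lab ST (arguments V) atk l \<and> d_lab (Lit 0 True) \<noteq> l (Lit 0 True)"
    then obtain l where l: "complete l" "\<forall>a\<in>arguments V. l a \<noteq> Und" "l (Lit 0 True) \<noteq> Out"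
      unfolding sem by auto
    then have "l (Lit 0 True) \<noteq> Und" using V_pos by (auto simp: arguments_def)
    then have "l (Lit 0 True) = In" using l(3) by (cases "l (Lit 0 True)") auto
    then have d: "l (Lit 0 False) \<noteq> In" using Lit_In[OF l(1) V_pos, of True] by auto
    have "l (Cb c) = Out" if "c < V" for c
    proof -
      have "l (Cb c) \<noteq> Und" using l(2) that by (simp add: arguments_def)
      then show ?thesis using never_In(1)[OF l(1) that] by (cases "l (Cb c)") auto
    qed
    then show "\<exists>W. \<forall>c<V. sat PB c W"
      using sat_of_lab[OF l(1) d] trivial_Ca[OF assms(1) l(1) d] by blast
  next
    assume "\<exists>W. \<forall>c<V. sat PB c W"
    then obtain W where "\<forall>c<V. sat PB c W" by blast
    then have "\<forall>c<V. sat PB c (W(0 := True))" using sat_cong[of W "W(0 := True)"] by simp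
    then have "complete (w_lab (W(0 := True)))" by (intro complete_w_lab) auto
    moreover have "w_lab U a \<noteq> Und" for a U by (cases a) (auto simp: X)
    ultimately show "\<exists>l. sem_lab ST (arguments V) atk l \<and> d_lab (Lit 0 True) \<noteq> l (Lit 0 True)"
      unfolding sem by (intro exI[of _ "w_lab (W(0 := True))"]) simp
  qed
qed

section \<open>The game behind the preferred and the semi-stable semantics\<close>

definition winning :: "(nat \<Rightarrow> bool) \<Rightarrow> bool" where
  "winning W \<longleftrightarrow> (\<forall>c<V. sat PA c W) \<and>
     (\<forall>W'. (\<forall>v. v \<noteq> 0 \<and> X v \<longrightarrow> W' v = W v) \<longrightarrow> (\<exists>c<V. \<not> sat PB c W'))"

definition quantified :: bool where
  "quantified \<longleftrightarrow> X 0 \<and> \<not> co \<and> (\<forall>c v b. PA c v b \<longrightarrow> X v)"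

text \<open>A competitor that keeps the in-arguments keeps the switch. One that only enlarges the
  range keeps \<open>Cmp 0 False\<close> decided, which is possible only with the switch in. Either
  way the competitor is forced to coincide with the default labelling.\<close>

lemma sem_d_lab:
  assumes "quantified"
  shows "sem_lab \<sigma> (arguments V) atk d_lab \<or> \<sigma> = ST"
proof -
  have "\<not> better \<sigma> (arguments V) d_lab l" if l: "complete l" for l
  proof
    assume b: "better \<sigma> (arguments V) d_lab l"
    have args: "Lit 0 False \<in> arguments V" "Cmp 0 False \<in> arguments V" using V_pos by (auto simp: arguments_def)
    have "l (Lit 0 False) = In"
    proof (cases "\<forall>a\<in>arguments V. d_lab a = In \<longrightarrow> l a = In")
      case True
      then show ?thesis using args by auto
    next
      case False
      then have "l (Cmp 0 False) \<noteq> Und" using b args unfolding better_def by auto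
      then have "l (Cmp 0 False) = Out"
        using never_In(3)[OF l V_pos] assms by (cases "l (Cmp 0 False)") (auto simp: quantified_def)
      then have "\<not> attackers (Cmp 0 False) (\<lambda>b. l b \<noteq> In)"
        using complete_Out[OF l, of "Cmp 0 False"] V_pos by simp
      then show ?thesis
        using V_pos assms never_In(3)[OF l V_pos] by (auto simp: attackers_simps quantified_def)
    qed
    then have "\<forall>a\<in>arguments V. l a = d_lab a" using d_lab_forced[OF l] by blast
    then show False using b unfolding better_def by auto
  qed
  then show ?thesis
    using complete_d_lab assms unfolding sem_lab_def quantified_def by auto
qed

text \<open>Read \<open>W\<close> off the literals that are in. As \<open>Ph\<close> is not in, no
  literal outside X can be in. If \<open>W\<close> were not winning, some \<open>U\<close> that
  agrees with \<open>W\<close> on X would violate the first family or satisfy the second one, and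
  \<open>w_lab U\<close> would be a complete labelling with more arguments in, among them
  \<open>Ph 0\<close>.\<close>

lemma preferred_winning:
  assumes q: "quantified" and l: "complete l" "l (Ph 0) \<noteq> In"
    and max: "\<And>m a. complete m \<Longrightarrow> (\<And>b. index b < V \<Longrightarrow> l b = In \<Longrightarrow> m b = In) \<Longrightarrow>
      index a < V \<Longrightarrow> m a = In \<Longrightarrow> l a = In"
  shows "\<exists>W. winning W"
proof -
  have X0: "X 0" and co: "\<not> co" and PAX: "\<And>c v b. PA c v b \<Longrightarrow> X v" using q by (auto simp: quantified_def)
  have d: "l (Lit 0 False) \<noteq> In"
    using d_lab_forced[OF l(1), of "Ph 0"] l(2) V_pos by (auto simp: arguments_def)
  note lits = complete_In[OF l(1), of "Lit _ _", unfolded index.simps]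
  \<comment> \<open>If neither literal of variable 0 were in, nothing would be in at all, and the
    default labelling would have more arguments in than \<open>l\<close>.\<close>
  have e: "l (Lit 0 True) = In"
  proof (rule ccontr)
    assume e: "l (Lit 0 True) \<noteq> In"
    then have dO: "l (Lit 0 False) \<noteq> Out"
      using complete_Out[OF l(1), of "Lit 0 False"] V_pos attackers_Lit[OF V_pos] co by simp
    have lit: "l (Lit v b) \<noteq> In" if "v < V" for v b
    proof (cases "v = 0")
      case True
      then show ?thesis using d e by (cases b) auto
    next
      case False
      then show ?thesis using complete_In[OF l(1), of "Lit v b"] attackers_Lit[OF that] that dO by simp
    qed
    have ca: "l (Ca v) \<noteq> In" if "v < V" for v
      using complete_In[OF l(1), of "Ca v"] attackers_Ca that dO by simp
    have cmp: "l (Cmp v b) \<noteq> In" if "v < V" for v b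
      using complete_In[OF l(1), of "Cmp v b"] attackers_Cmp[OF that] that dO never_In(3)[OF l(1) that]
      by (cases "X v") auto
    have "l (Cb 0) \<noteq> Out"
      using complete_Out[OF l(1), of "Cb 0"] attackers_Cb[OF V_pos] V_pos lit ca never_In(1)[OF l(1)] by simp
    then have ph: "l (Ph v) \<noteq> In" if "v < V" for v using Ph_eq[OF l(1) that] V_pos by blast
    have "l a \<noteq> In" if "index a < V" for a
      using that lit ca cmp ph never_In(1,2)[OF l(1)] by (cases a) auto
    then have "l (Lit 0 False) = In" using max[OF complete_d_lab[OF co], of "Lit 0 False"] V_pos by auto
    with d show False ..
  qed
  then have dO: "l (Lit 0 False) = Out" using Lit_In[OF l(1) V_pos, of True] by simp
  have ph: "l (Ph v) \<noteq> In" if "v < V" for v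
    using Ph_eq[OF l(1) that] Ph_eq[OF l(1) V_pos] l(2) by simp
  have sf: "l (Sf v) \<noteq> Out" if "v < V" for v
    using complete_Out[OF l(1), of "Sf v"] attackers_Sf[OF that] that ph never_In(2)[OF l(1) that] by simp
  have litX: "X v" if "v < V" "l (Lit v b) = In" for v b
    using complete_In[OF l(1), of "Lit v b"] attackers_Lit[OF that(1)] that sf X0 by (cases "v = 0") auto
  define W where "W v \<longleftrightarrow> v = 0 \<or> l (Lit v True) = In" for v
  have "winning W"
  proof (rule ccontr)
    assume "\<not> winning W"
    then have "\<exists>U. (\<forall>v. v \<noteq> 0 \<and> X v \<longrightarrow> U v = W v) \<and> ((\<exists>c<V. \<not> sat PA c U) \<or> (\<forall>c<V. sat PB c U))"
      unfolding winning_def by blast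
    then obtain U' where U': "\<forall>v. v \<noteq> 0 \<and> X v \<longrightarrow> U' v = W v"
      "(\<exists>c<V. \<not> sat PA c U') \<or> (\<forall>c<V. sat PB c U')" by blast
    define U where "U = U'(0 := True)"
    have U: "U 0" "\<And>v. X v \<Longrightarrow> U v = W v" using U'(1) by (auto simp: U_def W_def)
    have "sat P c U = sat P c U'" for P c by (rule sat_cong) (simp add: U_def)
    then have cU: "complete (w_lab U)" using U(1) U'(2) by (intro complete_w_lab) auto
    have WL: "W v = b" if "v < V" "l (Lit v b) = In" for v b
      using that e dO Lit_In[OF l(1) that] by (cases b; cases "v = 0") (auto simp: W_def)
    have "w_lab U a = In" if a: "index a < V" "l a = In" for a
    proof (cases a)
      case (Lit v b)
      then show ?thesis using WL litX a U(2) by auto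
    next
      case (Cmp v b)
      then show ?thesis
        using complete_In[OF l(1), of "Cmp v b"] attackers_Cmp[of v] a never_In(3)[OF l(1)] e by (cases "X v") auto
    next
      case (Ca c)
      \<comment> \<open>All literals of an in-argument \<open>Ca c\<close> are out, whereas a
        literal that \<open>W\<close> makes true on X is never out; so \<open>U\<close> violates
        clause \<open>c\<close> as well.\<close>
      have "l (Lit v b) = Out" if "v < V" "0 < v" "PA c v b" for v b
        using complete_In[OF l(1), of "Ca c"] attackers_Ca that a Ca by simp
      moreover have "l (Lit v (W v)) \<noteq> Out" if "v < V" "0 < v" "X v" for v
        using complete_Out[OF l(1), of "Lit v (W v)"] attackers_Lit[OF that(1)] that d WL[OF that(1), of "\<not> W v"]
        by auto
      ultimately have "\<not> PA c v (U v)" if "v < V" "0 < v" for v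
        using PAX[of c v "U v"] U(2)[of v] that by fastforce
      then have "\<not> sat PA c U" unfolding sat_def by blast
      then show ?thesis using Ca by simp
    next
      case (Ph w)
      then show ?thesis using ph a by simp
    qed (use a never_In(1,2)[OF l(1)] in auto)
    then have "l (Ph 0) = In" using max[OF cU, of "Ph 0"] V_pos by simp
    with l(2) show False ..
  qed
  then show ?thesis by blast
qed

lemma finite_arguments: "finite (arguments V)"
proof -
  have "arguments V \<subseteq> case_prod Lit ` ({..<V} \<times> UNIV) \<union> case_prod Cmp ` ({..<V} \<times> UNIV) \<union>
      Ca ` {..<V} \<union> Cb ` {..<V} \<union> Ph ` {..<V} \<union> Sf ` {..<V}"
  proof
    fix a assume "a \<in> arguments V"
    then show "a \<in> case_prod Lit ` ({..<V} \<times> UNIV) \<union> case_prod Cmp ` ({..<V} \<times> UNIV) \<union>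
      Ca ` {..<V} \<union> Cb ` {..<V} \<union> Ph ` {..<V} \<union> Sf ` {..<V}"
      by (cases a) (auto simp: arguments_def image_iff)
  qed
  then show ?thesis by (rule finite_subset) auto
qed

text \<open>The companions \<^const>\<open>Cmp\<close> keep the range of a labelling from growing when the assignment of
  the X-variables changes.\<close>

lemma winning_preferred:
  assumes q: "quantified" and W: "winning W"
  shows "\<exists>l. sem_lab PR (arguments V) atk l \<and> sem_lab SST (arguments V) atk l \<and> l (Ph 0) \<noteq> In"
proof -
  have X0: "X 0" and co: "\<not> co" and PAX: "\<And>c v b. PA c v b \<Longrightarrow> X v" using q by (auto simp: quantified_def)
  define U where "U = W(0 := True)"
  have satU: "sat P c U = sat P c W" for P c by (rule sat_cong) (simp add: U_def)
  have satA: "sat PA c U" if "c < V" for c using W that by (simp add: winning_def satU)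
  have satB: "\<exists>c<V. \<not> sat PB c U'" if "\<forall>v. v \<noteq> 0 \<and> X v \<longrightarrow> U' v = W v" for U'
    using W that unfolding winning_def by blast
  obtain c where "c < V" "\<not> sat PB c U" using satB[of U] by (auto simp: U_def)
  then have cx: "complete (x_lab U)" using X0 PAX satA by (intro complete_x_lab) (auto simp: U_def)
  \<comment> \<open>Attention is confined to labellings that keep the choice on X; it is shown below
    that a better competitor also keeps it.\<close>
  define above where "above l \<longleftrightarrow> complete l \<and> (\<forall>v<V. X v \<longrightarrow> l (Lit v (U v)) = In)" for l
  define range where "range l = {a \<in> arguments V. l a \<noteq> Und}" for l
  define ins where "ins l = {a \<in> arguments V. l a = In}" for l
  let ?n = "card (arguments V)"
  \<comment> \<open>The lexicographic order by the sizes of the range and of the in-set, coded as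
    one number; the second size is at most \<open>?n\<close>.\<close>
  let ?f = "\<lambda>l. card (range l) * (?n + 1) + card (ins l)"
  have le: "card (range l) \<le> ?n" "card (ins l) \<le> ?n" for l
    using finite_arguments by (auto simp: range_def ins_def intro: card_mono)
  have "above (x_lab U)" using cx by (auto simp: above_def)
  moreover have "?f l < Suc (?n * (?n + 1) + ?n)" for l
    unfolding less_Suc_eq_le using le by (intro add_mono mult_le_mono1)
  ultimately have "\<exists>l. above l \<and> (\<forall>m. above m \<longrightarrow> ?f m \<le> ?f l)"
    by (intro ex_has_greatest_nat[of above "x_lab U" ?f]) auto
  then obtain l where l: "above l" "\<And>m. above m \<Longrightarrow> ?f m \<le> ?f l" by blast
  have lc: "complete l" using l(1) by (simp add: above_def)
  have lX: "l (Lit v (U v)) = In" if "v < V" "X v" for v using l(1) that by (simp add: above_def)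
  have no: "\<not> better SST (arguments V) l m" if m: "complete m" for m
  proof
    assume b: "better SST (arguments V) l m"
    \<comment> \<open>An inclusion of in-sets yields an inclusion of ranges, since the out-arguments
      are those attacked by in-arguments.\<close>
    have sub: "ins l \<subseteq> ins m \<Longrightarrow> range l \<subseteq> range m"
    proof
      fix a assume i: "ins l \<subseteq> ins m" and "a \<in> range l"
      then have a: "a \<in> arguments V" "l a = In \<or> l a = Out" by (cases "l a"; auto simp: range_def)+
      then have "m a = In \<or> m a = Out"
        using lc m a i unfolding complete_lab_def ins_def by blast
      then show "a \<in> range m" using a by (auto simp: range_def)
    qed
    have "ins l \<subset> ins m \<or> range l \<subset> range m"
      using b unfolding better_def range_def ins_def by auto
    \<comment> \<open>A competitor whose range is not smaller has to decide
      \<open>Cmp v (U v)\<close>. As this argument is never in, it is out, and so the literal chosen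
      by \<open>U\<close> is in.\<close>
    moreover have "above m" if r: "range l \<subseteq> range m"
      unfolding above_def
    proof (intro conjI allI impI)
      fix v assume v: "v < V" "X v"
      have "l (Cmp v (U v)) = Out"
        using complete_Out[OF lc, of "Cmp v (U v)"] attackers_Cmp[OF v(1)] v lX by auto
      then have "Cmp v (U v) \<in> range l" using v(1) by (simp add: range_def arguments_def)
      then have "Cmp v (U v) \<in> range m" using r by blast
      then have "m (Cmp v (U v)) = Out"
        using never_In(3)[OF m v] by (cases "m (Cmp v (U v))") (auto simp: range_def)
      then show "m (Lit v (U v)) = In"
        using complete_Out[OF m, of "Cmp v (U v)"] attackers_Cmp[OF v(1)] v never_In(3)[OF m v] by auto
    qed (rule m)
    ultimately have am: "above m" using sub by blast
    have fin: "finite (range m)" "finite (ins m)"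
      using finite_arguments by (auto simp: range_def ins_def)
    show False
    proof (cases "range l \<subset> range m")
      case True
      then have "card (range l) + 1 \<le> card (range m)" using psubset_card_mono[OF fin(1)] by (simp add: Suc_leI)
      then have "(card (range l) + 1) * (?n + 1) \<le> card (range m) * (?n + 1)" by (rule mult_le_mono1)
      then have "?f l < ?f m" using le(2)[of l] by simp
      then show False using l(2)[OF am] by simp
    next
      case False
      then have i: "ins l \<subset> ins m" using \<open>ins l \<subset> ins m \<or> range l \<subset> range m\<close> by blast
      then have "card (ins l) < card (ins m)" using fin psubset_card_mono by blast
      moreover have "range l = range m" using sub i False by blast
      ultimately show False using l(2)[OF am] by simp
    qed
  qed
  moreover have "\<not> better PR (arguments V) l m" if "complete m" for m
    using no[OF that] unfolding better_def by blast
  moreover have "l (Ph 0) \<noteq> In"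
  proof
    assume "l (Ph 0) = In"
    then have cb: "\<forall>c<V. l (Cb c) = Out" using Ph_eq[OF lc V_pos] by simp
    have "l (Lit 0 True) = In" using lX[OF V_pos X0] by (simp add: U_def)
    then have d: "l (Lit 0 False) \<noteq> In" using Lit_In[OF lc V_pos, of True] by simp
    have "l (Ca c) \<noteq> In" if c: "c < V" for c
    proof -
      obtain v where v: "v < V" "0 < v" "PA c v (U v)" using satA[OF c] by (auto simp: sat_def)
      then have "l (Lit v (U v)) = In" using lX PAX by blast
      then show ?thesis
        using complete_In[OF lc, of "Ca c"] attackers_Ca[of c] c v by fastforce
    qed
    then have "sat PB c (\<lambda>v. l (Lit v True) = In)" if "c < V" for c
      using sat_of_lab[OF lc d] cb that by blast
    moreover have "(l (Lit v True) = In) = W v" if "v < V" "v \<noteq> 0" "X v" for v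
      using lX[OF that(1,3)] that Lit_In[OF lc that(1), of False] by (cases "W v") (auto simp: U_def)
    \<comment> \<open>Labels say nothing about variables beyond \<open>V\<close>, while
      \<open>satB\<close> demands agreement on all X-variables; there the assignment is completed by
      \<open>W\<close>.\<close>
    then have "sat PB c (\<lambda>v. l (Lit v True) = In) =
        sat PB c (\<lambda>v. if v < V then l (Lit v True) = In else W v)" for c
      unfolding sat_def by auto
    moreover have "\<exists>c<V. \<not> sat PB c (\<lambda>v. if v < V then l (Lit v True) = In else W v)"
      using \<open>\<And>v. v < V \<Longrightarrow> v \<noteq> 0 \<Longrightarrow> X v \<Longrightarrow> (l (Lit v True) = In) = W v\<close> by (intro satB) auto
    ultimately show False by blast
  qed
  ultimately show ?thesis using lc unfolding sem_lab_def by blast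
qed

theorem preferred_counterfactual:
  assumes "quantified" "\<sigma> \<in> {PR, SST}"
  shows "sem_lab \<sigma> (arguments V) atk d_lab"
    and "(\<exists>l. sem_lab \<sigma> (arguments V) atk l \<and> d_lab (Ph 0) \<noteq> l (Ph 0)) \<longleftrightarrow> (\<exists>W. winning W)"
proof -
  show "sem_lab \<sigma> (arguments V) atk d_lab" using sem_d_lab[OF assms(1), of \<sigma>] assms(2) by auto
  show "(\<exists>l. sem_lab \<sigma> (arguments V) atk l \<and> d_lab (Ph 0) \<noteq> l (Ph 0)) \<longleftrightarrow> (\<exists>W. winning W)"
  proof
    assume "\<exists>l. sem_lab \<sigma> (arguments V) atk l \<and> d_lab (Ph 0) \<noteq> l (Ph 0)"
    then obtain l where l: "complete l" "l (Ph 0) \<noteq> In" "\<And>m. complete m \<Longrightarrow> \<not> better \<sigma> (arguments V) l m"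
      by (auto simp: sem_lab_def)
    show "\<exists>W. winning W"
    proof (rule preferred_winning[OF assms(1) l(1,2)])
      fix m a assume m: "complete m" "\<And>b. index b < V \<Longrightarrow> l b = In \<Longrightarrow> m b = In" "index a < V" "m a = In"
      then show "l a = In" using l(3)[OF m(1)] assms(2) unfolding better_def arguments_def by auto
    qed
  next
    assume "\<exists>W. winning W"
    then show "\<exists>l. sem_lab \<sigma> (arguments V) atk l \<and> d_lab (Ph 0) \<noteq> l (Ph 0)"
      using winning_preferred[OF assms(1)] assms(2) by (metis d_lab.simps(3) insertE singletonD)
  qed
qed

end

section \<open>The reduction\<close>

text \<open>Composition by way of a bounded quantifier: \<open>u\<close> is searched up to the value
  itself.\<close>

lemma polypred_subst:
  assumes P: "polypred (\<lambda>z e. P z (e 0))" and f: "polyfun f"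
  shows "polypred (\<lambda>z e. P z (f z e))"
proof (rule polypred_cong)
  have "polypred (\<lambda>z e. P z (e 0))" by (rule P)
  then show "polypred (\<lambda>z e. \<exists>u<Suc (f z e). u = f z e \<and> P z u)"
    by (intro polypred_Bex polyfun_intros polyfun_rename[OF f] f)
qed auto

lemma polypred_subst2:
  assumes P: "polypred (\<lambda>z e. P z (e 0) (e (Suc 0)))" and f: "polyfun f" and g: "polyfun g"
  shows "polypred (\<lambda>z e. P z (f z e) (g z e))"
proof (rule polypred_cong)
  have 1: "polypred (\<lambda>z e. P z (e (Suc 0)) (e 0))"
    using polyfun_rename[OF P[unfolded polypred_def], of "case_nat (Suc 0) (\<lambda>_. 0)"]
    by (simp add: polypred_def)
  have 2: "polyfun (\<lambda>z e. g z (\<lambda>i. e (Suc i)))" by (rule polyfun_rename[OF g])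
  show "polypred (\<lambda>z e. \<exists>u<Suc (f z e). u = f z e \<and> (\<exists>w<Suc (g z e). w = g z e \<and> P z u w))"
    by (intro polypred_Bex polypred_conj polypred_eq polyfun_Suc polyfun_var f 1 2
        polyfun_rename[OF f] polyfun_rename[OF 2])
qed auto

text \<open>With \<open>N\<close> arguments the reduction uses \<open>k = 2 ^ N\<close>: it exceeds
  every distance, and its binary form is a row of zeros closed by a single 1.\<close>

lemma binary_power: "binary (2 ^ n) = map (\<lambda>i. i = n) [0..<n + 1]"
proof -
  have "binary_value (map (\<lambda>i. i = n) [m..<n + 1]) = 2 ^ (n - m)" if "m \<le> n" for m
    using that
  proof (induction "n - m" arbitrary: m)
    case (Suc d)
    then have "[m..<n + 1] = m # [Suc m..<n + 1]" "m \<noteq> n" by (auto simp: upt_rec)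
    moreover have "n - m = Suc (n - Suc m)" using Suc by simp
    ultimately show ?case using Suc.hyps(1)[of "Suc m"] Suc.hyps(2) Suc.prems by simp
  qed simp
  then have "binary_value (map (\<lambda>i. i = n) [0..<n + 1]) = 2 ^ n" by simp
  moreover have "binary (binary_value (map (\<lambda>i. i = n) [0..<n + 1])) = map (\<lambda>i. i = n) [0..<n + 1]"
    by (rule binary_binary_value) simp
  ultimately show ?thesis by simp
qed

lemma instance_code_computable:
  assumes N: "polyfun (\<lambda>z e. N z)" and R: "polypred (\<lambda>z e. R z (e 0) (e (Suc 0)))"
    and l: "polypred (\<lambda>z e. l z (e 0) = In)" "polypred (\<lambda>z e. l z (e 0) = Out)"
  shows "poly_time_computable (\<lambda>z. instance_code (N z) (R z) g (2 ^ N z) (l z))"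
proof -
  let ?s = "\<lambda>z. lab_start (N z)"
  let ?m = "\<lambda>z. ?s z + 2 * N z"
  let ?b = "\<lambda>z i. if i < N z then True else if i < N z + 1 then False
      else if i < N z + 1 + N z * N z then R z ((i - (N z + 1)) div N z) ((i - (N z + 1)) mod N z)
      else if i < ?s z then i - (N z + 1 + N z * N z) = g
      else if (i - ?s z) mod 2 = 0 then l z ((i - ?s z) div 2) = In else l z ((i - ?s z) div 2) = Out"
  have "code_bit (N z) (R z) g (l z) i = ?b z i" for z i
    by (auto simp: code_bit_def mod_2_eq_odd)
  then have "instance_code (N z) (R z) g (2 ^ N z) (l z) =
      map (\<lambda>i. if i < ?m z then ?b z i else i - ?m z = N z) [0..<?m z + (N z + 1)]" for z
    unfolding instance_code_def binary_power append_map_upt by presburger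
  moreover have "poly_time_computable
      (\<lambda>z. map (\<lambda>i. if i < ?m z then ?b z i else i - ?m z = N z) [0..<?m z + (N z + 1)])"
    by (rule computable_I, unfold lab_start_def)
      (intro polyfun_intros N polypred_subst2[OF R] polypred_subst[OF l(1)] polypred_subst[OF l(2)])+
  ultimately show ?thesis by simp
qed

text \<open>Eight arguments share an index, which turns the kind and the index of an argument into a
  remainder and a quotient.\<close>

definition dec :: "nat \<Rightarrow> arg" where
  "dec i = (let v = i div 8; t = i mod 8 in
     if t = 0 then Lit v True else if t = 1 then Lit v False else if t = 2 then Cmp v True
     else if t = 3 then Cmp v False else if t = 4 then Ca v else if t = 5 then Cb v
     else if t = 6 then Ph v else Sf v)"

lemma mod_8_cases: "i mod 8 = 0 \<or> i mod 8 = 1 \<or> i mod 8 = 2 \<or> i mod 8 = 3 \<or> i mod 8 = 4 \<or>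
    i mod 8 = 5 \<or> i mod 8 = 6 \<or> i mod 8 = (7 :: nat)"
  by arith

lemma dec_simps:
  "i mod 8 = 0 \<Longrightarrow> dec i = Lit (i div 8) True" "i mod 8 = 1 \<Longrightarrow> dec i = Lit (i div 8) False"
  "i mod 8 = 2 \<Longrightarrow> dec i = Cmp (i div 8) True" "i mod 8 = 3 \<Longrightarrow> dec i = Cmp (i div 8) False"
  "i mod 8 = 4 \<Longrightarrow> dec i = Ca (i div 8)" "i mod 8 = 5 \<Longrightarrow> dec i = Cb (i div 8)"
  "i mod 8 = 6 \<Longrightarrow> dec i = Ph (i div 8)" "i mod 8 = 7 \<Longrightarrow> dec i = Sf (i div 8)"
  by (simp_all add: dec_def)

fun enc :: "arg \<Rightarrow> nat" where
  "enc (Lit v b) = 8 * v + (if b then 0 else 1)"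
| "enc (Cmp v b) = 8 * v + (if b then 2 else 3)"
| "enc (Ca v) = 8 * v + 4"
| "enc (Cb v) = 8 * v + 5"
| "enc (Ph v) = 8 * v + 6"
| "enc (Sf v) = 8 * v + 7"

lemma dec_enc: "dec (enc a) = a"
proof -
  have "(8 * v + t) div 8 = v \<and> (8 * v + t) mod 8 = t" if "t < 8" for v t :: nat using that by auto
  from this[of 1] this[of 2] this[of 3] show ?thesis
    by (cases a) (simp_all add: dec_def)
qed

lemma enc_dec: "enc (dec i) = i"
proof -
  have "8 * (i div 8) + i mod 8 = i" by simp
  then show ?thesis using mod_8_cases[of i] by (elim disjE) (simp_all add: dec_simps)
qed

lemma index_dec: "index (dec i) = i div 8"
  using mod_8_cases[of i] by (elim disjE) (simp_all add: dec_simps)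

lemma bij_dec: "bij_betw dec {..<8 * V} (arguments V)"
proof (rule bij_betw_byWitness[where f' = enc])
  show "\<forall>i\<in>{..<8 * V}. enc (dec i) = i" "\<forall>a\<in>arguments V. dec (enc a) = a"
    by (auto simp: enc_dec dec_enc)
  show "dec ` {..<8 * V} \<subseteq> arguments V" by (auto simp: arguments_def index_dec)
  show "enc ` arguments V \<subseteq> {..<8 * V}"
  proof
    fix i assume "i \<in> enc ` arguments V"
    then obtain a where "i = enc a" "index a < V" by (auto simp: arguments_def)
    then show "i \<in> {..<8 * V}" by (cases a) auto
  qed
qed

lemma cf_index_dec:
  assumes "g < 8 * V"
  shows "cf_index \<sigma> (8 * V) (\<lambda>i j. R (dec i) (dec j)) g (2 ^ (8 * V)) (\<lambda>i. l (dec i)) \<longleftrightarrow>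
    sem_lab \<sigma> (arguments V) R l \<and> (\<exists>m. sem_lab \<sigma> (arguments V) R m \<and> l (dec g) \<noteq> m (dec g))"
proof -
  let ?R = "\<lambda>i j. R (dec i) (dec j)"
  note t = sem_lab_transfer[OF bij_dec, of \<sigma> V R]
  have "card {i. i < 8 * V \<and> l (dec i) \<noteq> m i} \<le> 2 ^ (8 * V)" for m
  proof -
    have "card {i. i < 8 * V \<and> l (dec i) \<noteq> m i} \<le> card {..<8 * V}" by (rule card_mono) auto
    also have "\<dots> \<le> 2 ^ (8 * V)" using less_exp[of "8 * V"] by simp
    finally show ?thesis .
  qed
  then have "cf_index \<sigma> (8 * V) ?R g (2 ^ (8 * V)) (\<lambda>i. l (dec i)) \<longleftrightarrow>
      sem_lab \<sigma> (arguments V) R l \<and> (\<exists>m. sem_lab \<sigma> {..<8 * V} ?R m \<and> l (dec g) \<noteq> m g)"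
    unfolding cf_index_def using assms t[of l] by auto
  also have "(\<exists>m. sem_lab \<sigma> {..<8 * V} ?R m \<and> l (dec g) \<noteq> m g) \<longleftrightarrow>
      (\<exists>m. sem_lab \<sigma> (arguments V) R m \<and> l (dec g) \<noteq> m (dec g))"
  proof
    assume "\<exists>m. sem_lab \<sigma> {..<8 * V} ?R m \<and> l (dec g) \<noteq> m g"
    then obtain m where "sem_lab \<sigma> {..<8 * V} ?R (\<lambda>i. m (enc (dec i)))" "l (dec g) \<noteq> m (enc (dec g))"
      by (auto simp: enc_dec)
    then show "\<exists>m. sem_lab \<sigma> (arguments V) R m \<and> l (dec g) \<noteq> m (dec g)"
      using t[of "\<lambda>a. m (enc a)"] by blast
  next
    assume "\<exists>m. sem_lab \<sigma> (arguments V) R m \<and> l (dec g) \<noteq> m (dec g)"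
    then show "\<exists>m. sem_lab \<sigma> {..<8 * V} ?R m \<and> l (dec g) \<noteq> m g" using t by blast
  qed
  finally show ?thesis .
qed

fun tag :: "arg \<Rightarrow> nat" where
  "tag (Lit v b) = (if b then 0 else 1)" | "tag (Cmp v b) = (if b then 2 else 3)"
| "tag (Ca v) = 4" | "tag (Cb v) = 5" | "tag (Ph v) = 6" | "tag (Sf v) = 7"

lemma tag_dec: "tag (dec i) = i mod 8"
  using mod_8_cases[of i] by (elim disjE) (simp_all add: dec_simps)

text \<open>The attacks in terms of kinds and indices, that is, as a predicate to which the closure
  properties of \<open>polypred\<close> apply.\<close>

definition atk_code :: "bool \<Rightarrow> (nat \<Rightarrow> bool) \<Rightarrow> (nat \<Rightarrow> nat \<Rightarrow> bool \<Rightarrow> bool) \<Rightarrow> (nat \<Rightarrow> nat \<Rightarrow> bool \<Rightarrow> bool) \<Rightarrow>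
    nat \<Rightarrow> nat \<Rightarrow> nat \<Rightarrow> nat \<Rightarrow> bool" where
  "atk_code co X PA PB t v u w \<longleftrightarrow>
      t < 2 \<and> u < 2 \<and> (v = w \<and> t \<noteq> u \<or> v = 0 \<and> t = 1 \<and> (w \<noteq> 0 \<or> co \<and> u = 1)) \<or>
      t < 2 \<and> (u = 2 \<or> u = 3) \<and> (if X w then v = w \<and> u = t + 2 else v = 0) \<or>
      t < 2 \<and> u = 4 \<and> (if v = 0 then t = 1 else if t = 0 then PA w v True else PA w v False) \<or>
      t < 2 \<and> u = 5 \<and> (if v = 0 then t = 1 else if t = 0 then PB w v True else PB w v False) \<or>
      (t = 2 \<or> t = 3) \<and> u = t \<and> v = w \<and> X w \<or>
      t = 4 \<and> u = 5 \<or> t = 5 \<and> u = 5 \<and> v = w \<or> t = 5 \<and> u = 6 \<or> t = 6 \<and> u = 7 \<and> v = w \<or>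
      t = 7 \<and> u = 7 \<and> v = w \<or> t = 7 \<and> u < 2 \<and> v = w \<and> w \<noteq> 0 \<and> \<not> X w"

lemma atk_code: "gadget.atk co X PA PB a b \<longleftrightarrow> atk_code co X PA PB (tag a) (index a) (tag b) (index b)"
proof -
  have g: "gadget (Suc 0)" by unfold_locales simp
  note a = gadget.atk.simps[OF g]
  show ?thesis
    by (cases a; cases b; auto simp: a atk_code_def)
qed

lemma d_lab_dec:
  "gadget.d_lab X (dec i) = In \<longleftrightarrow> i mod 8 = 1 \<and> i div 8 = 0 \<or> i mod 8 = 6"
  "gadget.d_lab X (dec i) = Out \<longleftrightarrow> \<not> (i mod 8 = 1 \<and> i div 8 = 0 \<or> i mod 8 = 6) \<and>
     \<not> ((i mod 8 = 2 \<or> i mod 8 = 3) \<and> X (i div 8) \<and> (i div 8 \<noteq> 0 \<or> i mod 8 = 2))"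
proof -
  have g: "gadget (Suc 0)" by unfold_locales simp
  note a = gadget.d_lab.simps[OF g]
  show "gadget.d_lab X (dec i) = In \<longleftrightarrow> i mod 8 = 1 \<and> i div 8 = 0 \<or> i mod 8 = 6"
    "gadget.d_lab X (dec i) = Out \<longleftrightarrow> \<not> (i mod 8 = 1 \<and> i div 8 = 0 \<or> i mod 8 = 6) \<and>
     \<not> ((i mod 8 = 2 \<or> i mod 8 = 3) \<and> X (i div 8) \<and> (i div 8 \<noteq> 0 \<or> i mod 8 = 2))"
    using mod_8_cases[of i] by (elim disjE; simp add: dec_simps a)+
qed

lemma gadget_computable:
  assumes V: "polyfun (\<lambda>z e. V z)" and X: "polypred (\<lambda>z e. X z (e 0))"
    and P: "\<And>b. polypred (\<lambda>z e. PA z (e 0) (e (Suc 0)) b)" "\<And>b. polypred (\<lambda>z e. PB z (e 0) (e (Suc 0)) b)"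
    and l: "polypred (\<lambda>z e. l z (dec (e 0)) = In)" "polypred (\<lambda>z e. l z (dec (e 0)) = Out)"
  shows "poly_time_computable (\<lambda>z. instance_code (8 * V z)
    (\<lambda>i j. gadget.atk co (X z) (PA z) (PB z) (dec i) (dec j)) g (2 ^ (8 * V z)) (\<lambda>i. l z (dec i)))"
proof (rule instance_code_computable)
  show "polyfun (\<lambda>z e. 8 * V z)" by (intro polyfun_intros V)
  show "polypred (\<lambda>z e. gadget.atk co (X z) (PA z) (PB z) (dec (e 0)) (dec (e (Suc 0))))"
    unfolding atk_code tag_dec index_dec atk_code_def
    by (intro polyfun_intros polypred_subst[OF X] polypred_subst2[OF P(1)] polypred_subst2[OF P(2)])
qed (use l in auto)

definition cnf :: "(bool list \<Rightarrow> (nat \<Rightarrow> bool) \<Rightarrow> bool) \<Rightarrow> bool" where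
  "cnf \<Phi> \<longleftrightarrow> (\<exists>C N pos neg. polyfun (\<lambda>z e. C z) \<and> polyfun (\<lambda>z e. N z) \<and>
     polypred (\<lambda>z e. pos z (e 0) (e (Suc 0))) \<and> polypred (\<lambda>z e. neg z (e 0) (e (Suc 0))) \<and>
     (\<forall>z W. \<Phi> z W \<longleftrightarrow> (\<forall>c<C z. \<exists>v<N z. pos z c v \<and> W v \<or> neg z c v \<and> \<not> W v)))"

text \<open>Clause c of a family of C clauses in N variables, as a set of literals (v, b). Variable v of the
  family becomes variable \<^term>\<open>Suc v\<close> of the gadget.\<close>

definition shifted :: "nat \<Rightarrow> nat \<Rightarrow> (nat \<Rightarrow> nat \<Rightarrow> bool) \<Rightarrow> (nat \<Rightarrow> nat \<Rightarrow> bool) \<Rightarrow> (nat \<Rightarrow> bool) \<Rightarrow>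
    nat \<Rightarrow> nat \<Rightarrow> bool \<Rightarrow> bool" where
  "shifted C N pos neg X c v b \<longleftrightarrow> (if c < C then 0 < v \<and> v - 1 < N \<and> (if b then pos c (v - 1) else neg c (v - 1)) else X v)"

lemma polypred_shifted:
  assumes "polyfun (\<lambda>z e. C z)" "polyfun (\<lambda>z e. N z)" "polypred (\<lambda>z e. pos z (e 0) (e (Suc 0)))"
    "polypred (\<lambda>z e. neg z (e 0) (e (Suc 0)))" "polypred (\<lambda>z e. X z (e 0))"
  shows "polypred (\<lambda>z e. shifted (C z) (N z) (pos z) (neg z) (X z) (e 0) (e (Suc 0)) b)"
  unfolding shifted_def
  by (intro polyfun_intros assms(1,2) polypred_subst2[OF assms(3)] polypred_subst2[OF assms(4)]
      polypred_subst[OF assms(5)])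

text \<open>Clause numbers from \<open>C\<close> on only fill up the family. Such a clause contains
  both literals of each X-variable and is therefore true under every assignment, provided that some
  X-variable other than the switch exists.\<close>

lemma sat_shifted:
  assumes "gadget V" "N + 1 < V"
  shows "gadget.sat V (shifted C N pos neg X) c W \<longleftrightarrow>
    (if c < C then \<exists>v<N. pos c v \<and> W (Suc v) \<or> neg c v \<and> \<not> W (Suc v) else \<exists>v<V. 0 < v \<and> X v)"
proof (cases "c < C")
  case True
  have "(\<exists>v<V. 0 < v \<and> v - 1 < N \<and> (if W v then pos c (v - 1) else neg c (v - 1))) \<longleftrightarrow>
      (\<exists>v<N. if W (Suc v) then pos c v else neg c v)"
  proof
    assume "\<exists>v<V. 0 < v \<and> v - 1 < N \<and> (if W v then pos c (v - 1) else neg c (v - 1))"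
    then obtain v where "0 < v" "v - 1 < N" "if W v then pos c (v - 1) else neg c (v - 1)" by blast
    then show "\<exists>v<N. if W (Suc v) then pos c v else neg c v" by (intro exI[of _ "v - 1"]) simp
  next
    assume "\<exists>v<N. if W (Suc v) then pos c v else neg c v"
    then obtain v where "v < N" "if W (Suc v) then pos c v else neg c v" by blast
    then show "\<exists>v<V. 0 < v \<and> v - 1 < N \<and> (if W v then pos c (v - 1) else neg c (v - 1))"
      using assms(2) by (intro exI[of _ "Suc v"]) simp
  qed
  then show ?thesis using True by (auto simp: gadget.sat_def[OF assms(1)] shifted_def)
qed (auto simp: gadget.sat_def[OF assms(1)] shifted_def)

theorem NP_hardness:
  assumes cnf: "cnf \<Phi>" and L: "\<And>x. x \<in> L \<longleftrightarrow> (\<exists>W. \<Phi> x W)" and \<sigma>: "\<sigma> \<in> {CO, ST}"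
  shows "poly_time_reducible L (CF_EX \<sigma>)"
proof -
  obtain C N pos neg where poly: "polyfun (\<lambda>z e. C z)" "polyfun (\<lambda>z e. N z)"
      "polypred (\<lambda>z e. pos z (e 0) (e (Suc 0)))" "polypred (\<lambda>z e. neg z (e 0) (e (Suc 0)))"
    and \<Phi>: "\<And>z W. \<Phi> z W \<longleftrightarrow> (\<forall>c<C z. \<exists>v<N z. pos z c v \<and> W v \<or> neg z c v \<and> \<not> W v)"
    using cnf unfolding cnf_def by blast
  define V where "V z = C z + N z + 2" for z
  define PA where "PA = (\<lambda>(z :: bool list) (c :: nat) (v :: nat) (b :: bool). True)"
  define PB where "PB z = shifted (C z) (N z) (pos z) (neg z) (\<lambda>_. True)" for z
  define X where "X z v \<longleftrightarrow> False" for z :: "bool list" and v :: nat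
  have V: "polyfun (\<lambda>z e. V z)" unfolding V_def by (intro polyfun_intros poly)
  have g: "gadget (V z)" for z by unfold_locales (simp add: V_def)
  have polyX: "polypred (\<lambda>z e. X z (e 0))" unfolding X_def by (rule polypred_const)
  have polyP: "polypred (\<lambda>z e. PA z (e 0) (e (Suc 0)) b)" "polypred (\<lambda>z e. PB z (e 0) (e (Suc 0)) b)" for b
    unfolding PA_def PB_def by (intro polypred_const polypred_shifted poly)+
  have sat: "(\<exists>W. \<forall>c<V z. gadget.sat (V z) (PB z) c W) \<longleftrightarrow> z \<in> L" for z
  proof -
    have "(\<forall>c<V z. gadget.sat (V z) (PB z) c W) \<longleftrightarrow> \<Phi> z (\<lambda>v. W (Suc v))" for W
      unfolding PB_def \<Phi> using sat_shifted[OF g, of "N z" z "C z"] by (auto simp: V_def)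
    moreover have "\<exists>W. \<Phi> z (\<lambda>v. W (Suc v))" if "\<Phi> z U" for U
      using that by (intro exI[of _ "\<lambda>v. U (v - 1)"]) simp
    ultimately show ?thesis unfolding L by blast
  qed
  have triv: "gadget.trivial (X z) (PA z) (V z)" for z
    unfolding gadget.trivial_def[OF g] by (auto simp: X_def PA_def V_def)
  show ?thesis
  proof (cases "\<sigma> = CO")
    case True
    \<comment> \<open>Argument number 6 is \<open>Ph 0\<close>, the goal.\<close>
    let ?f = "\<lambda>z. instance_code (8 * V z) (\<lambda>i j. gadget.atk True (X z) (PA z) (PB z) (dec i) (dec j)) 6
      (2 ^ (8 * V z)) (\<lambda>i. gadget.all_und (dec i))"
    have "poly_time_computable ?f"
      by (rule gadget_computable[OF V polyX polyP])
        (simp_all add: gadget.all_und_def[OF g] polypred_const)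
    moreover have "z \<in> L \<longleftrightarrow> ?f z \<in> CF_EX \<sigma>" for z
    proof -
      have "6 < 8 * V z" "dec 6 = Ph 0" by (simp_all add: V_def dec_simps)
      then show ?thesis
        unfolding CF_EX_code[OF \<open>6 < 8 * V z\<close>] cf_index_dec[OF \<open>6 < 8 * V z\<close>] True
        using gadget.complete_counterfactual[OF g triv[of z] TrueI, of "PB z"] sat[of z] by simp
    qed
    ultimately show ?thesis unfolding poly_time_reducible_def by blast
  next
    case False
    then have ST: "\<sigma> = ST" using \<sigma> by simp
    \<comment> \<open>Argument number 0 is \<open>Lit 0 True\<close>, the goal.\<close>
    let ?f = "\<lambda>z. instance_code (8 * V z) (\<lambda>i j. gadget.atk False (X z) (PA z) (PB z) (dec i) (dec j)) 0
      (2 ^ (8 * V z)) (\<lambda>i. gadget.d_lab (X z) (dec i))"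
    have "poly_time_computable ?f"
      by (rule gadget_computable[OF V polyX polyP], unfold d_lab_dec)
        (intro polyfun_intros polypred_subst[OF polyX])+
    moreover have "z \<in> L \<longleftrightarrow> ?f z \<in> CF_EX \<sigma>" for z
    proof -
      have "0 < 8 * V z" "dec 0 = Lit 0 True" by (simp_all add: V_def dec_simps)
      then show ?thesis
        unfolding CF_EX_code[OF \<open>0 < 8 * V z\<close>] cf_index_dec[OF \<open>0 < 8 * V z\<close>] ST
        using gadget.stable_counterfactual[OF g[of z] triv[of z], of False "PB z"] sat[of z] by simp
    qed
    ultimately show ?thesis unfolding poly_time_reducible_def by blast
  qed
qed

text \<open>The variables in \<open>Q\<close> are those that the existential player fixes. The truth
  of \<open>\<Phi>\<close> depends on them only, but its clauses may mention others, which the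
  framework does not admit; hence the clauses are rewritten first.\<close>

theorem Sigma2p_hardness:
  assumes cnf: "cnf \<Phi>" "cnf \<Psi>" and Q: "polypred (\<lambda>z e. Q z (e 0))" "\<And>z. Q z 0"
    and dep: "\<And>z W W'. (\<And>v. Q z v \<Longrightarrow> W v = W' v) \<Longrightarrow> \<Phi> z W \<Longrightarrow> \<Phi> z W'"
    and L: "\<And>x. x \<in> L \<longleftrightarrow> (\<exists>W. \<Phi> x W \<and> (\<forall>W'. (\<forall>v. Q x v \<longrightarrow> W' v = W v) \<longrightarrow> \<not> \<Psi> x W'))"
    and \<sigma>: "\<sigma> \<in> {PR, SST}"
  shows "poly_time_reducible L (CF_EX \<sigma>)"
proof -
  obtain C N pos' neg' where poly: "polyfun (\<lambda>z e. C z)" "polyfun (\<lambda>z e. N z)"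
      and poly': "polypred (\<lambda>z e. pos' z (e 0) (e (Suc 0)))" "polypred (\<lambda>z e. neg' z (e 0) (e (Suc 0)))"
    and \<Phi>': "\<And>z W. \<Phi> z W \<longleftrightarrow> (\<forall>c<C z. \<exists>v<N z. pos' z c v \<and> W v \<or> neg' z c v \<and> \<not> W v)"
    using cnf(1) unfolding cnf_def by blast
  obtain D M p n where polyD: "polyfun (\<lambda>z e. D z)" "polyfun (\<lambda>z e. M z)"
      "polypred (\<lambda>z e. p z (e 0) (e (Suc 0)))" "polypred (\<lambda>z e. n z (e 0) (e (Suc 0)))"
    and \<Psi>: "\<And>z W. \<Psi> z W \<longleftrightarrow> (\<forall>c<D z. \<exists>v<M z. p z c v \<and> W v \<or> n z c v \<and> \<not> W v)"
    using cnf(2) unfolding cnf_def by blast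
  \<comment> \<open>Drop the variables outside Q from the clauses of \<open>\<Phi>\<close>, keeping tautologies true.\<close>
  define pos where "pos z c v \<longleftrightarrow> Q z v \<and> pos' z c v \<or> v = 0 \<and> (\<exists>u<N z. pos' z c u \<and> neg' z c u)" for z c v
  define neg where "neg z c v \<longleftrightarrow> Q z v \<and> neg' z c v \<or> v = 0 \<and> (\<exists>u<N z. pos' z c u \<and> neg' z c u)" for z c v
  have polyC: "polypred (\<lambda>z e. pos z (e 0) (e (Suc 0)))" "polypred (\<lambda>z e. neg z (e 0) (e (Suc 0)))"
    unfolding pos_def neg_def
    by (intro polyfun_intros poly polypred_subst2[OF poly'(1)] polypred_subst2[OF poly'(2)] polypred_subst[OF Q(1)])+
  have \<Phi>: "\<Phi> z W \<longleftrightarrow> (\<forall>c<C z. \<exists>v<N z. pos z c v \<and> W v \<or> neg z c v \<and> \<not> W v)" for z W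
  proof
    assume W: "\<Phi> z W"
    show "\<forall>c<C z. \<exists>v<N z. pos z c v \<and> W v \<or> neg z c v \<and> \<not> W v"
    proof (intro allI impI)
      fix c assume c: "c < C z"
      \<comment> \<open>Outside \<open>Q\<close> this assignment makes every literal of clause
        \<open>c\<close> false, except where both literals of a variable occur. A true literal
        outside \<open>Q\<close> therefore exposes a tautology.\<close>
      have "\<Phi> z (\<lambda>v. if Q z v then W v else neg' z c v)" by (rule dep[OF _ W]) simp
      then obtain v where v: "v < N z" "if Q z v then pos' z c v \<and> W v \<or> neg' z c v \<and> \<not> W v
          else pos' z c v \<and> neg' z c v"
        unfolding \<Phi>' using c by (fastforce split: if_splits)
      show "\<exists>v<N z. pos z c v \<and> W v \<or> neg z c v \<and> \<not> W v"
      proof (cases "Q z v")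
        case True
        then show ?thesis using v unfolding pos_def neg_def by auto
      next
        case False
        then have "pos z c 0" "neg z c 0" "0 < N z" using v by (auto simp: pos_def neg_def)
        then show ?thesis by blast
      qed
    qed
  next
    assume r: "\<forall>c<C z. \<exists>v<N z. pos z c v \<and> W v \<or> neg z c v \<and> \<not> W v"
    show "\<Phi> z W"
      unfolding \<Phi>'
    proof (intro allI impI)
      fix c assume "c < C z"
      then obtain v where "v < N z" "pos z c v \<and> W v \<or> neg z c v \<and> \<not> W v" using r by blast
      then show "\<exists>v<N z. pos' z c v \<and> W v \<or> neg' z c v \<and> \<not> W v"
        unfolding pos_def neg_def by blast
    qed
  qed
  define V where "V z = C z + N z + D z + M z + 2" for z
  define X where "X z v \<longleftrightarrow> v = 0 \<or> Q z (v - 1)" for z v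
  define PA where "PA z = shifted (C z) (N z) (pos z) (neg z) (X z)" for z
  define PB where "PB z = shifted (D z) (M z) (p z) (n z) (\<lambda>_. True)" for z
  have V: "polyfun (\<lambda>z e. V z)" unfolding V_def by (intro polyfun_intros poly polyD)
  have g: "gadget (V z)" for z by unfold_locales (simp add: V_def)
  have polyX: "polypred (\<lambda>z e. X z (e 0))" unfolding X_def by (intro polyfun_intros polypred_subst[OF Q(1)])
  have polyP: "polypred (\<lambda>z e. PA z (e 0) (e (Suc 0)) b)" "polypred (\<lambda>z e. PB z (e 0) (e (Suc 0)) b)" for b
    unfolding PA_def PB_def by (intro polypred_const polypred_shifted poly polyC polyX polyD)+
  have X1: "X z (Suc 0)" for z by (simp add: X_def Q)
  have A: "(\<forall>c<V z. gadget.sat (V z) (PA z) c W) \<longleftrightarrow> \<Phi> z (\<lambda>v. W (Suc v))" for z W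
  proof -
    have "N z + 1 < V z" by (simp add: V_def)
    moreover have "\<exists>v<V z. 0 < v \<and> X z v" using X1[of z] by (intro exI[of _ "Suc 0"]) (simp add: V_def)
    ultimately show ?thesis
      unfolding PA_def \<Phi> using sat_shifted[OF g, of "N z" z "C z"] by (auto simp: V_def)
  qed
  have B: "(\<forall>c<V z. gadget.sat (V z) (PB z) c W) \<longleftrightarrow> \<Psi> z (\<lambda>v. W (Suc v))" for z W
    unfolding PB_def \<Psi> using sat_shifted[OF g, of "M z" z "D z"] by (auto simp: V_def)
  have quant: "gadget.quantified False (X z) (PA z)" for z
    using Q(2) by (auto simp: gadget.quantified_def[OF g] X_def PA_def shifted_def pos_def neg_def)
  have win: "(\<exists>W. gadget.winning (X z) (PA z) (PB z) (V z) W) \<longleftrightarrow> z \<in> L" for z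
  proof
    assume "\<exists>W. gadget.winning (X z) (PA z) (PB z) (V z) W"
    then obtain W where W: "\<Phi> z (\<lambda>v. W (Suc v))"
      "\<And>W'. \<forall>v. v \<noteq> 0 \<and> X z v \<longrightarrow> W' v = W v \<Longrightarrow> \<not> \<Psi> z (\<lambda>v. W' (Suc v))"
      unfolding gadget.winning_def[OF g[of z]] A by (metis B)
    have "\<not> \<Psi> z W'" if "\<forall>v. Q z v \<longrightarrow> W' v = W (Suc v)" for W'
    proof -
      have "W' (v - 1) = W v" if "v \<noteq> 0 \<and> X z v" for v
        using that \<open>\<forall>v. Q z v \<longrightarrow> W' v = W (Suc v)\<close> by (cases v) (auto simp: X_def)
      then show ?thesis using W(2)[of "\<lambda>v. W' (v - 1)"] by simp
    qed
    then show "z \<in> L" unfolding L using W(1) by blast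
  next
    assume "z \<in> L"
    then obtain W where W: "\<Phi> z W" "\<And>W'. \<forall>v. Q z v \<longrightarrow> W' v = W v \<Longrightarrow> \<not> \<Psi> z W'"
      unfolding L by blast
    have "gadget.winning (X z) (PA z) (PB z) (V z) (\<lambda>v. W (v - 1))"
      unfolding gadget.winning_def[OF g]
    proof (intro conjI allI impI)
      show "gadget.sat (V z) (PA z) c (\<lambda>v. W (v - 1))" if "c < V z" for c
        using A[of z "\<lambda>v. W (v - 1)"] W(1) that by simp
      fix W' assume "\<forall>v. v \<noteq> 0 \<and> X z v \<longrightarrow> W' v = W (v - 1)"
      then have "\<forall>v. Q z v \<longrightarrow> W' (Suc v) = W v" by (auto simp: X_def)
      then have "\<not> \<Psi> z (\<lambda>v. W' (Suc v))" by (rule W(2))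
      then show "\<exists>c<V z. \<not> gadget.sat (V z) (PB z) c W'" using B[of z W'] by blast
    qed
    then show "\<exists>W. gadget.winning (X z) (PA z) (PB z) (V z) W" by blast
  qed
  let ?f = "\<lambda>z. instance_code (8 * V z) (\<lambda>i j. gadget.atk False (X z) (PA z) (PB z) (dec i) (dec j)) 6
    (2 ^ (8 * V z)) (\<lambda>i. gadget.d_lab (X z) (dec i))"
  have "poly_time_computable ?f"
    by (rule gadget_computable[OF V polyX polyP], unfold d_lab_dec)
      (intro polyfun_intros polypred_subst[OF polyX])+
  moreover have "z \<in> L \<longleftrightarrow> ?f z \<in> CF_EX \<sigma>" for z
  proof -
    have "6 < 8 * V z" "dec 6 = Ph 0" by (simp_all add: V_def dec_simps)
    then show ?thesis
      unfolding CF_EX_code[OF \<open>6 < 8 * V z\<close>] cf_index_dec[OF \<open>6 < 8 * V z\<close>]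
      using gadget.preferred_counterfactual[OF g[of z] quant[of z] \<sigma>, of "PB z"] win[of z] by simp
  qed
  ultimately show ?thesis unfolding poly_time_reducible_def by blast
qed

section \<open>Closure properties of clause families\<close>

abbreviation push :: "nat \<Rightarrow> (nat \<Rightarrow> nat) \<Rightarrow> nat \<Rightarrow> nat" (infixr "##" 65) where
  "u ## e \<equiv> case_nat u e"

lemma push_eta: "e 0 ## (\<lambda>i. e (Suc i)) = e"
  by (auto simp: fun_eq_iff split: nat.split)

lemma polypred_rename:
  assumes "polypred P" "\<And>z e. Q z e = P z (\<lambda>i. e (g i))"
  shows "polypred Q"
proof -
  have "Q = (\<lambda>z e. P z (\<lambda>i. e (g i)))" by (simp add: fun_eq_iff assms(2))
  then show ?thesis using polyfun_rename[OF assms(1)[unfolded polypred_def], of g] by (simp add: polypred_def)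
qed

lemma polypred_push:
  assumes P: "polypred P" and f: "polyfun f"
  shows "polypred (\<lambda>z e. P z (f z e ## e))"
proof (rule polypred_cong)
  show "polypred (\<lambda>z e. \<exists>u<Suc (f z e). u = f z e \<and> P z (u ## e))"
    by (intro polyfun_intros f polyfun_rename[OF f]) (simp add: push_eta P)
qed auto

lemma bounded_fun_push:
  assumes B: "bounded_fun B" and t: "bounded_fun t"
  obtains B' where "bounded_fun B'" "\<And>z e u. u < t z e \<Longrightarrow> B z (u ## e) \<le> B' z e"
proof
  show "bounded_fun (\<lambda>z e. \<Sum>u<t z e. B z (u ## e))"
    unfolding bounded_fun_def
  proof (intro allI impI)
    fix b assume b: "pbounded b"
    obtain d where d: "pbounded d" "\<forall>z e. (\<forall>i. e i \<le> b (length z)) \<longrightarrow> t z e \<le> d (length z)"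
      using t b by (rule bounded_funD)
    obtain D where D: "pbounded D"
      "\<forall>z e. (\<forall>i. e i \<le> b (length z) + d (length z)) \<longrightarrow> B z e \<le> D (length z)"
      using B pbounded_add[OF b d(1)] by (rule bounded_funD)
    have "(\<Sum>u<t z e. B z (u ## e)) \<le> d (length z) * D (length z)" if e: "\<forall>i. e i \<le> b (length z)" for z e
    proof -
      have td: "t z e \<le> d (length z)" using d(2) e by blast
      have "B z (u ## e) \<le> D (length z)" if "u < t z e" for u
        using D(2)[rule_format, of "u ## e" z] e that td by (auto simp: trans_le_add1 trans_le_add2 split: nat.split)
      then have "(\<Sum>u<t z e. B z (u ## e)) \<le> t z e * D (length z)"
        using sum_bounded_above[of "{..<t z e}" "\<lambda>u. B z (u ## e)" "D (length z)"] by simp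
      also have "\<dots> \<le> d (length z) * D (length z)" using td by simp
      finally show ?thesis .
    qed
    then show "\<exists>D. pbounded D \<and> (\<forall>z e. (\<forall>i. e i \<le> b (length z)) \<longrightarrow> (\<Sum>u<t z e. B z (u ## e)) \<le> D (length z))"
      using pbounded_mult[OF d(1) D(1)] by blast
  qed
  show "B z (u ## e) \<le> (\<Sum>u<t z e. B z (u ## e))" if "u < t z e" for z e u
    using that by (intro member_le_sum) auto
qed

text \<open>The value lies between the squares of \<open>a + b\<close> and \<open>a + b + 1\<close>,
  hence the pairing is injective. It is a polynomial, so it stays within \<open>polyfun\<close>, and
  it dominates both components, so decoding is a bounded search.\<close>

definition pair :: "nat \<Rightarrow> nat \<Rightarrow> nat" where
  "pair a b = (a + b) * (a + b) + a"

lemma pair_eq: "pair a b = pair c d \<longleftrightarrow> a = c \<and> b = d"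
proof
  assume eq: "pair a b = pair c d"
  have lt: "pair a b < pair c d" if "a + b < c + d" for a b c d
  proof -
    have "(a + b) * (a + b) + a < (a + b + 1) * (a + b + 1)" by (simp add: algebra_simps)
    also have "\<dots> \<le> (c + d) * (c + d)" using that by (intro mult_le_mono) auto
    finally show ?thesis by (simp add: pair_def)
  qed
  have "a + b = c + d" using lt[of a b c d] lt[of c d a b] eq by linarith
  then show "a = c \<and> b = d" using eq by (auto simp: pair_def)
qed auto

lemma le_pair: "a \<le> pair a b" "b \<le> pair a b"
proof -
  have "a + b \<le> (a + b) * (a + b)" by (rule le_square)
  then show "a \<le> pair a b" "b \<le> pair a b" unfolding pair_def by linarith+
qed

lemma polyfun_pair: "polyfun f \<Longrightarrow> polyfun g \<Longrightarrow> polyfun (\<lambda>z e. pair (f z e) (g z e))"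
  unfolding pair_def by (intro polyfun_intros)

text \<open>The clause with index c is present if \<open>on z (c ## e)\<close>, and then contains the literals given by
  \<open>pos z (c ## v ## e)\<close> and \<open>neg z (c ## v ## e)\<close>.\<close>

definition clausal :: "bool wfun \<Rightarrow> bool wfun \<Rightarrow> bool wfun \<Rightarrow> nat wfun \<Rightarrow>
    (bool list \<Rightarrow> (nat \<Rightarrow> nat) \<Rightarrow> (nat \<Rightarrow> bool) \<Rightarrow> bool) \<Rightarrow> bool" where
  "clausal on pos neg B \<Phi> \<longleftrightarrow> polypred on \<and> polypred pos \<and> polypred neg \<and> bounded_fun B \<and>
     (\<forall>z e c. on z (c ## e) \<longrightarrow> c \<le> B z e) \<and>
     (\<forall>z e c v. on z (c ## e) \<longrightarrow> pos z (c ## v ## e) \<or> neg z (c ## v ## e) \<longrightarrow> v \<le> B z e) \<and>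
     (\<forall>z e W. \<Phi> z e W \<longleftrightarrow>
       (\<forall>c. on z (c ## e) \<longrightarrow> (\<exists>v. pos z (c ## v ## e) \<and> W v \<or> neg z (c ## v ## e) \<and> \<not> W v)))"

definition cnf_fun :: "(bool list \<Rightarrow> (nat \<Rightarrow> nat) \<Rightarrow> (nat \<Rightarrow> bool) \<Rightarrow> bool) \<Rightarrow> bool" where
  "cnf_fun \<Phi> \<longleftrightarrow> (\<exists>on pos neg B. clausal on pos neg B \<Phi>)"

lemma cnf_funI:
  assumes "polypred on" "polypred pos" "polypred neg" "bounded_fun B"
    and "\<And>z e c. on z (c ## e) \<Longrightarrow> c \<le> B z e"
    and "\<And>z e c v. on z (c ## e) \<Longrightarrow> pos z (c ## v ## e) \<or> neg z (c ## v ## e) \<Longrightarrow> v \<le> B z e"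
    and "\<And>z e W. \<Phi> z e W \<longleftrightarrow>
      (\<forall>c. on z (c ## e) \<longrightarrow> (\<exists>v. pos z (c ## v ## e) \<and> W v \<or> neg z (c ## v ## e) \<and> \<not> W v))"
  shows "cnf_fun \<Phi>"
  unfolding cnf_fun_def clausal_def
  by (rule exI[of _ on], rule exI[of _ pos], rule exI[of _ neg], rule exI[of _ B])
    (intro conjI allI impI assms; assumption)

lemma clausalD:
  assumes "clausal on pos neg B \<Phi>"
  shows "polypred on" "polypred pos" "polypred neg" "bounded_fun B"
    and "on z (c ## e) \<Longrightarrow> c \<le> B z e"
    and "on z (c ## e) \<Longrightarrow> pos z (c ## v ## e) \<Longrightarrow> v \<le> B z e"
    and "on z (c ## e) \<Longrightarrow> neg z (c ## v ## e) \<Longrightarrow> v \<le> B z e"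
    and "\<Phi> z e W \<longleftrightarrow>
      (\<forall>c. on z (c ## e) \<longrightarrow> (\<exists>v. pos z (c ## v ## e) \<and> W v \<or> neg z (c ## v ## e) \<and> \<not> W v))"
proof -
  note * = assms[unfolded clausal_def]
  show "polypred on" "polypred pos" "polypred neg" "bounded_fun B"
    by (rule *[THEN conjunct1] *[THEN conjunct2, THEN conjunct1] *[THEN conjunct2, THEN conjunct2, THEN conjunct1]
      *[THEN conjunct2, THEN conjunct2, THEN conjunct2, THEN conjunct1])+
  note * = *[THEN conjunct2, THEN conjunct2, THEN conjunct2, THEN conjunct2]
  show "on z (c ## e) \<Longrightarrow> c \<le> B z e" using *[THEN conjunct1] by blast
  note * = *[THEN conjunct2]
  show "on z (c ## e) \<Longrightarrow> pos z (c ## v ## e) \<Longrightarrow> v \<le> B z e"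
    "on z (c ## e) \<Longrightarrow> neg z (c ## v ## e) \<Longrightarrow> v \<le> B z e"
    using *[THEN conjunct1] by blast+
  show "\<Phi> z e W \<longleftrightarrow>
      (\<forall>c. on z (c ## e) \<longrightarrow> (\<exists>v. pos z (c ## v ## e) \<and> W v \<or> neg z (c ## v ## e) \<and> \<not> W v))"
    by (rule *[THEN conjunct2, THEN spec, THEN spec, THEN spec])
qed

lemma cnf_fun_cong: "cnf_fun \<Phi> \<Longrightarrow> (\<And>z e W. \<Phi> z e W = \<Psi> z e W) \<Longrightarrow> cnf_fun \<Psi>"
  unfolding cnf_fun_def clausal_def by simp

text \<open>A single empty clause, present exactly if \<open>P\<close> fails.\<close>

lemma cnf_fun_pred:
  assumes "polypred P"
  shows "cnf_fun (\<lambda>z e W. P z e)"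
proof (rule cnf_funI)
  show "polypred (\<lambda>z e. e 0 = 0 \<and> \<not> P z (\<lambda>i. e (Suc i)))"
    by (intro polyfun_intros polypred_rename[OF assms]) (rule refl)
qed (auto intro: polypred_const polyfun_bounded polyfun_const)

lemma cnf_fun_Bex_var:
  assumes t: "polyfun t" and f: "polyfun (\<lambda>z e. f (e 0) z (\<lambda>i. e (Suc i)))"
  shows "cnf_fun (\<lambda>z e W. \<exists>u<t z e. W (f u z e))"
proof -
  obtain B where B: "bounded_fun B" "\<And>z e u. u < t z e \<Longrightarrow> f u z e \<le> B z e"
    using bounded_fun_push[OF polyfun_bounded[OF f] polyfun_bounded[OF t]] by auto
  show ?thesis
  proof (rule cnf_funI)
    show "polypred (\<lambda>z e. e 0 = 0)" by (intro polyfun_intros)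
    have "polyfun (\<lambda>z e. f (e 0) z (\<lambda>i. e (Suc (Suc (Suc i)))))"
      using polyfun_rename[OF f, of "case_nat 0 (\<lambda>i. Suc (Suc (Suc i)))"] by simp
    then show "polypred (\<lambda>z e. \<exists>u<t z (\<lambda>i. e (Suc (Suc i))). e (Suc 0) = f u z (\<lambda>i. e (Suc (Suc i))))"
      by (intro polyfun_intros polyfun_rename[OF t])
  qed (use B in \<open>auto intro: polypred_const\<close>)
qed

lemma cnf_fun_var: "polyfun f \<Longrightarrow> cnf_fun (\<lambda>z e W. W (f z e))"
  using cnf_fun_Bex_var[of "\<lambda>z e. 1" "\<lambda>u. f"] polyfun_rename[of f Suc] by (simp add: polyfun_const)

lemma cnf_fun_not_var:
  assumes f: "polyfun f"
  shows "cnf_fun (\<lambda>z e W. \<not> W (f z e))"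
proof (rule cnf_funI[where pos = "\<lambda>z e. False"])
  show "polypred (\<lambda>z e. e 0 = 0)" by (intro polyfun_intros)
  show "polypred (\<lambda>z e. e (Suc 0) = f z (\<lambda>i. e (Suc (Suc i))))"
    by (intro polyfun_intros polyfun_rename[OF f])
qed (auto intro: polypred_const polyfun_bounded[OF f])

lemma bounded_fun_pair: "bounded_fun f \<Longrightarrow> bounded_fun g \<Longrightarrow> bounded_fun (\<lambda>z e. pair (f z e) (g z e))"
  unfolding pair_def by (intro bounded_fun_add bounded_fun_mult)

lemma pair_mono: "a \<le> c \<Longrightarrow> b \<le> d \<Longrightarrow> pair a b \<le> pair c d"
  unfolding pair_def by (intro add_mono mult_le_mono)

text \<open>A pair of indices is coded by one index i, and \<open>P z (a ## b ## e)\<close> is evaluated for its two components.\<close>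

definition unpair :: "bool wfun \<Rightarrow> bool wfun" where
  "unpair P z e \<longleftrightarrow> (\<exists>a<Suc (e 0). \<exists>b<Suc (e 0). e 0 = pair a b \<and> P z (a ## b ## (\<lambda>i. e (Suc i))))"

lemma unpair_pair: "unpair P z (pair a b ## e) \<longleftrightarrow> P z (a ## b ## e)"
  unfolding unpair_def using le_pair(1)[of a b] le_pair(2)[of b a] by (auto simp: pair_eq less_Suc_eq_le)

lemma unpairE:
  assumes "unpair P z (i ## e)"
  obtains a b where "i = pair a b" "P z (a ## b ## e)"
  using assms unfolding unpair_def by auto

lemma polypred_unpair:
  assumes "polypred P"
  shows "polypred (unpair P)"
proof -
  have "polypred (\<lambda>z e. P z (e (Suc 0) ## e 0 ## (\<lambda>i. e (Suc (Suc (Suc i))))))"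
    by (rule polypred_rename[OF assms, of _ "Suc 0 ## 0 ## (\<lambda>i. Suc (Suc (Suc i)))"])
      (auto intro!: arg_cong[of _ _ "P z" for z] simp: fun_eq_iff split: nat.split)
  then show ?thesis unfolding unpair_def by (intro polyfun_intros polyfun_pair)
qed

lemma polypred_rename3:
  assumes "polypred P"
  shows "polypred (\<lambda>z e. P z (e i ## e j ## (\<lambda>k. e (k + m))))"
  by (rule polypred_rename[OF assms, of _ "i ## j ## (\<lambda>k. k + m)"])
    (auto intro!: arg_cong[of _ _ "P z" for z] simp: fun_eq_iff split: nat.split)

lemma polypred_rename2:
  assumes "polypred P"
  shows "polypred (\<lambda>z e. P z (e i ## (\<lambda>k. e (k + m))))"
  by (rule polypred_rename[OF assms, of _ "i ## (\<lambda>k. k + m)"])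
    (auto intro!: arg_cong[of _ _ "P z" for z] simp: fun_eq_iff split: nat.split)

text \<open>Distributivity: one clause for every pair of clauses, containing the literals of both.
  The numbers of clauses get multiplied, which is affordable because disjunctions are nested to a
  depth that does not depend on the input.\<close>

lemma cnf_fun_disj:
  assumes "cnf_fun \<Phi>" "cnf_fun \<Psi>"
  shows "cnf_fun (\<lambda>z e W. \<Phi> z e W \<or> \<Psi> z e W)"
proof -
  obtain a p n B where 1: "clausal a p n B \<Phi>" using assms(1) unfolding cnf_fun_def by blast
  obtain a' p' n' B' where 2: "clausal a' p' n' B' \<Psi>" using assms(2) unfolding cnf_fun_def by blast
  note D = clausalD[OF 1] note D' = clausalD[OF 2]
  let ?a = "unpair (\<lambda>z e. a z (e 0 ## (\<lambda>k. e (k + 2))) \<and> a' z (e 1 ## (\<lambda>k. e (k + 2))))"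
  let ?p = "\<lambda>p p'. unpair (\<lambda>z e. p z (e 0 ## e 2 ## (\<lambda>k. e (k + 3))) \<or> p' z (e 1 ## e 2 ## (\<lambda>k. e (k + 3))))"
  have a: "?a z (pair i j ## e) \<longleftrightarrow> a z (i ## e) \<and> a' z (j ## e)" for z i j e
    by (simp add: unpair_pair numeral_2_eq_2)
  have p: "?p p p' z (pair i j ## v ## e) \<longleftrightarrow> p z (i ## v ## e) \<or> p' z (j ## v ## e)" for z i j v e p p'
    by (simp add: unpair_pair numeral_3_eq_3 numeral_2_eq_2)
  show ?thesis
  proof (rule cnf_funI)
    show "polypred ?a" "polypred (?p p p')" "polypred (?p n n')"
      by (intro polyfun_intros polypred_unpair polypred_rename2 polypred_rename3 D D')+
    show "bounded_fun (\<lambda>z e. pair (B z e) (B' z e))" by (intro bounded_fun_pair D D')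
    fix z e c assume "?a z (c ## e)"
    then obtain i j where c: "c = pair i j" "a z (i ## e)" "a' z (j ## e)"
      by (rule unpairE) (auto simp: numeral_2_eq_2)
    then show "c \<le> pair (B z e) (B' z e)" using D(5)[of z i e] D'(5)[of z j e] pair_mono by simp
    fix v assume "?p p p' z (c ## v ## e) \<or> ?p n n' z (c ## v ## e)"
    then have "v \<le> B z e \<or> v \<le> B' z e" unfolding c(1) p
      using D(6,7)[OF c(2), of v] D'(6,7)[OF c(3), of v] by blast
    then show "v \<le> pair (B z e) (B' z e)" using le_pair le_trans by blast
  next
    fix z e W
    let ?A = "\<lambda>i. \<exists>v. p z (i ## v ## e) \<and> W v \<or> n z (i ## v ## e) \<and> \<not> W v"
    let ?B = "\<lambda>j. \<exists>v. p' z (j ## v ## e) \<and> W v \<or> n' z (j ## v ## e) \<and> \<not> W v"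
    let ?C = "\<lambda>c. \<exists>v. ?p p p' z (c ## v ## e) \<and> W v \<or> ?p n n' z (c ## v ## e) \<and> \<not> W v"
    have C: "?C (pair i j) \<longleftrightarrow> ?A i \<or> ?B j" for i j unfolding p by blast
    have "(\<forall>c. ?a z (c ## e) \<longrightarrow> ?C c) \<longleftrightarrow> (\<forall>i j. a z (i ## e) \<and> a' z (j ## e) \<longrightarrow> ?A i \<or> ?B j)"
    proof
      assume "\<forall>c. ?a z (c ## e) \<longrightarrow> ?C c"
      then show "\<forall>i j. a z (i ## e) \<and> a' z (j ## e) \<longrightarrow> ?A i \<or> ?B j" using a C by blast
    next
      assume r: "\<forall>i j. a z (i ## e) \<and> a' z (j ## e) \<longrightarrow> ?A i \<or> ?B j"
      show "\<forall>c. ?a z (c ## e) \<longrightarrow> ?C c"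
      proof (intro allI impI)
        fix c assume "?a z (c ## e)"
        then obtain i j where c: "c = pair i j" "a z (i ## e)" "a' z (j ## e)"
          by (rule unpairE) (auto simp: numeral_2_eq_2)
        show "?C c" unfolding c(1) C using r c by blast
      qed
    qed
    then show "\<Phi> z e W \<or> \<Psi> z e W \<longleftrightarrow> (\<forall>c. ?a z (c ## e) \<longrightarrow> ?C c)"
      unfolding D(8) D'(8) by blast
  qed
qed

text \<open>Clauses are indexed by a value of \<open>u\<close> and a clause number. A bounded
  disjunction of whole families would multiply out exponentially, so bounded existential quantifiers
  are restricted to single variables as in \<open>cnf_fun_Bex_var\<close>.\<close>

lemma cnf_fun_Ball:
  assumes t: "polyfun t" and \<Phi>: "cnf_fun (\<lambda>z e W. \<Phi> (e 0) z (\<lambda>i. e (Suc i)) W)"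
  shows "cnf_fun (\<lambda>z e W. \<forall>u<t z e. \<Phi> u z e W)"
proof -
  obtain a p n B where 1: "clausal a p n B (\<lambda>z e W. \<Phi> (e 0) z (\<lambda>i. e (Suc i)) W)"
    using \<Phi> unfolding cnf_fun_def by blast
  note D = clausalD[OF 1]
  obtain B' where B': "bounded_fun B'" "\<And>z e u. u < t z e \<Longrightarrow> B z (u ## e) \<le> B' z e"
    using bounded_fun_push[OF D(4) polyfun_bounded[OF t]] by blast
  let ?a = "unpair (\<lambda>z e. e 0 < t z (\<lambda>k. e (k + 2)) \<and> a z (e 1 ## e 0 ## (\<lambda>k. e (k + 2))))"
  let ?p = "\<lambda>p. unpair (\<lambda>z e. p z (e 1 ## e 2 ## e 0 ## (\<lambda>k. e (k + 3))))"
  have a: "?a z (pair u c ## e) \<longleftrightarrow> u < t z e \<and> a z (c ## u ## e)" for z u c e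
    by (simp add: unpair_pair numeral_2_eq_2)
  have p: "?p p z (pair u c ## v ## e) \<longleftrightarrow> p z (c ## v ## u ## e)" for z u c v e p
    by (simp add: unpair_pair numeral_3_eq_3 numeral_2_eq_2)
  have r: "polypred (?p p)" if "polypred p" for p
    by (rule polypred_unpair, rule polypred_rename[OF that, of _ "1 ## 2 ## 0 ## (\<lambda>k. k + 3)"])
      (auto intro!: arg_cong[of _ _ "p z" for z] simp: fun_eq_iff split: nat.split)
  show ?thesis
  proof (rule cnf_funI)
    show "polypred ?a"
      by (intro polyfun_intros polypred_unpair polypred_rename3 polyfun_rename[OF t] D)
    show "polypred (?p p)" "polypred (?p n)" by (intro r D)+
    show "bounded_fun (\<lambda>z e. pair (t z e) (B' z e))" by (intro bounded_fun_pair polyfun_bounded t B')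
    fix z e c assume "?a z (c ## e)"
    then obtain u i where c: "c = pair u i" "u < t z e" "a z (i ## u ## e)"
      by (rule unpairE) (auto simp: numeral_2_eq_2)
    have "i \<le> B' z e" using D(5)[OF c(3)] B'(2)[OF c(2)] by simp
    then show "c \<le> pair (t z e) (B' z e)" using c(1,2) pair_mono[of u "t z e" i "B' z e"] by simp
    fix v assume "?p p z (c ## v ## e) \<or> ?p n z (c ## v ## e)"
    then have "v \<le> B' z e" unfolding c(1) p
      using D(6,7)[OF c(3), of v] B'(2)[OF c(2)] by fastforce
    then show "v \<le> pair (t z e) (B' z e)" using le_pair le_trans by blast
  next
    fix z e W
    let ?A = "\<lambda>u c. \<exists>v. p z (c ## v ## u ## e) \<and> W v \<or> n z (c ## v ## u ## e) \<and> \<not> W v"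
    let ?C = "\<lambda>c. \<exists>v. ?p p z (c ## v ## e) \<and> W v \<or> ?p n z (c ## v ## e) \<and> \<not> W v"
    have C: "?C (pair u c) \<longleftrightarrow> ?A u c" for u c unfolding p by blast
    have "\<Phi> u z e W \<longleftrightarrow> (\<forall>c. a z (c ## u ## e) \<longrightarrow> ?A u c)" for u
      using D(8)[where z = z and e = "u ## e" and W = W] by simp
    moreover have "(\<forall>c. ?a z (c ## e) \<longrightarrow> ?C c) \<longleftrightarrow> (\<forall>u<t z e. \<forall>c. a z (c ## u ## e) \<longrightarrow> ?A u c)"
    proof
      assume "\<forall>c. ?a z (c ## e) \<longrightarrow> ?C c"
      then show "\<forall>u<t z e. \<forall>c. a z (c ## u ## e) \<longrightarrow> ?A u c" using a C by blast
    next
      assume r: "\<forall>u<t z e. \<forall>c. a z (c ## u ## e) \<longrightarrow> ?A u c"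
      show "\<forall>c. ?a z (c ## e) \<longrightarrow> ?C c"
      proof (intro allI impI)
        fix c assume "?a z (c ## e)"
        then obtain u i where c: "c = pair u i" "u < t z e" "a z (i ## u ## e)"
          by (rule unpairE) (auto simp: numeral_2_eq_2)
        show "?C c" unfolding c(1) C using r c by blast
      qed
    qed
    ultimately show "(\<forall>u<t z e. \<Phi> u z e W) \<longleftrightarrow> (\<forall>c. ?a z (c ## e) \<longrightarrow> ?C c)" by blast
  qed
qed

lemma cnf_fun_rename:
  assumes "cnf_fun \<Phi>"
  shows "cnf_fun (\<lambda>z e W. \<Phi> z (\<lambda>i. e (g i)) W)"
proof -
  obtain a p n B where 1: "clausal a p n B \<Phi>" using assms unfolding cnf_fun_def by blast
  note D = clausalD[OF 1]
  let ?a = "\<lambda>z e. a z (e 0 ## (\<lambda>i. e (Suc (g i))))"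
  let ?p = "\<lambda>p z e. p z (e 0 ## e (Suc 0) ## (\<lambda>i. e (Suc (Suc (g i)))))"
  have "polypred (?p p)" if "polypred p" for p
    by (rule polypred_rename[OF that, of _ "0 ## Suc 0 ## (\<lambda>i. Suc (Suc (g i)))"])
      (auto intro!: arg_cong[of _ _ "p z" for z] simp: fun_eq_iff split: nat.split)
  then have p: "polypred (?p p)" "polypred (?p n)" using D by blast+
  have a: "polypred ?a"
    by (rule polypred_rename[OF D(1), of _ "0 ## (\<lambda>i. Suc (g i))"])
      (auto intro!: arg_cong[of _ _ "a z" for z] simp: fun_eq_iff split: nat.split)
  have B: "bounded_fun (\<lambda>z e. B z (\<lambda>i. e (g i)))"
    using D(4) unfolding bounded_fun_def by meson
  show ?thesis
    by (rule cnf_funI[OF a p B]) (use D(5-8) in auto)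
qed

lemma cnf_fun_if:
  assumes "polypred P" "cnf_fun \<Phi>" "cnf_fun \<Psi>"
  shows "cnf_fun (\<lambda>z e W. if P z e then \<Phi> z e W else \<Psi> z e W)"
proof -
  obtain a p n B where 1: "clausal a p n B \<Phi>" using assms(2) unfolding cnf_fun_def by blast
  obtain a' p' n' B' where 2: "clausal a' p' n' B' \<Psi>" using assms(3) unfolding cnf_fun_def by blast
  note D = clausalD[OF 1] note D' = clausalD[OF 2]
  let ?a = "\<lambda>z e. if P z (\<lambda>i. e (Suc i)) then a z e else a' z e"
  let ?p = "\<lambda>p p' z e. if P z (\<lambda>i. e (Suc (Suc i))) then p z e else p' z e"
  have a: "polypred ?a" by (intro polypred_if polypred_rename[OF assms(1)] D D') (rule refl)
  have p: "polypred (?p p p')" "polypred (?p n n')"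
    by (intro polypred_if polypred_rename[OF assms(1)] D D', rule refl)+
  have B: "bounded_fun (\<lambda>z e. B z e + B' z e)" by (intro bounded_fun_add D D')
  show ?thesis
  proof (rule cnf_funI[OF a p B])
    fix z e c assume c: "?a z (c ## e)"
    then show "c \<le> B z e + B' z e" using D(5)[of z c e] D'(5)[of z c e] by (auto split: if_splits)
    fix v assume "?p p p' z (c ## v ## e) \<or> ?p n n' z (c ## v ## e)"
    then show "v \<le> B z e + B' z e" using c D(6,7)[of z c e v] D'(6,7)[of z c e v]
      by (cases "P z e") auto
  next
    fix z e W
    show "(if P z e then \<Phi> z e W else \<Psi> z e W) \<longleftrightarrow> (\<forall>c. ?a z (c ## e) \<longrightarrow>
        (\<exists>v. ?p p p' z (c ## v ## e) \<and> W v \<or> ?p n n' z (c ## v ## e) \<and> \<not> W v))"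
      by (cases "P z e") (simp_all add: D(8)[where z = z and e = e and W = W] D'(8)[where z = z and e = e and W = W])
  qed
qed

lemma cnf_fun_conj:
  assumes "cnf_fun \<Phi>" "cnf_fun \<Psi>"
  shows "cnf_fun (\<lambda>z e W. \<Phi> z e W \<and> \<Psi> z e W)"
proof (rule cnf_fun_cong)
  show "cnf_fun (\<lambda>z e W. \<forall>u<2::nat. if u = 0 then \<Phi> z e W else \<Psi> z e W)"
    by (intro cnf_fun_Ball cnf_fun_if assms[THEN cnf_fun_rename] polyfun_intros)
qed (auto simp: numeral_2_eq_2 less_Suc_eq)

lemma cnf_fun_imp: "polypred P \<Longrightarrow> cnf_fun \<Phi> \<Longrightarrow> cnf_fun (\<lambda>z e W. P z e \<longrightarrow> \<Phi> z e W)"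
  unfolding imp_conv_disj by (intro cnf_fun_disj cnf_fun_pred polypred_not)

lemma cnf_fun_var_imp: "polyfun f \<Longrightarrow> cnf_fun \<Phi> \<Longrightarrow> cnf_fun (\<lambda>z e W. W (f z e) \<longrightarrow> \<Phi> z e W)"
  unfolding imp_conv_disj by (intro cnf_fun_disj cnf_fun_not_var)

lemma cnf_fun_static_Ball:
  assumes "finite A" "\<And>a. a \<in> A \<Longrightarrow> cnf_fun (\<Phi> a)"
  shows "cnf_fun (\<lambda>z e W. \<forall>a\<in>A. \<Phi> a z e W)"
  using assms
proof (induction A)
  case empty
  show ?case by (rule cnf_fun_cong[OF cnf_fun_pred[OF polypred_const[of True]]]) simp
next
  case (insert a A)
  have "cnf_fun (\<lambda>z e W. \<Phi> a z e W \<and> (\<forall>a\<in>A. \<Phi> a z e W))"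
    by (intro cnf_fun_conj insert) simp_all
  then show ?case by (rule cnf_fun_cong) simp
qed

text \<open>The bound is turned into an actual polynomial that serves for clauses and variables
  alike, and absent clauses have to be replaced by true ones.\<close>

lemma cnf_fun_cnf:
  assumes "cnf_fun (\<lambda>z e W. \<Phi> z W)"
  shows "cnf \<Phi>"
proof -
  obtain a p n B where 1: "clausal a p n B (\<lambda>z e W. \<Phi> z W)" using assms unfolding cnf_fun_def by blast
  note D = clausalD[OF 1]
  obtain D' where D': "pbounded D'" "\<forall>z e. (\<forall>i. e i \<le> 0) \<longrightarrow> B z e \<le> D' (length z)"
    using D(4) pbounded_const[of 0] by (rule bounded_funD)
  obtain d where d: "\<And>n. D' n \<le> (n + 2) ^ d" using D'(1) by (auto simp: pbounded_def)
  define N where "N z = Suc (poly ([:2, 1:] ^ d) (length z))" for z :: "bool list"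
  have B: "B z (\<lambda>_. 0) < N z" for z
    using D'(2)[rule_format, of "\<lambda>_. 0" z] d[of "length z"] by (simp add: N_def add.commute)
  have N: "polyfun (\<lambda>z e. N z)" unfolding N_def by (intro polyfun_intros)
  have p: "polypred (\<lambda>z e. p z (e 0 ## e (Suc 0) ## (\<lambda>_. 0)))" if "polypred p" for p
  proof -
    \<comment> \<open>The remaining environment is first collapsed to variable 0, which is then set
      to 0; this yields the constant environment 0.\<close>
    have "polypred (\<lambda>z e. p z (e (Suc 0) ## e 2 ## (\<lambda>_. e 0)))"
      by (rule polypred_rename[OF that, of _ "Suc 0 ## 2 ## (\<lambda>_. 0)"])
        (auto intro!: arg_cong[of _ _ "p z" for z] simp: fun_eq_iff split: nat.split)
    from polypred_push[OF this polyfun_0] show ?thesis by (simp add: numeral_2_eq_2)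
  qed
  have a: "polypred (\<lambda>z e. a z (e 0 ## (\<lambda>_. 0)))"
    by (rule polypred_cong[OF p[OF polypred_rename[OF D(1), of _ "0 ## (\<lambda>i. Suc (Suc i))"]]])
      (auto intro!: arg_cong[of _ _ "a z" for z] simp: fun_eq_iff split: nat.split)
  \<comment> \<open>An absent clause becomes the tautology that holds both literals of variable
    0.\<close>
  let ?p = "\<lambda>p z c v. if a z (c ## (\<lambda>_. 0)) then p z (c ## v ## (\<lambda>_. 0)) else v = 0"
  have \<Phi>: "\<Phi> z W \<longleftrightarrow> (\<forall>c<N z. \<exists>v<N z. ?p p z c v \<and> W v \<or> ?p n z c v \<and> \<not> W v)" for z W
  proof
    assume \<Phi>: "\<Phi> z W"
    show "\<forall>c<N z. \<exists>v<N z. ?p p z c v \<and> W v \<or> ?p n z c v \<and> \<not> W v"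
    proof (intro allI impI)
      fix c
      show "\<exists>v<N z. ?p p z c v \<and> W v \<or> ?p n z c v \<and> \<not> W v"
      proof (cases "a z (c ## (\<lambda>_. 0))")
        case True
        obtain v where v: "p z (c ## v ## (\<lambda>_. 0)) \<and> W v \<or> n z (c ## v ## (\<lambda>_. 0)) \<and> \<not> W v"
          using D(8)[where z = z and e = "\<lambda>_. 0" and W = W, THEN iffD1, OF \<Phi>, rule_format, OF True] by blast
        then have "v \<le> B z (\<lambda>_. 0)" using D(6,7)[OF True, of v] by blast
        then show ?thesis using v True B[of z] by (intro exI[of _ v]) auto
      next
        case False
        then show ?thesis by (intro exI[of _ 0]) (simp add: N_def)
      qed
    qed
  next
    assume r: "\<forall>c<N z. \<exists>v<N z. ?p p z c v \<and> W v \<or> ?p n z c v \<and> \<not> W v"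
    show "\<Phi> z W"
      unfolding D(8)[where z = z and e = "\<lambda>_. 0" and W = W]
    proof (intro allI impI)
      fix c assume c: "a z (c ## (\<lambda>_. 0))"
      then have "c < N z" using D(5)[OF c] B[of z] by simp
      then show "\<exists>v. p z (c ## v ## (\<lambda>_. 0)) \<and> W v \<or> n z (c ## v ## (\<lambda>_. 0)) \<and> \<not> W v"
        using r[rule_format, of c] c by auto
    qed
  qed
  have P: "polypred (\<lambda>z e. ?p p z (e 0) (e (Suc 0)))" "polypred (\<lambda>z e. ?p n z (e 0) (e (Suc 0)))"
    by (intro polypred_if a p D polyfun_intros)+
  show ?thesis
    unfolding cnf_def
    by (rule exI[of _ N], rule exI[of _ N], rule exI[of _ "?p p"], rule exI[of _ "?p n"])
      (intro conjI allI N P \<Phi>)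
qed

section \<open>Tableaux\<close>

text \<open>Each tape has its own partial function of the scanned symbol. This covers transitions,
  which demand given symbols, and the two answers to a query, which accept any symbols and leave the
  tapes alone.\<close>

type_synonym rule = "nat \<times> (nat \<Rightarrow> symbol \<Rightarrow> (symbol \<times> move) option) \<times> nat"

definition applies :: "rule \<Rightarrow> config \<Rightarrow> config \<Rightarrow> bool" where
  "applies = (\<lambda>(src, f, tgt) (q, ts) (q', ts'). q = src \<and> q' = tgt \<and> length ts' = length ts \<and>
     (\<forall>k<length ts. \<exists>a. f k (scanned (ts ! k)) = Some a \<and> ts' ! k = act a (ts ! k)))"

fun sym_code :: "symbol \<Rightarrow> nat" where
  "sym_code Blank = 0"
| "sym_code (Bit b) = (if b then 1 else 2)"
| "sym_code (Aux n) = n + 3"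

lemma sym_code_eq: "sym_code s = sym_code s' \<longleftrightarrow> s = s'"
  by (cases s; cases s') auto

text \<open>Cells -T..T of the tapes are numbered 0..2T.\<close>

abbreviation "chosen V t j \<equiv> V (pair 0 (pair t j))"
abbreviation "state V t q \<equiv> V (pair 1 (pair t q))"
abbreviation "head V t k p \<equiv> V (pair 2 (pair t (pair k p)))"
abbreviation "holds V t k p s \<equiv> V (pair 3 (pair t (pair k (pair p (sym_code s)))))"

abbreviation "word V t i s \<equiv> V (pair 4 (pair t (pair i (sym_code s))))"

fun mv :: "move \<Rightarrow> nat \<Rightarrow> nat" where
  "mv Left p = p - 1"
| "mv Stay p = p"
| "mv Right p = p + 1"

fun moved :: "(nat \<Rightarrow> bool) \<Rightarrow> nat \<Rightarrow> nat \<Rightarrow> nat \<Rightarrow> (symbol \<times> move) option \<Rightarrow> bool" where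
  "moved V t k p None \<longleftrightarrow> False"
| "moved V t k p (Some (w, m)) \<longleftrightarrow> holds V (Suc t) k p w \<and> head V (Suc t) k (mv m p)"

definition padded :: "bool list \<Rightarrow> nat \<Rightarrow> symbol" where
  "padded x i = (if i < length x then Bit (x ! i) else Blank)"

text \<open>\<open>Qs\<close> and \<open>Ss\<close> are finite and closed under the rules, so
  quantifiers over states and symbols unfold into finitely many constraints.\<close>

locale rules =
  fixes K :: nat and R :: "rule list" and Qs :: "nat set" and Ss :: "symbol set" and start acc :: nat
  assumes finite_Qs: "finite Qs" and finite_Ss: "finite Ss"
    and start: "start \<in> Qs" and Blank: "Blank \<in> Ss" and Bit: "\<And>b. Bit b \<in> Ss"
    and tgt: "\<And>src f tgt. (src, f, tgt) \<in> set R \<Longrightarrow> tgt \<in> Qs"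
    and written: "\<And>src f tgt k s w m. (src, f, tgt) \<in> set R \<Longrightarrow> k < K \<Longrightarrow> s \<in> Ss \<Longrightarrow> f k s = Some (w, m) \<Longrightarrow> w \<in> Ss"
    and K: "0 < K"
begin

text \<open>\<open>chosen V t (length R)\<close> says that the run stops at time t. Except for \<open>choice\<close> the constraints are Horn
  clauses, so an arbitrary table satisfying them contains at least the true facts of the run that it chooses.\<close>

definition fires :: "nat \<Rightarrow> (nat \<Rightarrow> bool) \<Rightarrow> nat \<Rightarrow> rule \<Rightarrow> bool" where
  "fires T V t = (\<lambda>(src, f, tgt). (\<forall>q\<in>Qs. state V t q \<longrightarrow> q = src) \<and> state V (Suc t) tgt \<and>
     (\<forall>k\<in>{..<K}. \<forall>p<2 * T + 1. \<forall>s\<in>Ss. head V t k p \<longrightarrow> holds V t k p s \<longrightarrow> moved V t k p (f k s)))"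

text \<open>The frame condition asks for a head at another cell instead of the absence of the head
  from \<open>p\<close>; so it remains a Horn clause.\<close>

definition tab :: "nat \<Rightarrow> (nat \<Rightarrow> bool) \<Rightarrow> bool" where
  "tab T V \<longleftrightarrow> (\<forall>t<T. (\<forall>j\<in>{..<length R}. chosen V t j \<longrightarrow> fires T V t (R ! j)) \<and>
       (\<forall>k\<in>{..<K}. \<forall>s\<in>Ss. \<forall>p<2 * T + 1. \<forall>p'<2 * T + 1. p' \<noteq> p \<longrightarrow>
          holds V t k p s \<longrightarrow> head V t k p' \<longrightarrow> holds V (Suc t) k p s)) \<and>
     (\<forall>t<Suc T. chosen V t (length R) \<longrightarrow> (\<forall>q\<in>Qs. state V t q \<longrightarrow> q = acc))"

text \<open>Kept apart from \<open>tab\<close> because the slices for times without a positive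
  answer satisfy the Horn part without describing a run.\<close>

definition choice :: "nat \<Rightarrow> (nat \<Rightarrow> bool) \<Rightarrow> bool" where
  "choice T V \<longleftrightarrow> (\<forall>t<T. (\<exists>u<Suc t. chosen V u (length R)) \<or> (\<exists>j<length R. chosen V t j)) \<and>
     (\<exists>u<Suc T. chosen V u (length R))"

text \<open>The input is a relation \<open>I\<close>, so that it can be the given word or the
  variables for the word on a query tape. Cell 0 has the number \<open>T\<close>.\<close>

definition init :: "nat \<Rightarrow> (nat \<Rightarrow> symbol \<Rightarrow> bool) \<Rightarrow> (nat \<Rightarrow> bool) \<Rightarrow> bool" where
  "init T I V \<longleftrightarrow> state V 0 start \<and> (\<forall>k\<in>{..<K}. head V 0 k T \<and> (\<forall>p<2 * T + 1.
     if k = 0 \<and> T \<le> p then \<forall>s\<in>{Blank, Bit False, Bit True}. I (p - T) s \<longrightarrow> holds V 0 k p s else holds V 0 k p Blank))"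

definition start_config :: "bool list \<Rightarrow> config" where
  "start_config x = (start, input_tape x # replicate (K - 1) (input_tape []))"

lemmas cnf_intros = cnf_fun_var cnf_fun_not_var cnf_fun_Bex_var cnf_fun_Ball cnf_fun_static_Ball
  cnf_fun_var_imp cnf_fun_imp cnf_fun_conj cnf_fun_disj cnf_fun_if finite_Qs finite_Ss finite_lessThan finite.intros

lemma cnf_moved:
  assumes "polyfun r" "polyfun t" "polyfun p"
  shows "cnf_fun (\<lambda>z e W. moved (\<lambda>v. W (pair (r z e) v)) (t z e) k (p z e) a)"
proof (cases a)
  case None
  then show ?thesis by (simp add: cnf_fun_pred polypred_const)
next
  case (Some b)
  obtain w m where b: "b = (w, m)" by (cases b)
  have "polyfun (\<lambda>z e. mv m (p z e))" by (cases m) (simp, intro polyfun_intros assms)+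
  then show ?thesis unfolding Some b moved.simps
    by (intro cnf_intros polyfun_intros polyfun_pair assms)
qed

lemma cnf_tab:
  assumes T: "polyfun (\<lambda>z e. T z)" and r: "polyfun r"
  shows "cnf_fun (\<lambda>z e W. tab (T z) (\<lambda>v. W (pair (r z e) v)))"
proof -
  have "cnf_fun (\<lambda>z e W. fires (T z) (\<lambda>v. W (pair (r z (\<lambda>i. e (Suc i))) v)) (e 0) a)" for a
  proof (cases a)
    case (fields src f tgt)
    show ?thesis unfolding fields fires_def split
      by (intro cnf_intros polyfun_intros polyfun_pair T r[THEN polyfun_rename] cnf_moved cnf_fun_pred polypred_const)
  qed
  then show ?thesis
    unfolding tab_def
    by (intro cnf_intros polyfun_intros polyfun_pair T r[THEN polyfun_rename] cnf_fun_pred polypred_const)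
qed

lemma cnf_choice:
  assumes T: "polyfun (\<lambda>z e. T z)" and r: "polyfun r"
  shows "cnf_fun (\<lambda>z e W. choice (T z) (\<lambda>v. W (pair (r z e) v)))"
  unfolding choice_def
  by (intro cnf_intros polyfun_intros polyfun_pair T r[THEN polyfun_rename])

lemma cnf_init_word:
  assumes T: "polyfun (\<lambda>z e. T z)" and r: "polyfun r" and t: "polyfun t"
  shows "cnf_fun (\<lambda>z e W. init (T z) (word (\<lambda>v. W (pair 0 v)) (t z e)) (\<lambda>v. W (pair (r z e) v)))"
  unfolding init_def
  by (intro cnf_intros polyfun_intros polyfun_pair T r[THEN polyfun_rename] t[THEN polyfun_rename])

lemma cnf_init_input:
  assumes T: "polyfun (\<lambda>z e. T z)" and r: "polyfun r"
  shows "cnf_fun (\<lambda>z e W. init (T z) (\<lambda>i s. s = padded z i) (\<lambda>v. W (pair (r z e) v)))"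
proof -
  have padded: "s = padded z i \<longleftrightarrow> (i < length z \<and> (bit_at z i \<and> s = Bit True \<or> \<not> bit_at z i \<and> s = Bit False)) \<or>
      \<not> i < length z \<and> s = Blank" for s z i
    by (auto simp: padded_def bit_at_def)
  show ?thesis
    unfolding init_def padded
    by (intro cnf_intros polyfun_intros polyfun_pair polypred_const T r[THEN polyfun_rename])
qed

definition valid :: "nat \<Rightarrow> (nat \<Rightarrow> bool) \<Rightarrow> nat \<Rightarrow> config \<Rightarrow> bool" where
  "valid T V t c \<longleftrightarrow> fst c \<in> Qs \<and> state V t (fst c) \<and> length (snd c) = K \<and>
     (\<forall>k<K. \<bar>snd (snd c ! k)\<bar> \<le> int t \<and> head V t k (nat (snd (snd c ! k) + int T)) \<and>
       (\<forall>p<2 * T + 1. fst (snd c ! k) (int p - int T) \<in> Ss \<and> holds V t k p (fst (snd c ! k) (int p - int T))))"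

lemma valid_step:
  assumes tab: "tab T V" and t: "t < T" and c: "valid T V t c" and j: "j < length R" "chosen V t j"
  obtains c' where "applies (R ! j) c c'" "valid T V (Suc t) c'"
proof -
  obtain src f tgt where R: "R ! j = (src, f, tgt)" by (cases "R ! j")
  obtain q ts where c_def: "c = (q, ts)" by (cases c)
  have q: "q \<in> Qs" "state V t q" and len: "length ts = K" using c by (auto simp: valid_def c_def)
  have Rj: "(src, f, tgt) \<in> set R" using nth_mem[OF j(1)] by (simp add: R)
  have fires: "fires T V t (src, f, tgt)" using tab t j unfolding tab_def R[symmetric] by blast
  have frame: "holds V (Suc t) k p s" if "k < K" "s \<in> Ss" "p < 2 * T + 1" "p' < 2 * T + 1" "p' \<noteq> p"
      "holds V t k p s" "head V t k p'" for k s p p'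
    using tab t that unfolding tab_def by blast
  have src: "q = src" using fires q unfolding fires_def by blast
  have tgt': "state V (Suc t) tgt" using fires unfolding fires_def by blast
  define p where "p k = nat (snd (ts ! k) + int T)" for k
  have pos: "\<bar>snd (ts ! k)\<bar> \<le> int t" "head V t k (p k)"
      "\<And>i. i < 2 * T + 1 \<Longrightarrow> fst (ts ! k) (int i - int T) \<in> Ss"
      "\<And>i. i < 2 * T + 1 \<Longrightarrow> holds V t k i (fst (ts ! k) (int i - int T))" if "k < K" for k
    using c that unfolding valid_def c_def p_def by auto
  have p: "p k < 2 * T + 1" "int (p k) = snd (ts ! k) + int T" "0 < p k" if "k < K" for k
    using pos(1)[OF that] t unfolding p_def by auto
  have scanned: "scanned (ts ! k) = fst (ts ! k) (int (p k) - int T)" if "k < K" for k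
    using p(2)[OF that] by (cases "ts ! k") simp
  have "\<exists>w m. f k (scanned (ts ! k)) = Some (w, m) \<and> holds V (Suc t) k (p k) w \<and> head V (Suc t) k (mv m (p k))"
    if k: "k < K" for k
  proof -
    have "moved V t k (p k) (f k (scanned (ts ! k)))"
      using fires k p(1)[OF k] pos(2)[OF k] pos(3,4)[OF k p(1)[OF k]] unfolding fires_def scanned[OF k] by auto
    then show ?thesis by (cases "f k (scanned (ts ! k))") auto
  qed
  then obtain w m where wm: "\<And>k. k < K \<Longrightarrow> f k (scanned (ts ! k)) = Some (w k, m k)"
      "\<And>k. k < K \<Longrightarrow> holds V (Suc t) k (p k) (w k)" "\<And>k. k < K \<Longrightarrow> head V (Suc t) k (mv (m k) (p k))"
    by metis
  define ts' where "ts' = map (\<lambda>k. act (w k, m k) (ts ! k)) [0..<K]"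
  have ts': "ts' ! k = act (w k, m k) (ts ! k)" if "k < K" for k using that by (simp add: ts'_def)
  have tape: "snd (ts' ! k) = snd (ts ! k) + shift (m k)"
      "fst (ts' ! k) i = (if i = snd (ts ! k) then w k else fst (ts ! k) i)" if "k < K" for k i
    using ts'[OF that] by (cases "ts ! k"; simp)+
  have "applies (R ! j) c (tgt, ts')"
    unfolding applies_def R c_def using src len wm(1) ts' by (auto simp: ts'_def)
  moreover have "valid T V (Suc t) (tgt, ts')"
    unfolding valid_def
  proof (intro conjI allI impI)
    show "fst (tgt, ts') \<in> Qs" using tgt[OF Rj] by simp
    show "state V (Suc t) (fst (tgt, ts'))" using tgt' by simp
    show "length (snd (tgt, ts')) = K" by (simp add: ts'_def)
    fix k assume k: "k < K"
    show "\<bar>snd (snd (tgt, ts') ! k)\<bar> \<le> int (Suc t)"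
      using pos(1)[OF k] tape(1)[OF k] by (cases "m k") auto
    have "nat (snd (ts' ! k) + int T) = mv (m k) (p k)"
      using tape(1)[OF k] p(2,3)[OF k] by (cases "m k") auto
    then show "head V (Suc t) k (nat (snd (snd (tgt, ts') ! k) + int T))" using wm(3)[OF k] by simp
    fix i assume i: "i < 2 * T + 1"
    have eq: "int i - int T = snd (ts ! k) \<longleftrightarrow> i = p k" using p(2)[OF k] by linarith
    show "fst (snd (tgt, ts') ! k) (int i - int T) \<in> Ss"
      using pos(3)[OF k i] written[OF Rj k _ wm(1)[OF k]] pos(3)[OF k p(1)[OF k]] scanned[OF k] by (simp add: tape(2)[OF k])
    show "holds V (Suc t) k i (fst (snd (tgt, ts') ! k) (int i - int T))"
    proof (cases "i = p k")
      case True
      then show ?thesis using wm(2)[OF k] eq by (simp add: tape(2)[OF k])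
    next
      case False
      then have "holds V (Suc t) k i (fst (ts ! k) (int i - int T))"
        using frame[OF k pos(3)[OF k i] i p(1)[OF k] _ pos(4)[OF k i] pos(2)[OF k]] by simp
      then show ?thesis using False eq by (simp add: tape(2)[OF k])
    qed
  qed
  ultimately show thesis by (rule that)
qed

text \<open>Follow the chosen rules up to the first time at which the table stops. The relation is
  abstract: for an oracle machine both answers are applicable rules, and the hypothesis on
  \<open>Rel\<close> provides reachability and validity to justify the one that was chosen.\<close>

theorem sound:
  assumes tab: "tab T V" and choice: "choice T V" and c0: "valid T V 0 c0"
    and Rel: "\<And>t j c c'. t < T \<Longrightarrow> (Rel ^^ t) c0 c \<Longrightarrow> valid T V t c \<Longrightarrow> j < length R \<Longrightarrow> chosen V t j \<Longrightarrow>
      applies (R ! j) c c' \<Longrightarrow> Rel c c'"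
  shows "\<exists>ts. Rel\<^sup>*\<^sup>* c0 (acc, ts)"
proof -
  define u where "u = (LEAST u. chosen V u (length R))"
  have "\<exists>u<Suc T. chosen V u (length R)" using choice by (simp add: choice_def)
  then obtain u' where u': "u' < Suc T" "chosen V u' (length R)" by blast
  have u: "chosen V u (length R)" unfolding u_def using u'(2) by (rule LeastI)
  have uT: "u < Suc T" using Least_le[of "\<lambda>u. chosen V u (length R)" u'] u' by (simp add: u_def)
  have less: "\<not> chosen V t (length R)" if "t < u" for t
    using not_less_Least that unfolding u_def by blast
  have "\<exists>c. (Rel ^^ t) c0 c \<and> valid T V t c" if "t \<le> u" for t
    using that
  proof (induction t)
    case 0
    then show ?case using c0 by auto
  next
    case (Suc t)
    then obtain c where c: "(Rel ^^ t) c0 c" "valid T V t c" by auto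
    have t: "t < T" using Suc.prems uT by simp
    have "\<not> (\<exists>u<Suc t. chosen V u (length R))" using less Suc.prems by auto
    then obtain j where j: "j < length R" "chosen V t j" using choice t unfolding choice_def by blast
    obtain c' where c': "applies (R ! j) c c'" "valid T V (Suc t) c'" using valid_step[OF tab t c(2) j] .
    have "Rel c c'" using Rel[OF t c j c'(1)] .
    then show ?case using c(1) c'(2) by (meson relpowp_Suc_I)
  qed
  then obtain c where c: "(Rel ^^ u) c0 c" "valid T V u c" by blast
  have "fst c = acc" using tab u uT c(2) unfolding tab_def valid_def by blast
  then show ?thesis using relpowp_imp_rtranclp[OF c(1)] by (metis prod.collapse)
qed

lemma padded_input: "fst (input_tape x) (int i) = padded x i"
  by (simp add: input_tape_def padded_def)

lemma start_config_nth: "k < K \<Longrightarrow> snd (start_config x) ! k = input_tape (if k = 0 then x else [])"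
  by (simp add: start_config_def nth_Cons split: nat.split)

lemma valid_init:
  assumes init: "init T I V" and I: "\<And>i. i \<le> T \<Longrightarrow> I i (padded x i)"
  shows "valid T V 0 (start_config x)"
  unfolding valid_def
proof (intro conjI allI impI)
  show "fst (start_config x) \<in> Qs" by (simp add: start_config_def start)
  show "state V 0 (fst (start_config x))" using init by (simp add: start_config_def init_def)
  show "length (snd (start_config x)) = K" using K by (simp add: start_config_def)
  fix k assume k: "k < K"
  note nth = start_config_nth[OF k]
  show "\<bar>snd (snd (start_config x) ! k)\<bar> \<le> int 0" by (simp add: nth input_tape_def)
  show "head V 0 k (nat (snd (snd (start_config x) ! k) + int T))"
    using init k by (simp add: nth input_tape_def init_def)
  fix p assume p: "p < 2 * T + 1"
  let ?s = "fst (snd (start_config x) ! k) (int p - int T)"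
  show s: "?s \<in> Ss" using Blank Bit by (simp add: nth input_tape_def)
  show "holds V 0 k p ?s"
  proof (cases "k = 0 \<and> T \<le> p")
    case True
    then have "?s = padded x (p - T)" using padded_input[of x "p - T"] nth by (simp add: of_nat_diff)
    moreover have "I (p - T) (padded x (p - T))" using p True by (intro I) auto
    moreover have "padded x (p - T) \<in> {Blank, Bit False, Bit True}" by (auto simp: padded_def)
    ultimately show ?thesis using init p s True K unfolding init_def by (metis lessThan_iff)
  next
    case False
    then have s: "?s = Blank" by (auto simp: nth input_tape_def)
    have "k \<in> {..<K}" using k by simp
    then have "holds V 0 k p Blank" using init p False unfolding init_def by (metis (lifting))
    then show ?thesis by (simp only: s)
  qed
qed

text \<open>For the direction from runs to tables: no surplus facts, and after the accepting time
  \<open>n\<close> the last configuration is repeated, hence \<open>min t n\<close>.\<close>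

definition exact :: "nat \<Rightarrow> (nat \<Rightarrow> config) \<Rightarrow> (nat \<Rightarrow> nat) \<Rightarrow> nat \<Rightarrow> (nat \<Rightarrow> bool) \<Rightarrow> bool" where
  "exact T c js n V \<longleftrightarrow> (\<forall>t.
     (\<forall>j. chosen V t j \<longleftrightarrow> t < n \<and> j = js t \<or> t = n \<and> j = length R) \<and>
     (\<forall>q. state V t q \<longleftrightarrow> q = fst (c (min t n))) \<and>
     (\<forall>k p. head V t k p \<longleftrightarrow> int p = snd (snd (c (min t n)) ! k) + int T) \<and>
     (\<forall>k p s. holds V t k p s \<longleftrightarrow> s = fst (snd (c (min t n)) ! k) (int p - int T)))"

lemma exactD:
  assumes "exact T c js n V"
  shows "chosen V t j \<longleftrightarrow> t < n \<and> j = js t \<or> t = n \<and> j = length R"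
    and "state V t q \<longleftrightarrow> q = fst (c (min t n))"
    and "head V t k p \<longleftrightarrow> int p = snd (snd (c (min t n)) ! k) + int T"
    and "holds V t k p s \<longleftrightarrow> s = fst (snd (c (min t n)) ! k) (int p - int T)"
  using assms unfolding exact_def by blast+

definition rule_run :: "(nat \<Rightarrow> config) \<Rightarrow> (nat \<Rightarrow> nat) \<Rightarrow> nat \<Rightarrow> bool" where
  "rule_run c js n \<longleftrightarrow> (\<exists>x. c 0 = start_config x) \<and> fst (c n) = acc \<and>
     (\<forall>t<n. js t < length R \<and> applies (R ! js t) (c t) (c (Suc t)))"

lemma rule_run_bound:
  assumes run: "rule_run c js n" and "t \<le> n"
  shows "length (snd (c t)) = K \<and> (\<forall>k<K. \<bar>snd (snd (c t) ! k)\<bar> \<le> int t)"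
  using assms(2)
proof (induction t)
  case 0
  obtain x where "c 0 = start_config x" using run unfolding rule_run_def by blast
  then show ?case using K start_config_nth[of _ x] by (auto simp: input_tape_def start_config_def)
next
  case (Suc t)
  then have IH: "length (snd (c t)) = K" "\<And>k. k < K \<Longrightarrow> \<bar>snd (snd (c t) ! k)\<bar> \<le> int t" by auto
  obtain src f tgt where R: "R ! js t = (src, f, tgt)" by (cases "R ! js t")
  have "applies (R ! js t) (c t) (c (Suc t))" using run Suc.prems unfolding rule_run_def by simp
  then have a: "length (snd (c (Suc t))) = length (snd (c t))"
    "\<And>k. k < K \<Longrightarrow> \<exists>a. snd (c (Suc t)) ! k = act a (snd (c t) ! k)"
    unfolding R applies_def using IH(1) by (fastforce split: prod.splits)+
  have "\<bar>snd (snd (c (Suc t)) ! k)\<bar> \<le> int (Suc t)" if k: "k < K" for k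
  proof -
    obtain w m where "snd (c (Suc t)) ! k = act (w, m) (snd (c t) ! k)" using a(2)[OF k] by auto
    then have "snd (snd (c (Suc t)) ! k) = snd (snd (c t) ! k) + shift m"
      by (cases "snd (c t) ! k") simp
    then show ?thesis using IH(2)[OF k] by (cases m) auto
  qed
  then show ?case using a(1) IH(1) by simp
qed

theorem exact_tab:
  assumes run: "rule_run c js n" and ex: "exact T c js n V" and n: "n \<le> T"
  shows "tab T V"
proof -
  note E = exactD[OF ex]
  have fires: "fires T V t (R ! j)" if tT: "t < T" and j: "j < length R" and ch: "chosen V t j" for t j
  proof -
    obtain src f tgt where R: "R ! j = (src, f, tgt)" by (cases "R ! j")
    have t: "t < n" "j = js t" using ch j unfolding E(1) by auto
    then have "applies (R ! j) (c t) (c (Suc t))" using run by (simp add: rule_run_def)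
    then have a: "fst (c t) = src" "fst (c (Suc t)) = tgt"
        "\<And>k. k < K \<Longrightarrow> \<exists>a. f k (scanned (snd (c t) ! k)) = Some a \<and> snd (c (Suc t)) ! k = act a (snd (c t) ! k)"
      unfolding R applies_def using rule_run_bound[OF run, of t] t by (auto split: prod.splits)
    have min: "min t n = t" "min (Suc t) n = Suc t" using t by auto
    show ?thesis
      unfolding R fires_def split E(2) min a
    proof (intro conjI ballI allI impI)
      fix k p s assume k: "k \<in> {..<K}" and p: "p < 2 * T + 1" "head V t k p" and s: "holds V t k p s"
      have kK: "k < K" using k by simp
      obtain h g where ck: "snd (c t) ! k = (g, h)" by (cases "snd (c t) ! k")
      have h: "int p = h + int T" "s = g h" using p(2) s unfolding E(3,4) min ck by auto
      have "\<bar>h\<bar> \<le> int t" using rule_run_bound[OF run, of t] t kK ck by force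
      \<comment> \<open>The head is at most \<open>t < T\<close> cells away from cell number
        \<open>T\<close>. So it is never at number 0, and the truncated subtraction in
        \<open>mv\<close> is exact.\<close>
      then have p0: "0 < p" using h(1) tT by linarith
      obtain w m where a': "f k s = Some (w, m)" "snd (c (Suc t)) ! k = (g(h := w), h + shift m)"
        using a(3)[OF kK] ck h(2) by auto
      have "int (mv m p) = h + shift m + int T" using h(1) p0 by (cases m) auto
      then show "moved V t k p (f k s)"
        unfolding a'(1) moved.simps E(3,4) min a'(2) using h(1) by simp
    qed simp_all
  qed
  have frame: "holds V (Suc t) k p s"
    if k: "k < K" and pp: "p' \<noteq> p" and s: "holds V t k p s" and h: "head V t k p'" for t k p p' s
  proof (cases "t < n")
    case True
    then have min: "min t n = t" "min (Suc t) n = Suc t" by auto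
    obtain src f tgt where R: "R ! js t = (src, f, tgt)" by (cases "R ! js t")
    have "applies (R ! js t) (c t) (c (Suc t))" using run True by (simp add: rule_run_def)
    then obtain w m where a: "snd (c (Suc t)) ! k = act (w, m) (snd (c t) ! k)"
      unfolding R applies_def using rule_run_bound[OF run, of t] True k by (fastforce split: prod.splits)
    obtain i g where ck: "snd (c t) ! k = (g, i)" by (cases "snd (c t) ! k")
    have "s = g (int p - int T)" "int p' = i + int T" using s h unfolding E(3,4) min ck by auto
    then show ?thesis unfolding E(4) min a ck using pp by auto
  next
    case False
    then have "min (Suc t) n = min t n" by auto
    then show ?thesis using s unfolding E(4) by simp
  qed
  have stop: "q = acc" if "chosen V t (length R)" "state V t q" for t q
  proof -
    have "\<not> (t < n \<and> length R = js t)" using run unfolding rule_run_def by fastforce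
    then have "t = n" using that(1) unfolding E(1) by blast
    then show ?thesis using that(2) run unfolding E(2) rule_run_def by simp
  qed
  show ?thesis
    unfolding tab_def using fires frame stop by blast
qed

theorem exact_choice:
  assumes ex: "exact T c js n V" and run: "rule_run c js n" and n: "n \<le> T"
  shows "choice T V"
proof -
  note E = exactD[OF ex]
  have "chosen V n (length R)" unfolding E(1) by simp
  moreover have "\<exists>j<length R. chosen V t j" if "t < n" for t
    unfolding E(1) using run that unfolding rule_run_def by blast
  ultimately show ?thesis
    unfolding choice_def using n by (meson le_imp_less_Suc not_less)
qed

theorem exact_init:
  assumes ex: "exact T c js n V" and c: "c 0 = start_config x"
    and I: "\<And>i s. i \<le> T \<Longrightarrow> s \<in> {Blank, Bit False, Bit True} \<Longrightarrow> I i s \<Longrightarrow> s = padded x i"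
  shows "init T I V"
proof -
  note E = exactD[OF ex]
  note E0 = E(2-4)[where t = 0, simplified min_0L c]
  show ?thesis
    unfolding init_def E0
  proof (intro conjI ballI allI impI)
    show "start = fst (start_config x)" by (simp add: start_config_def)
    fix k assume "k \<in> {..<K}"
    then have nth: "snd (start_config x) ! k = input_tape (if k = 0 then x else [])"
      using start_config_nth by simp
    show "int T = snd (snd (start_config x) ! k) + int T" by (simp add: nth input_tape_def)
    fix p assume p: "p < 2 * T + 1"
    show "if k = 0 \<and> T \<le> p then \<forall>s\<in>{Blank, Bit False, Bit True}. I (p - T) s \<longrightarrow> s = fst (snd (start_config x) ! k) (int p - int T)
        else Blank = fst (snd (start_config x) ! k) (int p - int T)"
    proof (cases "k = 0 \<and> T \<le> p")
      case True
      then have "fst (snd (start_config x) ! k) (int p - int T) = padded x (p - T)"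
        using padded_input[of x "p - T"] nth by (simp add: of_nat_diff)
      then show ?thesis using I[of "p - T"] p True by auto
    next
      case False
      then show ?thesis by (auto simp: nth input_tape_def)
    qed
  qed
qed

end

text \<open>Puts independent relations together into one assignment, kept apart by the tags 0 to 5.
  Tag 5 is reserved for the selection of times.\<close>

definition table :: "(nat \<Rightarrow> nat \<Rightarrow> bool) \<Rightarrow> (nat \<Rightarrow> nat \<Rightarrow> bool) \<Rightarrow> (nat \<Rightarrow> nat \<Rightarrow> nat \<Rightarrow> bool) \<Rightarrow>
    (nat \<Rightarrow> nat \<Rightarrow> nat \<Rightarrow> symbol \<Rightarrow> bool) \<Rightarrow> (nat \<Rightarrow> nat \<Rightarrow> symbol \<Rightarrow> bool) \<Rightarrow> (nat \<Rightarrow> bool) \<Rightarrow> nat \<Rightarrow> bool" where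
  "table D Q H C U S v \<longleftrightarrow> (\<exists>t j. v = pair 0 (pair t j) \<and> D t j) \<or> (\<exists>t q. v = pair 1 (pair t q) \<and> Q t q) \<or>
     (\<exists>t k p. v = pair 2 (pair t (pair k p)) \<and> H t k p) \<or>
     (\<exists>t k p s. v = pair 3 (pair t (pair k (pair p (sym_code s)))) \<and> C t k p s) \<or>
     (\<exists>t i s. v = pair 4 (pair t (pair i (sym_code s))) \<and> U t i s) \<or> (\<exists>t. v = pair 5 t \<and> S t)"

lemma table:
  "chosen (table D Q H C U S) t j = D t j" "state (table D Q H C U S) t q = Q t q"
  "head (table D Q H C U S) t k p = H t k p" "holds (table D Q H C U S) t k p s = C t k p s"
  "word (table D Q H C U S) t i s = U t i s" "table D Q H C U S (pair 5 t) = S t"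
  unfolding table_def pair_eq by (simp_all add: sym_code_eq)

context rules
begin

lemma exact_exists: "\<exists>V. exact T c js n V \<and> (\<forall>t i s. word V t i s = U t i s) \<and> (\<forall>t. V (pair 5 t) = S t)"
proof -
  let ?V = "table (\<lambda>t j. t < n \<and> j = js t \<or> t = n \<and> j = length R) (\<lambda>t q. q = fst (c (min t n)))
    (\<lambda>t k p. int p = snd (snd (c (min t n)) ! k) + int T)
    (\<lambda>t k p s. s = fst (snd (c (min t n)) ! k) (int p - int T)) U S"
  have "exact T c js n ?V" unfolding exact_def table by blast
  then show ?thesis by (intro exI[of _ ?V] conjI allI table)
qed

text \<open>Everything is true except \<open>chosen\<close>: each constraint in \<open>tab\<close>
  is guarded by \<open>chosen\<close> or has a positive conclusion, and \<open>init\<close> only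
  demands facts.\<close>

lemma idle_exists: "\<exists>V. tab T V \<and> (\<forall>I. init T I V)"
proof -
  let ?V = "table (\<lambda>_ _. False) (\<lambda>_ _. True) (\<lambda>_ _ _. True) (\<lambda>_ _ _ _. True) (\<lambda>_ _ _. True) (\<lambda>_. True)"
  have "tab T ?V \<and> (\<forall>I. init T I ?V)" unfolding tab_def init_def table by simp
  then show ?thesis by blast
qed

end

section \<open>Machine steps as rules, and the tableau of a language in NP\<close>

fun machine_rule :: "transition \<Rightarrow> rule" where
  "machine_rule (q, rs, q', as) = (q, \<lambda>k s. if s = rs ! k then Some (as ! k) else None, q')"

lemma applies_machine_rule:
  assumes "length rs = length ts" "length as = length ts"
  shows "applies (machine_rule (q, rs, q', as)) (p, ts) c' \<longleftrightarrow>
    p = q \<and> rs = map scanned ts \<and> c' = (q', map2 act as ts)"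
proof -
  obtain p' ts' where c': "c' = (p', ts')" by (cases c')
  have iff: "(\<exists>a. (if P then Some b else None) = Some a \<and> Q a) \<longleftrightarrow> P \<and> Q b" for P Q and b :: "symbol \<times> move"
    by (cases P) simp_all
  have r: "rs = map scanned ts \<longleftrightarrow> (\<forall>k<length ts. scanned (ts ! k) = rs ! k)"
    using assms(1) by (auto simp: list_eq_iff_nth_eq)
  have a: "ts' = map2 act as ts \<longleftrightarrow> length ts' = length ts \<and> (\<forall>k<length ts. ts' ! k = act (as ! k) (ts ! k))"
    using assms(2) by (auto simp: list_eq_iff_nth_eq)
  show ?thesis unfolding c' applies_def machine_rule.simps split iff r prod.inject a by blast
qed

definition query_rule :: "nat \<Rightarrow> nat \<Rightarrow> rule" where
  "query_rule q q' = (q, \<lambda>k s. Some (s, Stay), q')"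

lemma applies_query_rule: "applies (query_rule q q') (p, ts) c' \<longleftrightarrow> p = q \<and> c' = (q', ts)"
proof -
  obtain p' ts' where c': "c' = (p', ts')" by (cases c')
  have stay: "act (scanned t, Stay) t = t" for t by (cases t) simp
  show ?thesis unfolding c' applies_def query_rule_def
    by (auto simp: stay list_eq_iff_nth_eq)
qed

definition rule_states :: "('x) ntm_scheme \<Rightarrow> rule list \<Rightarrow> nat set" where
  "rule_states M R = insert (start_state M) ((\<lambda>(q, f, q'). q') ` set R)"

definition written_symbols :: "('x) ntm_scheme \<Rightarrow> symbol set" where
  "written_symbols M = insert Blank (insert (Bit True) (insert (Bit False)
     (\<Union>(q, rs, q', as)\<in>transitions M. fst ` set as)))"

lemma rules_machine:
  assumes wf: "wf_ntm M" and trs: "set trs \<subseteq> transitions M" and qs: "set qs \<subseteq> range (case_prod query_rule)"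
  shows "rules (num_tapes M) (qs @ map machine_rule trs) (rule_states M (qs @ map machine_rule trs))
    (written_symbols M) (start_state M)"
proof
  show "finite (rule_states M (qs @ map machine_rule trs))" unfolding rule_states_def by simp
  show "finite (written_symbols M)" using wf unfolding written_symbols_def wf_ntm_def by auto
  show "start_state M \<in> rule_states M (qs @ map machine_rule trs)" by (simp add: rule_states_def)
  show "Blank \<in> written_symbols M" by (simp add: written_symbols_def)
  show "Bit b \<in> written_symbols M" for b by (cases b) (simp_all add: written_symbols_def)
  show "0 < num_tapes M" using wf by (simp add: wf_ntm_def)
  fix src f tgt assume r: "(src, f, tgt) \<in> set (qs @ map machine_rule trs)"
  then show "tgt \<in> rule_states M (qs @ map machine_rule trs)" by (force simp: rule_states_def)
  fix k s w m assume k: "k < num_tapes M" and s: "s \<in> written_symbols M" and f: "f k s = Some (w, m)"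
  from r consider "(src, f, tgt) \<in> set qs" | tr where "tr \<in> set trs" "(src, f, tgt) = machine_rule tr" by auto
  then show "w \<in> written_symbols M"
  proof cases
    case 1
    then have "f = (\<lambda>k s. Some (s, Stay))" using qs by (auto simp: query_rule_def)
    then show ?thesis using f s by simp
  next
    case 2
    obtain q rs q' as where tr: "tr = (q, rs, q', as)" by (cases tr)
    have "tr \<in> transitions M" using 2(1) trs by blast
    then have "length as = num_tapes M" using wf tr unfolding wf_ntm_def by fastforce
    moreover have "as ! k = (w, m)" using f 2(2) tr by (auto split: if_splits)
    ultimately have "w \<in> fst ` set as" using k by (metis fst_conv imageI nth_mem)
    then show ?thesis using \<open>tr \<in> transitions M\<close> tr unfolding written_symbols_def by blast
  qed
qed

lemma poly_nat_mono: "m \<le> n \<Longrightarrow> poly p m \<le> poly p (n :: nat)"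
  by (induction p) (auto intro: add_mono mult_le_mono)

lemma relpowp_run:
  assumes "(Rel ^^ n) x y" and Rel: "\<And>t c c'. t < n \<Longrightarrow> (Rel ^^ t) x c \<Longrightarrow> Rel c c' \<Longrightarrow> \<exists>j. P j c c'"
  obtains c js where "c 0 = x" "c n = y" "\<And>t. t < n \<Longrightarrow> P (js t) (c t) (c (Suc t))"
    "\<And>t. t \<le> n \<Longrightarrow> (Rel ^^ t) x (c t)"
proof -
  obtain c where c: "c 0 = x" "c n = y" "\<And>t. t < n \<Longrightarrow> Rel (c t) (c (Suc t))"
    using assms(1) unfolding relpowp_fun_conv by auto
  have reach: "(Rel ^^ t) x (c t)" if "t \<le> n" for t
    unfolding relpowp_fun_conv using c(1,3) that by (intro exI[of _ c]) auto
  have "\<forall>t. \<exists>j. t < n \<longrightarrow> P j (c t) (c (Suc t))" using Rel[OF _ reach c(3)] by auto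
  then obtain js where "\<And>t. t < n \<Longrightarrow> P (js t) (c t) (c (Suc t))" by metis
  then show thesis using that c(1,2) reach by blast
qed

lemma step_length: "wf_ntm M \<Longrightarrow> step M c c' \<Longrightarrow> length (snd c) = num_tapes M \<Longrightarrow> length (snd c') = num_tapes M"
  unfolding wf_ntm_def by (cases c) (fastforce simp: step_iff)

lemma applies_step:
  assumes wf: "wf_ntm M" and len: "length ts = num_tapes M" and tr: "tr \<in> transitions M"
    and "applies (machine_rule tr) (q, ts) c'"
  shows "step M (q, ts) c'" "fst tr = q"
proof -
  obtain q0 rs q' as where t: "tr = (q0, rs, q', as)" by (cases tr)
  have "length rs = length ts" "length as = length ts" using wf tr len unfolding t wf_ntm_def by auto
  then show "step M (q, ts) c'" "fst tr = q" using assms(3,4) unfolding t applies_machine_rule[OF \<open>length rs = _\<close> \<open>length as = _\<close>] step_iff by auto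
qed

lemma step_applies:
  assumes wf: "wf_ntm M" and len: "length ts = num_tapes M" and "step M (q, ts) c'"
  obtains tr where "tr \<in> transitions M" "fst tr = q" "applies (machine_rule tr) (q, ts) c'"
proof -
  obtain q' as where c': "c' = (q', map2 act as ts)" "(q, map scanned ts, q', as) \<in> transitions M"
    using assms(3) unfolding step_iff by blast
  then have "length as = length ts" using wf len unfolding wf_ntm_def by auto
  then have "applies (machine_rule (q, map scanned ts, q', as)) (q, ts) c'"
    using applies_machine_rule[of "map scanned ts" ts as] c'(1) by simp
  then show thesis using that c'(2) by fastforce
qed

text \<open>What the tableau of a machine guarantees, with the machine itself hidden. Soundness
  holds for every bound \<open>T\<close>. In the completeness part one table serves every input
  relation that asserts only true symbols, and its values at tag 5 can be prescribed; a refutation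
  of an oracle answer uses the variables for the query word as \<open>I\<close> and tag 5 as
  selector.\<close>

definition tableau_for :: "bool list set \<Rightarrow> nat \<Rightarrow> rule list \<Rightarrow> nat set \<Rightarrow> symbol set \<Rightarrow> nat \<Rightarrow> nat \<Rightarrow> nat poly \<Rightarrow> bool" where
  "tableau_for L K R Qs Ss st acc p \<longleftrightarrow> rules K R Qs Ss st \<and>
     (\<forall>T V x I. rules.tab K R Qs Ss acc T V \<longrightarrow> rules.choice R T V \<longrightarrow> rules.init K st T I V \<longrightarrow>
       (\<forall>i\<le>T. I i (padded x i)) \<longrightarrow> x \<in> L) \<and>
     (\<forall>T x S. x \<in> L \<longrightarrow> poly p (length x) \<le> T \<longrightarrow> (\<exists>V. rules.tab K R Qs Ss acc T V \<and> rules.choice R T V \<and>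
       (\<forall>I. (\<forall>i s. i \<le> T \<longrightarrow> s \<in> {Blank, Bit False, Bit True} \<longrightarrow> I i s \<longrightarrow> s = padded x i) \<longrightarrow> rules.init K st T I V) \<and> (\<forall>t. V (pair 5 t) = S t)))"

lemma tableau_rules: "tableau_for L K R Qs Ss st acc p \<Longrightarrow> rules K R Qs Ss st"
  unfolding tableau_for_def by (elim conjE)

lemma tableau_sound:
  "tableau_for L K R Qs Ss st acc p \<Longrightarrow> rules.tab K R Qs Ss acc T V \<Longrightarrow> rules.choice R T V \<Longrightarrow>
    rules.init K st T I V \<Longrightarrow> \<forall>i\<le>T. I i (padded x i) \<Longrightarrow> x \<in> L"
  unfolding tableau_for_def by (elim conjE) (drule spec[of _ T], drule spec[of _ V], drule spec[of _ x], drule spec[of _ I], simp)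

lemma tableau_complete:
  "tableau_for L K R Qs Ss st acc p \<Longrightarrow> x \<in> L \<Longrightarrow> poly p (length x) \<le> T \<Longrightarrow>
    \<exists>V. rules.tab K R Qs Ss acc T V \<and> rules.choice R T V \<and>
      (\<forall>I. (\<forall>i s. i \<le> T \<longrightarrow> s \<in> {Blank, Bit False, Bit True} \<longrightarrow> I i s \<longrightarrow> s = padded x i) \<longrightarrow> rules.init K st T I V) \<and> (\<forall>t. V (pair 5 t) = S t)"
  unfolding tableau_for_def by simp

theorem NP_tableau:
  assumes "L \<in> NP"
  shows "\<exists>K R Qs Ss st acc p. tableau_for L K R Qs Ss st acc p"
proof -
  obtain N :: ntm where wf: "wf_ntm N" and time: "poly_time (step N) N" and L: "L = {x. accepts (step N) N x}"
    using assms unfolding NP_def by blast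
  obtain p where p: "\<And>x. halts_within (step N) (init_config N x) (poly p (length x))"
    using time unfolding poly_time_def by blast
  have "finite (transitions N)" using wf by (simp add: wf_ntm_def)
  then obtain trs where trs: "set trs = transitions N" using finite_list by auto
  let ?R = "map machine_rule trs"
  interpret rules "num_tapes N" ?R "rule_states N ?R" "written_symbols N" "start_state N" "accept_state N"
    using rules_machine[OF wf, of trs "[]"] trs by simp
  have init: "init_config N x = start_config x" for x by (simp add: init_config_def start_config_def)
  have "tableau_for L (num_tapes N) ?R (rule_states N ?R) (written_symbols N) (start_state N) (accept_state N) p"
    unfolding tableau_for_def
  proof (intro conjI allI impI)
    show "rules (num_tapes N) ?R (rule_states N ?R) (written_symbols N) (start_state N)" by unfold_locales
    show "x \<in> L" if tab: "tab T V" and choice: "choice T V" and i: "init T I V"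
        "\<forall>i\<le>T. I i (padded x i)" for T V x I
    proof -
      have "\<exists>ts. (step N)\<^sup>*\<^sup>* (start_config x) (accept_state N, ts)"
      proof (rule sound[OF tab choice valid_init[OF i(1) i(2)[rule_format]]])
        fix t j c c' assume c: "valid T V t c" and j: "j < length ?R" "applies (?R ! j) c c'"
        obtain q ts where qts: "c = (q, ts)" by (cases c)
        have "length ts = num_tapes N" using c by (simp add: valid_def qts)
        moreover have "trs ! j \<in> transitions N" using j trs nth_mem[of j trs] by simp
        ultimately show "step N c c'" using applies_step(1)[OF wf, of ts "trs ! j"] j unfolding qts by simp
      qed
      then show ?thesis by (simp add: L accepts_def init)
    qed
    show "\<exists>V. tab T V \<and> choice T V \<and> (\<forall>I. (\<forall>i s. i \<le> T \<longrightarrow> s \<in> {Blank, Bit False, Bit True} \<longrightarrow> I i s \<longrightarrow> s = padded x i) \<longrightarrow> init T I V) \<and>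
        (\<forall>t. V (pair 5 t) = S t)" if x: "x \<in> L" and T: "poly p (length x) \<le> T" for T x S
    proof -
      obtain ts n where n: "(step N ^^ n) (start_config x) (accept_state N, ts)"
        using x unfolding L accepts_def init by (auto dest: rtranclp_imp_relpowp)
      have "n \<le> T" using n p[of x] T unfolding halts_within_def init by fastforce
      have len: "length (snd c) = num_tapes N" if "(step N ^^ t) (start_config x) c" for t c
        using that
      proof (induction t arbitrary: c)
        case 0
        then show ?case using K by (auto simp: start_config_def)
      next
        case (Suc t)
        then show ?case using step_length[OF wf] by (metis relpowp_Suc_E)
      qed
      have "\<exists>j. j < length ?R \<and> applies (?R ! j) c c'" if c: "(step N ^^ t) (start_config x) c" "step N c c'" for t c c'
      proof -
        obtain q ts where qts: "c = (q, ts)" by (cases c)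
        have "length ts = num_tapes N" "step N (q, ts) c'" using len[OF c(1)] c(2) by (simp_all add: qts)
        then obtain tr where "tr \<in> transitions N" "applies (machine_rule tr) c c'"
          unfolding qts by (rule step_applies[OF wf])
        then show ?thesis using trs by (metis in_set_conv_nth length_map nth_map)
      qed
      then obtain c js where c: "c 0 = start_config x" "c n = (accept_state N, ts)"
        "\<And>t. t < n \<Longrightarrow> js t < length ?R \<and> applies (?R ! js t) (c t) (c (Suc t))"
        using relpowp_run[OF n, of "\<lambda>j c c'. j < length ?R \<and> applies (?R ! j) c c'"] by metis
      have run: "rule_run c js n" unfolding rule_run_def
      proof (intro conjI exI allI impI)
        show "fst (c n) = accept_state N" by (simp add: c(2))
      qed (use c(1,3) in blast)+
      obtain V where V: "exact T c js n V" "\<forall>t. V (pair 5 t) = S t"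
        using exact_exists[of T c js n "\<lambda>_ _ _. True" S] by (elim exE conjE) (rule that)
      show ?thesis
      proof (intro exI conjI)
        show "tab T V" using run V(1) \<open>n \<le> T\<close> by (rule exact_tab)
        show "choice T V" using V(1) run \<open>n \<le> T\<close> by (rule exact_choice)
        show "\<forall>I. (\<forall>i s. i \<le> T \<longrightarrow> s \<in> {Blank, Bit False, Bit True} \<longrightarrow> I i s \<longrightarrow> s = padded x i) \<longrightarrow> init T I V"
          by (intro allI impI exact_init[OF V(1) c(1)]) blast
      qed (rule V(2))
    qed
  qed
  then show ?thesis by (intro exI)
qed

theorem NP_cnf_hardness:
  assumes "L \<in> NP" and \<sigma>: "\<sigma> \<in> {CO, ST}"
  shows "poly_time_reducible L (CF_EX \<sigma>)"
proof -
  obtain K R Qs Ss st acc p where N: "tableau_for L K R Qs Ss st acc p" using NP_tableau[OF assms(1)] by (elim exE)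
  interpret rules K R Qs Ss st acc by (rule tableau_rules[OF N])
  define T where "T x = poly p (length x)" for x :: "bool list"
  define \<Phi> where "\<Phi> x W \<longleftrightarrow> tab (T x) (\<lambda>v. W (pair 0 v)) \<and> choice (T x) (\<lambda>v. W (pair 0 v)) \<and>
    init (T x) (\<lambda>i s. s = padded x i) (\<lambda>v. W (pair 0 v))" for x W
  have T: "polyfun (\<lambda>z e. T z)" unfolding T_def by (intro polyfun_intros)
  have "cnf \<Phi>"
    unfolding \<Phi>_def
    by (intro cnf_fun_cnf cnf_fun_conj cnf_tab cnf_choice cnf_init_input T polyfun_const)
  moreover have "x \<in> L \<longleftrightarrow> (\<exists>W. \<Phi> x W)" for x
  proof
    assume "x \<in> L"
    then obtain V where V: "tab (T x) V" "choice (T x) V" "init (T x) (\<lambda>i s. s = padded x i) V"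
      using tableau_complete[OF N, of x "T x" "\<lambda>_. True"] unfolding T_def by auto
    have "(\<lambda>v. \<exists>u. pair 0 v = pair 0 u \<and> V u) = V" by (simp add: pair_eq)
    then show "\<exists>W. \<Phi> x W" using V unfolding \<Phi>_def by (intro exI[of _ "\<lambda>v. \<exists>u. v = pair 0 u \<and> V u"]) simp
  next
    assume "\<exists>W. \<Phi> x W"
    then obtain W where W: "\<Phi> x W" ..
    show "x \<in> L"
      by (rule tableau_sound[OF N, of "T x" "\<lambda>v. W (pair 0 v)" "\<lambda>i s. s = padded x i"])
        (use W in \<open>simp_all add: \<Phi>_def\<close>)
  qed
  ultimately show ?thesis using NP_hardness \<sigma> by blast
qed

section \<open>Runs of oracle machines\<close>

text \<open>The word on a tape ends at the first symbol that is not a bit, so all such symbols count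
  as blank.\<close>

definition bit_part :: "symbol \<Rightarrow> symbol" where
  "bit_part s = (if s \<in> range Bit then s else Blank)"

lemma bit_part_word:
  assumes w: "tape_word tp w" and i: "i = 0 \<or> i \<le> length w"
  shows "bit_part (fst tp (int i)) = padded w i"
proof -
  have "i \<le> length w" using i by auto
  then consider "i < length w" | "i = length w" by linarith
  then show ?thesis
    using w by cases (auto simp: tape_word_def bit_part_def padded_def)
qed

context rules
begin

text \<open>Along the query tape the word is copied up to the first symbol that is not a bit, and
  blanks follow. Unlike the rest of the tableau this part also forbids two symbols at one place: a
  surplus symbol would impose an additional demand on a refutation in slice 1 and could protect a
  wrong negative answer.\<close>

definition words :: "nat \<Rightarrow> (nat \<Rightarrow> bool) \<Rightarrow> bool" where
  "words T V \<longleftrightarrow> (\<forall>t<T.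
     (\<forall>s\<in>Ss. holds V t (K - 1) T s \<longrightarrow> word V t 0 (bit_part s)) \<and>
     (\<forall>i<T. (\<forall>s'\<in>{Bit False, Bit True}. \<forall>s\<in>Ss. word V t i s' \<longrightarrow>
          holds V t (K - 1) (T + i + 1) s \<longrightarrow> word V t (i + 1) (bit_part s)) \<and>
        (word V t i Blank \<longrightarrow> word V t (i + 1) Blank)) \<and>
     (\<forall>i<T + 1. \<forall>s\<in>{Blank, Bit False, Bit True}. \<forall>s'\<in>{Blank, Bit False, Bit True}. s \<noteq> s' \<longrightarrow>
        word V t i s \<longrightarrow> \<not> word V t i s'))"

lemma cnf_words:
  assumes T: "polyfun (\<lambda>z e. T z)" and r: "polyfun r"
  shows "cnf_fun (\<lambda>z e W. words (T z) (\<lambda>v. W (pair (r z e) v)))"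
  unfolding words_def
  by (intro cnf_intros polyfun_intros polyfun_pair polypred_const T r[THEN polyfun_rename])

lemma words_valid:
  assumes words: "words T V" and t: "t < T" and c: "valid T V t c" and w: "tape_word (last (snd c)) w"
    and i: "i \<le> T"
  shows "word V t i (padded w i)"
    and "s \<in> {Blank, Bit False, Bit True} \<Longrightarrow> word V t i s \<Longrightarrow> s = padded w i"
proof -
  have last: "last (snd c) = snd c ! (K - 1)"
    using c K by (intro trans[OF last_conv_nth]) (auto simp: valid_def)
  have cell: "fst (last (snd c)) (int i) \<in> Ss" "holds V t (K - 1) (T + i) (fst (last (snd c)) (int i))" if "i \<le> T" for i
  proof -
    have "\<forall>p<2 * T + 1. fst (last (snd c)) (int p - int T) \<in> Ss \<and> holds V t (K - 1) p (fst (last (snd c)) (int p - int T))"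
      using c K unfolding last valid_def by simp
    from this[rule_format, of "T + i"] that
    show "fst (last (snd c)) (int i) \<in> Ss" "holds V t (K - 1) (T + i) (fst (last (snd c)) (int i))" by simp_all
  qed
  note W = words[unfolded words_def, rule_format, OF t]
  show pos: "word V t i (padded w i)"
    using i
  proof (induction i)
    case 0
    then show ?case using W[THEN conjunct1] cell[of 0] bit_part_word[OF w, of 0] by auto
  next
    case (Suc i)
    then have IH: "word V t i (padded w i)" and i: "i < T" by auto
    note Wi = W[THEN conjunct2, THEN conjunct1, rule_format, OF i]
    show ?case
    proof (cases "i < length w")
      case True
      then have b: "padded w i \<in> {Bit False, Bit True}" by (auto simp: padded_def)
      have "holds V t (K - 1) (T + i + 1) (fst (last (snd c)) (int (Suc i)))" using cell(2)[of "Suc i"] Suc.prems by simp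
      then have "word V t (i + 1) (bit_part (fst (last (snd c)) (int (Suc i))))"
        using Wi[THEN conjunct1, rule_format, OF b cell(1)[OF Suc.prems] IH] by blast
      then show ?thesis using bit_part_word[OF w, of "Suc i"] True by simp
    next
      case False
      then have "padded w i = Blank" "padded w (Suc i) = Blank" by (auto simp: padded_def)
      then show ?thesis using Wi[THEN conjunct2, rule_format] IH by simp
    qed
  qed
  assume s: "s \<in> {Blank, Bit False, Bit True}" "word V t i s"
  have b: "padded w i \<in> {Blank, Bit False, Bit True}" by (auto simp: padded_def)
  have "i < T + 1" using i by simp
  note U = W[THEN conjunct2, THEN conjunct2, rule_format, OF this s(1) b]
  show "s = padded w i"
  proof (rule ccontr)
    assume "s \<noteq> padded w i"
    from U[OF this s(2)] show False using pos by simp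
  qed
qed

lemma words_exact:
  assumes ex: "exact T c js n V" and w: "\<And>t. t < T \<Longrightarrow> tape_word (snd (c (min t n)) ! (K - 1)) (w t)"
    and U: "\<And>t i s. word V t i s = (s = padded (w t) i)"
  shows "words T V"
  unfolding words_def exactD(4)[OF ex] U
proof (intro allI impI conjI ballI)
  fix t s assume t: "t < T" "s = fst (snd (c (min t n)) ! (K - 1)) (int T - int T)"
  then show "bit_part s = padded (w t) 0" using bit_part_word[OF w[OF t(1)], of 0] by simp
next
  fix t i s s' assume t: "t < T" and s': "s' \<in> {Bit False, Bit True}" "s' = padded (w t) i"
    and s: "s = fst (snd (c (min t n)) ! (K - 1)) (int (T + i + 1) - int T)"
  have "i < length (w t)" using s' by (auto simp: padded_def split: if_splits)
  moreover have "int (T + i + 1) - int T = int (i + 1)" by simp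
  ultimately show "bit_part s = padded (w t) (i + 1)"
    using bit_part_word[OF w[OF t], of "i + 1"] unfolding s by (simp only: of_nat_add) simp
qed (auto simp: padded_def split: if_splits)

end

text \<open>A run of \<open>t\<close> steps leaves the cells from \<open>length x + t\<close> on
  blank. So the query tape always carries a word, and its length is bounded.\<close>

lemma oracle_run_tapes:
  assumes wf: "wf_ntm M" and "(oracle_step B M ^^ t) (init_config M x) c"
  shows "length (snd c) = num_tapes M \<and> (\<forall>k<num_tapes M. \<bar>snd (snd c ! k)\<bar> \<le> int t \<and>
    (\<forall>i\<ge>int (length x + t). fst (snd c ! k) i = Blank))"
  using assms(2)
proof (induction t arbitrary: c)
  case 0
  have "0 < num_tapes M" using wf by (simp add: wf_ntm_def)
  moreover have "c = init_config M x" using 0 by simp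
  moreover have "snd (init_config M x) ! k = input_tape (if k = 0 then x else [])" if "k < num_tapes M" for k
    using that by (simp add: init_config_def nth_Cons split: nat.split)
  ultimately show ?case by (auto simp: init_config_def input_tape_def)
next
  case (Suc t)
  obtain c0 where c0: "(oracle_step B M ^^ t) (init_config M x) c0" "oracle_step B M c0 c"
    using Suc.prems by (auto elim: relpowp_Suc_E)
  obtain q ts where qts: "c0 = (q, ts)" by (cases c0)
  have len: "length ts = num_tapes M" and
    IH: "\<And>k. k < num_tapes M \<Longrightarrow> \<bar>snd (ts ! k)\<bar> \<le> int t"
      "\<And>k i. k < num_tapes M \<Longrightarrow> int (length x + t) \<le> i \<Longrightarrow> fst (ts ! k) i = Blank"
    using Suc.IH[OF c0(1)] unfolding qts by auto
  show ?case
  proof (cases "q = query_state M")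
    case True
    then have c: "snd c = ts" using c0(2) unfolding qts oracle_step_iff by auto
    have "\<bar>snd (ts ! k)\<bar> \<le> int (Suc t)" if "k < num_tapes M" for k
      using IH(1)[OF that] by simp
    then show ?thesis using len IH(2) unfolding c by simp
  next
    case False
    then have "step M (q, ts) c" using c0(2) unfolding qts oracle_step_iff by simp
    then obtain q' as where c: "c = (q', map2 act as ts)" "(q, map scanned ts, q', as) \<in> transitions M"
      unfolding step_iff by blast
    have as: "length as = num_tapes M" using wf c(2) unfolding wf_ntm_def by fastforce
    show ?thesis
    proof (intro conjI allI impI)
      show "length (snd c) = num_tapes M" using as len by (simp add: c(1))
      fix k assume k: "k < num_tapes M"
      obtain w m where a: "as ! k = (w, m)" by (cases "as ! k")
      obtain g h where ts: "ts ! k = (g, h)" by (cases "ts ! k")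
      have ck: "snd c ! k = (g(h := w), h + shift m)" using k as len by (simp add: c(1) a ts)
      have h: "\<bar>h\<bar> \<le> int t" using IH(1)[OF k] ts by simp
      then show "\<bar>snd (snd c ! k)\<bar> \<le> int (Suc t)" unfolding ck by (cases m) auto
      fix i assume i: "int (length x + Suc t) \<le> i"
      then have "i \<noteq> h" using h by simp
      then show "fst (snd c ! k) i = Blank" using IH(2)[OF k, of i] i unfolding ck ts by simp
    qed
  qed
qed

lemma tape_word_bounded:
  assumes "\<forall>i\<ge>int b. fst tp i = Blank"
  shows "\<exists>w. tape_word tp w" and "tape_word tp w \<Longrightarrow> length w \<le> b"
proof -
  let ?P = "\<lambda>i. fst tp (int i) \<notin> range Bit"
  have b: "?P b" using assms by auto
  define l where "l = (LEAST i. ?P i)"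
  have l: "?P l" unfolding l_def using b by (rule LeastI)
  have "\<exists>x. fst tp (int i) = Bit x" if "i < l" for i
    using not_less_Least[of i ?P] that unfolding l_def by blast
  then obtain f where f: "\<And>i. i < l \<Longrightarrow> fst tp (int i) = Bit (f i)" by metis
  have "tape_word tp (map f [0..<l])" using l f by (simp add: tape_word_def)
  then show "\<exists>w. tape_word tp w" by blast
  show "length w \<le> b" if "tape_word tp w"
    using that assms unfolding tape_word_def by (metis linorder_not_le order_refl symbol.distinct(1))
qed

text \<open>Rules 0 and 1 are the answers yes and no, so choosing one of them is a claim about the
  oracle. The list \<open>trs\<close> is meant to omit the transitions from the query state, where
  the oracle replaces the ordinary step.\<close>

definition oracle_rules :: "oracle_ntm \<Rightarrow> transition list \<Rightarrow> rule list" where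
  "oracle_rules M trs = [query_rule (query_state M) (yes_state M), query_rule (query_state M) (no_state M)] @
     map machine_rule trs"

lemma applies_oracle_step:
  assumes wf: "wf_ntm M" and trs: "set trs = {tr \<in> transitions M. fst tr \<noteq> query_state M}"
    and len: "length ts = num_tapes M" and j: "j < length (oracle_rules M trs)"
    and a: "applies (oracle_rules M trs ! j) (q, ts) c'"
    and w: "tape_word (last ts) w" "j = 0 \<Longrightarrow> w \<in> B" "j = 1 \<Longrightarrow> w \<notin> B"
  shows "oracle_step B M (q, ts) c'"
proof -
  consider "j = 0" | "j = 1" | i where "j = i + 2" "i < length trs"
    using j by (auto simp: oracle_rules_def less_Suc_eq_0_disj)
  then show ?thesis
  proof cases
    case 1
    then show ?thesis using a w unfolding oracle_step_iff by (auto simp: oracle_rules_def applies_query_rule)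
  next
    case 2
    then show ?thesis using a w unfolding oracle_step_iff by (auto simp: oracle_rules_def applies_query_rule)
  next
    case 3
    then have "trs ! i \<in> transitions M" "fst (trs ! i) \<noteq> query_state M" using trs nth_mem by blast+
    moreover have "applies (machine_rule (trs ! i)) (q, ts) c'" using a 3 by (simp add: oracle_rules_def)
    ultimately show ?thesis using applies_step[OF wf len] unfolding oracle_step_iff by metis
  qed
qed

lemma oracle_step_applies:
  assumes wf: "wf_ntm M" and trs: "set trs = {tr \<in> transitions M. fst tr \<noteq> query_state M}"
    and len: "length ts = num_tapes M" and s: "oracle_step B M (q, ts) c'"
  shows "\<exists>j. j < length (oracle_rules M trs) \<and> applies (oracle_rules M trs ! j) (q, ts) c' \<and>
    (\<forall>w. tape_word (last ts) w \<longrightarrow> (j = 0 \<longrightarrow> w \<in> B) \<and> (j = 1 \<longrightarrow> w \<notin> B))"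
proof (cases "q = query_state M")
  case True
  then obtain w where w: "tape_word (last ts) w" "c' = (if w \<in> B then yes_state M else no_state M, ts)"
    using s unfolding oracle_step_iff by auto
  have "\<forall>w'. tape_word (last ts) w' \<longrightarrow> w' = w" using tape_word_unique[OF _ w(1)] by blast
  then show ?thesis
    using w(2) True by (intro exI[of _ "if w \<in> B then 0 else 1"])
      (auto simp: oracle_rules_def applies_query_rule)
next
  case False
  then have "step M (q, ts) c'" using s unfolding oracle_step_iff by simp
  then obtain tr where tr: "tr \<in> transitions M" "fst tr = q" "applies (machine_rule tr) (q, ts) c'"
    using step_applies[OF wf len] by metis
  have "tr \<in> set trs" using tr(1,2) False trs by simp
  then obtain i where "i < length trs" "trs ! i = tr" by (auto simp: in_set_conv_nth)
  then show ?thesis using tr(3) by (intro exI[of _ "i + 2"]) (auto simp: oracle_rules_def)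
qed

text \<open>Slice 0 of an assignment holds the run of the oracle machine and the words on its query tape, and slice t + 2
  holds an accepting run of the oracle's machine in case the query at time t is answered positively. Slice 1, which is
  quantified universally, may refute a negative answer at a time that it selects.\<close>

locale alternation = M: rules K R Qs Ss st acc + N: rules K' R' Qs' Ss' st' acc'
  for K R Qs Ss st acc K' R' Qs' Ss' st' acc' +
  fixes T :: "bool list \<Rightarrow> nat"
begin

definition first :: "bool list \<Rightarrow> (nat \<Rightarrow> nat \<Rightarrow> bool) \<Rightarrow> bool" where
  "first x V \<longleftrightarrow> M.tab (T x) (V 0) \<and> M.choice (T x) (V 0) \<and> M.init (T x) (\<lambda>i s. s = padded x i) (V 0) \<and>
     M.words (T x) (V 0) \<and> (\<forall>t<T x. N.tab (T x) (V (t + 2)) \<and> N.init (T x) (word (V 0) t) (V (t + 2)) \<and>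
       (chosen (V 0) t 0 \<longrightarrow> N.choice (T x) (V (t + 2))))"

text \<open>An existential statement about a time with a conjunction behind it is no clause family.
  So the time of the refuted answer is selected by the variables with tag 5: at least one time is
  selected, and every selected one has to fit the run in slice 1.\<close>

definition second :: "bool list \<Rightarrow> (nat \<Rightarrow> nat \<Rightarrow> bool) \<Rightarrow> bool" where
  "second x V \<longleftrightarrow> N.tab (T x) (V 1) \<and> N.choice (T x) (V 1) \<and> (\<exists>t<T x. V 1 (pair 5 t)) \<and>
     (\<forall>t<T x. V 1 (pair 5 t) \<longrightarrow> chosen (V 0) t 1 \<and> N.init (T x) (word (V 0) t) (V 1))"

lemma cnf_first:
  assumes T: "polyfun (\<lambda>z e. T z)"
  shows "cnf (\<lambda>x W. first x (\<lambda>r v. W (pair r v)))"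
  unfolding first_def
  by (intro cnf_fun_cnf M.cnf_tab M.cnf_choice M.cnf_init_input M.cnf_words N.cnf_tab N.cnf_choice N.cnf_init_word
      M.cnf_intros polyfun_intros polyfun_pair T)

lemma cnf_second:
  assumes T: "polyfun (\<lambda>z e. T z)"
  shows "cnf (\<lambda>x W. second x (\<lambda>r v. W (pair r v)))"
  unfolding second_def
  by (intro cnf_fun_cnf N.cnf_tab N.cnf_choice N.cnf_init_word M.cnf_intros polyfun_intros polyfun_pair T)

lemma first_cong: "V 0 = V' 0 \<Longrightarrow> (\<And>t. V (t + 2) = V' (t + 2)) \<Longrightarrow> first x V \<longleftrightarrow> first x V'"
  unfolding first_def by simp

theorem hardness:
  assumes T: "polyfun (\<lambda>z e. T z)" and \<sigma>: "\<sigma> \<in> {PR, SST}"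
    and sound: "\<And>x V. first x V \<Longrightarrow> (\<And>S. \<not> second x (V(1 := S))) \<Longrightarrow> x \<in> L"
    and complete: "\<And>x. x \<in> L \<Longrightarrow> \<exists>V. first x V \<and> (\<forall>S. \<not> second x (V(1 := S)))"
  shows "poly_time_reducible L (CF_EX \<sigma>)"
proof (rule Sigma2p_hardness[OF cnf_first[OF T] cnf_second[OF T]])
  \<comment> \<open>Everything outside slice 1 is existential. Bounding \<open>u\<close> by
    \<open>v\<close> loses nothing, as a pair is at least as large as its components.\<close>
  let ?Q = "\<lambda>(z :: bool list) v. \<not> (\<exists>u<Suc v. v = pair 1 u)"
  have Q: "?Q z v \<longleftrightarrow> (\<forall>u. v \<noteq> pair 1 u)" for v and z :: "bool list"
    using le_pair(2) by (auto simp: less_Suc_eq_le)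
  show "polypred (\<lambda>z e. ?Q z (e 0))" by (intro polyfun_intros polyfun_pair)
  show "?Q z 0" for z by (simp add: pair_def)
  show "first z (\<lambda>r v. W' (pair r v))"
    if eq: "\<And>v. ?Q z v \<Longrightarrow> W v = W' v" and W: "first z (\<lambda>r v. W (pair r v))" for z W W'
  proof -
    have "W (pair r v) = W' (pair r v)" if "r \<noteq> 1" for r v
      using that by (intro eq) (simp add: pair_eq)
    then have "(\<lambda>v. W (pair 0 v)) = (\<lambda>v. W' (pair 0 v))"
      "\<And>t. (\<lambda>v. W (pair (t + 2) v)) = (\<lambda>v. W' (pair (t + 2) v))" by auto
    from first_cong[OF this] W show ?thesis by blast
  qed
  show "x \<in> L \<longleftrightarrow> (\<exists>W. first x (\<lambda>r v. W (pair r v)) \<and>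
      (\<forall>W'. (\<forall>v. ?Q x v \<longrightarrow> W' v = W v) \<longrightarrow> \<not> second x (\<lambda>r v. W' (pair r v))))" for x
  proof
    assume "x \<in> L"
    then obtain V where V: "first x V" "\<And>S. \<not> second x (V(1 := S))" using complete by blast
    let ?W = "\<lambda>v. \<exists>r u. v = pair r u \<and> V r u"
    have W: "(\<lambda>r v. ?W (pair r v)) = V" by (simp add: pair_eq)
    have neg: "\<not> second x (\<lambda>r v. W' (pair r v))" if W': "\<forall>v. ?Q x v \<longrightarrow> W' v = ?W v" for W'
    proof -
      have "W' (pair r v) = V r v" if "r \<noteq> 1" for r v
        using W'[rule_format, of "pair r v"] that by (simp add: pair_eq)
      then have "(\<lambda>r v. W' (pair r v)) = V(1 := \<lambda>v. W' (pair 1 v))" by (auto simp: fun_eq_iff)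
      then show ?thesis using V(2) by simp
    qed
    show "\<exists>W. first x (\<lambda>r v. W (pair r v)) \<and>
      (\<forall>W'. (\<forall>v. ?Q x v \<longrightarrow> W' v = W v) \<longrightarrow> \<not> second x (\<lambda>r v. W' (pair r v)))"
    proof (intro exI[of _ ?W] conjI allI impI)
      show "first x (\<lambda>r v. ?W (pair r v))" unfolding W by (rule V)
    qed (rule neg)
  next
    assume "\<exists>W. first x (\<lambda>r v. W (pair r v)) \<and>
      (\<forall>W'. (\<forall>v. ?Q x v \<longrightarrow> W' v = W v) \<longrightarrow> \<not> second x (\<lambda>r v. W' (pair r v)))"
    then obtain W where W: "first x (\<lambda>r v. W (pair r v))"
      "\<And>W'. (\<forall>v. ?Q x v \<longrightarrow> W' v = W v) \<Longrightarrow> \<not> second x (\<lambda>r v. W' (pair r v))" by blast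
    show "x \<in> L"
    proof (rule sound[OF W(1)])
      fix S
      let ?W = "\<lambda>v. if \<exists>u. v = pair 1 u then \<exists>u. v = pair 1 u \<and> S u else W v"
      have "(\<lambda>r v. ?W (pair r v)) = (\<lambda>r v. W (pair r v))(1 := S)"
        by (auto simp: fun_eq_iff pair_eq)
      moreover have "\<forall>v. ?Q x v \<longrightarrow> ?W v = W v" unfolding Q by auto
      ultimately show "\<not> second x ((\<lambda>r v. W (pair r v))(1 := S))" using W(2)[of ?W] by simp
    qed
  qed
qed (rule \<sigma>)

end

theorem Sigma2p_cnf_hardness:
  assumes "L \<in> Sigma2p" and \<sigma>: "\<sigma> \<in> {PR, SST}"
  shows "poly_time_reducible L (CF_EX \<sigma>)"
proof -
  obtain B where B: "B \<in> NP" "L \<in> NP_oracle B" using assms(1) unfolding Sigma2p_def by blast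
  obtain M :: oracle_ntm where wf: "wf_ntm M" and time: "poly_time (oracle_step B M) M"
    and L: "L = {x. accepts (oracle_step B M) M x}"
    using B(2) unfolding NP_oracle_def by blast
  obtain p where p: "\<forall>x. halts_within (oracle_step B M) (init_config M x) (poly p (length x))"
    using time unfolding poly_time_def by (elim exE)
  have "finite {tr \<in> transitions M. fst tr \<noteq> query_state M}" using wf by (simp add: wf_ntm_def)
  then obtain trs where trs: "set trs = {tr \<in> transitions M. fst tr \<noteq> query_state M}" using finite_list by auto
  obtain K' R' Qs' Ss' st' acc' p' where N: "tableau_for B K' R' Qs' Ss' st' acc' p'"
    using NP_tableau[OF B(1)] by (elim exE)
  let ?K = "num_tapes M" and ?R = "oracle_rules M trs"
  \<comment> \<open>\<open>T0\<close> bounds the length of every query that a run on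
    \<open>x\<close> can ask; \<open>T\<close> leaves room for the oracle's machine to work on such
    a query.\<close>
  define T0 where "T0 x = length x + poly p (length x)" for x :: "bool list"
  define T where "T x = T0 x + poly p' (T0 x)" for x
  have rules: "rules ?K ?R (rule_states M ?R) (written_symbols M) (start_state M)"
    unfolding oracle_rules_def by (rule rules_machine[OF wf]) (use trs in auto)
  interpret alternation ?K ?R "rule_states M ?R" "written_symbols M" "start_state M" "accept_state M"
    K' R' Qs' Ss' st' acc' T
    unfolding alternation_def using rules tableau_rules[OF N] by blast
  have init: "init_config M x = M.start_config x" for x by (simp add: init_config_def M.start_config_def)
  have last: "last (snd c) = snd c ! (?K - 1)" if "length (snd c) = ?K" for c :: config
    using that M.K by (intro trans[OF last_conv_nth]) auto
  have len: "length (snd c) = ?K" and query: "\<exists>w. tape_word (last (snd c)) w"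
    and short: "tape_word (last (snd c)) w \<Longrightarrow> poly p' (length w) \<le> T x" and time: "t \<le> poly p (length x)"
    if c: "(oracle_step B M ^^ t) (M.start_config x) c" for x t c w
  proof -
    have *: "length (snd c) = ?K" "\<And>k. k < ?K \<Longrightarrow> \<forall>i\<ge>int (length x + t). fst (snd c ! k) i = Blank"
      using oracle_run_tapes[OF wf c[folded init]] by blast+
    then show "length (snd c) = ?K" by blast
    have blank: "\<forall>i\<ge>int (length x + t). fst (last (snd c)) i = Blank"
      using *(2)[of "?K - 1"] M.K unfolding last[OF *(1)] by simp
    show "\<exists>w. tape_word (last (snd c)) w" using tape_word_bounded(1)[OF blank] .
    show t: "t \<le> poly p (length x)" using p c unfolding init halts_within_def by blast
    assume "tape_word (last (snd c)) w"
    then have "length w \<le> T0 x" using tape_word_bounded(2)[OF blank] t unfolding T0_def by fastforce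
    then have "poly p' (length w) \<le> poly p' (T0 x)" by (rule poly_nat_mono)
    then show "poly p' (length w) \<le> T x" unfolding T_def by simp
  qed
  show ?thesis
  proof (rule hardness[OF _ \<sigma>])
    show "polyfun (\<lambda>z e. T z)" unfolding T_def T0_def by (intro polyfun_intros)
  next
    fix x V assume first: "first x V" and neg: "\<And>S. \<not> second x (V(1 := S))"
    have tab: "M.tab (T x) (V 0)" and choice: "M.choice (T x) (V 0)"
      and i: "M.init (T x) (\<lambda>i s. s = padded x i) (V 0)" and words: "M.words (T x) (V 0)"
      using first unfolding first_def by blast+
    have N2: "N.tab (T x) (V (t + 2))" "N.init (T x) (word (V 0) t) (V (t + 2))"
      "chosen (V 0) t 0 \<Longrightarrow> N.choice (T x) (V (t + 2))" if "t < T x" for t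
      using first that unfolding first_def by blast+
    have "\<exists>ts. (oracle_step B M)\<^sup>*\<^sup>* (M.start_config x) (accept_state M, ts)"
    proof (rule M.sound[OF tab choice M.valid_init[OF i refl]])
      fix t j c c'
      assume t: "t < T x" and run: "(oracle_step B M ^^ t) (M.start_config x) c" and c: "M.valid (T x) (V 0) t c"
        and j: "j < length ?R" "chosen (V 0) t j" "applies (?R ! j) c c'"
      obtain q ts where qts: "c = (q, ts)" by (cases c)
      obtain w where w: "tape_word (last (snd c)) w" using query[OF run] ..
      note W = M.words_valid[OF words t c w]
      have yes: "w \<in> B" if "j = 0"
        by (rule tableau_sound[OF N N2(1)[OF t] N2(3)[OF t] N2(2)[OF t]]) (use j(2) that W(1) in auto)
      have no: "w \<notin> B" if "j = 1"
      proof
        assume "w \<in> B"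
        \<comment> \<open>An accepting run of the oracle's machine on \<open>w\<close> that selects
          the time \<open>t\<close> only; it refutes the negative answer.\<close>
        then obtain S where S: "N.tab (T x) S" "N.choice (T x) S"
          "\<forall>I. (\<forall>i s. i \<le> T x \<longrightarrow> s \<in> {Blank, Bit False, Bit True} \<longrightarrow> I i s \<longrightarrow> s = padded w i) \<longrightarrow> N.init (T x) I S" "\<forall>u. S (pair 5 u) = (u = t)"
          using tableau_complete[OF N \<open>w \<in> B\<close> short[OF run w], of "\<lambda>u. u = t"] by blast
        have "second x (V(1 := S))"
          unfolding second_def
        proof (intro conjI allI impI)
          show "\<exists>u<T x. (V(1 := S)) 1 (pair 5 u)" using t S(4) by auto
          fix u assume "(V(1 := S)) 1 (pair 5 u)"
          then have u: "u = t" using S(4) by simp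
          show "chosen ((V(1 := S)) 0) u 1" using j(2) that u by simp
          have "N.init (T x) (word (V 0) t) S"
            by (rule S(3)[rule_format]) (rule W(2))
          then show "N.init (T x) (word ((V(1 := S)) 0) u) ((V(1 := S)) 1)" unfolding u by simp
        qed (use S(1,2) in simp_all)
        then show False using neg by blast
      qed
      show "oracle_step B M c c'"
        using applies_oracle_step[OF wf trs _ j(1) j(3)[unfolded qts]] len[OF run] w yes no unfolding qts by simp
    qed
    then show "x \<in> L" by (simp add: L accepts_def init)
  next
    fix x assume "x \<in> L"
    then obtain ts n where n: "(oracle_step B M ^^ n) (M.start_config x) (accept_state M, ts)"
      unfolding L accepts_def init by (auto dest: rtranclp_imp_relpowp)
    have nT: "n \<le> T x" using time[OF n] unfolding T_def T0_def by simp
    define P where "P j c c' \<longleftrightarrow> j < length ?R \<and> applies (?R ! j) c c' \<and>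
        (\<forall>w. tape_word (last (snd c)) w \<longrightarrow> (j = 0 \<longrightarrow> w \<in> B) \<and> (j = 1 \<longrightarrow> w \<notin> B))" for j c c'
    have step: "\<exists>j. P j c c'"
      if c: "(oracle_step B M ^^ t) (M.start_config x) c" "oracle_step B M c c'" for t c c'
    proof -
      obtain q ts where qts: "c = (q, ts)" by (cases c)
      show ?thesis
        using oracle_step_applies[OF wf trs, of ts B q c'] len[OF c(1)] c(2) unfolding qts P_def by simp
    qed
    obtain c js where c: "c 0 = M.start_config x" "c n = (accept_state M, ts)"
      "\<And>t. t < n \<Longrightarrow> P (js t) (c t) (c (Suc t))" "\<And>t. t \<le> n \<Longrightarrow> (oracle_step B M ^^ t) (M.start_config x) (c t)"
      by (rule relpowp_run[OF n, of P]) (erule (1) step, rule that)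
    have run: "M.rule_run c js n" unfolding M.rule_run_def
    proof (intro conjI exI allI impI)
      show "fst (c n) = accept_state M" by (simp add: c(2))
    qed (use c(1) c(3)[unfolded P_def] in blast)+
    \<comment> \<open>Defined beyond the accepting time as well, since \<open>words\<close> speaks
      of all times below \<open>T x\<close>.\<close>
    define w where "w t = (SOME w. tape_word (last (snd (c (min t n)))) w)" for t
    have w: "tape_word (last (snd (c (min t n)))) (w t)" for t
      unfolding w_def by (rule someI_ex, rule query[OF c(4)]) simp
    have js: "js t = 0 \<Longrightarrow> w t \<in> B" "js t = 1 \<Longrightarrow> w t \<notin> B" if "t < n" for t
      using c(3)[OF that] w[of t] that by (simp_all add: P_def min_absorb1)
    obtain V0 where V0: "M.exact (T x) c js n V0" "\<forall>t i s. word V0 t i s = (s = padded (w t) i)"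
      using M.exact_exists[of "T x" c js n "\<lambda>t i s. s = padded (w t) i" "\<lambda>_. True"] by (elim exE conjE)
    note E = M.exactD(1)[OF V0(1)]
    have "\<exists>V. N.tab (T x) V \<and> N.init (T x) (word V0 t) V \<and> (chosen V0 t 0 \<longrightarrow> N.choice (T x) V)" for t
    proof (cases "chosen V0 t 0")
      case True
      then have "t < n" "js t = 0" unfolding E by (auto simp: oracle_rules_def)
      then have "w t \<in> B" using js(1) by blast
      moreover have "poly p' (length (w t)) \<le> T x"
        by (rule short[OF c(4)]) (use w[of t] in auto)
      ultimately obtain S where "N.tab (T x) S" "N.choice (T x) S"
          "\<forall>I. (\<forall>i s. i \<le> T x \<longrightarrow> s \<in> {Blank, Bit False, Bit True} \<longrightarrow> I i s \<longrightarrow> s = padded (w t) i) \<longrightarrow> N.init (T x) I S"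
        using tableau_complete[OF N, of "w t" "T x" "\<lambda>_. True"] by blast
      then show ?thesis using V0(2) by (intro exI[of _ S]) simp
    next
      case False
      then show ?thesis using N.idle_exists[of "T x"] by blast
    qed
    then obtain VV where VV: "\<And>t. N.tab (T x) (VV t)" "\<And>t. N.init (T x) (word V0 t) (VV t)"
        "\<And>t. chosen V0 t 0 \<Longrightarrow> N.choice (T x) (VV t)" by metis
    define V where "V r = (if r = 0 then V0 else VV (r - 2))" for r :: nat
    have V: "V 0 = V0" "V (t + 2) = VV t" for t by (simp_all add: V_def)
    have "first x V"
      unfolding first_def V
    proof (intro conjI allI impI)
      show "M.tab (T x) V0" using run V0(1) nT by (rule M.exact_tab)
      show "M.choice (T x) V0" using V0(1) run nT by (rule M.exact_choice)
      show "M.init (T x) (\<lambda>i s. s = padded x i) V0" by (rule M.exact_init[OF V0(1) c(1)])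
      show "M.words (T x) V0"
      proof (rule M.words_exact[OF V0(1)])
        show "tape_word (snd (c (min t n)) ! (?K - 1)) (w t)" for t
          using w[of t] last[OF len[OF c(4)], of "min t n"] by simp
      qed (use V0(2) in blast)
    qed (rule VV; assumption)+
    moreover have "\<not> second x (V(1 := S))" for S
    proof
      assume "second x (V(1 := S))"
      then obtain t where S: "N.tab (T x) S" "N.choice (T x) S" and t: "chosen V0 t 1" "N.init (T x) (word V0 t) S"
        unfolding second_def by (auto simp: V)
      have "t < n" "js t = 1" using t(1) unfolding E by (auto simp: oracle_rules_def)
      moreover have "w t \<in> B"
        by (rule tableau_sound[OF N S t(2)]) (use V0(2) in simp)
      ultimately show False using js(2) by blast
    qed
    ultimately show "\<exists>V. first x V \<and> (\<forall>S. \<not> second x (V(1 := S)))" by blast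
  qed
qed

theorem theorem1:
  "(\<forall>\<sigma>\<in>{CO, ST}. complete_for NP (CF_EX \<sigma>)) \<and>
   (\<forall>\<sigma>\<in>{PR, SST}. complete_for Sigma2p (CF_EX \<sigma>))"
  unfolding complete_for_def using CF_EX_NP CF_EX_Sigma2p NP_cnf_hardness Sigma2p_cnf_hardness by blast

end
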